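(* Let $n\ge1$. For every $\lambda>2n-1$, we have a Hilbert direct sum $$\mathcal{A}^2_\lambda(\mathrm{D}^{\mathrm{I}}_{n\times n})=\bigoplus_{\mu\in P(n)}\mathcal{P}^\mu(M_{n\times n}(\mathbb{C})),$$ which is the isotypic decomposition for the $\mathrm{U}(n)\times\mathrm{U}(n)$-action. Furthermore, for every $\mu\in P(n)$ the subspace $\mathcal{P}^\mu(M_{n\times n}(\mathbb{C}))$ is isomorphic to $W^{\mu*}\otimes W^\mu$ as a module over $\mathrm{U}(n)\times\mathrm{U}(n)$. In particular, this $\mathrm{U}(n)\times\mathrm{U}(n)$-action is multiplicity-free.
   Context: $\mathrm{D}^{\mathrm{I}}_{n\times n}=\{Z\in M_{n\times n}(\mathbb{C}): Z^*Z<I_n\}$. For $\lambda>2n-1$, $dv_\lambda(Z)=c_\lambda\det(I_n-ZZ^* )^{\lambda-2n}dv(Z)$, with $dv$ Lebesgue measure and $c_\lambda>0$ such that $v_\lambda(\mathrm{D}^{\mathrm{I}}_{n\times n})=1$. $\mathcal{A}^2_\lambda(\mathrm{D}^{\mathrm{I}}_{n\times n})$ is the weighted Bergman space of holomorphic functions in $L^2(\mathrm{D}^{\mathrm{I}}_{n\times n},v_\lambda)$. $\mathrm{U}(n)\times\mathrm{U}(n)$ acts unitarily on it by $(\pi_\lambda(A,B)f)(Z)=f(A^{-1}ZB)$. $P(n)$ is the set of non-negative dominant weights $\mu=(m_1,\dots,m_n)\in\mathbb{Z}^n$, $m_1\ge\dots\ge m_n\ge0$. $W^\mu$ is the irreducible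 rational $\mathrm{GL}(n,\mathbb{C})$-module with highest weight $\mu$ (with respect to the diagonal torus and the usual positive roots $e_j-e_k$, $j<k$), also regarded as a $\mathrm{U}(n)$-module by restriction, and $W^{\mu*}$ is its dual module. The group $\mathrm{GL}(n,\mathbb{C})\times\mathrm{GL}(n,\mathbb{C})$ acts on the space $\mathcal{P}(M_{n\times n}(\mathbb{C}))$ of holomorphic polynomials on $M_{n\times n}(\mathbb{C})$ by $((A,B)\cdot p)(Z)=p(A^{-1}ZB)$; it is a known fact that $\mathcal{P}(M_{n\times n}(\mathbb{C}))=\bigoplus_{\mu\in P(n)}\mathcal{P}^\mu(M_{n\times n}(\mathbb{C}))$ as an algebraic direct sum, where $\mathcal{P}^\mu(M_{n\times n}(\mathbb{C}))$ is the (unique) $\mathrm{GL}(n,\mathbb{C})\times\mathrm{GL}(n,\mathbb{C})$-submodule isomorphic to $W^{\mu*}\otimes W^\mu$ (first factor of the group acting on $W^{\mu*}$, second on $W^\mu$); it consists of homogeneous polynomials of degree $m_1+\dots+m_n$. Polynomials are regarded as elements of $\mathcal{A}^2_\lambda(\mathrm{D}^{\mathrm{I}}_{n\times n})$ by restriction. For a unitary representation of a compact group $H$ on $\mathcal{H}$ and an equivalence class $[\mathcal{K}]$ of irreducible $H$-modules, the isotypic component $\mathcal{H}_{[\mathcal{K}]}$ is the closed subspace given by the sum of all $H$-submodules in the class $[\mathcal{K}]$; the isotypic decomposition is the Hilbert direct sum of the isotypic components, and the representation is multiplicity-free if every isotypic component is $0$ or irreducible. *)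

theory Defs
  imports
    "HOL-Analysis.Analysis"
    "HOL-Algebra.Group"
    "HOL-Library.Function_Algebras"
begin

section \<open>Modules realised on spaces of complex-valued functions\<close>

definition cscale :: "complex \<Rightarrow> ('x \<Rightarrow> complex) \<Rightarrow> 'x \<Rightarrow> complex" where
  "cscale c f = (\<lambda>x. c * f x)"

interpretation cfun: vector_space "cscale :: complex \<Rightarrow> ('x \<Rightarrow> complex) \<Rightarrow> 'x \<Rightarrow> complex"
  by unfold_locales (auto simp: cscale_def fun_eq_iff algebra_simps)

text \<open>
  All representation spaces in this development (polynomials, Bergman spaces, abstract
  finite-dimensional modules, their duals and tensor products) are complex subspaces
  \<open>vecs M\<close> of some function space \<open>'x \<Rightarrow> complex\<close>. The values of \<open>act M\<close>
  outside \<open>vecs M\<close>, or at group elements outside the acting group, are irrelevant. The acting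
  group is not a component of the record, so that a module may be restricted to a subgroup.
\<close>

record ('g, 'x) gmodule =
  vecs :: "('x \<Rightarrow> complex) set"
  act :: "'g \<Rightarrow> ('x \<Rightarrow> complex) \<Rightarrow> 'x \<Rightarrow> complex"

definition clinear_on ::
  "('x \<Rightarrow> complex) set \<Rightarrow> (complex \<Rightarrow> 'b \<Rightarrow> 'b) \<Rightarrow> (('x \<Rightarrow> complex) \<Rightarrow> 'b::ab_group_add) \<Rightarrow> bool" where
  "clinear_on V sc T \<longleftrightarrow>
     (\<forall>u\<in>V. \<forall>v\<in>V. T (u + v) = T u + T v) \<and>
     (\<forall>c. \<forall>v\<in>V. T (cscale c v) = sc c (T v))"

definition is_gmodule :: "'g monoid \<Rightarrow> ('g, 'x) gmodule \<Rightarrow> bool" where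
  "is_gmodule G M \<longleftrightarrow>
     cfun.subspace (vecs M) \<and>
     (\<forall>g\<in>carrier G. act M g ` vecs M \<subseteq> vecs M \<and> clinear_on (vecs M) cscale (act M g)) \<and>
     (\<forall>v\<in>vecs M. act M \<one>\<^bsub>G\<^esub> v = v) \<and>
     (\<forall>g\<in>carrier G. \<forall>h\<in>carrier G. \<forall>v\<in>vecs M. act M (g \<otimes>\<^bsub>G\<^esub> h) v = act M g (act M h v))"

definition is_submodule :: "'g monoid \<Rightarrow> ('g, 'x) gmodule \<Rightarrow> ('x \<Rightarrow> complex) set \<Rightarrow> bool" where
  "is_submodule G M V \<longleftrightarrow>
     cfun.subspace V \<and> V \<subseteq> vecs M \<and> (\<forall>g\<in>carrier G. act M g ` V \<subseteq> V)"

definition module_iso :: "'g monoid \<Rightarrow> ('g, 'x) gmodule \<Rightarrow> ('g, 'y) gmodule \<Rightarrow> bool" where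
  "module_iso G M N \<longleftrightarrow>
     (\<exists>T. bij_betw T (vecs M) (vecs N) \<and> clinear_on (vecs M) cscale T \<and>
          (\<forall>g\<in>carrier G. \<forall>v\<in>vecs M. T (act M g v) = act N g (T v)))"

definition simple_module :: "'g monoid \<Rightarrow> ('g, 'x) gmodule \<Rightarrow> bool" where
  "simple_module G M \<longleftrightarrow>
     is_gmodule G M \<and> vecs M \<noteq> {0} \<and>
     (\<forall>V. is_submodule G M V \<longrightarrow> V = {0} \<or> V = vecs M)"

definition finite_dim :: "('x \<Rightarrow> complex) set \<Rightarrow> bool" where
  "finite_dim V \<longleftrightarrow> (\<exists>B. finite B \<and> V = cfun.span B)"

text \<open>Functionals are extended by zero outside \<open>V\<close>, so that they are determined by their
  values on \<open>V\<close>.\<close>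

definition dual_vecs :: "('x \<Rightarrow> complex) set \<Rightarrow> (('x \<Rightarrow> complex) \<Rightarrow> complex) set" where
  "dual_vecs V = {\<phi>. clinear_on V (*) \<phi> \<and> (\<forall>u. u \<notin> V \<longrightarrow> \<phi> u = 0)}"

definition dual_module :: "'g monoid \<Rightarrow> ('g, 'x) gmodule \<Rightarrow> ('g, 'x \<Rightarrow> complex) gmodule" where
  "dual_module G M =
     \<lparr>vecs = dual_vecs (vecs M),
      act = (\<lambda>g \<phi> v. if v \<in> vecs M then \<phi> (act M (inv\<^bsub>G\<^esub> g) v) else 0)\<rparr>"

text \<open>
  For subspaces \<open>V\<close> of \<open>'x \<Rightarrow> complex\<close> and \<open>W\<close> of \<open>'y \<Rightarrow> complex\<close> the linear map sending
  \<open>f \<otimes> g\<close> to \<open>\<lambda>(x, y). f x * g y\<close> is injective on the algebraic tensor product, which is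
  therefore identified with the span of these functions. An element \<open>t\<close> of it satisfies
  \<open>t (x, \<cdot>) \<in> W\<close> and \<open>t (\<cdot>, y) \<in> V\<close>, and \<open>(a, b)\<close> sends \<open>f \<otimes> g\<close> to
  \<open>(a f) \<otimes> (b g)\<close> by acting with \<open>b\<close> in the second variable and with \<open>a\<close> in the first.
\<close>

definition outer_tensor ::
  "('g, 'x) gmodule \<Rightarrow> ('h, 'y) gmodule \<Rightarrow> ('g \<times> 'h, 'x \<times> 'y) gmodule" where
  "outer_tensor M N =
     \<lparr>vecs = cfun.span {\<lambda>(x, y). f x * g y | f g. f \<in> vecs M \<and> g \<in> vecs N},
      act = (\<lambda>(a, b) t (x, y). act M a (\<lambda>x'. act N b (\<lambda>y'. t (x', y')) y) x)\<rparr>"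


section \<open>Hilbert direct sums and isotypic decompositions\<close>

text \<open>\<open>H\<close> is a space of functions with inner product \<open>ip\<close>.\<close>

definition hilbert_closure ::
  "('x \<Rightarrow> complex) set \<Rightarrow> (('x \<Rightarrow> complex) \<Rightarrow> ('x \<Rightarrow> complex) \<Rightarrow> complex)
    \<Rightarrow> ('x \<Rightarrow> complex) set \<Rightarrow> ('x \<Rightarrow> complex) set" where
  "hilbert_closure H ip S = {f \<in> H. \<forall>e>0. \<exists>g\<in>S. sqrt (Re (ip (f - g) (f - g))) < e}"

definition hilbert_direct_sum ::
  "('x \<Rightarrow> complex) set \<Rightarrow> (('x \<Rightarrow> complex) \<Rightarrow> ('x \<Rightarrow> complex) \<Rightarrow> complex)
    \<Rightarrow> 'i set \<Rightarrow> ('i \<Rightarrow> ('x \<Rightarrow> complex) set) \<Rightarrow> bool" where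
  "hilbert_direct_sum H ip I V \<longleftrightarrow>
     (\<forall>i\<in>I. cfun.subspace (V i) \<and> V i \<subseteq> H \<and> hilbert_closure H ip (V i) = V i) \<and>
     (\<forall>i\<in>I. \<forall>j\<in>I. i \<noteq> j \<longrightarrow> (\<forall>f\<in>V i. \<forall>g\<in>V j. ip f g = 0)) \<and>
     hilbert_closure H ip (cfun.span (\<Union>i\<in>I. V i)) = H"

text \<open>Irreducible modules of a compact group; these are always finite-dimensional.\<close>

definition irreducible_compact ::
  "'g::topological_space monoid \<Rightarrow> ('g, 'x) gmodule \<Rightarrow> bool" where
  "irreducible_compact G M \<longleftrightarrow>
     simple_module G M \<and> finite_dim (vecs M) \<and>
     (\<forall>v\<in>vecs M. \<forall>\<phi>\<in>dual_vecs (vecs M). continuous_on (carrier G) (\<lambda>g. \<phi> (act M g v)))"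

definition isotypic_component ::
  "'g monoid \<Rightarrow> ('g, 'x) gmodule \<Rightarrow> (('x \<Rightarrow> complex) \<Rightarrow> ('x \<Rightarrow> complex) \<Rightarrow> complex)
    \<Rightarrow> ('g, 'y) gmodule \<Rightarrow> ('x \<Rightarrow> complex) set" where
  "isotypic_component G M ip K =
     hilbert_closure (vecs M) ip
       (cfun.span (\<Union>{V. is_submodule G M V \<and> module_iso G (M\<lparr>vecs := V\<rparr>) K}))"

text \<open>Every finite-dimensional module is isomorphic to one realised on a subspace of
  \<open>nat \<Rightarrow> complex\<close>, so that such modules represent all equivalence classes.\<close>

definition isotypic_components ::
  "'g::topological_space monoid \<Rightarrow> ('g, 'x) gmodule
    \<Rightarrow> (('x \<Rightarrow> complex) \<Rightarrow> ('x \<Rightarrow> complex) \<Rightarrow> complex) \<Rightarrow> ('x \<Rightarrow> complex) set set" where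
  "isotypic_components G M ip =
     {isotypic_component G M ip K | K :: ('g, nat) gmodule. irreducible_compact G K}"

text \<open>The family \<open>V\<close> lists each nonzero isotypic component exactly once, and the
  representation is their Hilbert direct sum.\<close>

definition is_isotypic_decomposition ::
  "'g::topological_space monoid \<Rightarrow> ('g, 'x) gmodule
    \<Rightarrow> (('x \<Rightarrow> complex) \<Rightarrow> ('x \<Rightarrow> complex) \<Rightarrow> complex)
    \<Rightarrow> 'i set \<Rightarrow> ('i \<Rightarrow> ('x \<Rightarrow> complex) set) \<Rightarrow> bool" where
  "is_isotypic_decomposition G M ip I V \<longleftrightarrow>
     hilbert_direct_sum (vecs M) ip I V \<and>
     bij_betw V I (isotypic_components G M ip - {{0}})"

definition multiplicity_free ::
  "'g::topological_space monoid \<Rightarrow> ('g, 'x) gmodule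
    \<Rightarrow> (('x \<Rightarrow> complex) \<Rightarrow> ('x \<Rightarrow> complex) \<Rightarrow> complex) \<Rightarrow> bool" where
  "multiplicity_free G M ip \<longleftrightarrow>
     (\<forall>V\<in>isotypic_components G M ip. V = {0} \<or> irreducible_compact G (M\<lparr>vecs := V\<rparr>))"


section \<open>Matrices and matrix groups\<close>

text \<open>
  The index type \<open>'n\<close> is a nonempty finite linear order; its elements in increasing order
  play the role of the indices \<open>1, \<dots>, n\<close>, where \<open>n = CARD('n)\<close>.
\<close>

type_synonym 'n cmat = "complex^'n^'n"

definition adj :: "'n::finite cmat \<Rightarrow> 'n cmat" where
  "adj A = (\<chi> i j. cnj (A $ j $ i))"

definition pos_def :: "'n::finite cmat \<Rightarrow> bool" where
  "pos_def A \<longleftrightarrow> adj A = A \<and> (\<forall>v. v \<noteq> 0 \<longrightarrow> 0 < Re (\<Sum>i\<in>UNIV. cnj (v $ i) * (A *v v) $ i))"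

definition GL :: "'n::finite cmat monoid" where
  "GL = \<lparr>carrier = {A. invertible A}, monoid.mult = (**), one = mat 1\<rparr>"

definition unitary_grp :: "'n::finite cmat monoid" where
  "unitary_grp = \<lparr>carrier = {A. adj A ** A = mat 1}, monoid.mult = (**), one = mat 1\<rparr>"

definition diag_mat :: "('n \<Rightarrow> complex) \<Rightarrow> 'n::finite cmat" where
  "diag_mat t = (\<chi> i j. if i = j then t i else 0)"

definition upper_unitriangular :: "'n::{finite,wellorder} cmat \<Rightarrow> bool" where
  "upper_unitriangular A \<longleftrightarrow> (\<forall>i. A $ i $ i = 1) \<and> (\<forall>i j. j < i \<longrightarrow> A $ i $ j = 0)"


section \<open>Polynomials and rational modules of the general linear group\<close>

definition polynomials :: "('n::finite cmat \<Rightarrow> complex) set" where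
  "polynomials =
     cfun.span (range (\<lambda>(\<alpha> :: 'n \<Rightarrow> 'n \<Rightarrow> nat) Z. \<Prod>i\<in>UNIV. \<Prod>j\<in>UNIV. Z $ i $ j ^ \<alpha> i j))"

text \<open>The regular functions on the algebraic group \<open>GL\<close> are the quotients of polynomials by
  powers of the determinant.\<close>

definition rational_module :: "('n::finite cmat, 'x) gmodule \<Rightarrow> bool" where
  "rational_module M \<longleftrightarrow>
     is_gmodule GL M \<and> finite_dim (vecs M) \<and>
     (\<forall>v\<in>vecs M. \<forall>\<phi>\<in>dual_vecs (vecs M). \<exists>p\<in>polynomials. \<exists>k::nat.
        \<forall>A\<in>carrier GL. \<phi> (act M A v) = p A / det A ^ k)"

text \<open>A highest weight vector is a weight vector for the diagonal torus fixed by the unipotent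
  group generated by the root subgroups of the positive roots \<open>e\<^sub>j - e\<^sub>k\<close>, \<open>j < k\<close>.\<close>

definition has_highest_weight ::
  "('n::{finite,wellorder} \<Rightarrow> int) \<Rightarrow> ('n cmat, 'x) gmodule \<Rightarrow> bool" where
  "has_highest_weight \<mu> M \<longleftrightarrow>
     (\<exists>v\<in>vecs M. v \<noteq> 0 \<and>
        (\<forall>t. (\<forall>i. t i \<noteq> 0) \<longrightarrow> act M (diag_mat t) v = cscale (\<Prod>i\<in>UNIV. t i powi \<mu> i) v) \<and>
        (\<forall>U. upper_unitriangular U \<longrightarrow> act M U v = v))"

text \<open>The irreducible rational module with highest weight \<open>\<mu>\<close>, which is unique up to
  isomorphism; a representative is chosen on a finite-dimensional subspace of
  \<open>nat \<Rightarrow> complex\<close>.\<close>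

definition gl_irrep :: "('n::{finite,wellorder} \<Rightarrow> int) \<Rightarrow> ('n cmat, nat) gmodule" where
  "gl_irrep \<mu> = (SOME M. rational_module M \<and> simple_module GL M \<and> has_highest_weight \<mu> M)"

definition irrep_dual_tensor_irrep ::
  "('n::{finite,wellorder} \<Rightarrow> int) \<Rightarrow> ('n cmat \<times> 'n cmat, (nat \<Rightarrow> complex) \<times> nat) gmodule" where
  "irrep_dual_tensor_irrep \<mu> = outer_tensor (dual_module GL (gl_irrep \<mu>)) (gl_irrep \<mu>)"

definition dominant_weights :: "('n::{finite,wellorder} \<Rightarrow> int) set" where
  "dominant_weights = {\<mu>. antimono \<mu> \<and> (\<forall>i. 0 \<le> \<mu> i)}"

definition two_sided_act ::
  "'n::finite cmat \<times> 'n cmat \<Rightarrow> ('n cmat \<Rightarrow> complex) \<Rightarrow> 'n cmat \<Rightarrow> complex" where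
  "two_sided_act = (\<lambda>(A, B) f Z. f (matrix_inv A ** Z ** B))"

definition poly_module :: "('n::finite cmat \<times> 'n cmat, 'n cmat) gmodule" where
  "poly_module = \<lparr>vecs = polynomials, act = two_sided_act\<rparr>"

definition poly_component :: "('n::{finite,wellorder} \<Rightarrow> int) \<Rightarrow> ('n cmat \<Rightarrow> complex) set" where
  "poly_component \<mu> =
     (THE V. is_submodule (GL \<times>\<times> GL) poly_module V \<and>
             module_iso (GL \<times>\<times> GL) (poly_module\<lparr>vecs := V\<rparr>) (irrep_dual_tensor_irrep \<mu>))"


section \<open>Weighted Bergman spaces on the Cartan domain of type I\<close>

definition cartan_domain :: "'n::finite cmat set" where
  "cartan_domain = {Z. pos_def (mat 1 - adj Z ** Z)}"

text \<open>The determinant of \<open>I - Z Z\<^sup>*\<close> is a positive real number on the domain.\<close>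

definition unnormalized_density :: "real \<Rightarrow> 'n::finite cmat \<Rightarrow> real" where
  "unnormalized_density lam Z =
     indicator cartan_domain Z * Re (det (mat 1 - Z ** adj Z)) powr (lam - 2 * real CARD('n))"

definition normalizing_const :: "'n::finite itself \<Rightarrow> real \<Rightarrow> real" where
  "normalizing_const _ lam =
     (THE c. 0 < c \<and>
        emeasure (density lborel (\<lambda>Z :: 'n cmat. ennreal (c * unnormalized_density lam Z)))
          cartan_domain = 1)"

definition bergman_measure :: "real \<Rightarrow> 'n::finite cmat measure" where
  "bergman_measure lam =
     density lborel (\<lambda>Z. ennreal (normalizing_const TYPE('n) lam * unnormalized_density lam Z))"

text \<open>The domain is open; holomorphy means Frechet differentiability with complex linear
  derivative.\<close>

definition holomorphic_mat_on :: "('n::finite cmat \<Rightarrow> complex) \<Rightarrow> 'n cmat set \<Rightarrow> bool" where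
  "holomorphic_mat_on f S \<longleftrightarrow>
     (\<forall>Z\<in>S. \<exists>f'. (f has_derivative f') (at Z) \<and>
        (\<forall>c X. f' (\<chi> i j. c * X $ i $ j) = c * f' X))"

text \<open>Elements of the Bergman space are represented by their unique holomorphic representatives
  on the domain, extended by zero; \<open>restrict_domain\<close> accordingly is restriction to the domain.\<close>

definition bergman_space :: "real \<Rightarrow> ('n::finite cmat \<Rightarrow> complex) set" where
  "bergman_space lam =
     {f. holomorphic_mat_on f cartan_domain \<and> (\<forall>Z. Z \<notin> cartan_domain \<longrightarrow> f Z = 0) \<and>
         integrable (bergman_measure lam) (\<lambda>Z. (cmod (f Z))\<^sup>2)}"

definition bergman_inner ::
  "real \<Rightarrow> ('n::finite cmat \<Rightarrow> complex) \<Rightarrow> ('n cmat \<Rightarrow> complex) \<Rightarrow> complex" where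
  "bergman_inner lam f g = (LINT Z|bergman_measure lam. f Z * cnj (g Z))"

definition bergman_module :: "real \<Rightarrow> ('n::finite cmat \<times> 'n cmat, 'n cmat) gmodule" where
  "bergman_module lam = \<lparr>vecs = bergman_space lam, act = two_sided_act\<rparr>"

definition restrict_domain :: "('n::finite cmat \<Rightarrow> complex) \<Rightarrow> 'n cmat \<Rightarrow> complex" where
  "restrict_domain p = (\<lambda>Z. if Z \<in> cartan_domain then p Z else 0)"

definition bergman_component :: "('n::{finite,wellorder} \<Rightarrow> int) \<Rightarrow> ('n cmat \<Rightarrow> complex) set" where
  "bergman_component \<mu> = restrict_domain ` poly_component \<mu>"

end

theory Submission
  imports Defs "HOL-Complex_Analysis.Complex_Analysis" "HOL-Real_Asymp.Real_Asymp"
begin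

text \<open>
  The proof has an algebraic half, which decomposes the space of polynomials, and an analytic half,
  which puts the polynomials into the Bergman space. They meet in a single observation: the algebra
  needs nothing but one inner product on polynomials that is invariant under \<open>f \<mapsto> f (g ** Z ** h)\<close>
  with unitary \<open>g\<close> and \<open>h\<close>, and the Bergman inner product is such an inner product.

  \<^bold>\<open>Polynomials.\<close> A polynomial identity that holds on the unitary group holds for all matrices
  (\<open>polynomial_eq_0_if_eq_0_on_unitary\<close>, by the Cayley transform). Hence unitary invariance sharpens
  to \<open>ip (bitrans g h f) k = ip f (bitrans (adj g) (adj h) k)\<close> for arbitrary matrices
  (\<open>ip_adjoint\<close>), and triangular matrices become available. For a dominant weight \<open>\<mu>\<close> there is
  exactly one polynomial \<open>F\<close> with \<open>F (mat 1) = 1\<close> that is invariant under lower unitriangular matrices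
  on the left and upper unitriangular ones on the right and has weight \<open>\<mu>\<close> under diagonal matrices: a
  product of powers of leading principal minors (\<open>ex_hw_function\<close>, \<open>hw_function_unique\<close>). Let
  \<open>wspace \<mu>\<close> be the span of its two-sided translates. Spaces with different weights are orthogonal
  (\<open>hw_orthogonal\<close>): move the factors of a triangular decomposition across the inner product and
  compare torus weights. Every nonzero finite-dimensional stable space of polynomials contains one of the functions \<open>F\<close>
  (\<open>ex_hw_function_in_stable\<close>): leading coefficients along one-parameter subgroups of the torus are
  invariant under unipotent matrices. Together these facts make \<open>wspace \<mu>\<close> simple
  (\<open>wspace_simple\<close>) and make the polynomials the sum of these spaces (\<open>polynomials_decomposition\<close>).

  \<^bold>\<open>Identification with the tensor product.\<close> Let \<open>W\<close> be any simple rational module with highest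
  weight vector \<open>v0\<close> of weight \<open>\<mu>\<close>. Contracting \<open>W\<close> by a one-parameter subgroup of the torus yields in
  the limit a functional \<open>\<phi>0\<close> with \<open>\<phi>0 (A v0) = F A\<close>. Therefore the matrix coefficients of \<open>W\<close>
  are polynomials in \<open>wspace \<mu>\<close>, and \<open>f \<otimes> w \<mapsto> (A \<mapsto> f (A w))\<close> is an isomorphism of the
  dual of \<open>W\<close> tensor \<open>W\<close> onto \<open>wspace \<mu>\<close> (\<open>Tens_iso_wspace\<close>). Applied to the
  chosen irreducible module, this shows that \<open>poly_component \<mu>\<close> is \<open>wspace \<mu>\<close>.

  \<^bold>\<open>The Bergman space.\<close> The density is integrable for \<open>lam > 2n - 1\<close>: scaling the rows of \<open>Z\<close>
  one after the other reduces this to an integral in one variable (\<open>unnormalized_finite\<close>). The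
  measure is invariant because the domain and \<open>det (I - Z Z\<^sup>*)\<close> are. The polynomials are dense
  (\<open>polynomials_dense\<close>): on the disc through a point \<open>Z\<close> the function \<open>\<zeta> \<mapsto> f (\<zeta> Z)\<close> has a Taylor series,
  whose coefficients are homogeneous polynomials in \<open>Z\<close>; averaging over the circle, which the measure
  allows, turns the Bessel inequality on the circle into a dominated convergence argument on the domain.

  \<^bold>\<open>Conclusion.\<close> For a unitary representation, a dense orthogonal family of pairwise
  non-isomorphic irreducible submodules is the isotypic decomposition, and the representation is
  multiplicity-free (locale \<open>unitary_module_family\<close>). The restrictions of the spaces \<open>wspace \<mu>\<close> to the
  domain are such a family.
\<close>

section \<open>Finite-dimensional spaces of functions\<close>

lemma cscale_apply: "cscale c f x = c * f x"
  by (simp add: cscale_def)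

lemma fun_sum_apply: "(\<Sum>i\<in>A. f i) x = (\<Sum>i\<in>A. f i x)"
  by (induction A rule: infinite_finite_induct) auto

text \<open>On a finite-dimensional space of functions, coordinates can be taken to be values at finitely many
  points: \<open>e\<close> is the basis dual to evaluation at the points of \<open>X\<close>. Algebraic identities between
  vectors then become identities between numbers, to which density arguments apply.\<close>

definition interpolates :: "'x set \<Rightarrow> ('x \<Rightarrow> 'x \<Rightarrow> complex) \<Rightarrow> ('x \<Rightarrow> complex) set \<Rightarrow> bool" where
  "interpolates X e V \<longleftrightarrow> finite X \<and> (\<forall>x\<in>X. e x \<in> V) \<and>
     (\<forall>x\<in>X. \<forall>y\<in>X. e x y = (if x = y then 1 else 0)) \<and>
     (\<forall>f\<in>V. \<forall>z. f z = (\<Sum>x\<in>X. f x * e x z))"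

lemma interpolatesD:
  assumes "interpolates X e V"
  shows "finite X" "\<And>x. x \<in> X \<Longrightarrow> e x \<in> V"
    "\<And>x y. x \<in> X \<Longrightarrow> y \<in> X \<Longrightarrow> e x y = (if x = y then 1 else 0)"
    "\<And>f z. f \<in> V \<Longrightarrow> f z = (\<Sum>x\<in>X. f x * e x z)"
  using assms unfolding interpolates_def by blast+

lemma interpolation_sum_mem:
  assumes "interpolates X e V" "cfun.subspace V"
  shows "(\<lambda>z. \<Sum>x\<in>X. c x * e x z) \<in> V"
proof -
  have "(\<Sum>x\<in>X. cscale (c x) (e x)) \<in> V"
    using assms interpolatesD[OF assms(1)] by (intro cfun.subspace_sum cfun.subspace_scale) auto
  also have "(\<Sum>x\<in>X. cscale (c x) (e x)) = (\<lambda>z. \<Sum>x\<in>X. c x * e x z)"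
    by (simp add: fun_eq_iff fun_sum_apply cscale_apply)
  finally show ?thesis .
qed

lemma interpolation_mem:
  assumes "interpolates X e V" "cfun.subspace V" "\<And>z. f z = (\<Sum>x\<in>X. c x * e x z)"
  shows "f \<in> V"
proof -
  have "f = (\<lambda>z. \<Sum>x\<in>X. c x * e x z)" using assms(3) by auto
  then show ?thesis using interpolation_sum_mem[OF assms(1,2)] by simp
qed

lemma interpolation_eq:
  assumes "interpolates X e V" "f \<in> V"
  shows "f = (\<Sum>x\<in>X. cscale (f x) (e x))"
proof
  fix z
  show "f z = (\<Sum>x\<in>X. cscale (f x) (e x)) z"
    using interpolatesD(4)[OF assms(1,2), of z] by (simp add: fun_sum_apply cscale_apply)
qed

text \<open>Such points are added one at a time: if a further spanning vector differs from its interpolant at the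
  points of \<open>X\<close>, the difference is nonzero at some new point of \<open>D\<close>, where it can be normalised.\<close>

lemma ex_interpolation_on:
  assumes "finite_dim V" and sep: "\<And>f. f \<in> V \<Longrightarrow> (\<And>x. x \<in> D \<Longrightarrow> f x = 0) \<Longrightarrow> f = 0"
  shows "\<exists>X e. X \<subseteq> D \<and> interpolates X e V"
proof -
  obtain B where B: "finite B" "V = cfun.span B" using assms(1) by (auto simp: finite_dim_def)
  have "\<exists>X e. X \<subseteq> D \<and> interpolates X e (cfun.span C)" if "finite C" "C \<subseteq> B" for C
    using that
  proof (induction C rule: finite_induct)
    case empty
    have "interpolates {} (\<lambda>_ _. 0) (cfun.span ({} :: ('a \<Rightarrow> complex) set))"
      by (auto simp: interpolates_def)
    then show ?case by blast
  next
    case (insert b C)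
    then obtain X e where X: "X \<subseteq> D" and I: "interpolates X e (cfun.span C)" by blast
    note J = interpolatesD[OF I]
    define r where "r = b - (\<Sum>x\<in>X. cscale (b x) (e x))"
    have rV: "r \<in> cfun.span (insert b C)"
      unfolding r_def using J(2) cfun.span_mono[of C "insert b C"]
      by (intro cfun.span_diff cfun.span_sum cfun.span_scale) (auto intro: cfun.span_base)
    have rX: "r y = 0" if "y \<in> X" for y
    proof -
      have "(\<Sum>x\<in>X. b x * e x y) = (\<Sum>x\<in>X. if x = y then b x else 0)"
        using J(3) that by (intro sum.cong) auto
      then show ?thesis using that J(1) by (simp add: r_def fun_sum_apply cscale_apply)
    qed
    show ?case
    proof (cases "r = 0")
      case True
      then have "b = (\<Sum>x\<in>X. cscale (b x) (e x))" by (simp add: r_def)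
      then have "b \<in> cfun.span C" using J(2) by (metis (no_types, lifting) cfun.span_sum cfun.span_scale)
      then have "cfun.span (insert b C) = cfun.span C" by (rule cfun.span_redundant)
      then show ?thesis using X I by auto
    next
      case False
      have "r \<in> V" using rV insert.prems B cfun.span_mono by blast
      then obtain w where w: "w \<in> D" "r w \<noteq> 0" using sep False by blast
      have wX: "w \<notin> X" using rX w by auto
      define r' where "r' = cscale (1 / r w) r"
      define e' where "e' = (\<lambda>x. if x = w then r' else e x - cscale (e x w) r')"
      have r'V: "r' \<in> cfun.span (insert b C)" unfolding r'_def by (intro cfun.span_scale rV)
      have r'w: "r' w = 1" "\<And>y. y \<in> X \<Longrightarrow> r' y = 0" using w rX by (auto simp: r'_def cscale_apply)
      have "interpolates (insert w X) e' (cfun.span (insert b C))"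
        unfolding interpolates_def
      proof (intro conjI ballI allI)
        show "finite (insert w X)" using J(1) by simp
        show "e' x \<in> cfun.span (insert b C)" if "x \<in> insert w X" for x
          using that r'V J(2)[of x] cfun.span_mono[of C "insert b C"]
          by (auto simp: e'_def intro!: cfun.span_diff cfun.span_scale)
        show "e' x y = (if x = y then 1 else 0)" if "x \<in> insert w X" "y \<in> insert w X" for x y
          using that wX r'w J(3) by (auto simp: e'_def cscale_apply)
        fix f z assume "f \<in> cfun.span (insert b C)"
        then obtain k where k: "f - cscale k b \<in> cfun.span C"
          by (auto simp: cfun.span_insert)
        define g where "g = f - cscale k b + (\<Sum>x\<in>X. cscale (k * b x) (e x))"
        have gC: "g \<in> cfun.span C" unfolding g_def
          using k J(2) by (intro cfun.span_add cfun.span_sum cfun.span_scale) auto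
        have rr: "r z = r w * r' z" for z using w by (simp add: r'_def cscale_apply)
        have gr: "f z = g z + k * r z" for z
          by (simp add: g_def r_def fun_sum_apply cscale_apply sum_distrib_left algebra_simps)
        have fg: "f z = g z + k * r w * r' z" for z using gr[of z] rr[of z] by simp
        have fX: "f x = g x" if "x \<in> X" for x using fg[of x] r'w(2)[OF that] by simp
        have fw: "f w = g w + k * r w" using fg[of w] r'w by simp
        have s1: "(\<Sum>x\<in>X. f x * e' x z) = g z - g w * r' z"
        proof -
          have "f x * e' x z = g x * e x z - g x * e x w * r' z" if "x \<in> X" for x
          proof -
            have "e' x z = e x z - e x w * r' z" using that wX by (auto simp: e'_def cscale_apply)
            then show ?thesis unfolding fX[OF that] by (simp only: right_diff_distrib mult.assoc)
          qed
          then have "(\<Sum>x\<in>X. f x * e' x z) = (\<Sum>x\<in>X. g x * e x z - g x * e x w * r' z)"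
            by (rule sum.cong[OF refl])
          also have "\<dots> = (\<Sum>x\<in>X. g x * e x z) - (\<Sum>x\<in>X. g x * e x w) * r' z"
            by (simp only: sum_subtractf sum_distrib_right)
          also have "\<dots> = g z - g w * r' z"
            by (simp only: J(4)[OF gC, of z, symmetric] J(4)[OF gC, of w, symmetric])
          finally show ?thesis .
        qed
        have "(\<Sum>x\<in>insert w X. f x * e' x z) = f w * e' w z + (\<Sum>x\<in>X. f x * e' x z)"
          by (rule sum.insert[OF J(1) wX])
        also have "\<dots> = (g w + k * r w) * r' z + (g z - g w * r' z)"
          unfolding s1 fw by (simp add: e'_def)
        also have "\<dots> = f z" unfolding fg[of z] by (simp add: algebra_simps)
        finally show "f z = (\<Sum>x\<in>insert w X. f x * e' x z)" by simp
      qed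
      then show ?thesis using X w by blast
    qed
  qed
  from this[of B] B show ?thesis by auto
qed

lemma ex_interpolation:
  assumes "finite_dim V"
  shows "\<exists>X e. interpolates X e V"
  using ex_interpolation_on[OF assms, of UNIV] by (auto simp: fun_eq_iff)

lemma finite_dim_subspace:
  assumes "finite_dim V" "cfun.subspace U" "U \<subseteq> V"
  shows "finite_dim U"
proof -
  obtain B where B: "finite B" "V = cfun.span B" using assms(1) by (auto simp: finite_dim_def)
  obtain C where C: "C \<subseteq> U" "cfun.independent C" "U \<subseteq> cfun.span C"
    by (metis cfun.maximal_independent_subset)
  have "finite C" using cfun.independent_span_bound[OF B(1) C(2)] C(1) assms(3) B(2) by auto
  moreover have "U = cfun.span C"
    using C cfun.span_minimal[OF C(1) assms(2)] by auto
  ultimately show ?thesis by (auto simp: finite_dim_def)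
qed

lemma finite_dim_imp_subspace: "finite_dim V \<Longrightarrow> cfun.subspace V"
  by (auto simp: finite_dim_def)

lemma clinear_on_add: "clinear_on V sc T \<Longrightarrow> u \<in> V \<Longrightarrow> v \<in> V \<Longrightarrow> T (u + v) = T u + T v"
  unfolding clinear_on_def by blast

lemma clinear_on_scale: "clinear_on V sc T \<Longrightarrow> v \<in> V \<Longrightarrow> T (cscale c v) = sc c (T v)"
  unfolding clinear_on_def by blast

lemma clinear_on_0:
  assumes T: "clinear_on V cscale T" and V: "cfun.subspace V"
  shows "T 0 = 0"
proof -
  have "T (0 + 0) = T 0 + T 0" using T cfun.subspace_0[OF V] unfolding clinear_on_def by blast
  then show ?thesis by simp
qed

lemma clinear_on_functional_0:
  assumes T: "clinear_on V (*) T" and V: "cfun.subspace V"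
  shows "T 0 = (0::complex)"
proof -
  have "T (0 + 0) = T 0 + T 0" using T cfun.subspace_0[OF V] unfolding clinear_on_def by blast
  then show ?thesis by simp
qed

lemma clinear_on_sum:
  assumes T: "clinear_on V cscale T" and V: "cfun.subspace V" and f: "\<And>i. i \<in> A \<Longrightarrow> f i \<in> V"
  shows "T (\<Sum>i\<in>A. cscale (c i) (f i)) = (\<Sum>i\<in>A. cscale (c i) (T (f i)))"
  using f
proof (induction A rule: infinite_finite_induct)
  case (insert a A)
  then have "(\<Sum>i\<in>A. cscale (c i) (f i)) \<in> V" "cscale (c a) (f a) \<in> V"
    using V by (auto intro!: cfun.subspace_sum cfun.subspace_scale)
  then have *: "T (cscale (c a) (f a) + (\<Sum>i\<in>A. cscale (c i) (f i)))
      = cscale (c a) (T (f a)) + T (\<Sum>i\<in>A. cscale (c i) (f i))"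
    using clinear_on_add[OF T] clinear_on_scale[OF T insert.prems[OF insertI1]] by simp
  have IH: "T (\<Sum>i\<in>A. cscale (c i) (f i)) = (\<Sum>i\<in>A. cscale (c i) (T (f i)))"
    by (rule insert.IH) (use insert.prems in auto)
  show ?case unfolding sum.insert[OF insert.hyps] * IH by (rule refl)
qed (use clinear_on_0[OF T V] in auto)

lemma clinear_on_functional_sum:
  assumes T: "clinear_on V (*) T" and V: "cfun.subspace V" and f: "\<And>i. i \<in> A \<Longrightarrow> f i \<in> V"
  shows "T (\<Sum>i\<in>A. cscale (c i) (f i)) = (\<Sum>i\<in>A. c i * T (f i))"
  using f
proof (induction A rule: infinite_finite_induct)
  case (insert a A)
  then have "(\<Sum>i\<in>A. cscale (c i) (f i)) \<in> V" "cscale (c a) (f a) \<in> V"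
    using V by (auto intro!: cfun.subspace_sum cfun.subspace_scale)
  then have *: "T (cscale (c a) (f a) + (\<Sum>i\<in>A. cscale (c i) (f i)))
      = (*) (c a) (T (f a)) + T (\<Sum>i\<in>A. cscale (c i) (f i))"
    using clinear_on_add[OF T] clinear_on_scale[OF T insert.prems[OF insertI1]] by simp
  have IH: "T (\<Sum>i\<in>A. cscale (c i) (f i)) = (\<Sum>i\<in>A. c i * T (f i))"
    by (rule insert.IH) (use insert.prems in auto)
  show ?case unfolding sum.insert[OF insert.hyps] * IH by (rule refl)
qed (use clinear_on_functional_0[OF T V] in auto)

lemma interpolation_linear:
  assumes "interpolates X e V" "clinear_on V cscale T" "cfun.subspace V" "f \<in> V"
  shows "T f z = (\<Sum>x\<in>X. f x * T (e x) z)"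
proof -
  have "T f = (\<Sum>x\<in>X. cscale (f x) (T (e x)))"
    by (rule trans[OF arg_cong[OF interpolation_eq[OF assms(1,4)], of T]
          clinear_on_sum[OF assms(2,3) interpolatesD(2)[OF assms(1)]]])
  then show ?thesis by (simp add: fun_sum_apply cscale_apply)
qed

lemma interpolation_functional:
  assumes "interpolates X e V" "clinear_on V (*) \<phi>" "cfun.subspace V" "f \<in> V"
  shows "\<phi> f = (\<Sum>x\<in>X. f x * \<phi> (e x))"
  by (rule trans[OF arg_cong[OF interpolation_eq[OF assms(1,4)], of \<phi>]
          clinear_on_functional_sum[OF assms(2,3) interpolatesD(2)[OF assms(1)]]])

lemma clinear_on_image_subspace:
  assumes "clinear_on V cscale T" "cfun.subspace V"
  shows "cfun.subspace (T ` V)"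
proof (rule cfun.subspaceI)
  show "0 \<in> T ` V" using clinear_on_0[OF assms] cfun.subspace_0[OF assms(2)] by (metis image_eqI)
  show "x + y \<in> T ` V" if "x \<in> T ` V" "y \<in> T ` V" for x y
    using that clinear_on_add[OF assms(1)] cfun.subspace_add[OF assms(2)] by (smt (verit) image_iff)
  show "cscale c x \<in> T ` V" if "x \<in> T ` V" for c x
    using that clinear_on_scale[OF assms(1)] cfun.subspace_scale[OF assms(2)] by (smt (verit) image_iff)
qed

lemma finite_dim_image:
  assumes T: "clinear_on V cscale T" and V: "finite_dim V"
  shows "finite_dim (T ` V)"
proof -
  obtain X e where I: "interpolates X e V" using ex_interpolation V by blast
  note sV = finite_dim_imp_subspace[OF V]
  have "T ` V \<subseteq> cfun.span ((\<lambda>x. T (e x)) ` X)"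
  proof
    fix w assume "w \<in> T ` V"
    then obtain f where f: "f \<in> V" "w = T f" by blast
    have "w = (\<Sum>x\<in>X. cscale (f x) (T (e x)))"
      using trans[OF arg_cong[OF interpolation_eq[OF I f(1)], of T]
          clinear_on_sum[OF T sV interpolatesD(2)[OF I]]] f(2) by simp
    also have "\<dots> \<in> cfun.span ((\<lambda>x. T (e x)) ` X)"
      by (intro cfun.span_sum cfun.span_scale cfun.span_base) auto
    finally show "w \<in> cfun.span ((\<lambda>x. T (e x)) ` X)" .
  qed
  moreover have "finite_dim (cfun.span ((\<lambda>x. T (e x)) ` X))"
    using interpolatesD(1)[OF I] unfolding finite_dim_def by blast
  ultimately show ?thesis using finite_dim_subspace[OF _ clinear_on_image_subspace[OF T sV]] by blast
qed

text \<open>The infix \<open>$\<close> is needed for components of vectors and matrices.\<close>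

no_notation fps_nth (infixl "$" 75)

section \<open>Polynomial functions on matrices\<close>

text \<open>Polynomial dependence on one complex parameter; one-parameter curves of matrices reduce statements
  about polynomials on matrices to this case.\<close>

definition is_poly1 :: "(complex \<Rightarrow> complex) \<Rightarrow> bool" where
  "is_poly1 \<phi> \<longleftrightarrow> (\<exists>p. \<forall>s. \<phi> s = poly p s)"

lemma is_poly1_const [intro]: "is_poly1 (\<lambda>s. c)"
  unfolding is_poly1_def by (rule exI[of _ "[:c:]"]) simp

lemma is_poly1_ident [intro]: "is_poly1 (\<lambda>s. s)"
  unfolding is_poly1_def by (rule exI[of _ "[:0, 1:]"]) simp

lemma is_poly1_add [intro]: "is_poly1 \<phi> \<Longrightarrow> is_poly1 \<psi> \<Longrightarrow> is_poly1 (\<lambda>s. \<phi> s + \<psi> s)"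
  unfolding is_poly1_def by (metis poly_add)

lemma is_poly1_mult [intro]: "is_poly1 \<phi> \<Longrightarrow> is_poly1 \<psi> \<Longrightarrow> is_poly1 (\<lambda>s. \<phi> s * \<psi> s)"
  unfolding is_poly1_def by (metis poly_mult)

lemma is_poly1_diff [intro]: "is_poly1 \<phi> \<Longrightarrow> is_poly1 \<psi> \<Longrightarrow> is_poly1 (\<lambda>s. \<phi> s - \<psi> s)"
  unfolding is_poly1_def by (metis poly_diff)

lemma is_poly1_power [intro]: "is_poly1 \<phi> \<Longrightarrow> is_poly1 (\<lambda>s. \<phi> s ^ n)"
  by (induction n) auto

lemma is_poly1_sum [intro]: "(\<And>i. i \<in> A \<Longrightarrow> is_poly1 (\<phi> i)) \<Longrightarrow> is_poly1 (\<lambda>s. \<Sum>i\<in>A. \<phi> i s)"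
  by (induction A rule: infinite_finite_induct) auto

lemma is_poly1_prod [intro]: "(\<And>i. i \<in> A \<Longrightarrow> is_poly1 (\<phi> i)) \<Longrightarrow> is_poly1 (\<lambda>s. \<Prod>i\<in>A. \<phi> i s)"
  by (induction A rule: infinite_finite_induct) auto

lemma is_poly1_zero_infinite:
  assumes "is_poly1 \<phi>" "infinite {s. \<phi> s = 0}"
  shows "\<phi> s = 0"
proof -
  obtain p where p: "\<And>s. \<phi> s = poly p s" using assms(1) by (auto simp: is_poly1_def)
  then have "p = 0" using assms(2) poly_roots_finite[of p] by auto
  then show ?thesis using p by simp
qed

lemma is_poly1_zero_product:
  assumes "is_poly1 \<phi>" "is_poly1 \<psi>" "\<psi> s0 \<noteq> 0" "\<And>s. \<psi> s \<noteq> 0 \<Longrightarrow> \<phi> s = 0"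
  shows "\<phi> s = 0"
proof -
  obtain p q where p: "\<And>s. \<phi> s = poly p s" "\<And>s. \<psi> s = poly q s"
    using assms(1,2) by (auto simp: is_poly1_def)
  have "\<forall>s. poly (p * q) s = 0" using assms(4) by (auto simp: p)
  then have "p * q = 0" by (simp only: poly_all_0_iff_0)
  moreover have "q \<noteq> 0" using assms(3) p by auto
  ultimately show ?thesis using p by simp
qed

lemma matrix_monomial_mem:
  "(\<lambda>Z. \<Prod>i\<in>UNIV. \<Prod>j\<in>UNIV. Z $ i $ j ^ \<alpha> i j) \<in> (polynomials :: ('n::finite cmat \<Rightarrow> complex) set)"
  unfolding polynomials_def by (rule cfun.span_base) auto

lemma polynomials_subspace: "cfun.subspace polynomials"
  by (simp add: polynomials_def)

lemma polynomials_add: "f \<in> polynomials \<Longrightarrow> g \<in> polynomials \<Longrightarrow> (\<lambda>Z. f Z + g Z) \<in> polynomials"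
  using cfun.subspace_add[OF polynomials_subspace, of f g] by (simp add: plus_fun_def)

lemma polynomials_diff: "f \<in> polynomials \<Longrightarrow> g \<in> polynomials \<Longrightarrow> (\<lambda>Z. f Z - g Z) \<in> polynomials"
  using cfun.subspace_diff[OF polynomials_subspace, of f g] by (simp add: fun_diff_def)

lemma polynomials_scale: "f \<in> polynomials \<Longrightarrow> (\<lambda>Z. c * f Z) \<in> polynomials"
  using cfun.subspace_scale[OF polynomials_subspace, of f c] by (simp add: cscale_def)

lemma polynomials_const: "(\<lambda>Z. c) \<in> polynomials"
proof -
  have "(\<lambda>Z. c * (\<Prod>i\<in>UNIV. \<Prod>j\<in>UNIV. Z $ i $ j ^ (\<lambda>_ _. 0) i j)) \<in> (polynomials :: ('n::finite cmat \<Rightarrow> complex) set)"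
    by (rule polynomials_scale[OF matrix_monomial_mem])
  then show ?thesis by simp
qed

lemma polynomials_entry: "(\<lambda>Z. Z $ i $ j) \<in> (polynomials :: ('n::finite cmat \<Rightarrow> complex) set)"
proof -
  have "(\<Prod>a\<in>UNIV. \<Prod>b\<in>UNIV. Z $ a $ b ^ (if a = i \<and> b = j then 1 else 0)) = Z $ i $ j" for Z :: "'n cmat"
  proof -
    have "(\<Prod>b\<in>UNIV. Z $ a $ b ^ (if a = i \<and> b = j then 1 else 0)) = (if a = i then Z $ i $ j else 1)" for a
    proof (cases "a = i")
      case True
      have "(\<Prod>b\<in>UNIV. Z $ a $ b ^ (if a = i \<and> b = j then 1 else 0)) = (\<Prod>b\<in>UNIV. if b = j then Z $ i $ b else 1)"
        using True by (intro prod.cong) auto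
      then show ?thesis using True by (simp add: prod.delta)
    qed simp
    then show ?thesis by (simp add: prod.delta)
  qed
  then show ?thesis
    using matrix_monomial_mem[where ?'n='n and \<alpha>="\<lambda>a b. if a = i \<and> b = j then 1 else 0"] by simp
qed

lemma polynomials_mult:
  assumes "f \<in> polynomials" "g \<in> polynomials"
  shows "(\<lambda>Z :: 'n::finite cmat. f Z * g Z) \<in> polynomials"
proof -
  let ?m = "\<lambda>(\<alpha> :: 'n \<Rightarrow> 'n \<Rightarrow> nat) Z. \<Prod>i\<in>UNIV. \<Prod>j\<in>UNIV. Z $ i $ j ^ \<alpha> i j"
  have 0: "(\<lambda>Z. h Z * g Z) \<in> polynomials" if h: "h = ?m \<beta>" for h \<beta>
    using assms(2) unfolding polynomials_def
  proof (induction rule: cfun.span_induct_alt)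
    case base
    show ?case using cfun.span_zero by (simp add: zero_fun_def)
  next
    case (step c x y)
    then obtain \<alpha> where x: "x = ?m \<alpha>" by auto
    have "(\<lambda>Z. h Z * x Z) = ?m (\<lambda>i j. \<beta> i j + \<alpha> i j)"
      unfolding h x by (rule ext) (simp add: prod.distrib power_add)
    then have "(\<lambda>Z. h Z * x Z) \<in> polynomials" using matrix_monomial_mem by simp
    then have "(\<lambda>Z. c * (h Z * x Z) + h Z * y Z) \<in> polynomials"
      using step(2) by (intro polynomials_add polynomials_scale) (simp_all add: polynomials_def)
    also have "(\<lambda>Z. c * (h Z * x Z) + h Z * y Z) = (\<lambda>Z. h Z * (cscale c x + y) Z)"
      by (simp add: fun_eq_iff cscale_def algebra_simps)
    finally show ?case unfolding polynomials_def .
  qed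
  show ?thesis using assms(1) unfolding polynomials_def
  proof (induction rule: cfun.span_induct_alt)
    case base
    show ?case using cfun.span_zero by (simp add: zero_fun_def)
  next
    case (step c x y)
    then have "(\<lambda>Z. x Z * g Z) \<in> polynomials" using 0 by blast
    then have "(\<lambda>Z. c * (x Z * g Z) + y Z * g Z) \<in> polynomials"
      using step(2) by (intro polynomials_add polynomials_scale) (simp_all add: polynomials_def)
    also have "(\<lambda>Z. c * (x Z * g Z) + y Z * g Z) = (\<lambda>Z. (cscale c x + y) Z * g Z)"
      by (simp add: fun_eq_iff cscale_def algebra_simps)
    finally show ?case unfolding polynomials_def .
  qed
qed

lemma polynomials_power: "f \<in> polynomials \<Longrightarrow> (\<lambda>Z. f Z ^ k) \<in> polynomials"
  by (induction k) (auto intro: polynomials_const polynomials_mult)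

lemma polynomials_sum: "(\<And>i. i \<in> A \<Longrightarrow> f i \<in> polynomials) \<Longrightarrow> (\<lambda>Z. \<Sum>i\<in>A. f i Z) \<in> polynomials"
  by (induction A rule: infinite_finite_induct) (auto intro: polynomials_const polynomials_add)

lemma polynomials_prod: "(\<And>i. i \<in> A \<Longrightarrow> f i \<in> polynomials) \<Longrightarrow> (\<lambda>Z. \<Prod>i\<in>A. f i Z) \<in> polynomials"
  by (induction A rule: infinite_finite_induct) (auto intro: polynomials_const polynomials_mult)

lemmas polynomials_intros = polynomials_const polynomials_entry polynomials_add polynomials_diff
  polynomials_scale polynomials_mult polynomials_power polynomials_sum polynomials_prod

lemma polynomials_induct [consumes 1, case_names const entry add mult]:
  fixes P :: "('n::finite cmat \<Rightarrow> complex) \<Rightarrow> bool"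
  assumes "f \<in> polynomials"
    and const: "\<And>c. P (\<lambda>Z. c)" and entry: "\<And>i j. P (\<lambda>Z :: 'n cmat. Z $ i $ j)"
    and add: "\<And>f g. P f \<Longrightarrow> P g \<Longrightarrow> P (\<lambda>Z. f Z + g Z)"
    and mult: "\<And>f g. P f \<Longrightarrow> P g \<Longrightarrow> P (\<lambda>Z. f Z * g Z)"
  shows "P f"
proof -
  have pw: "P (\<lambda>Z. h Z ^ k)" if "P h" for h k
    using that by (induction k) (auto intro: const mult)
  have pr: "P (\<lambda>Z. \<Prod>i\<in>A. h i Z)" if "\<And>i. P (h i)" for h and A :: "'a set"
    using that by (induction A rule: infinite_finite_induct) (auto intro: const mult)
  show ?thesis using assms(1) unfolding polynomials_def
  proof (induction rule: cfun.span_induct_alt)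
    case base
    show ?case using const[of 0] by (simp add: zero_fun_def)
  next
    case (step c x y)
    then obtain \<alpha> where x: "x = (\<lambda>Z. \<Prod>i\<in>UNIV. \<Prod>j\<in>UNIV. Z $ i $ j ^ \<alpha> i j)" by auto
    have "P x" unfolding x by (intro pr pw entry)
    then have "P (\<lambda>Z. c * x Z + y Z)" by (intro add step mult[OF const])
    then show ?case by (simp add: cscale_def plus_fun_def)
  qed
qed

lemma polynomials_compose:
  assumes "f \<in> polynomials" "\<And>i j. (\<lambda>Z. T Z $ i $ j) \<in> polynomials"
  shows "(\<lambda>Z. f (T Z)) \<in> polynomials"
  using assms(1) by (induction rule: polynomials_induct) (auto intro: polynomials_intros assms(2))

lemma polynomials_continuous:
  assumes "f \<in> polynomials" shows "continuous_on S f"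
  using assms by (induction rule: polynomials_induct) (auto intro!: continuous_intros)

lemma polynomials_curve:
  assumes "f \<in> polynomials" "\<And>i j. is_poly1 (\<lambda>s. \<gamma> s $ i $ j)"
  shows "is_poly1 (\<lambda>s. f (\<gamma> s))"
  using assms(1) by (induction rule: polynomials_induct) (auto intro: assms(2))

lemma polynomials_det:
  assumes "\<And>i j. (\<lambda>Z. T Z $ i $ j) \<in> polynomials"
  shows "(\<lambda>Z. det (T Z)) \<in> polynomials"
  unfolding det_def using assms by (intro polynomials_intros)

lemma det_is_poly1:
  assumes "\<And>i j. is_poly1 (\<lambda>s. \<gamma> s $ i $ j)"
  shows "is_poly1 (\<lambda>s. det (\<gamma> s))"
  unfolding det_def using assms by (intro is_poly1_sum is_poly1_mult is_poly1_prod is_poly1_const)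

lemma polynomials_mult_entry:
  assumes "\<And>i j. (\<lambda>Z. S Z $ i $ j) \<in> polynomials" "\<And>i j. (\<lambda>Z. T Z $ i $ j) \<in> polynomials"
  shows "(\<lambda>Z. (S Z ** T Z) $ i $ j) \<in> polynomials"
  unfolding matrix_matrix_mult_def vec_lambda_beta using assms by (intro polynomials_intros)

lemma is_poly1_mult_entry:
  assumes "\<And>i j. is_poly1 (\<lambda>s. S s $ i $ j)" "\<And>i j. is_poly1 (\<lambda>s. T s $ i $ j)"
  shows "is_poly1 (\<lambda>s. (S s ** T s) $ i $ j)"
  unfolding matrix_matrix_mult_def vec_lambda_beta using assms by (intro is_poly1_sum is_poly1_mult)

text \<open>Restrict to the line through \<open>Z0\<close> and \<open>Z\<close>: a product of polynomials in one variable vanishes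
  only if a factor does.\<close>

lemma polynomial_eq_0_if_eq_0_off_zeros:
  assumes "p \<in> polynomials" "q \<in> polynomials" "q Z0 \<noteq> 0" "\<And>Z. q Z \<noteq> 0 \<Longrightarrow> p Z = 0"
  shows "p (Z :: 'n::finite cmat) = 0"
proof -
  define \<gamma> where "\<gamma> = (\<lambda>s. (\<chi> i j. Z0 $ i $ j + s * (Z $ i $ j - Z0 $ i $ j)) :: 'n cmat)"
  have \<gamma>: "is_poly1 (\<lambda>s. \<gamma> s $ i $ j)" for i j
    unfolding \<gamma>_def vec_lambda_beta by (intro is_poly1_add is_poly1_mult is_poly1_const is_poly1_ident)
  have e: "\<gamma> 0 = Z0" "\<gamma> 1 = Z" by (simp_all add: \<gamma>_def vec_eq_iff)
  have "p (\<gamma> 1) = 0"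
    by (rule is_poly1_zero_product[OF polynomials_curve[OF assms(1) \<gamma>] polynomials_curve[OF assms(2) \<gamma>], of 0])
      (use assms(3,4) e in auto)
  then show ?thesis using e by simp
qed

section \<open>Adjoints, inverses and Zariski density of the unitary group\<close>

lemma adj_mult: "adj (A ** B) = adj B ** adj A"
  by (simp add: adj_def matrix_matrix_mult_def vec_eq_iff mult.commute)

lemma adj_adj [simp]: "adj (adj A) = A" by (simp add: adj_def vec_eq_iff)
lemma adj_mat_1 [simp]: "adj (mat 1) = mat 1" by (auto simp: adj_def vec_eq_iff mat_def)
lemma adj_add: "adj (A + B) = adj A + adj B" by (simp add: adj_def vec_eq_iff)
lemma adj_diff: "adj (A - B) = adj A - adj B" by (simp add: adj_def vec_eq_iff)
lemma adj_nth [simp]: "adj A $ i $ j = cnj (A $ j $ i)" by (simp add: adj_def)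

lemma mat_mult_nth [simp]: "(mat c ** A) $ i $ j = c * A $ i $ j" for A :: "'n::finite cmat"
  by (simp add: mat_def matrix_matrix_mult_def if_distrib[of "\<lambda>x. x * _"] cong: if_cong)

lemma mult_mat_nth [simp]: "(A ** mat c) $ i $ j = c * A $ i $ j" for A :: "'n::finite cmat"
  by (simp add: mat_def matrix_matrix_mult_def if_distrib[of "\<lambda>x. _ * x"] cong: if_cong)

lemma matrix_mult_add_left: "(A + B) ** (C :: 'n::finite cmat) = A ** C + B ** C"
  by (simp add: vec_eq_iff matrix_matrix_mult_def algebra_simps sum.distrib)
lemma matrix_mult_add_right: "(C :: 'n::finite cmat) ** (A + B) = C ** A + C ** B"
  by (simp add: vec_eq_iff matrix_matrix_mult_def algebra_simps sum.distrib)
lemma matrix_mult_diff_left: "(A - B) ** (C :: 'n::finite cmat) = A ** C - B ** C"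
  by (simp add: vec_eq_iff matrix_matrix_mult_def algebra_simps sum_subtractf)
lemma matrix_mult_diff_right: "(C :: 'n::finite cmat) ** (A - B) = C ** A - C ** B"
  by (simp add: vec_eq_iff matrix_matrix_mult_def algebra_simps sum_subtractf)

lemmas matrix_mult_distribs = matrix_mult_add_left matrix_mult_add_right matrix_mult_diff_left matrix_mult_diff_right

lemma det_adj: "det (adj A) = cnj (det A)"
proof -
  have "det (adj A) = det (transpose (adj A))" by (simp add: det_transpose)
  also have "\<dots> = cnj (det A)" by (simp add: det_def transpose_def adj_def)
  finally show ?thesis .
qed

lemma matrix_inv_props:
  assumes "invertible (A :: 'n::finite cmat)"
  shows "A ** matrix_inv A = mat 1" "matrix_inv A ** A = mat 1"
  using someI_ex[OF assms[unfolded invertible_def]] unfolding matrix_inv_def by auto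

lemma matrix_inv_eqI: "(A :: 'n::finite cmat) ** B = mat 1 \<Longrightarrow> matrix_inv A = B"
  by (metis invertible_right_inverse matrix_inv_props(2) matrix_mul_assoc matrix_mul_lid matrix_mul_rid)

lemma invertible_matrix_inv: "invertible (A :: 'n::finite cmat) \<Longrightarrow> invertible (matrix_inv A)"
  using matrix_inv_props[of A] unfolding invertible_def by blast

lemma matrix_inv_matrix_inv: "invertible (A :: 'n::finite cmat) \<Longrightarrow> matrix_inv (matrix_inv A) = A"
  by (simp add: matrix_inv_eqI matrix_inv_props)

text \<open>Cramer's rule.\<close>

lemma matrix_inv_entry:
  fixes A :: "'n::finite cmat"
  assumes "det A \<noteq> 0"
  shows "matrix_inv A $ i $ j = det (\<chi> a b. if b = i then (if a = j then 1 else 0) else A $ a $ b) / det A"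
proof -
  have "A ** matrix_inv A = mat 1" using assms matrix_inv_props invertible_det_nz by blast
  then have "A *v column j (matrix_inv A) = axis j 1"
    by (simp add: vec_eq_iff matrix_vector_mult_def matrix_matrix_mult_def column_def mat_def axis_def)
  then have "column j (matrix_inv A) = (\<chi> k. det (\<chi> a b. if b = k then axis j 1 $ a else A $ a $ b) / det A)"
    using cramer[OF assms] by blast
  then have "column j (matrix_inv A) $ i = det (\<chi> a b. if b = i then axis j 1 $ a else A $ a $ b) / det A" by simp
  moreover have "(\<chi> a b. if b = i then axis j 1 $ a else A $ a $ b)
      = (\<chi> a b. if b = i then (if a = j then 1 else 0) else A $ a $ b)"
    by (auto simp: vec_eq_iff axis_def)
  ultimately show ?thesis by (simp add: column_def)
qed

text \<open>Clearing denominators: a power of \<open>d\<close> makes the composition of a polynomial with a rational curve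
  polynomial.\<close>

lemma polynomials_curve_quotient:
  assumes "p \<in> polynomials" "\<And>i j. is_poly1 (\<lambda>s. B s $ i $ j)" "is_poly1 d"
  shows "\<exists>N P. is_poly1 P \<and> (\<forall>s. d s \<noteq> 0 \<longrightarrow> P s = d s ^ N * p (\<chi> i j. B s $ i $ j / d s))"
  using assms(1)
proof (induction rule: polynomials_induct)
  case (const c)
  show ?case by (rule exI[of _ 0], rule exI[of _ "\<lambda>_. c"]) auto
next
  case (entry i j)
  show ?case by (rule exI[of _ 1], rule exI[of _ "\<lambda>s. B s $ i $ j"]) (use assms(2) in auto)
next
  case (add f g)
  then obtain N P M Q where P: "is_poly1 P" "\<And>s. d s \<noteq> 0 \<Longrightarrow> P s = d s ^ N * f (\<chi> i j. B s $ i $ j / d s)"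
    and Q: "is_poly1 Q" "\<And>s. d s \<noteq> 0 \<Longrightarrow> Q s = d s ^ M * g (\<chi> i j. B s $ i $ j / d s)" by blast
  show ?case
  proof (intro exI conjI allI impI)
    show "is_poly1 (\<lambda>s. d s ^ M * P s + d s ^ N * Q s)" using P Q assms(3) by (intro is_poly1_add is_poly1_mult is_poly1_power)
    show "d s ^ M * P s + d s ^ N * Q s =
      d s ^ (N + M) * (f (\<chi> i j. B s $ i $ j / d s) + g (\<chi> i j. B s $ i $ j / d s))" if "d s \<noteq> 0" for s
      unfolding P(2)[OF that] Q(2)[OF that] power_add by (simp only: algebra_simps)
  qed
next
  case (mult f g)
  then obtain N P M Q where P: "is_poly1 P" "\<And>s. d s \<noteq> 0 \<Longrightarrow> P s = d s ^ N * f (\<chi> i j. B s $ i $ j / d s)"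
    and Q: "is_poly1 Q" "\<And>s. d s \<noteq> 0 \<Longrightarrow> Q s = d s ^ M * g (\<chi> i j. B s $ i $ j / d s)" by blast
  show ?case
  proof (intro exI conjI allI impI)
    show "is_poly1 (\<lambda>s. P s * Q s)" using P Q by (intro is_poly1_mult)
    show "P s * Q s = d s ^ (N + M) * (f (\<chi> i j. B s $ i $ j / d s) * g (\<chi> i j. B s $ i $ j / d s))" if "d s \<noteq> 0" for s
      unfolding P(2)[OF that] Q(2)[OF that] power_add by (simp only: algebra_simps)
  qed
qed

lemma cayley_unitary:
  fixes S :: "'n::finite cmat"
  assumes S: "adj S = - S" and d: "det (mat 1 + S) \<noteq> 0"
  defines "U \<equiv> (mat 1 - S) ** matrix_inv (mat 1 + S)"
  shows "adj U ** U = mat 1"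
proof -
  define N where "N = mat 1 + S"
  define T where "T = mat 1 - S"
  define Ni where "Ni = matrix_inv N"
  have inv: "N ** Ni = mat 1" using d matrix_inv_props(1) invertible_det_nz unfolding N_def Ni_def by blast
  have aN: "adj N = T" "adj T = N" using S by (simp_all add: N_def T_def adj_add adj_diff)
  have com: "N ** T = T ** N"
    by (simp add: N_def T_def matrix_mult_distribs algebra_simps)
  have "adj U ** U = adj Ni ** (N ** T) ** Ni"
    by (simp add: U_def N_def[symmetric] T_def[symmetric] Ni_def[symmetric] adj_mult aN matrix_mul_assoc)
  also have "\<dots> = (adj Ni ** T) ** (N ** Ni)" unfolding com by (simp add: matrix_mul_assoc)
  also have "adj Ni ** T = mat 1" using arg_cong[OF inv, of adj] by (simp add: adj_mult aN)
  finally show ?thesis by (simp add: inv)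
qed

text \<open>The Cayley transform \<open>S \<mapsto> (1 - S) (1 + S)\<^sup>-\<^sup>1\<close> maps skew-Hermitian matrices to unitary ones and is an
  involution, so it suffices to move from a skew-Hermitian matrix to an arbitrary \<open>S\<close>. On the curve
  \<open>c \<mapsto> X + c Y\<close> the matrix is skew-Hermitian for real \<open>c\<close> and equals \<open>S\<close> for \<open>c = \<i>\<close>, and a
  polynomial in \<open>c\<close> that vanishes on the reals vanishes at \<open>\<i>\<close>.\<close>

lemma polynomial_eq_0_if_eq_0_on_unitary:
  fixes p :: "'n::finite cmat \<Rightarrow> complex"
  assumes p: "p \<in> polynomials" and z: "\<And>A. adj A ** A = mat 1 \<Longrightarrow> p A = 0"
  shows "p A = 0"
proof -
  have main: "p A = 0" if dA: "det (mat 1 + A) \<noteq> 0" for A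
  proof -
    define M where "M = mat 1 + A"
    define Mi where "Mi = matrix_inv M"
    have M: "M ** Mi = mat 1" "Mi ** M = mat 1"
      using dA matrix_inv_props[of M] invertible_det_nz[of M] unfolding M_def Mi_def by auto
    define S where "S = (mat 1 - A) ** Mi"
    have S1: "mat 1 + S = Mi + Mi"
    proof -
      have "mat 1 + S = (M + (mat 1 - A)) ** Mi" by (simp add: S_def M matrix_mult_distribs)
      also have "M + (mat 1 - A) = mat 1 + mat 1" by (simp add: M_def)
      finally show ?thesis by (simp only: matrix_mult_distribs matrix_mul_lid)
    qed
    have S2: "mat 1 - S = A ** (Mi + Mi)"
    proof -
      have "mat 1 - S = (M - (mat 1 - A)) ** Mi" by (simp add: S_def M matrix_mult_distribs)
      also have "M - (mat 1 - A) = A + A" by (simp add: M_def)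
      finally show ?thesis by (simp only: matrix_mult_distribs)
    qed
    define X where "X = mat (1/2) ** (S - adj S)"
    define Y where "Y = mat (- \<i> / 2) ** (S + adj S)"
    define G where "G = (\<lambda>c. X + mat c ** Y)"
    have G: "is_poly1 (\<lambda>c. G c $ i $ j)" for i j
      unfolding G_def by (simp, intro is_poly1_add is_poly1_mult is_poly1_const is_poly1_ident)
    have Gi: "G \<i> = S" by (simp add: G_def X_def Y_def vec_eq_iff field_simps)
    have Gr: "adj (G (of_real r)) = - G (of_real r)" for r
      by (simp add: G_def X_def Y_def vec_eq_iff field_simps)
    define d where "d = (\<lambda>c. det (mat 1 + G c))"
    have dpoly: "is_poly1 d" unfolding d_def using G by (intro det_is_poly1) (auto simp: intro!: is_poly1_add is_poly1_const)
    define Q where "Q = (\<lambda>c. (\<chi> i j. det (\<chi> a b. if b = i then (if a = j then 1 else 0) else (mat 1 + G c) $ a $ b)) :: 'n cmat)"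
    have Q: "is_poly1 (\<lambda>c. Q c $ i $ j)" for i j
      unfolding Q_def vec_lambda_beta
    proof (rule det_is_poly1)
      fix a b
      show "is_poly1 (\<lambda>s. (\<chi> a b. if b = i then if a = j then 1 else 0 else (mat 1 + G s) $ a $ b) $ a $ b)"
        using G[of a b] by (cases "b = i") (auto intro!: is_poly1_add is_poly1_const)
    qed
    define B where "B = (\<lambda>c. (mat 1 - G c) ** Q c)"
    have B: "is_poly1 (\<lambda>c. B c $ i $ j)" for i j
      unfolding B_def using G Q by (intro is_poly1_mult_entry) (auto intro!: is_poly1_diff is_poly1_const)
    have BU: "(\<chi> i j. B c $ i $ j / d c) = (mat 1 - G c) ** matrix_inv (mat 1 + G c)" if "d c \<noteq> 0" for c
    proof -
      have "matrix_inv (mat 1 + G c) $ i $ j = Q c $ i $ j / d c" for i j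
        using matrix_inv_entry[of "mat 1 + G c"] that unfolding Q_def d_def by simp
      then show ?thesis by (simp add: B_def vec_eq_iff matrix_matrix_mult_def sum_divide_distrib)
    qed
    obtain N P where P: "is_poly1 P" "\<And>s. d s \<noteq> 0 \<Longrightarrow> P s = d s ^ N * p (\<chi> i j. B s $ i $ j / d s)"
      using polynomials_curve_quotient[OF p B dpoly] by blast
    have "P (of_real r) * d (of_real r) = 0" for r
    proof (cases "d (of_real r) = 0")
      case False
      have "p (\<chi> i j. B (of_real r) $ i $ j / d (of_real r)) = 0"
        unfolding BU[OF False] by (rule z, rule cayley_unitary[OF Gr]) (use False in \<open>simp add: d_def\<close>)
      then show ?thesis using P(2)[OF False] by simp
    qed simp
    then have "range complex_of_real \<subseteq> {s. P s * d s = 0}" by auto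
    moreover have "infinite (range complex_of_real)"
      by (simp add: finite_image_iff inj_of_real infinite_UNIV_char_0)
    ultimately have "infinite {s. P s * d s = 0}" using finite_subset by blast
    then have "P \<i> * d \<i> = 0" using is_poly1_zero_infinite[OF is_poly1_mult[OF P(1) dpoly]] by blast
    moreover have di: "d \<i> \<noteq> 0"
    proof -
      have "(mat 1 + S) ** (mat (1/2) ** M) = mat 1"
      proof -
        have "(Mi + Mi) ** (mat (1/2) ** M) = (Mi + Mi) ** (mat (1/2)) ** M" by (simp add: matrix_mul_assoc)
        also have "(Mi + Mi) ** (mat (1/2)) = Mi" by (simp add: vec_eq_iff)
        finally show ?thesis using M S1 by simp
      qed
      then have "invertible (mat 1 + S)" using invertible_right_inverse by blast
      then show ?thesis using invertible_det_nz unfolding d_def Gi by blast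
    qed
    ultimately have "P \<i> = 0" by simp
    then have "p (\<chi> i j. B \<i> $ i $ j / d \<i>) = 0" using P(2)[OF di] di by simp
    moreover have "(\<chi> i j. B \<i> $ i $ j / d \<i>) = A"
    proof -
      have "invertible (mat 1 + S)" using di invertible_det_nz unfolding d_def Gi by blast
      then have "(mat 1 - S) ** matrix_inv (mat 1 + S) = A"
        unfolding S2 S1[symmetric] using matrix_inv_props(1)[of "mat 1 + S"] by (simp add: matrix_mul_assoc[symmetric])
      then show ?thesis unfolding BU[OF di] Gi .
    qed
    ultimately show ?thesis by simp
  qed
  have "(\<lambda>A :: 'n cmat. det (mat 1 + A)) \<in> polynomials"
    by (intro polynomials_det) (simp, intro polynomials_intros)
  from polynomial_eq_0_if_eq_0_off_zeros[OF p this, of 0] main show ?thesis by auto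
qed

lemma polynomial_eq_0_if_eq_0_on_invertible:
  assumes "p \<in> polynomials" "\<And>A. invertible A \<Longrightarrow> p A = 0"
  shows "p (A :: 'n::finite cmat) = 0"
  by (rule polynomial_eq_0_if_eq_0_off_zeros[OF assms(1), where q=det and ?Z0.0="mat 1"])
    (auto simp: assms(2) invertible_det_nz intro!: polynomials_det[where T="\<lambda>x. x"] polynomials_entry)

section \<open>Principal minors and the big cell\<close>

definition lower_unitriangular :: "'n::{finite,wellorder} cmat \<Rightarrow> bool" where
  "lower_unitriangular A \<longleftrightarrow> (\<forall>i. A $ i $ i = 1) \<and> (\<forall>i j. i < j \<longrightarrow> A $ i $ j = 0)"

text \<open>Only the block with row and column index in \<open>S\<close> is kept; the identity fills the rest, so that
  all minors are determinants of matrices of the same size.\<close>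

definition trunc :: "'n set \<Rightarrow> 'n::finite cmat \<Rightarrow> 'n cmat" where
  "trunc S A = (\<chi> a b. if a \<in> S \<and> b \<in> S then A $ a $ b else if a = b then 1 else 0)"

definition minor :: "'n set \<Rightarrow> 'n::finite cmat \<Rightarrow> complex" where
  "minor S A = det (trunc S A)"

definition down_set :: "'n::order set \<Rightarrow> bool" where
  "down_set S \<longleftrightarrow> (\<forall>x\<in>S. \<forall>y\<le>x. y \<in> S)"

lemma trunc_nth: "trunc S A $ a $ b = (if a \<in> S \<and> b \<in> S then A $ a $ b else if a = b then 1 else 0)"
  by (simp add: trunc_def)

lemma minor_polynomial: "minor S \<in> (polynomials :: ('n::finite cmat \<Rightarrow> complex) set)"
proof -
  have "(\<lambda>A. trunc S A $ i $ j) \<in> (polynomials :: ('n cmat \<Rightarrow> complex) set)" for i j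
    by (cases "i \<in> S \<and> j \<in> S"; cases "i = j") (auto simp: trunc_nth intro: polynomials_const polynomials_entry)
  from polynomials_det[OF this] show ?thesis by (simp add: minor_def[abs_def])
qed

lemma minor_mat_1 [simp]: "minor S (mat 1) = 1"
proof -
  have "trunc S (mat 1) = mat 1" by (auto simp: vec_eq_iff trunc_nth mat_def)
  then show ?thesis by (simp add: minor_def)
qed

text \<open>A row of a lower triangular matrix with index in a down-set has no nonzero entries in columns outside the
  down-set.\<close>

lemma trunc_mult_lower:
  fixes M N :: "'n::{finite,wellorder} cmat"
  assumes M: "\<And>i j. i < j \<Longrightarrow> M $ i $ j = 0" and S: "down_set S"
  shows "trunc S (M ** N) = trunc S M ** trunc S N"
proof -
  have "trunc S (M ** N) $ a $ b = (trunc S M ** trunc S N) $ a $ b" for a b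
  proof (cases "a \<in> S")
    case True
    have "trunc S M $ a $ l * trunc S N $ l $ b = (if b \<in> S then M $ a $ l * N $ l $ b else 0)" for l
    proof (cases "l \<in> S")
      case True then show ?thesis using \<open>a \<in> S\<close> by (auto simp: trunc_nth)
    next
      case False
      then have "a < l" using \<open>a \<in> S\<close> S unfolding down_set_def by (metis not_le)
      then show ?thesis using False \<open>a \<in> S\<close> M by (auto simp: trunc_nth)
    qed
    then have "(trunc S M ** trunc S N) $ a $ b = (\<Sum>l\<in>UNIV. if b \<in> S then M $ a $ l * N $ l $ b else 0)"
      by (simp add: matrix_matrix_mult_def)
    then show ?thesis using True by (auto simp: trunc_nth matrix_matrix_mult_def)
  next
    case False
    have "(trunc S M ** trunc S N) $ a $ b = (\<Sum>l\<in>UNIV. if l = a then trunc S N $ a $ b else 0)"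
      unfolding matrix_matrix_mult_def vec_lambda_beta
      by (rule sum.cong) (use False in \<open>auto simp: trunc_nth\<close>)
    then show ?thesis using False by (simp add: trunc_nth)
  qed
  then show ?thesis by (simp add: vec_eq_iff)
qed

lemma trunc_transpose: "trunc S (transpose A) = transpose (trunc S A)"
  by (auto simp: vec_eq_iff trunc_nth transpose_def)

lemma minor_transpose: "minor S (transpose A) = minor S A"
  by (simp add: minor_def trunc_transpose det_transpose)

lemma minor_mult_lower:
  fixes M N :: "'n::{finite,wellorder} cmat"
  assumes M: "\<And>i j. i < j \<Longrightarrow> M $ i $ j = 0" and S: "down_set S"
  shows "minor S (M ** N) = (\<Prod>i\<in>S. M $ i $ i) * minor S N"
proof -
  have "det (trunc S M) = (\<Prod>i\<in>UNIV. trunc S M $ i $ i)"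
    by (rule det_lowerdiagonal) (use M in \<open>auto simp: trunc_nth\<close>)
  also have "\<dots> = (\<Prod>i\<in>UNIV. if i \<in> S then M $ i $ i else 1)"
    by (rule prod.cong) (auto simp: trunc_nth)
  also have "\<dots> = (\<Prod>i\<in>S. M $ i $ i)" by (simp add: prod.If_cases)
  finally have "det (trunc S M) = (\<Prod>i\<in>S. M $ i $ i)" .
  moreover have "trunc S (M ** N) = trunc S M ** trunc S N" using M S by (rule trunc_mult_lower)
  ultimately show ?thesis by (simp only: minor_def det_mul)
qed

lemma minor_mult_upper:
  fixes M N :: "'n::{finite,wellorder} cmat"
  assumes N: "\<And>i j. j < i \<Longrightarrow> N $ i $ j = 0" and S: "down_set S"
  shows "minor S (M ** N) = minor S M * (\<Prod>i\<in>S. N $ i $ i)"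
proof -
  have "minor S (M ** N) = minor S (transpose N ** transpose M)"
    by (metis matrix_transpose_mul minor_transpose)
  also have "\<dots> = (\<Prod>i\<in>S. transpose N $ i $ i) * minor S (transpose M)"
    by (rule minor_mult_lower[OF _ S]) (simp add: transpose_def N)
  also have "(\<Prod>i\<in>S. transpose N $ i $ i) = (\<Prod>i\<in>S. N $ i $ i)" by (simp add: transpose_def)
  finally show ?thesis by (simp add: minor_transpose)
qed

text \<open>The triangular decomposition is stated as \<open>A U = L D\<close>, which avoids inverses.\<close>

definition big_cell :: "'n::{finite,wellorder} cmat \<Rightarrow> bool" where
  "big_cell A \<longleftrightarrow> (\<exists>U L a. upper_unitriangular U \<and> lower_unitriangular L \<and> (\<forall>i. a i \<noteq> 0) \<and>
     A ** U = L ** diag_mat a)"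

lemma diag_mat_nth: "diag_mat t $ i $ j = (if i = j then t i else 0)"
  by (simp add: diag_mat_def)

lemma diag_mult_nth [simp]: "(diag_mat t ** A) $ i $ j = t i * A $ i $ j"
  by (simp add: diag_mat_nth matrix_matrix_mult_def if_distrib[of "\<lambda>x. x * _"] cong: if_cong)

lemma mult_diag_nth [simp]: "(A ** diag_mat t) $ i $ j = A $ i $ j * t j"
  by (simp add: diag_mat_nth matrix_matrix_mult_def if_distrib[of "\<lambda>x. _ * x"] cong: if_cong)

lemma diag_mult_diag: "diag_mat s ** diag_mat t = diag_mat (\<lambda>i. s i * t i)"
  by (simp add: vec_eq_iff diag_mat_nth)

lemma diag_mat_1 [simp]: "diag_mat (\<lambda>i. 1) = mat 1"
  by (simp add: vec_eq_iff diag_mat_nth mat_def)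

lemma diag_mat_const: "diag_mat (\<lambda>i. c) = mat c"
  by (simp add: vec_eq_iff diag_mat_nth mat_def)

lemma det_diag_mat: "det (diag_mat t) = (\<Prod>i\<in>UNIV. t i)"
  by (subst det_diagonal) (simp_all add: diag_mat_nth)

lemma det_upper_unitriangular: "upper_unitriangular U \<Longrightarrow> det U = 1"
  by (subst det_upperdiagonal) (auto simp: upper_unitriangular_def)

lemma det_lower_unitriangular: "lower_unitriangular L \<Longrightarrow> det L = 1"
  by (subst det_lowerdiagonal) (auto simp: lower_unitriangular_def)

lemma invertible_upper_unitriangular: "upper_unitriangular U \<Longrightarrow> invertible U"
  by (simp add: invertible_det_nz det_upper_unitriangular)

lemma invertible_lower_unitriangular: "lower_unitriangular L \<Longrightarrow> invertible L"
  by (simp add: invertible_det_nz det_lower_unitriangular)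

lemma invertible_diag_mat: "(\<And>i. a i \<noteq> 0) \<Longrightarrow> invertible (diag_mat a)"
  by (simp add: invertible_det_nz det_diag_mat)

text \<open>Gaussian elimination on columns. The \<open>i\<close>-th column of \<open>U\<close> is found by solving the linear system
  whose matrix is the leading block strictly before \<open>i\<close>; its determinant is the minor assumed
  nonzero.\<close>

lemma big_cell_if_minors_nonzero:
  fixes A :: "'n::{finite,wellorder} cmat"
  assumes m: "\<And>i. minor {..<i} A \<noteq> 0" and d: "det A \<noteq> 0"
  shows "big_cell A"
proof -
  define T where "T = (\<lambda>i. trunc {..<i} A)"
  define r where "r = (\<lambda>i. (\<chi> b. if b < i then - A $ b $ i else 0) :: (complex, 'n) vec)"
  define u where "u = (\<lambda>i. matrix_inv (T i) *v r i)"
  have "invertible (T i)" for i using m by (simp add: T_def minor_def invertible_det_nz)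
  then have Tu: "T i *v u i = r i" for i
    by (simp add: u_def matrix_vector_mul_assoc matrix_inv_props)
  have u0: "u i $ b = 0" if "\<not> b < i" for i b
  proof -
    have "(T i *v u i) $ b = (\<Sum>a\<in>UNIV. if a = b then u i $ a else 0)"
      unfolding matrix_vector_mult_def vec_lambda_beta by (rule sum.cong) (use that in \<open>auto simp: T_def trunc_nth\<close>)
    then show ?thesis using that unfolding Tu by (simp add: r_def)
  qed
  have u1: "(\<Sum>a\<in>UNIV. A $ b $ a * u i $ a) = - A $ b $ i" if "b < i" for i b
  proof -
    have "(\<Sum>a\<in>UNIV. A $ b $ a * u i $ a) = (T i *v u i) $ b"
      unfolding matrix_vector_mult_def vec_lambda_beta by (rule sum.cong) (use that u0 in \<open>auto simp: T_def trunc_nth\<close>)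
    then show ?thesis using that unfolding Tu by (simp add: r_def)
  qed
  define U where "U = ((\<chi> a i. u i $ a + (if a = i then 1 else 0)) :: 'n cmat)"
  have U: "upper_unitriangular U" using u0 by (auto simp: upper_unitriangular_def U_def)
  define M where "M = A ** U"
  have M0: "M $ b $ i = 0" if "b < i" for b i
  proof -
    have "M $ b $ i = (\<Sum>a\<in>UNIV. A $ b $ a * u i $ a) + (\<Sum>a\<in>UNIV. if a = i then A $ b $ a else 0)"
      unfolding M_def U_def matrix_matrix_mult_def vec_lambda_beta sum.distrib[symmetric]
      by (rule sum.cong) (auto simp: algebra_simps)
    then show ?thesis using u1[OF that] by simp
  qed
  have "det M = det A" using det_upper_unitriangular[OF U] by (simp add: M_def det_mul)
  moreover have "det M = (\<Prod>i\<in>UNIV. M $ i $ i)" by (rule det_lowerdiagonal) (use M0 in auto)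
  ultimately have "(\<Prod>i\<in>UNIV. M $ i $ i) \<noteq> 0" using d by simp
  then have a: "M $ i $ i \<noteq> 0" for i by (metis UNIV_I finite_class.finite_UNIV prod_zero)
  define a where "a = (\<lambda>i. M $ i $ i)"
  define L where "L = ((\<chi> i j. M $ i $ j / a j) :: 'n cmat)"
  have "lower_unitriangular L" using M0 a by (auto simp: lower_unitriangular_def L_def a_def)
  moreover have "A ** U = L ** diag_mat a" using a by (simp add: M_def[symmetric] vec_eq_iff L_def a_def)
  moreover have "\<forall>i. a i \<noteq> 0" using a by (simp add: a_def)
  ultimately show ?thesis unfolding big_cell_def using U by blast
qed

text \<open>The big cell contains the set where a certain nonzero polynomial does not vanish.\<close>

lemma polynomial_eq_0_if_eq_0_on_big_cell:
  fixes p :: "'n::{finite,wellorder} cmat \<Rightarrow> complex"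
  assumes "p \<in> polynomials" "\<And>A. big_cell A \<Longrightarrow> p A = 0"
  shows "p A = 0"
proof (rule polynomial_eq_0_if_eq_0_off_zeros[OF assms(1)])
  show "(\<lambda>A. (\<Prod>i\<in>UNIV. minor {..<i} A) * det A) \<in> (polynomials :: ('n cmat \<Rightarrow> complex) set)"
    by (intro polynomials_mult polynomials_prod minor_polynomial polynomials_det[where T="\<lambda>x. x"] polynomials_entry)
  show "(\<Prod>i\<in>UNIV. minor {..<i} (mat 1 :: 'n cmat)) * det (mat 1 :: 'n cmat) \<noteq> 0" by simp
  show "p Z = 0" if "(\<Prod>i\<in>UNIV. minor {..<i} Z) * det Z \<noteq> 0" for Z
    using that by (intro assms(2) big_cell_if_minors_nonzero) auto
qed

lemma big_cell_invertible: "big_cell A \<Longrightarrow> invertible A"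
proof -
  assume "big_cell A"
  then obtain U L a where h: "upper_unitriangular U" "lower_unitriangular L" "\<And>i. a i \<noteq> 0" "A ** U = L ** diag_mat a"
    unfolding big_cell_def by blast
  have "det A * det U = det L * det (diag_mat a)" using arg_cong[OF h(4), of det] by (simp add: det_mul)
  then show ?thesis using h(3) det_upper_unitriangular[OF h(1)] det_lower_unitriangular[OF h(2)]
    by (simp add: det_diag_mat invertible_det_nz)
qed

section \<open>Highest weight functions\<close>

definition torus_char :: "('n::finite \<Rightarrow> int) \<Rightarrow> ('n \<Rightarrow> complex) \<Rightarrow> complex" where
  "torus_char \<mu> a = (\<Prod>i\<in>UNIV. a i powi \<mu> i)"

text \<open>The function \<open>A \<mapsto> v' (A v)\<close> for a highest weight vector \<open>v\<close> and the lowest weight covector \<open>v'\<close> of the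
  dual behaves like this. On the big cell its values follow from the one at the identity.\<close>

definition hw_function :: "('n::{finite,wellorder} \<Rightarrow> int) \<Rightarrow> ('n cmat \<Rightarrow> complex) \<Rightarrow> bool" where
  "hw_function \<mu> F \<longleftrightarrow> F \<in> polynomials \<and>
     (\<forall>L Z. lower_unitriangular L \<longrightarrow> F (L ** Z) = F Z) \<and>
     (\<forall>U Z. upper_unitriangular U \<longrightarrow> F (Z ** U) = F Z) \<and>
     (\<forall>a Z. (\<forall>i. a i \<noteq> 0) \<longrightarrow> F (diag_mat a ** Z) = torus_char \<mu> a * F Z)"

lemma hw_functionD:
  assumes "hw_function \<mu> F"
  shows "F \<in> polynomials" "\<And>L Z. lower_unitriangular L \<Longrightarrow> F (L ** Z) = F Z"
    "\<And>U Z. upper_unitriangular U \<Longrightarrow> F (Z ** U) = F Z"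
    "\<And>a Z. (\<And>i. a i \<noteq> 0) \<Longrightarrow> F (diag_mat a ** Z) = torus_char \<mu> a * F Z"
  using assms unfolding hw_function_def by blast+

lemma torus_char_nonzero: "(\<And>i. a i \<noteq> 0) \<Longrightarrow> torus_char \<mu> a \<noteq> 0"
  by (simp add: torus_char_def)

lemma hw_function_big_cell:
  assumes "hw_function \<mu> F" "upper_unitriangular U" "lower_unitriangular L" "\<And>i. a i \<noteq> 0" "A ** U = L ** diag_mat a"
  shows "F A = torus_char \<mu> a * F (mat 1)"
proof -
  note h = hw_functionD[OF assms(1)]
  have "F A = F (L ** diag_mat a)" using h(3)[OF assms(2), of A] assms(5) by simp
  also have "\<dots> = torus_char \<mu> a * F (mat 1)" using h(2)[OF assms(3)] h(4)[where Z="mat 1"] assms(4) by simp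
  finally show ?thesis .
qed

lemma hw_function_unique:
  assumes F: "hw_function \<mu> F" "F (mat 1) = 1" and G: "hw_function \<mu> G"
  shows "G = cscale (G (mat 1)) F"
proof
  fix A
  have "G A - G (mat 1) * F A = 0"
  proof (rule polynomial_eq_0_if_eq_0_on_big_cell[where p="\<lambda>A. G A - G (mat 1) * F A"])
    show "(\<lambda>A. G A - G (mat 1) * F A) \<in> polynomials"
      using hw_functionD(1)[OF F(1)] hw_functionD(1)[OF G] by (intro polynomials_diff polynomials_scale)
    fix A :: "'a cmat" assume "big_cell A"
    then obtain U L a where h: "upper_unitriangular U" "lower_unitriangular L" "\<And>i. a i \<noteq> 0" "A ** U = L ** diag_mat a"
      unfolding big_cell_def by blast
    show "G A - G (mat 1) * F A = 0"
      using hw_function_big_cell[OF F(1) h] hw_function_big_cell[OF G h] F(2) by simp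
  qed
  then show "G A = cscale (G (mat 1)) F A" by (simp add: cscale_apply)
qed

text \<open>Weights are separated by diagonal matrices whose entries are \<open>2\<close> in one place and \<open>1\<close> elsewhere.\<close>

lemma torus_char_eq_imp_eq:
  fixes \<mu> \<nu> :: "'n::finite \<Rightarrow> int"
  assumes "\<And>a. (\<And>i. a i \<noteq> 0) \<Longrightarrow> torus_char \<mu> a = torus_char \<nu> a"
  shows "\<mu> = \<nu>"
proof
  fix i
  define a where "a = (\<lambda>j :: 'n. if j = i then 2 else 1 :: complex)"
  have t: "torus_char \<kappa> a = 2 powi \<kappa> i" for \<kappa> :: "'n \<Rightarrow> int"
  proof -
    have "torus_char \<kappa> a = (\<Prod>j\<in>UNIV. if j = i then 2 powi \<kappa> j else 1)"
      unfolding torus_char_def a_def by (rule prod.cong) auto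
    then show ?thesis by simp
  qed
  have "(2::complex) powi \<mu> i = 2 powi \<nu> i" using assms[of a] t by (simp add: a_def)
  then have "cmod (2 powi \<mu> i) = cmod (2 powi \<nu> i)" by simp
  then have "(2::real) powi \<mu> i = 2 powi \<nu> i" by (simp add: norm_power_int)
  then show "\<mu> i = \<nu> i" using power_int_strict_increasing[of _ _ "2::real"]
    by (metis linorder_neqE_linordered_idom one_less_numeral_iff order_less_irrefl semiring_norm(76))
qed

text \<open>Induction on the size of the weight. The indices with positive weight form a down-set \<open>S\<close>, and
  multiplication by the minor on \<open>S\<close> raises exactly these weights by one.\<close>

lemma ex_hw_function:
  fixes \<mu> :: "'n::{finite,wellorder} \<Rightarrow> int"
  assumes "\<mu> \<in> dominant_weights"
  shows "\<exists>F. hw_function \<mu> F \<and> F (mat 1) = 1"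
  using assms
proof (induction "nat (\<Sum>i\<in>UNIV. \<mu> i)" arbitrary: \<mu> rule: less_induct)
  case less
  have dom: "\<And>i j. i \<le> j \<Longrightarrow> \<mu> j \<le> \<mu> i" "\<And>i. 0 \<le> \<mu> i"
    using less.prems by (auto simp: dominant_weights_def antimono_def)
  show ?case
  proof (cases "\<forall>i. \<mu> i = 0")
    case True
    then have "hw_function \<mu> (\<lambda>_. 1)" by (simp add: hw_function_def torus_char_def polynomials_const)
    then show ?thesis by auto
  next
    case False
    define S where "S = {i. \<mu> i > 0}"
    have S: "down_set S" unfolding down_set_def S_def using dom(1) by force
    define \<nu> where "\<nu> = (\<lambda>i. \<mu> i - (if i \<in> S then 1 else 0))"
    have "\<nu> \<in> dominant_weights"
      unfolding dominant_weights_def antimono_def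
    proof (intro CollectI conjI allI impI)
      show "0 \<le> \<nu> i" for i using dom(2)[of i] by (auto simp: \<nu>_def S_def)
      show "\<nu> j \<le> \<nu> i" if "i \<le> j" for i j using dom(1)[OF that] dom(2)[of j] by (auto simp: \<nu>_def S_def)
    qed
    moreover have "(\<Sum>i\<in>UNIV. \<nu> i) < (\<Sum>i\<in>UNIV. \<mu> i)"
    proof -
      obtain i where i: "\<mu> i \<noteq> 0" using False by blast
      have "\<nu> i < \<mu> i" using i dom(2)[of i] by (simp add: \<nu>_def S_def)
      then have "\<exists>i\<in>UNIV. \<nu> i < \<mu> i" by blast
      then show ?thesis by (intro sum_strict_mono_ex1) (simp_all add: \<nu>_def)
    qed
    moreover have "0 \<le> (\<Sum>i\<in>UNIV. \<nu> i)"
      using \<open>\<nu> \<in> dominant_weights\<close> by (intro sum_nonneg) (auto simp: dominant_weights_def)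
    ultimately obtain F where F: "hw_function \<nu> F" "F (mat 1) = 1"
      using less.hyps[of \<nu>] by auto
    note h = hw_functionD[OF F(1)]
    have tc: "torus_char \<mu> a = torus_char \<nu> a * (\<Prod>i\<in>S. a i)" if "\<And>i. a i \<noteq> 0" for a
    proof -
      have "(\<Prod>i\<in>S. a i) = (\<Prod>i\<in>UNIV. if i \<in> S then a i else 1)" by (simp add: prod.If_cases)
      then have "torus_char \<nu> a * (\<Prod>i\<in>S. a i) = (\<Prod>i\<in>UNIV. a i powi \<nu> i * (if i \<in> S then a i else 1))"
        by (simp add: torus_char_def prod.distrib)
      also have "\<dots> = torus_char \<mu> a"
        unfolding torus_char_def
      proof (rule prod.cong[OF refl])
        fix i
        show "a i powi \<nu> i * (if i \<in> S then a i else 1) = a i powi \<mu> i"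
          using power_int_add_1[of "a i" "\<mu> i - 1"] that[of i] by (simp add: \<nu>_def)
      qed
      finally show ?thesis by simp
    qed
    have "hw_function \<mu> (\<lambda>Z. F Z * minor S Z)"
      unfolding hw_function_def
    proof (intro conjI allI impI)
      show "(\<lambda>Z. F Z * minor S Z) \<in> polynomials" by (intro polynomials_mult h minor_polynomial)
      fix Z :: "'n cmat"
      show "F (L ** Z) * minor S (L ** Z) = F Z * minor S Z" if "lower_unitriangular L" for L
        using that h(2)[OF that] minor_mult_lower[OF _ S, of L Z] by (simp add: lower_unitriangular_def)
      show "F (Z ** U) * minor S (Z ** U) = F Z * minor S Z" if "upper_unitriangular U" for U
        using that h(3)[OF that] minor_mult_upper[OF _ S, of U Z] by (simp add: upper_unitriangular_def)
      show "F (diag_mat a ** Z) * minor S (diag_mat a ** Z) = torus_char \<mu> a * (F Z * minor S Z)" if "\<forall>i. a i \<noteq> 0" for a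
        using that h(4)[of a] minor_mult_lower[OF _ S, of "diag_mat a" Z] tc[of a] by (simp add: diag_mat_nth)
    qed
    then show ?thesis using F(2) by (intro exI[of _ "\<lambda>Z. F Z * minor S Z"]) simp
  qed
qed

section \<open>Two-sided translation\<close>

definition bitrans :: "'n::finite cmat \<Rightarrow> 'n cmat \<Rightarrow> ('n cmat \<Rightarrow> complex) \<Rightarrow> 'n cmat \<Rightarrow> complex" where
  "bitrans g h f = (\<lambda>Z. f (g ** Z ** h))"

lemma bitrans_bitrans: "bitrans g h (bitrans g' h' f) = bitrans (g' ** g) (h ** h') f"
  by (simp add: bitrans_def matrix_mul_assoc)

lemma bitrans_1 [simp]: "bitrans (mat 1) (mat 1) f = f"
  by (simp add: bitrans_def)

lemma polynomials_bitrans: "f \<in> polynomials \<Longrightarrow> bitrans g h f \<in> polynomials"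
  unfolding bitrans_def
  by (rule polynomials_compose, assumption) (intro polynomials_mult_entry polynomials_const polynomials_entry)

lemma polynomials_bitrans_left: "f \<in> polynomials \<Longrightarrow> (\<lambda>g. f (g ** Z ** h)) \<in> polynomials"
  by (rule polynomials_compose, assumption) (intro polynomials_mult_entry polynomials_const polynomials_entry)

lemma polynomials_bitrans_right: "f \<in> polynomials \<Longrightarrow> (\<lambda>h. f (g ** Z ** h)) \<in> polynomials"
  by (rule polynomials_compose, assumption) (intro polynomials_mult_entry polynomials_const polynomials_entry)

text \<open>Stability under all matrices, singular ones included, is no stronger than stability under unitary
  ones on spaces of polynomials of finite dimension; it removes all side conditions.\<close>

definition bi_stable :: "('n::finite cmat \<Rightarrow> complex) set \<Rightarrow> bool" where
  "bi_stable V \<longleftrightarrow> (\<forall>g h. \<forall>f\<in>V. bitrans g h f \<in> V)"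

definition unitary :: "'n::finite cmat \<Rightarrow> bool" where
  "unitary A \<longleftrightarrow> adj A ** A = mat 1"

text \<open>Membership in a finite-dimensional space is expressed by interpolation, hence by identities that are
  polynomial in the group element and may be checked on unitary matrices, for one side at a time.\<close>

lemma bi_stable_if_unitary_stable:
  fixes V :: "('n::finite cmat \<Rightarrow> complex) set"
  assumes V: "finite_dim V" "V \<subseteq> polynomials"
    and st: "\<And>g h f. unitary g \<Longrightarrow> unitary h \<Longrightarrow> f \<in> V \<Longrightarrow> bitrans g h f \<in> V"
  shows "bi_stable V"
proof -
  obtain X e where I: "interpolates X e V" using ex_interpolation V(1) by blast
  note s = finite_dim_imp_subspace[OF V(1)]
  have eq: "f (g ** Z ** h) = (\<Sum>x\<in>X. f (g ** x ** h) * e x Z)" if "bitrans g h f \<in> V" for f g h Z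
    using interpolatesD(4)[OF I that, of Z] by (simp add: bitrans_def)
  have 1: "bitrans g h f \<in> V" if h: "unitary h" and f: "f \<in> V" for g h f
  proof (rule interpolation_mem[OF I s])
    fix Z
    have fp: "(\<lambda>g. f (g ** z ** h)) \<in> polynomials" for z
      by (rule polynomials_bitrans_left) (use f V(2) in blast)
    have p: "(\<lambda>g. f (g ** Z ** h) - (\<Sum>x\<in>X. f (g ** x ** h) * e x Z)) \<in> polynomials"
      by (intro polynomials_diff polynomials_sum polynomials_mult fp polynomials_const)
    have "f (A ** Z ** h) - (\<Sum>x\<in>X. f (A ** x ** h) * e x Z) = 0" if "adj A ** A = mat 1" for A
      using eq[OF st[OF _ h f], of A Z] that unfolding unitary_def by simp
    from polynomial_eq_0_if_eq_0_on_unitary[OF p this, of g]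
    have "f (g ** Z ** h) - (\<Sum>x\<in>X. f (g ** x ** h) * e x Z) = 0" .
    then show "bitrans g h f Z = (\<Sum>x\<in>X. f (g ** x ** h) * e x Z)" by (simp add: bitrans_def)
  qed
  have "bitrans g h f \<in> V" if f: "f \<in> V" for g h f
  proof (rule interpolation_mem[OF I s])
    fix Z
    have fp: "(\<lambda>h. f (g ** z ** h)) \<in> polynomials" for z
      by (rule polynomials_bitrans_right) (use f V(2) in blast)
    have p: "(\<lambda>h. f (g ** Z ** h) - (\<Sum>x\<in>X. f (g ** x ** h) * e x Z)) \<in> polynomials"
      by (intro polynomials_diff polynomials_sum polynomials_mult fp polynomials_const)
    have "f (g ** Z ** A) - (\<Sum>x\<in>X. f (g ** x ** A) * e x Z) = 0" if "adj A ** A = mat 1" for A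
      using eq[OF 1[OF _ f], of A g Z] that unfolding unitary_def by simp
    from polynomial_eq_0_if_eq_0_on_unitary[OF p this, of h]
    have "f (g ** Z ** h) - (\<Sum>x\<in>X. f (g ** x ** h) * e x Z) = 0" .
    then show "bitrans g h f Z = (\<Sum>x\<in>X. f (g ** x ** h) * e x Z)" by (simp add: bitrans_def)
  qed
  then show ?thesis by (auto simp: bi_stable_def)
qed

lemma bi_stable_if_invertible_stable:
  fixes V :: "('n::finite cmat \<Rightarrow> complex) set"
  assumes V: "finite_dim V" "V \<subseteq> polynomials"
    and st: "\<And>g h f. invertible g \<Longrightarrow> invertible h \<Longrightarrow> f \<in> V \<Longrightarrow> bitrans g h f \<in> V"
  shows "bi_stable V"
proof (rule bi_stable_if_unitary_stable[OF V])
  fix g h f assume *: "unitary (g :: 'n cmat)" "unitary (h :: 'n cmat)" "f \<in> V"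
  have "invertible A" if "unitary A" for A :: "'n cmat"
    using that invertible_left_inverse unfolding unitary_def by blast
  then show "bitrans g h f \<in> V" using * st by blast
qed

definition bi_span :: "('n::finite cmat \<Rightarrow> complex) \<Rightarrow> ('n cmat \<Rightarrow> complex) set" where
  "bi_span p = cfun.span {bitrans g h p | g h. True}"

lemma bi_span_base: "bitrans g h p \<in> bi_span p"
  unfolding bi_span_def by (rule cfun.span_base) blast

lemma bi_span_self: "p \<in> bi_span p"
  using bi_span_base[of "mat 1" "mat 1" p] by simp

lemma bi_span_subspace: "cfun.subspace (bi_span p)"
  by (simp add: bi_span_def)

lemma bi_span_least:
  assumes "cfun.subspace V" "\<And>g h. bitrans g h p \<in> V"
  shows "bi_span p \<subseteq> V"
  unfolding bi_span_def by (rule cfun.span_minimal[OF _ assms(1)]) (use assms(2) in auto)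

lemma bitrans_add: "bitrans g h (f1 + f2) = bitrans g h f1 + bitrans g h f2"
  by (simp add: bitrans_def fun_eq_iff)

lemma bitrans_cscale: "bitrans g h (cscale c f) = cscale c (bitrans g h f)"
  by (simp add: bitrans_def cscale_def)

lemma bitrans_0: "bitrans g h 0 = 0"
  by (simp add: bitrans_def fun_eq_iff)

lemma subspace_bitrans_vimage:
  assumes "cfun.subspace V" shows "cfun.subspace {f. bitrans g h f \<in> V}"
  by (rule cfun.subspaceI)
    (simp_all add: bitrans_add bitrans_cscale bitrans_0 cfun.subspace_0[OF assms]
      cfun.subspace_add[OF assms] cfun.subspace_scale[OF assms])

lemma bi_span_bi_stable: "bi_stable (bi_span p)"
  unfolding bi_stable_def
proof (intro allI)
  fix g h
  have "bi_span p \<subseteq> {f. bitrans g h f \<in> bi_span p}"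
    by (rule bi_span_least[OF subspace_bitrans_vimage[OF bi_span_subspace]])
      (simp add: bitrans_bitrans bi_span_base)
  then show "\<forall>f\<in>bi_span p. bitrans g h f \<in> bi_span p" by blast
qed

lemma bi_span_least_stable: "cfun.subspace V \<Longrightarrow> bi_stable V \<Longrightarrow> p \<in> V \<Longrightarrow> bi_span p \<subseteq> V"
  by (rule bi_span_least) (auto simp: bi_stable_def)

lemma bi_span_polynomials: "p \<in> polynomials \<Longrightarrow> bi_span p \<subseteq> polynomials"
  by (rule bi_span_least[OF polynomials_subspace polynomials_bitrans])

text \<open>By induction on the polynomial: the translates of a product lie in the span of products.\<close>

lemma bi_span_finite_dim:
  assumes "p \<in> polynomials" shows "finite_dim (bi_span (p :: 'n::finite cmat \<Rightarrow> complex))"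
proof -
  have "\<exists>B. finite B \<and> (\<forall>g h. bitrans g h p \<in> cfun.span B)"
    using assms
  proof (induction rule: polynomials_induct)
    case (const c)
    show ?case by (rule exI[of _ "{\<lambda>_. c}"]) (auto simp: bitrans_def intro: cfun.span_base)
  next
    case (entry i j)
    define B where "B = range (\<lambda>(a, b) (Z :: 'n cmat). Z $ a $ b)"
    have "bitrans g h (\<lambda>Z. Z $ i $ j) \<in> cfun.span B" for g h
    proof -
      have "(\<Sum>b\<in>UNIV. \<Sum>a\<in>UNIV. cscale (g $ i $ a * h $ b $ j) (\<lambda>Z :: 'n cmat. Z $ a $ b)) \<in> cfun.span B"
        by (intro cfun.span_sum cfun.span_scale cfun.span_base) (auto simp: B_def)
      also have "(\<Sum>b\<in>UNIV. \<Sum>a\<in>UNIV. cscale (g $ i $ a * h $ b $ j) (\<lambda>Z :: 'n cmat. Z $ a $ b))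
          = bitrans g h (\<lambda>Z. Z $ i $ j)"
        by (simp add: fun_eq_iff fun_sum_apply cscale_def bitrans_def matrix_matrix_mult_def sum_distrib_right sum_distrib_left mult_ac)
      finally show ?thesis .
    qed
    moreover have "finite B" by (simp add: B_def)
    ultimately show ?case by blast
  next
    case (add f g)
    then obtain B C where B: "finite B" "\<And>g h. bitrans g h f \<in> cfun.span B"
      and C: "finite C" "\<And>a b. bitrans a b g \<in> cfun.span C" by blast
    have "bitrans a b f + bitrans a b g \<in> cfun.span (B \<union> C)" for a b
      using B(2)[of a b] C(2)[of a b] cfun.span_mono[of B "B \<union> C"] cfun.span_mono[of C "B \<union> C"]
      by (intro cfun.span_add) auto
    then have "bitrans a b (\<lambda>Z. f Z + g Z) \<in> cfun.span (B \<union> C)" for a b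
      by (simp add: bitrans_def plus_fun_def)
    then show ?case using B(1) C(1) by (intro exI[of _ "B \<union> C"]) auto
  next
    case (mult f g)
    then obtain B C where B: "finite B" "\<And>g h. bitrans g h f \<in> cfun.span B"
      and C: "finite C" "\<And>a b. bitrans a b g \<in> cfun.span C" by blast
    define D where "D = (\<lambda>(u, v) Z. u Z * v Z) ` (B \<times> C)"
    have 1: "(\<lambda>Z. u Z * v Z) \<in> cfun.span D" if u: "u \<in> B" and v: "v \<in> cfun.span C" for u v
      using v
    proof (induction rule: cfun.span_induct_alt)
      case base
      show ?case using cfun.span_zero[of D] by (simp add: zero_fun_def)
    next
      case (step c x y)
      have "(\<lambda>Z. u Z * x Z) \<in> cfun.span D" using u step(1) by (intro cfun.span_base) (auto simp: D_def)
      then have "cscale c (\<lambda>Z. u Z * x Z) + (\<lambda>Z. u Z * y Z) \<in> cfun.span D"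
        using step(2) by (intro cfun.span_add cfun.span_scale)
      also have "cscale c (\<lambda>Z. u Z * x Z) + (\<lambda>Z. u Z * y Z) = (\<lambda>Z. u Z * (cscale c x + y) Z)"
        by (simp add: fun_eq_iff cscale_def algebra_simps)
      finally show ?case .
    qed
    have 2: "(\<lambda>Z. u Z * v Z) \<in> cfun.span D" if u: "u \<in> cfun.span B" and v: "v \<in> cfun.span C" for u v
      using u
    proof (induction rule: cfun.span_induct_alt)
      case base
      show ?case using cfun.span_zero[of D] by (simp add: zero_fun_def)
    next
      case (step c x y)
      have "cscale c (\<lambda>Z. x Z * v Z) + (\<lambda>Z. y Z * v Z) \<in> cfun.span D"
        using step 1[OF _ v] by (intro cfun.span_add cfun.span_scale)
      also have "cscale c (\<lambda>Z. x Z * v Z) + (\<lambda>Z. y Z * v Z) = (\<lambda>Z. (cscale c x + y) Z * v Z)"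
        by (simp add: fun_eq_iff cscale_def algebra_simps)
      finally show ?case .
    qed
    have "bitrans a b (\<lambda>Z. f Z * g Z) \<in> cfun.span D" for a b
      using 2[OF B(2)[of a b] C(2)[of a b]] by (simp add: bitrans_def)
    then show ?case using B(1) C(1) by (intro exI[of _ D]) (auto simp: D_def)
  qed
  then obtain B where "finite B" "\<And>g h. bitrans g h p \<in> cfun.span B" by blast
  then show ?thesis
    by (intro finite_dim_subspace[OF _ bi_span_subspace bi_span_least]) (auto simp: finite_dim_def)
qed

section \<open>Existence of highest weight functions in stable spaces\<close>

lemma poly_eq_if_eq_off_0:
  assumes "\<And>s. s \<noteq> 0 \<Longrightarrow> poly p s = poly q (s :: complex)" shows "p = q"
proof -
  have "- {0} \<subseteq> {s. poly (p - q) s = 0}" using assms by auto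
  moreover have "infinite (- {0 :: complex})" by (simp add: finite_compl infinite_UNIV_char_0)
  ultimately have "p - q = 0" using poly_roots_finite[of "p - q"] finite_subset by blast
  then show ?thesis by simp
qed

lemma is_poly1_eq_if_eq_off_0:
  assumes "is_poly1 \<phi>" "is_poly1 \<psi>" "\<And>s. s \<noteq> 0 \<Longrightarrow> \<phi> s = \<psi> s" shows "\<phi> s = \<psi> s"
proof -
  obtain p q where "\<And>s. \<phi> s = poly p s" "\<And>s. \<psi> s = poly q s" using assms(1,2) by (auto simp: is_poly1_def)
  then show ?thesis using poly_eq_if_eq_off_0[of p q] assms(3) by simp
qed

text \<open>Among all polynomials \<open>s \<mapsto> f (\<sigma> s x)\<close> with \<open>f\<close> in \<open>V\<close> let \<open>m\<close> be the largest degree. The coefficient of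
  \<open>s\<^sup>m\<close>, as a function of \<open>x\<close>, lies in \<open>V\<close> and is an eigenvector of \<open>\<sigma>\<close>: this produces both weight vectors
  and, with \<open>unipotent_invariance\<close>, vectors fixed by unipotent groups.\<close>

lemma ex_leading_coefficient:
  fixes \<sigma> :: "complex \<Rightarrow> 'x \<Rightarrow> 'x"
  assumes V: "finite_dim V" "V \<noteq> {0}" and st: "\<And>s f. s \<noteq> 0 \<Longrightarrow> f \<in> V \<Longrightarrow> (\<lambda>x. f (\<sigma> s x)) \<in> V"
    and pol: "\<And>f x. f \<in> V \<Longrightarrow> is_poly1 (\<lambda>s. f (\<sigma> s x))"
    and one: "\<And>x. \<sigma> 1 x = x" and mult: "\<And>s r x. \<sigma> s (\<sigma> r x) = \<sigma> (s * r) x"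
  shows "\<exists>m h. h \<in> V \<and> h \<noteq> 0 \<and> (\<forall>r x. r \<noteq> 0 \<longrightarrow> h (\<sigma> r x) = r ^ m * h x) \<and>
     (\<forall>f\<in>V. \<forall>x. \<exists>p. degree p \<le> m \<and> (\<forall>s. f (\<sigma> s x) = poly p s))"
proof -
  obtain X e where I: "interpolates X e V" using ex_interpolation V(1) by blast
  note J = interpolatesD[OF I]
  note sV = finite_dim_imp_subspace[OF V(1)]
  define P where "P = (\<lambda>f x. SOME p. \<forall>s. f (\<sigma> s x) = poly p s)"
  have P: "f (\<sigma> s x) = poly (P f x) s" if "f \<in> V" for f x s
    unfolding P_def by (rule someI2_ex[OF pol[OF that, unfolded is_poly1_def]]) blast
  have PP: "P f z = (\<Sum>y\<in>X. \<Sum>x\<in>X. smult (f x * e y z) (P (e x) y))" if f: "f \<in> V" for f z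
  proof (rule poly_eq_if_eq_off_0)
    fix s :: complex assume s: "s \<noteq> 0"
    have "f (\<sigma> s z) = (\<Sum>y\<in>X. f (\<sigma> s y) * e y z)" by (rule J(4)[OF st[OF s f]])
    also have "\<dots> = (\<Sum>y\<in>X. (\<Sum>x\<in>X. f x * e x (\<sigma> s y)) * e y z)"
      by (rule sum.cong[OF refl]) (simp only: J(4)[OF f, of "\<sigma> s _", symmetric])
    also have "\<dots> = (\<Sum>y\<in>X. \<Sum>x\<in>X. f x * e y z * poly (P (e x) y) s)"
      unfolding sum_distrib_right by (intro sum.cong refl) (simp add: P J(2) mult_ac)
    also have "\<dots> = poly (\<Sum>y\<in>X. \<Sum>x\<in>X. smult (f x * e y z) (P (e x) y)) s"
      by (simp only: poly_sum poly_smult)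
    finally show "poly (P f z) s = poly (\<Sum>y\<in>X. \<Sum>x\<in>X. smult (f x * e y z) (P (e x) y)) s"
      by (simp only: P[OF f])
  qed
  have "X \<noteq> {}"
  proof
    assume "X = {}"
    then have "f = 0" if "f \<in> V" for f
      using J(4)[OF that] by (simp only: sum.empty) (simp add: fun_eq_iff)
    then show False using V(2) cfun.subspace_0[OF sV] by auto
  qed
  then obtain x1 where x1: "x1 \<in> X" by blast
  define D where "D = {(x, y) \<in> X \<times> X. P (e x) y \<noteq> 0}"
  have "poly (P (e x1) x1) 1 = 1" using P[OF J(2)[OF x1], of 1 x1] J(3)[OF x1 x1] one by simp
  then have x1D: "(x1, x1) \<in> D" using x1 by (auto simp: D_def)
  have finD: "finite D" using J(1) by (auto simp: D_def intro: finite_subset[of _ "X \<times> X"])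
  define m where "m = Max ((\<lambda>(x, y). degree (P (e x) y)) ` D)"
  have "m \<in> (\<lambda>(x, y). degree (P (e x) y)) ` D"
    unfolding m_def using finD x1D by (intro Max_in) auto
  then obtain x0 y0 where xy: "x0 \<in> X" "y0 \<in> X" "P (e x0) y0 \<noteq> 0" "degree (P (e x0) y0) = m"
    by (auto simp: D_def)
  have degm: "degree (P (e x) y) \<le> m" if "x \<in> X" "y \<in> X" for x y
  proof (cases "P (e x) y = 0")
    case False
    then show ?thesis unfolding m_def using that finD by (intro Max_ge) (auto simp: D_def)
  qed simp
  have deg: "degree (P f z) \<le> m" if "f \<in> V" for f z
    unfolding PP[OF that] using degm by (intro degree_sum_le J(1)) (auto intro: le_trans[OF degree_smult_le])
  define h where "h = (\<lambda>z. coeff (P (e x0) z) m)"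
  have "h z = (\<Sum>y\<in>X. coeff (P (e x0) y) m * e y z)" for z
  proof -
    have "h z = (\<Sum>y\<in>X. \<Sum>x\<in>X. e x0 x * e y z * coeff (P (e x) y) m)"
      unfolding h_def PP[OF J(2)[OF xy(1)], of z] by (simp add: coeff_sum)
    also have "\<dots> = (\<Sum>y\<in>X. \<Sum>x\<in>X. if x = x0 then e y z * coeff (P (e x0) y) m else 0)"
      using J(3)[OF xy(1)] by (intro sum.cong refl) auto
    also have "\<dots> = (\<Sum>y\<in>X. coeff (P (e x0) y) m * e y z)"
      using J(1) xy(1) by (simp add: mult.commute)
    finally show ?thesis .
  qed
  then have hV: "h \<in> V" by (rule interpolation_mem[OF I sV])
  have "h y0 \<noteq> 0" using xy(3,4) leading_coeff_0_iff unfolding h_def by blast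
  then have h0: "h \<noteq> 0" by auto
  have "h (\<sigma> r x) = r ^ m * h x" if r: "r \<noteq> 0" for r x
  proof -
    have "P (e x0) (\<sigma> r x) = pcompose (P (e x0) x) [:0, r:]"
    proof (rule poly_eq_if_eq_off_0)
      fix s
      have "poly (P (e x0) (\<sigma> r x)) s = e x0 (\<sigma> s (\<sigma> r x))" by (simp add: P[OF J(2)[OF xy(1)]])
      also have "\<dots> = poly (P (e x0) x) (s * r)" by (simp only: mult P[OF J(2)[OF xy(1)]])
      finally show "poly (P (e x0) (\<sigma> r x)) s = poly (pcompose (P (e x0) x) [:0, r:]) s"
        by (simp add: poly_pcompose)
    qed
    then show ?thesis by (simp add: h_def coeff_pcompose_linear)
  qed
  then show ?thesis using hV h0 deg P by blast
qed

text \<open>Conjugation by \<open>\<sigma> s\<close> contracts \<open>y\<close> to the identity as \<open>s\<close> tends to \<open>0\<close>. The polynomial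
  \<open>s \<mapsto> h (y (\<sigma> s x)) = s\<^sup>m h (u s x)\<close> has degree at most \<open>m\<close>, so \<open>h (u s x)\<close> does not depend on
  \<open>s\<close>; compare \<open>s = 0\<close> with \<open>s = 1\<close>.\<close>

lemma unipotent_invariance:
  fixes \<sigma> :: "complex \<Rightarrow> 'x \<Rightarrow> 'x"
  assumes h: "\<And>r x. r \<noteq> 0 \<Longrightarrow> h (\<sigma> r x) = r ^ m * h x"
    and deg: "\<And>x. \<exists>p. degree p \<le> m \<and> (\<forall>s. h (y (\<sigma> s x)) = poly p s)"
    and u: "\<And>s x. s \<noteq> 0 \<Longrightarrow> y (\<sigma> s x) = \<sigma> s (u s x)" "\<And>x. is_poly1 (\<lambda>s. h (u s x))"
      "\<And>x. u 0 x = x" "\<And>x. u 1 x = y x"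
  shows "h (y x) = h x"
proof -
  obtain p where p: "degree p \<le> m" "\<And>s. h (y (\<sigma> s x)) = poly p s" using deg by blast
  obtain q where q: "\<And>s. h (u s x) = poly q s" using u(2) by (auto simp: is_poly1_def)
  have "p = monom 1 m * q"
  proof (rule poly_eq_if_eq_off_0)
    fix s :: complex assume "s \<noteq> 0"
    then show "poly p s = poly (monom 1 m * q) s"
      using p(2)[of s] u(1)[of s x] h[of s "u s x"] q[of s] by (simp add: poly_monom)
  qed
  then have "degree q = 0"
    using p(1) by (cases "q = 0") (auto simp: degree_mult_eq degree_monom_eq)
  then obtain c where "q = [:c:]" by (auto elim: degree_eq_zeroE)
  then show ?thesis using q[of 0] q[of 1] u(3,4)[of x] by simp
qed

lemma is_poly1_if: "is_poly1 \<phi> \<Longrightarrow> is_poly1 \<psi> \<Longrightarrow> is_poly1 (\<lambda>s. if P then \<phi> s else \<psi> s)"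
  by (cases P) simp_all

lemmas is_poly1_intros = is_poly1_const is_poly1_ident is_poly1_if is_poly1_mult is_poly1_power

lemma hw_function_nonzero_at_1:
  assumes "hw_function \<mu> F" "F \<noteq> 0" shows "F (mat 1) \<noteq> 0"
proof
  assume 0: "F (mat 1) = 0"
  have "F A = 0" for A
  proof (rule polynomial_eq_0_if_eq_0_on_big_cell[OF hw_functionD(1)[OF assms(1)]])
    fix A :: "'a cmat" assume "big_cell A"
    then show "F A = 0" using hw_function_big_cell[OF assms(1)] 0 unfolding big_cell_def by fastforce
  qed
  then show False using assms(2) by (auto simp: fun_eq_iff)
qed

text \<open>If \<open>\<nu> i < \<nu> j\<close> for some \<open>i < j\<close>, consider the curve \<open>B x\<close> of matrices that have the block
  \<open>(x, 1; -1, 0)\<close> in rows and columns \<open>i, j\<close>. For \<open>x \<noteq> 0\<close> the diagonal part of \<open>B x\<close> is \<open>x\<close> and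
  \<open>1 / x\<close>, so \<open>F (B x)\<close> is a negative power of \<open>x\<close>, which is impossible for a polynomial.\<close>

lemma hw_function_dominant:
  fixes F :: "'n::{finite,wellorder} cmat \<Rightarrow> complex" and \<nu> :: "'n \<Rightarrow> nat"
  assumes F: "hw_function (\<lambda>i. int (\<nu> i)) F" "F \<noteq> 0"
  shows "(\<lambda>i. int (\<nu> i)) \<in> dominant_weights"
proof -
  have "\<nu> j \<le> \<nu> i" if ij: "i < j" for i j
  proof (rule ccontr)
    assume "\<not> \<nu> j \<le> \<nu> i"
    then have lt: "\<nu> i < \<nu> j" by simp
    define B :: "complex \<Rightarrow> 'n cmat" where "B = (\<lambda>x. \<chi> a b. if a = i \<and> b = i then x else if a = i \<and> b = j then 1
      else if a = j \<and> b = i then -1 else if a = j \<and> b = j then 0 else if a = b then 1 else 0)"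
    define U :: "complex \<Rightarrow> 'n cmat" where "U = (\<lambda>x. \<chi> a b. if a = b then 1 else if a = i \<and> b = j then - 1 / x else 0)"
    define L :: "complex \<Rightarrow> 'n cmat" where "L = (\<lambda>x. \<chi> a b. if a = b then 1 else if a = j \<and> b = i then - 1 / x else 0)"
    define t :: "complex \<Rightarrow> 'n \<Rightarrow> complex" where "t = (\<lambda>x b. if b = i then x else if b = j then 1 / x else 1)"
    have Bp: "is_poly1 (\<lambda>x. F (B x))"
    proof (rule polynomials_curve[OF hw_functionD(1)[OF F(1)]])
      fix a b
      show "is_poly1 (\<lambda>s. B s $ a $ b)"
        unfolding B_def vec_lambda_beta
        by (intro is_poly1_intros)
    qed
    have FB: "F (B x) = torus_char (\<lambda>i. int (\<nu> i)) (t x) * F (mat 1)" if x: "x \<noteq> 0" for x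
    proof (rule hw_function_big_cell[OF F(1)])
      show "upper_unitriangular (U x)" using ij by (auto simp: upper_unitriangular_def U_def)
      show "lower_unitriangular (L x)" using ij by (auto simp: lower_unitriangular_def L_def)
      show "t x k \<noteq> 0" for k using x by (simp add: t_def)
      have "(B x ** U x) $ a $ b = B x $ a $ b + (if b = j then B x $ a $ i * (- 1 / x) else 0)" for a b
      proof -
        have "(B x ** U x) $ a $ b = (\<Sum>k\<in>UNIV. (if k = b then B x $ a $ k else 0)
            + (if k = i then (if b = j then B x $ a $ i * (- 1 / x) else 0) else 0))"
          unfolding matrix_matrix_mult_def vec_lambda_beta
          by (rule sum.cong) (use ij in \<open>auto simp: U_def\<close>)
        then show ?thesis by (simp add: sum.distrib)
      qed
      then show "B x ** U x = L x ** diag_mat (t x)"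
        using ij x by (auto simp: vec_eq_iff B_def L_def t_def)
    qed
    have tc: "torus_char (\<lambda>i. int (\<nu> i)) (t x) * x ^ \<nu> j = x ^ \<nu> i" if x: "x \<noteq> 0" for x
    proof -
      have "torus_char (\<lambda>i. int (\<nu> i)) (t x) = (\<Prod>k\<in>UNIV. (if k = i then x ^ \<nu> i else 1) * (if k = j then (1 / x) ^ \<nu> j else 1))"
        unfolding torus_char_def by (rule prod.cong) (use ij in \<open>auto simp: t_def\<close>)
      then show ?thesis using x by (simp add: prod.distrib power_one_over)
    qed
    have "F (B 0) * 0 ^ (\<nu> j - \<nu> i) = F (mat 1)"
    proof (rule is_poly1_eq_if_eq_off_0[where \<phi>="\<lambda>x. F (B x) * x ^ (\<nu> j - \<nu> i)" and \<psi>="\<lambda>x. F (mat 1)" and s=0])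
      show "is_poly1 (\<lambda>x. F (B x) * x ^ (\<nu> j - \<nu> i))" by (intro is_poly1_mult Bp is_poly1_power is_poly1_ident)
      show "is_poly1 (\<lambda>x. F (mat 1))" by (rule is_poly1_const)
      fix x :: complex assume x: "x \<noteq> 0"
      have "F (B x) * x ^ (\<nu> j - \<nu> i) * x ^ \<nu> i = F (B x) * x ^ \<nu> j"
        using lt by (simp add: power_add[symmetric])
      also have "\<dots> = F (mat 1) * (torus_char (\<lambda>i. int (\<nu> i)) (t x) * x ^ \<nu> j)" unfolding FB[OF x] by (simp only: mult_ac)
      also have "\<dots> = F (mat 1) * x ^ \<nu> i" unfolding tc[OF x] ..
      finally show "F (B x) * x ^ (\<nu> j - \<nu> i) = F (mat 1)" using x by simp
    qed
    then show False using lt hw_function_nonzero_at_1[OF F] by (simp add: power_0_left)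
  qed
  then show ?thesis unfolding dominant_weights_def antimono_def
    by (auto simp: order_le_less)
qed

text \<open>The exponents of \<open>\<gamma>\<close> decrease strictly along the index order, so conjugation by \<open>\<gamma> s\<close> multiplies each
  entry above the diagonal by a positive power of \<open>s\<close>.\<close>

lemma ex_right_unipotent_invariant:
  fixes V :: "('n::{finite,wellorder} cmat \<Rightarrow> complex) set"
  assumes V: "finite_dim V" "V \<subseteq> polynomials" "V \<noteq> {0}"
    and right: "\<And>f g. f \<in> V \<Longrightarrow> (\<lambda>Z. f (Z ** g)) \<in> V"
  shows "\<exists>h\<in>V. h \<noteq> 0 \<and> (\<forall>U Z. upper_unitriangular U \<longrightarrow> h (Z ** U) = h Z)"
proof -
  define d :: "'n \<Rightarrow> nat" where "d = (\<lambda>i. card {j. i < j})"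
  have d: "d j < d i" if "i < j" for i j
    unfolding d_def using that by (intro psubset_card_mono) auto
  have dn: "\<not> d j \<le> d i" if "j < i" for i j using d[OF that] by simp
  define \<gamma> :: "complex \<Rightarrow> 'n cmat" where "\<gamma> = (\<lambda>s. diag_mat (\<lambda>i. s ^ d i))"
  have \<gamma>1: "\<gamma> 1 = mat 1" by (simp add: \<gamma>_def)
  have \<gamma>m: "\<gamma> s ** \<gamma> r = \<gamma> (s * r)" for s r by (simp add: \<gamma>_def diag_mult_diag power_mult_distrib)
  have \<gamma>p: "is_poly1 (\<lambda>s. \<gamma> s $ i $ j)" for i j
    unfolding \<gamma>_def diag_mat_nth by (intro is_poly1_intros)

    have "\<exists>m h. h \<in> V \<and> h \<noteq> 0 \<and> (\<forall>r x. r \<noteq> 0 \<longrightarrow> h (x ** \<gamma> r) = r ^ m * h x) \<and>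
       (\<forall>f\<in>V. \<forall>x. \<exists>p. degree p \<le> m \<and> (\<forall>s. f (x ** \<gamma> s) = poly p s))"
    proof (rule ex_leading_coefficient[OF V(1,3), where \<sigma>="\<lambda>s x. x ** \<gamma> s"])
      show "is_poly1 (\<lambda>s. f (x ** \<gamma> s))" if "f \<in> V" for f x
        by (rule polynomials_curve[of f], use that V(2) in blast) (intro is_poly1_mult_entry \<gamma>p is_poly1_const)
    qed (simp_all add: right \<gamma>1 matrix_mul_assoc[symmetric] \<gamma>m mult.commute)
    then obtain m h where h: "h \<in> V" "h \<noteq> 0" "\<And>r x. r \<noteq> 0 \<Longrightarrow> h (x ** \<gamma> r) = r ^ m * h x"
      "\<And>f x. f \<in> V \<Longrightarrow> \<exists>p. degree p \<le> m \<and> (\<forall>s. f (x ** \<gamma> s) = poly p s)" by blast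
    have "h (Z ** U) = h Z" if U: "upper_unitriangular U" for U Z
    proof -
      define Us :: "complex \<Rightarrow> 'n cmat"
        where "Us = (\<lambda>s. \<chi> i j. if i = j then 1 else if i < j then s ^ (d i - d j) * U $ i $ j else 0)"
      show ?thesis
      proof (rule unipotent_invariance[where \<sigma>="\<lambda>s Z. Z ** \<gamma> s" and y="\<lambda>Z. Z ** U" and u="\<lambda>s Z. Z ** Us s" and m=m, OF h(3)])
        show "\<exists>p. degree p \<le> m \<and> (\<forall>s. h (x ** \<gamma> s ** U) = poly p s)" for x
          using h(4)[OF right[OF h(1), of U], of x] .
        show "is_poly1 (\<lambda>s. h (x ** Us s))" for x
        proof (rule polynomials_curve[of h])
          show "h \<in> polynomials" using h(1) V(2) by blast
          show "is_poly1 (\<lambda>s. (x ** Us s) $ i $ j)" for i j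
          proof (rule is_poly1_mult_entry)
            show "is_poly1 (\<lambda>s. Us s $ i $ j)" for i j
              unfolding Us_def vec_lambda_beta
              by (intro is_poly1_intros)
          qed (rule is_poly1_const)
        qed
        have "Us 0 = mat 1" by (auto simp: Us_def vec_eq_iff mat_def power_0_left dn)
        then show "x ** Us 0 = x" for x by simp
        have "Us 1 = U" using U by (auto simp: Us_def vec_eq_iff upper_unitriangular_def)
        then show "x ** Us 1 = x ** U" for x by simp
        show "x ** \<gamma> s ** U = x ** Us s ** \<gamma> s" for s x
        proof -
          have "s ^ d i * U $ i $ j = Us s $ i $ j * s ^ d j" for i j
            using U d[of i j] by (auto simp: Us_def upper_unitriangular_def mult_ac power_add[symmetric])
          then have "\<gamma> s ** U = Us s ** \<gamma> s" by (simp add: vec_eq_iff \<gamma>_def)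
          then show ?thesis by (simp add: matrix_mul_assoc[symmetric])
        qed
      qed
    qed
    then show ?thesis using h(1,2) by blast
qed

text \<open>Transposition exchanges the two sides.\<close>

lemma ex_left_unipotent_invariant:
  fixes V :: "('n::{finite,wellorder} cmat \<Rightarrow> complex) set"
  assumes V: "finite_dim V" "V \<subseteq> polynomials" "V \<noteq> {0}"
    and left: "\<And>f g. f \<in> V \<Longrightarrow> (\<lambda>Z. f (g ** Z)) \<in> V"
  shows "\<exists>h\<in>V. h \<noteq> 0 \<and> (\<forall>L Z. lower_unitriangular L \<longrightarrow> h (L ** Z) = h Z)"
proof -
  define T :: "('n cmat \<Rightarrow> complex) \<Rightarrow> 'n cmat \<Rightarrow> complex" where "T = (\<lambda>f Z. f (transpose Z))"
  have lin: "clinear_on V cscale T" by (auto simp: clinear_on_def T_def cscale_def plus_fun_def)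
  have T0: "T f = 0 \<Longrightarrow> f = 0" for f by (rule ext) (metis T_def transpose_transpose zero_fun_apply)
  have "\<exists>h\<in>T ` V. h \<noteq> 0 \<and> (\<forall>U Z. upper_unitriangular U \<longrightarrow> h (Z ** U) = h Z)"
  proof (rule ex_right_unipotent_invariant[OF finite_dim_image[OF lin V(1)]])
    show "T ` V \<subseteq> polynomials"
    proof clarify
      fix f assume "f \<in> V"
      show "T f \<in> polynomials"
        unfolding T_def
      proof (rule polynomials_compose)
        show "f \<in> polynomials" using V(2) \<open>f \<in> V\<close> by blast
        show "(\<lambda>Z. transpose Z $ i $ j) \<in> polynomials" for i j
          unfolding transpose_def vec_lambda_beta by (rule polynomials_entry)
      qed
    qed
    show "T ` V \<noteq> {0}" using V(3) T0 finite_dim_imp_subspace[OF V(1), THEN cfun.subspace_0] by fastforce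
    fix f g assume "f \<in> T ` V"
    then obtain k where k: "k \<in> V" "f = T k" by blast
    have "(\<lambda>Z. f (Z ** g)) = T (\<lambda>Z. k (transpose g ** Z))"
      by (rule ext) (simp add: k(2) T_def matrix_transpose_mul)
    then show "(\<lambda>Z. f (Z ** g)) \<in> T ` V" using left[OF k(1)] by blast
  qed
  then obtain h where h: "h \<in> V" "T h \<noteq> 0" "\<And>U Z. upper_unitriangular U \<Longrightarrow> T h (Z ** U) = T h Z" by blast
  have "h (L ** Z) = h Z" if "lower_unitriangular L" for L Z
    using h(3)[of "transpose L" "transpose Z"] that
    by (simp add: T_def matrix_transpose_mul upper_unitriangular_def lower_unitriangular_def transpose_def[of L])
      (simp add: transpose_def)
  moreover have "h \<noteq> 0" using h(2) by (auto simp: T_def)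
  ultimately show ?thesis using h(1) by blast
qed

text \<open>The two unipotent groups and the torus are treated one after the other. Each step passes to the
  subspace of vectors found so far, which the remaining groups preserve.\<close>

lemma ex_hw_function_in_stable:
  fixes V :: "('n::{finite,wellorder} cmat \<Rightarrow> complex) set"
  assumes V: "finite_dim V" "V \<subseteq> polynomials" "V \<noteq> {0}" and st: "bi_stable V"
  shows "\<exists>\<nu>\<in>dominant_weights. \<exists>F\<in>V. hw_function \<nu> F \<and> F (mat 1) = 1"
proof -
  note sV = finite_dim_imp_subspace[OF V(1)]
  have left: "(\<lambda>Z. f (g ** Z)) \<in> V" and right: "(\<lambda>Z. f (Z ** g)) \<in> V" if "f \<in> V" for f g
  proof -
    have "bitrans g (mat 1) f \<in> V" "bitrans (mat 1) g f \<in> V" using st that unfolding bi_stable_def by blast+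
    then show "(\<lambda>Z. f (g ** Z)) \<in> V" "(\<lambda>Z. f (Z ** g)) \<in> V" by (simp_all add: bitrans_def)
  qed
  define V1 where "V1 = {f \<in> V. \<forall>L Z. lower_unitriangular L \<longrightarrow> f (L ** Z) = f Z}"
  have V1: "V1 \<subseteq> V" by (auto simp: V1_def)
  have sV1: "cfun.subspace V1"
    unfolding V1_def by (rule cfun.subspaceI)
      (auto simp: cfun.subspace_0[OF sV] cfun.subspace_add[OF sV] cfun.subspace_scale[OF sV] cscale_apply)
  have fV1: "finite_dim V1" by (rule finite_dim_subspace[OF V(1) sV1 V1])
  have V1_nz: "V1 \<noteq> {0}" using ex_left_unipotent_invariant[OF V left] by (auto simp: V1_def)
  have right1: "(\<lambda>Z. f (Z ** g)) \<in> V1" if "f \<in> V1" for f g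
    using that right by (auto simp: V1_def matrix_mul_assoc[symmetric])

  define V2 where "V2 = {f \<in> V1. \<forall>U Z. upper_unitriangular U \<longrightarrow> f (Z ** U) = f Z}"
  have V2: "V2 \<subseteq> V1" by (auto simp: V2_def)
  have sV2: "cfun.subspace V2"
    unfolding V2_def by (rule cfun.subspaceI)
      (auto simp: cfun.subspace_0[OF sV1] cfun.subspace_add[OF sV1] cfun.subspace_scale[OF sV1] cscale_apply)
  have V2_nz: "V2 \<noteq> {0}"
  proof -
    obtain h where h: "h \<in> V1" "h \<noteq> 0" "\<And>U Z. upper_unitriangular U \<Longrightarrow> h (Z ** U) = h Z"
      using ex_right_unipotent_invariant[OF fV1 _ V1_nz right1] V(2) V1 by blast
    then have "h \<in> V2" by (simp add: V2_def)
    then show ?thesis using h(2) by blast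
  qed
  have left2: "(\<lambda>Z. f (diag_mat a ** Z)) \<in> V2" if f: "f \<in> V2" and a: "\<And>i. a i \<noteq> 0" for f a
  proof -
    have "f (diag_mat a ** (L ** Z)) = f (diag_mat a ** Z)" if L: "lower_unitriangular L" for L Z
    proof -
      define L' :: "'n cmat" where "L' = (\<chi> i j. a i * L $ i $ j / a j)"
      have L': "lower_unitriangular L'" using L a by (auto simp: L'_def lower_unitriangular_def)
      have "diag_mat a ** L = L' ** diag_mat a" using a by (simp add: vec_eq_iff L'_def)
      then have "f (diag_mat a ** (L ** Z)) = f (L' ** (diag_mat a ** Z))" by (simp add: matrix_mul_assoc)
      then show ?thesis using f L' by (simp add: V2_def V1_def)
    qed
    then show ?thesis using f left by (auto simp: V2_def V1_def matrix_mul_assoc)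
  qed

  \<comment> \<open>A joint eigenvector of the commuting one-parameter subgroups \<open>t i\<close>, one subgroup at a time.\<close>
  define t :: "'n \<Rightarrow> complex \<Rightarrow> 'n cmat" where "t = (\<lambda>i r. diag_mat (\<lambda>j. if j = i then r else 1))"
  have tm: "t i r ** t i s = t i (r * s)" for i r s
    by (simp add: t_def diag_mult_diag if_distrib cong: if_cong)
  have tc: "t i r ** t j s = t j s ** t i r" for i j r s by (simp add: t_def diag_mult_diag mult.commute)
  have tp: "is_poly1 (\<lambda>s. t i s $ a $ b)" for i a b
    unfolding t_def diag_mat_nth by (intro is_poly1_intros)
  have "\<exists>f \<nu>. f \<in> V2 \<and> f \<noteq> 0 \<and> (\<forall>i\<in>S. \<forall>r Z. r \<noteq> 0 \<longrightarrow> f (t i r ** Z) = r ^ \<nu> i * f Z)" if "finite S" for S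
    using that
  proof (induction S rule: finite_induct)
    case empty
    have "\<exists>f. f \<in> V2 \<and> f \<noteq> 0" using V2_nz cfun.subspace_0[OF sV2] by blast
    then show ?case by blast
  next
    case (insert k S)
    then obtain f0 \<nu> where f0: "f0 \<in> V2" "f0 \<noteq> 0" "\<And>i r Z. i \<in> S \<Longrightarrow> r \<noteq> 0 \<Longrightarrow> f0 (t i r ** Z) = r ^ \<nu> i * f0 Z" by blast
    define V3 where "V3 = {f \<in> V2. \<forall>i\<in>S. \<forall>r Z. r \<noteq> 0 \<longrightarrow> f (t i r ** Z) = r ^ \<nu> i * f Z}"
    have sV3: "cfun.subspace V3"
      unfolding V3_def by (rule cfun.subspaceI)
        (auto simp: cfun.subspace_0[OF sV2] cfun.subspace_add[OF sV2] cfun.subspace_scale[OF sV2] cscale_apply algebra_simps)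
    have V3: "V3 \<subseteq> V" using V1 V2 by (auto simp: V3_def)
    have V3_nz: "V3 \<noteq> {0}" using f0 by (auto simp: V3_def)
    have "\<exists>m h. h \<in> V3 \<and> h \<noteq> 0 \<and> (\<forall>r x. r \<noteq> 0 \<longrightarrow> h (t k r ** x) = r ^ m * h x) \<and>
       (\<forall>f\<in>V3. \<forall>x. \<exists>p. degree p \<le> m \<and> (\<forall>s. f (t k s ** x) = poly p s))"
    proof (rule ex_leading_coefficient[OF finite_dim_subspace[OF V(1) sV3 V3] V3_nz, where \<sigma>="\<lambda>s x. t k s ** x"])
      show "is_poly1 (\<lambda>s. f (t k s ** x))" if "f \<in> V3" for f x
        by (rule polynomials_curve[of f], use that V(2) V3 in blast) (intro is_poly1_mult_entry tp is_poly1_const)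
      show "(\<lambda>x. f (t k s ** x)) \<in> V3" if "s \<noteq> 0" "f \<in> V3" for s f
      proof -
        have "(\<lambda>x. f (t k s ** x)) \<in> V2" unfolding t_def by (rule left2) (use that in \<open>auto simp: V3_def\<close>)
        moreover have "f (t k s ** (t i r ** Z)) = r ^ \<nu> i * f (t k s ** Z)" if "i \<in> S" "r \<noteq> 0" for i r Z
        proof -
          have "t k s ** (t i r ** Z) = t i r ** (t k s ** Z)" by (simp add: matrix_mul_assoc tc)
          then show ?thesis using that \<open>f \<in> V3\<close> by (simp add: V3_def)
        qed
        ultimately show ?thesis by (simp add: V3_def)
      qed
      show "t k 1 ** x = x" for x by (simp add: t_def)
      show "t k s ** (t k r ** x) = t k (s * r) ** x" for s r x by (simp add: matrix_mul_assoc tm)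
    qed
    then obtain m h where h: "h \<in> V3" "h \<noteq> 0" "\<And>r x. r \<noteq> 0 \<Longrightarrow> h (t k r ** x) = r ^ m * h x" by blast
    have "\<forall>i\<in>insert k S. \<forall>r Z. r \<noteq> 0 \<longrightarrow> h (t i r ** Z) = r ^ (\<nu>(k := m)) i * h Z"
      using h insert.hyps(2) by (auto simp: V3_def)
    then show ?case using h V3_def by blast
  qed
  from this[OF finite_class.finite_UNIV] obtain f \<nu> where f: "f \<in> V2" "f \<noteq> 0" "\<And>i r Z. r \<noteq> 0 \<Longrightarrow> f (t i r ** Z) = r ^ \<nu> i * f Z"
    by blast
  have diag: "f (diag_mat a ** Z) = (\<Prod>i\<in>UNIV. a i ^ \<nu> i) * f Z" if a: "\<And>i. a i \<noteq> 0" for a Z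
  proof -
    have "f (diag_mat (\<lambda>j. if j \<in> T then a j else 1) ** Z) = (\<Prod>i\<in>T. a i ^ \<nu> i) * f Z" if "finite T" for T
      using that
    proof (induction T rule: finite_induct)
      case (insert k T)
      have "diag_mat (\<lambda>j. if j \<in> insert k T then a j else 1) = t k (a k) ** diag_mat (\<lambda>j. if j \<in> T then a j else 1)"
        using insert.hyps by (auto simp: t_def diag_mult_diag vec_eq_iff diag_mat_nth)
      then show ?case using insert f(3)[OF a[of k], of k] by (simp add: matrix_mul_assoc[symmetric])
    qed simp
    from this[OF finite_class.finite_UNIV] show ?thesis by simp
  qed
  have hw: "hw_function (\<lambda>i. int (\<nu> i)) f"
    unfolding hw_function_def torus_char_def
    using f(1) diag V(2) V1 V2 by (auto simp: V2_def V1_def)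
  have dom: "(\<lambda>i. int (\<nu> i)) \<in> dominant_weights" by (rule hw_function_dominant[OF hw f(2)])
  define F where "F = cscale (1 / f (mat 1)) f"
  have "F \<in> V" unfolding F_def using f(1) V1 V2 by (intro cfun.subspace_scale[OF sV]) auto
  moreover have "hw_function (\<lambda>i. int (\<nu> i)) F"
    using hw V(2) \<open>F \<in> V\<close> by (auto simp: hw_function_def F_def cscale_apply)
  moreover have "F (mat 1) = 1" using hw_function_nonzero_at_1[OF hw f(2)] by (simp add: F_def cscale_apply)
  ultimately show ?thesis using dom by blast
qed

section \<open>Inner products on spaces of functions\<close>

text \<open>The space \<open>H\<close> need not be complete. Orthogonal projections are only taken onto finite-dimensional
  subspaces, and density replaces the use of orthogonal complements.\<close>

locale inner_product_on =
  fixes H :: "('x \<Rightarrow> complex) set" and ip :: "('x \<Rightarrow> complex) \<Rightarrow> ('x \<Rightarrow> complex) \<Rightarrow> complex"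
  assumes H: "cfun.subspace H"
    and ip_add_left: "\<And>f g h. f \<in> H \<Longrightarrow> g \<in> H \<Longrightarrow> h \<in> H \<Longrightarrow> ip (f + g) h = ip f h + ip g h"
    and ip_scale_left: "\<And>f h c. f \<in> H \<Longrightarrow> h \<in> H \<Longrightarrow> ip (cscale c f) h = c * ip f h"
    and ip_cnj: "\<And>f g. f \<in> H \<Longrightarrow> g \<in> H \<Longrightarrow> cnj (ip f g) = ip g f"
    and ip_pos: "\<And>f. f \<in> H \<Longrightarrow> 0 \<le> Re (ip f f)"
    and ip_definite: "\<And>f. f \<in> H \<Longrightarrow> ip f f = 0 \<Longrightarrow> f = 0"
begin

lemmas H_simps = cfun.subspace_0[OF H] cfun.subspace_add[OF H] cfun.subspace_diff[OF H] cfun.subspace_scale[OF H]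

lemma ip_add_right: "f \<in> H \<Longrightarrow> g \<in> H \<Longrightarrow> h \<in> H \<Longrightarrow> ip h (f + g) = ip h f + ip h g"
  by (metis H_simps(2) complex_cnj_add ip_add_left ip_cnj)

lemma ip_scale_right: "f \<in> H \<Longrightarrow> h \<in> H \<Longrightarrow> ip h (cscale c f) = cnj c * ip h f"
  by (metis H_simps(4) complex_cnj_mult ip_scale_left ip_cnj)

lemma ip_zero_left: "h \<in> H \<Longrightarrow> ip 0 h = 0"
  using ip_scale_left[OF H_simps(1), of h 0] by (simp add: cscale_def zero_fun_def)

lemma ip_zero_right: "h \<in> H \<Longrightarrow> ip h 0 = 0"
  using ip_scale_right[OF H_simps(1), of h 0] by (simp add: cscale_def zero_fun_def)

lemma ip_diff_left: "f \<in> H \<Longrightarrow> g \<in> H \<Longrightarrow> h \<in> H \<Longrightarrow> ip (f - g) h = ip f h - ip g h"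
  using ip_add_left[of "f - g" g h] by (simp add: H_simps)

lemma ip_diff_right: "f \<in> H \<Longrightarrow> g \<in> H \<Longrightarrow> h \<in> H \<Longrightarrow> ip h (f - g) = ip h f - ip h g"
  using ip_add_right[of "f - g" g h] by (simp add: H_simps)

lemma ip_sum_left:
  assumes "\<And>i. i \<in> A \<Longrightarrow> f i \<in> H" "h \<in> H"
  shows "ip (\<Sum>i\<in>A. cscale (c i) (f i)) h = (\<Sum>i\<in>A. c i * ip (f i) h)"
  using assms(1)
proof (induction A rule: infinite_finite_induct)
  case (insert a A)
  have 1: "cscale (c a) (f a) \<in> H" "(\<Sum>i\<in>A. cscale (c i) (f i)) \<in> H"
    using insert.prems by (auto intro!: cfun.subspace_sum[OF H] cfun.subspace_scale[OF H])
  have 2: "ip (\<Sum>i\<in>A. cscale (c i) (f i)) h = (\<Sum>i\<in>A. c i * ip (f i) h)"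
    by (rule insert.IH) (use insert.prems in auto)
  have 3: "ip (cscale (c a) (f a)) h = c a * ip (f a) h"
    by (rule ip_scale_left) (use insert.prems assms(2) in auto)
  show ?case unfolding sum.insert[OF insert.hyps] ip_add_left[OF 1 assms(2)] 2 3 ..
qed (simp_all add: ip_zero_left assms(2))

lemma ip_self_real: "f \<in> H \<Longrightarrow> ip f f = of_real (Re (ip f f))"
  by (metis Reals_cnj_iff ip_cnj of_real_Re)

lemma ip_definite_Re: "f \<in> H \<Longrightarrow> Re (ip f f) = 0 \<Longrightarrow> f = 0"
  by (metis ip_definite ip_self_real of_real_0)

lemma orthogonal_span:
  assumes f: "f \<in> H" and S: "S \<subseteq> H" "\<And>g. g \<in> S \<Longrightarrow> ip f g = 0" and g: "g \<in> cfun.span S"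
  shows "ip f g = 0"
proof -
  have "cfun.subspace {g \<in> H. ip f g = 0}"
    by (rule cfun.subspaceI) (simp_all add: H_simps ip_zero_right ip_add_right ip_scale_right f)
  then have "cfun.span S \<subseteq> {g \<in> H. ip f g = 0}" using S by (intro cfun.span_minimal) auto
  then show ?thesis using g by blast
qed

lemma ip_commute_0: "f \<in> H \<Longrightarrow> g \<in> H \<Longrightarrow> ip f g = 0 \<Longrightarrow> ip g f = 0"
  by (metis complex_cnj_zero ip_cnj)

text \<open>Gram-Schmidt, one spanning vector at a time.\<close>

lemma ex_projection:
  assumes "finite_dim V" "V \<subseteq> H" "f \<in> H"
  shows "\<exists>p\<in>V. \<forall>v\<in>V. ip (f - p) v = 0"
proof -
  obtain B where B: "finite B" "V = cfun.span B" using assms(1) by (auto simp: finite_dim_def)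
  have BH: "B \<subseteq> H" using B assms(2) cfun.span_superset by blast
  have "\<forall>f\<in>H. \<exists>p\<in>cfun.span C. \<forall>v\<in>C. ip (f - p) v = 0" if "finite C" "C \<subseteq> B" for C
    using that
  proof (induction C rule: finite_induct)
    case empty
    then show ?case by (auto intro: bexI[of _ 0])
  next
    case (insert b C)
    have CH: "cfun.span C \<subseteq> H" using insert.prems BH by (intro cfun.span_minimal[OF _ H]) auto
    have bH: "b \<in> H" using insert.prems BH by auto
    have IH: "\<forall>f\<in>H. \<exists>p\<in>cfun.span C. \<forall>v\<in>C. ip (f - p) v = 0" using insert.IH insert.prems by blast
    then obtain q where q: "q \<in> cfun.span C" "\<And>v. v \<in> C \<Longrightarrow> ip (b - q) v = 0" using bH by blast
    define r where "r = b - q"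
    have qH: "q \<in> H" using q CH by auto
    have rH: "r \<in> H" using bH qH by (simp add: r_def H_simps)
    have rs: "r \<in> cfun.span (insert b C)"
      unfolding r_def using q(1) cfun.span_mono[of C "insert b C"] by (intro cfun.span_diff) (auto intro: cfun.span_base)
    have rC: "ip r v = 0" if "v \<in> cfun.span C" for v
      by (rule orthogonal_span[OF rH _ _ that]) (use q(2) insert.prems BH in \<open>auto simp: r_def\<close>)
    show ?case
    proof
      fix f assume f: "f \<in> H"
      obtain p where p: "p \<in> cfun.span C" "\<And>v. v \<in> C \<Longrightarrow> ip (f - p) v = 0" using IH f by blast
      have pH: "p \<in> H" using p CH by auto
      define c where "c = (if ip r r = 0 then 0 else ip (f - p) r / ip r r)"
      define p' where "p' = p + cscale c r"
      have p'H: "p' \<in> H" using pH rH by (simp add: p'_def H_simps)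
      have p's: "p' \<in> cfun.span (insert b C)"
        unfolding p'_def using p(1) rs cfun.span_mono[of C "insert b C"] by (intro cfun.span_add cfun.span_scale) auto
      have e: "ip (f - p') v = ip (f - p) v - c * ip r v" if "v \<in> H" for v
        using that f pH rH p'H by (simp add: ip_diff_left p'_def ip_add_left ip_scale_left H_simps)
      have v1: "ip (f - p') v = 0" if "v \<in> C" for v
        using e[of v] p(2)[OF that] rC[of v] cfun.span_base[OF that] that insert.prems BH by auto
      have fp: "f - p' \<in> H" using f p'H by (simp add: H_simps)
      have v2: "ip (f - p') q = 0"
        by (rule orthogonal_span[OF fp _ v1 q(1)]) (use insert.prems BH in auto)
      have v3: "ip (f - p') r = 0"
      proof (cases "ip r r = 0")
        case True
        then have "r = 0" using ip_definite rH by blast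
        then show ?thesis using ip_zero_right[OF fp] by simp
      next
        case False
        then show ?thesis using e[OF rH] by (simp add: c_def)
      qed
      have "b = q + r" by (simp add: r_def)
      then have "ip (f - p') b = 0" using ip_add_right[OF qH rH fp] v2 v3 by simp
      then show "\<exists>p\<in>cfun.span (insert b C). \<forall>v\<in>insert b C. ip (f - p) v = 0" using v1 p's by auto
    qed
  qed
  from this[OF B(1)] obtain p where p: "p \<in> cfun.span B" "\<And>v. v \<in> B \<Longrightarrow> ip (f - p) v = 0" using assms(3) by blast
  have "p \<in> H" using p B(2) assms(2) by auto
  then have "f - p \<in> H" using assms(3) by (simp add: H_simps)
  then have "ip (f - p) v = 0" if "v \<in> V" for v
    using orthogonal_span[OF _ BH p(2)] that B(2) by auto
  then show ?thesis using p(1) B(2) by blast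
qed

lemma pythagoras:
  assumes "f \<in> H" "g \<in> H" "ip f g = 0"
  shows "Re (ip f f) \<le> Re (ip (f - g) (f - g))"
proof -
  have "ip (f - g) (f - g) = ip f f + ip g g"
    using assms ip_commute_0[OF assms] by (simp add: ip_diff_left ip_diff_right H_simps)
  then show ?thesis using ip_pos[OF assms(2)] by simp
qed

lemma hilbert_closure_superset: "S \<subseteq> H \<Longrightarrow> S \<subseteq> hilbert_closure H ip S"
  unfolding hilbert_closure_def
proof
  fix f assume "S \<subseteq> H" "f \<in> S"
  then show "f \<in> {f \<in> H. \<forall>e>0. \<exists>g\<in>S. sqrt (Re (ip (f - g) (f - g))) < e}"
    using ip_zero_left[OF H_simps(1)] by (auto intro!: bexI[of _ f])
qed

text \<open>A vector orthogonal to its approximants is no longer than the error of approximation.\<close>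

lemma orthogonal_closure_imp_0:
  assumes f: "f \<in> hilbert_closure H ip S" and S: "S \<subseteq> H" and o: "\<And>g. g \<in> S \<Longrightarrow> ip f g = 0"
  shows "f = 0"
proof (rule ccontr)
  assume "f \<noteq> 0"
  have fH: "f \<in> H" using f by (simp add: hilbert_closure_def)
  then have "Re (ip f f) \<noteq> 0" using ip_definite_Re[OF fH] \<open>f \<noteq> 0\<close> by blast
  then have p: "sqrt (Re (ip f f)) > 0" using ip_pos[OF fH] by simp
  then obtain g where g: "g \<in> S" "sqrt (Re (ip (f - g) (f - g))) < sqrt (Re (ip f f))"
    using f p unfolding hilbert_closure_def by blast
  then show False using pythagoras[OF fH _ o[OF g(1)]] S by (auto simp: not_less)
qed

lemma hilbert_closure_finite_dim:
  assumes V: "finite_dim V" "V \<subseteq> H"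
  shows "hilbert_closure H ip V = V"
proof
  show "V \<subseteq> hilbert_closure H ip V" by (rule hilbert_closure_superset[OF V(2)])
  show "hilbert_closure H ip V \<subseteq> V"
  proof
    fix f assume f: "f \<in> hilbert_closure H ip V"
    then have fH: "f \<in> H" by (simp add: hilbert_closure_def)
    obtain p where p: "p \<in> V" "\<And>v. v \<in> V \<Longrightarrow> ip (f - p) v = 0" using ex_projection[OF V fH] by blast
    have "f - p = 0"
    proof (rule orthogonal_closure_imp_0[where S=V])
      show "f - p \<in> hilbert_closure H ip V"
        unfolding hilbert_closure_def
      proof (intro CollectI conjI allI impI)
        show "f - p \<in> H" using fH p(1) V(2) by (auto intro: H_simps)
        fix e :: real assume "0 < e"
        then obtain g where "g \<in> V" "sqrt (Re (ip (f - g) (f - g))) < e" using f unfolding hilbert_closure_def by blast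
        then show "\<exists>g\<in>V. sqrt (Re (ip (f - p - g) (f - p - g))) < e"
          using cfun.subspace_diff[OF finite_dim_imp_subspace[OF V(1)], of g p] p(1)
          by (intro bexI[of _ "g - p"]) (auto simp: algebra_simps)
      qed
    qed (use V p in auto)
    then show "f \<in> V" using p(1) by simp
  qed
qed

end

section \<open>The two-sided modules generated by the highest weight functions\<close>

lemma polynomials_cnj_adj: "f \<in> polynomials \<Longrightarrow> (\<lambda>Z. cnj (f (adj Z))) \<in> polynomials"
  by (induction rule: polynomials_induct) (auto intro: polynomials_intros)

lemma cnj_torus_char: "cnj (torus_char \<mu> (\<lambda>i. cnj (a i))) = torus_char \<mu> a"
  by (simp add: torus_char_def)

lemma adj_upper_unitriangular: "upper_unitriangular U \<Longrightarrow> lower_unitriangular (adj U)"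
  by (auto simp: upper_unitriangular_def lower_unitriangular_def)

lemma adj_diag_mat: "adj (diag_mat a) = diag_mat (\<lambda>i. cnj (a i))"
  by (simp add: vec_eq_iff diag_mat_nth)

lemma unitary_adj: "unitary g \<Longrightarrow> unitary (adj g)"
  by (simp add: unitary_def matrix_left_right_inverse)

lemma unitary_invertible: "unitary A \<Longrightarrow> invertible A"
  using invertible_left_inverse unfolding unitary_def by blast

lemma unitary_matrix_inv: "unitary A \<Longrightarrow> matrix_inv A = adj A"
  by (simp add: unitary_def matrix_left_right_inverse matrix_inv_eqI)

locale unitary_invariant_product = inner_product_on polynomials ip
  for ip :: "('n::{finite,wellorder} cmat \<Rightarrow> complex) \<Rightarrow> ('n cmat \<Rightarrow> complex) \<Rightarrow> complex" +
  assumes ip_unitary: "\<And>g h f k. unitary g \<Longrightarrow> unitary h \<Longrightarrow> f \<in> polynomials \<Longrightarrow> k \<in> polynomials \<Longrightarrow>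
    ip (bitrans g h f) (bitrans g h k) = ip f k"
begin

text \<open>The translates of \<open>f\<close> span a finite-dimensional space, so the inner product depends polynomially on the
  matrices \<open>g\<close> and \<open>h\<close>.\<close>

lemma ip_bitrans_expand:
  assumes f: "f \<in> polynomials"
  obtains X e where "finite X" "\<And>x. x \<in> X \<Longrightarrow> e x \<in> polynomials"
    "\<And>g h k. k \<in> polynomials \<Longrightarrow> ip (bitrans g h f) k = (\<Sum>x\<in>X. f (g ** x ** h) * ip (e x) k)"
proof -
  obtain X e where I: "interpolates X e (bi_span f)" using ex_interpolation bi_span_finite_dim[OF f] by blast
  have e: "e x \<in> polynomials" if "x \<in> X" for x using interpolatesD(2)[OF I that] bi_span_polynomials[OF f] by blast
  have "ip (bitrans g h f) k = (\<Sum>x\<in>X. f (g ** x ** h) * ip (e x) k)" if k: "k \<in> polynomials" for g h k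
  proof -
    have "bitrans g h f = (\<Sum>x\<in>X. cscale (bitrans g h f x) (e x))" by (rule interpolation_eq[OF I bi_span_base])
    then have "ip (bitrans g h f) k = ip (\<Sum>x\<in>X. cscale (bitrans g h f x) (e x)) k" by simp
    also have "\<dots> = (\<Sum>x\<in>X. bitrans g h f x * ip (e x) k)" by (rule ip_sum_left[OF e k])
    finally show ?thesis by (simp add: bitrans_def)
  qed
  then show ?thesis using that[of X e] interpolatesD(1)[OF I] e by blast
qed

lemma ip_bitrans_polynomial:
  assumes f: "f \<in> polynomials" and k: "k \<in> polynomials"
  shows "(\<lambda>g. ip (bitrans g h f) k) \<in> polynomials" "(\<lambda>h. ip (bitrans g h f) k) \<in> polynomials"
    "(\<lambda>g. ip k (bitrans (adj g) h f)) \<in> polynomials" "(\<lambda>h. ip k (bitrans g (adj h) f)) \<in> polynomials"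
proof -
  obtain X e where X: "finite X" "\<And>x. x \<in> X \<Longrightarrow> e x \<in> polynomials"
    and E: "\<And>g h k. k \<in> polynomials \<Longrightarrow> ip (bitrans g h f) k = (\<Sum>x\<in>X. f (g ** x ** h) * ip (e x) k)"
    using ip_bitrans_expand[OF f] by blast
  have E': "ip k (bitrans g h f) = (\<Sum>x\<in>X. cnj (f (g ** x ** h)) * cnj (ip (e x) k))" for g h
    using E[OF k, of g h] ip_cnj[OF polynomials_bitrans[OF f] k, of g h] by (simp add: cnj_sum)
  note fl = polynomials_bitrans_left[OF f] and fr = polynomials_bitrans_right[OF f]
  show "(\<lambda>g. ip (bitrans g h f) k) \<in> polynomials"
    unfolding E[OF k] by (intro polynomials_sum polynomials_mult fl polynomials_const)
  show "(\<lambda>h. ip (bitrans g h f) k) \<in> polynomials"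
    unfolding E[OF k] by (intro polynomials_sum polynomials_mult fr polynomials_const)
  show "(\<lambda>g. ip k (bitrans (adj g) h f)) \<in> polynomials"
    unfolding E' by (intro polynomials_sum polynomials_mult polynomials_cnj_adj[OF fl] polynomials_const)
  show "(\<lambda>h. ip k (bitrans g (adj h) f)) \<in> polynomials"
    unfolding E' by (intro polynomials_sum polynomials_mult polynomials_cnj_adj[OF fr] polynomials_const)
qed

text \<open>For unitary matrices this is invariance; both sides are polynomial in \<open>g\<close> and in \<open>h\<close>.\<close>

lemma ip_adjoint:
  assumes f: "f \<in> polynomials" and k: "k \<in> polynomials"
  shows "ip (bitrans g h f) k = ip f (bitrans (adj g) (adj h) k)"
proof -
  have 1: "ip (bitrans u v f) k = ip f (bitrans (adj u) (adj v) k)" if u: "unitary u" and v: "unitary v" for u v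
  proof -
    have uv: "adj u ** u = mat 1" "v ** adj v = mat 1" using u v unitary_adj[OF v] by (simp_all add: unitary_def)
    have "ip (bitrans u v f) k = ip (bitrans u v f) (bitrans u v (bitrans (adj u) (adj v) k))"
      by (simp add: bitrans_bitrans uv)
    also have "\<dots> = ip f (bitrans (adj u) (adj v) k)" by (rule ip_unitary[OF u v f polynomials_bitrans[OF k]])
    finally show ?thesis .
  qed
  have 2: "ip (bitrans g v f) k - ip f (bitrans (adj g) (adj v) k) = 0" if v: "unitary v" for g v
  proof (rule polynomial_eq_0_if_eq_0_on_unitary[where p="\<lambda>g. ip (bitrans g v f) k - ip f (bitrans (adj g) (adj v) k)"])
    show "(\<lambda>g. ip (bitrans g v f) k - ip f (bitrans (adj g) (adj v) k)) \<in> polynomials"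
      by (intro polynomials_diff ip_bitrans_polynomial f k)
  qed (use 1 v in \<open>simp add: unitary_def\<close>)
  have "ip (bitrans g h f) k - ip f (bitrans (adj g) (adj h) k) = 0"
  proof (rule polynomial_eq_0_if_eq_0_on_unitary[where p="\<lambda>h. ip (bitrans g h f) k - ip f (bitrans (adj g) (adj h) k)"])
    show "(\<lambda>h. ip (bitrans g h f) k - ip f (bitrans (adj g) (adj h) k)) \<in> polynomials"
      by (intro polynomials_diff ip_bitrans_polynomial f k)
  qed (use 2 in \<open>simp add: unitary_def\<close>)
  then show ?thesis by simp
qed

text \<open>For a diagonal \<open>a\<close>, moving \<open>diag_mat a\<close> across the inner product multiplies it by
  \<open>torus_char \<mu> a\<close> on one side and by \<open>torus_char \<nu> a\<close> on the other. A left translation by a matrix \<open>A\<close>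
  of the big cell reduces to this case: \<open>U\<close> can be inserted for free, because its adjoint is lower
  triangular and fixes \<open>G\<close>, and \<open>A U = L D\<close> acts on \<open>F\<close> by a scalar.\<close>

lemma hw_orthogonal:
  assumes F: "hw_function \<mu> F" and G: "hw_function \<nu> G" and ne: "\<mu> \<noteq> \<nu>"
  shows "ip (bitrans g h F) (bitrans g' h' G) = 0"
proof -
  note hF = hw_functionD[OF F] and hG = hw_functionD[OF G]
  have 1: "ip (bitrans (mat 1) h F) G = 0" for h
  proof -
    obtain a where a: "\<And>i. a i \<noteq> 0" "torus_char \<mu> a \<noteq> torus_char \<nu> a" using torus_char_eq_imp_eq ne by metis
    have p: "bitrans (mat 1) h F \<in> polynomials" by (rule polynomials_bitrans[OF hF(1)])
    have "bitrans (diag_mat a) (mat 1) (bitrans (mat 1) h F) = cscale (torus_char \<mu> a) (bitrans (mat 1) h F)"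
      using hF(4)[OF a(1)] by (simp add: bitrans_def cscale_def matrix_mul_assoc[symmetric])
    then have "torus_char \<mu> a * ip (bitrans (mat 1) h F) G = ip (bitrans (diag_mat a) (mat 1) (bitrans (mat 1) h F)) G"
      by (simp add: ip_scale_left p hG(1))
    also have "\<dots> = ip (bitrans (mat 1) h F) (bitrans (diag_mat (\<lambda>i. cnj (a i))) (mat 1) G)"
      by (simp add: ip_adjoint p hG(1) adj_diag_mat)
    also have "bitrans (diag_mat (\<lambda>i. cnj (a i))) (mat 1) G = cscale (torus_char \<nu> (\<lambda>i. cnj (a i))) G"
      using hG(4)[of "\<lambda>i. cnj (a i)"] a(1) by (simp add: bitrans_def cscale_def)
    also have "ip (bitrans (mat 1) h F) (cscale (torus_char \<nu> (\<lambda>i. cnj (a i))) G) = torus_char \<nu> a * ip (bitrans (mat 1) h F) G"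
      by (simp only: ip_scale_right[OF hG(1) p] cnj_torus_char)
    finally show ?thesis using a(2) by simp
  qed
  have 2: "ip (bitrans g h F) G = 0" for g h
  proof (rule polynomial_eq_0_if_eq_0_on_big_cell[OF ip_bitrans_polynomial(1)[OF hF(1) hG(1)]])
    fix A :: "'n cmat" assume "big_cell A"
    then obtain U L a where c: "upper_unitriangular U" "lower_unitriangular L" "\<And>i. a i \<noteq> 0" "A ** U = L ** diag_mat a"
      unfolding big_cell_def by blast
    have p: "bitrans A h F \<in> polynomials" by (rule polynomials_bitrans[OF hF(1)])
    have "bitrans (adj U) (mat 1) G = G"
      using hG(2)[OF adj_upper_unitriangular[OF c(1)]] by (simp add: bitrans_def)
    then have "ip (bitrans A h F) G = ip (bitrans U (mat 1) (bitrans A h F)) G"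
      using ip_adjoint[OF p hG(1), of U "mat 1"] by simp
    also have "bitrans U (mat 1) (bitrans A h F) = cscale (torus_char \<mu> a) (bitrans (mat 1) h F)"
      using hF(2)[OF c(2)] hF(4)[OF c(3)]
      by (simp add: bitrans_bitrans c(4)) (simp add: bitrans_def cscale_def matrix_mul_assoc[symmetric])
    also have "ip (cscale (torus_char \<mu> a) (bitrans (mat 1) h F)) G = 0"
      using 1[of h] by (simp add: ip_scale_left polynomials_bitrans[OF hF(1)] hG(1))
    finally show "ip (bitrans A h F) G = 0" .
  qed
  have "ip (bitrans g h F) (bitrans g' h' G) = ip (bitrans (adj g') (adj h') (bitrans g h F)) G"
    by (simp add: ip_adjoint polynomials_bitrans hF(1) hG(1))
  then show ?thesis by (simp add: bitrans_bitrans 2)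
qed

lemma bi_span_orthogonal:
  assumes F: "hw_function \<mu> F" and G: "hw_function \<nu> G" and ne: "\<mu> \<noteq> \<nu>"
    and f: "f \<in> bi_span F" and k: "k \<in> bi_span G"
  shows "ip f k = 0"
proof -
  note pF = hw_functionD(1)[OF F] and pG = hw_functionD(1)[OF G]
  have 1: "ip (bitrans g h F) k = 0" for g h
    by (rule orthogonal_span[OF polynomials_bitrans[OF pF] _ _ k[unfolded bi_span_def]])
      (use polynomials_bitrans[OF pG] hw_orthogonal[OF F G ne] in auto)
  have kp: "k \<in> polynomials" and fp: "f \<in> polynomials" using f k bi_span_polynomials pF pG by blast+
  have "ip k f = 0"
    by (rule orthogonal_span[OF kp _ _ f[unfolded bi_span_def]])
      (use polynomials_bitrans[OF pF] 1 ip_commute_0[OF polynomials_bitrans[OF pF] kp] in auto)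
  then show ?thesis by (rule ip_commute_0[OF kp fp])
qed

end

definition hwf :: "('n::{finite,wellorder} \<Rightarrow> int) \<Rightarrow> 'n cmat \<Rightarrow> complex" where
  "hwf \<mu> = (SOME F. hw_function \<mu> F \<and> F (mat 1) = 1)"

definition wspace :: "('n::{finite,wellorder} \<Rightarrow> int) \<Rightarrow> ('n cmat \<Rightarrow> complex) set" where
  "wspace \<mu> = bi_span (hwf \<mu>)"

lemma hwf:
  assumes "\<mu> \<in> dominant_weights" shows "hw_function \<mu> (hwf \<mu>)" "hwf \<mu> (mat 1) = 1"
  using someI_ex[OF ex_hw_function[OF assms]] by (simp_all add: hwf_def)

lemma hwf_polynomial: "\<mu> \<in> dominant_weights \<Longrightarrow> hwf \<mu> \<in> polynomials"
  using hw_functionD(1)[OF hwf(1)] .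

lemma wspace_finite_dim: "\<mu> \<in> dominant_weights \<Longrightarrow> finite_dim (wspace \<mu>)"
  by (simp add: wspace_def bi_span_finite_dim hwf_polynomial)

lemma wspace_polynomials: "\<mu> \<in> dominant_weights \<Longrightarrow> wspace \<mu> \<subseteq> polynomials"
  by (simp add: wspace_def bi_span_polynomials hwf_polynomial)

lemma wspace_subspace: "cfun.subspace (wspace \<mu>)"
  by (simp add: wspace_def bi_span_subspace)

lemma wspace_bi_stable: "bi_stable (wspace \<mu>)"
  by (simp add: wspace_def bi_span_bi_stable)

lemma hwf_in_wspace: "hwf \<mu> \<in> wspace \<mu>"
  by (simp add: wspace_def bi_span_self)

lemma hwf_nonzero: "\<mu> \<in> dominant_weights \<Longrightarrow> hwf \<mu> \<noteq> 0"
  using hwf(2) by fastforce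

text \<open>Equivariance at \<open>(g, h)\<close> is a polynomial identity in \<open>g\<close> and in \<open>h\<close>.\<close>

lemma equivariant_extension:
  fixes V :: "('n::finite cmat \<Rightarrow> complex) set"
  assumes V: "finite_dim V" "V \<subseteq> polynomials" "bi_stable V"
    and T: "clinear_on V cscale T" "\<And>f. f \<in> V \<Longrightarrow> T f \<in> polynomials"
    and eq: "\<And>g h f. unitary g \<Longrightarrow> unitary h \<Longrightarrow> f \<in> V \<Longrightarrow> T (bitrans g h f) = bitrans g h (T f)"
    and f: "f \<in> V"
  shows "T (bitrans g h f) = bitrans g h (T f)"
proof -
  obtain X e where I: "interpolates X e V" using ex_interpolation V(1) by blast
  note sV = finite_dim_imp_subspace[OF V(1)]
  have st: "bitrans g h f \<in> V" for g h using V(3) f by (simp add: bi_stable_def)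
  have TE: "T (bitrans g h f) Z = (\<Sum>x\<in>X. f (g ** x ** h) * T (e x) Z)" for g h Z
    using interpolation_linear[OF I T(1) sV st, of g h Z] by (simp add: bitrans_def)
  have fp: "f \<in> polynomials" using f V(2) by blast
  have "T (bitrans g h f) Z = bitrans g h (T f) Z" for Z
  proof -
    have 1: "T (bitrans g v f) Z - T f (g ** Z ** v) = 0" if v: "unitary v" for g v
    proof (rule polynomial_eq_0_if_eq_0_on_unitary[where p="\<lambda>g. T (bitrans g v f) Z - T f (g ** Z ** v)"])
      show "(\<lambda>g. T (bitrans g v f) Z - T f (g ** Z ** v)) \<in> polynomials"
        unfolding TE by (intro polynomials_diff polynomials_sum polynomials_mult polynomials_const
          polynomials_bitrans_left[OF fp] polynomials_bitrans_left[OF T(2)[OF f]])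
      show "T (bitrans A v f) Z - T f (A ** Z ** v) = 0" if "adj A ** A = mat 1" for A
        using eq[OF _ v f, of A] that by (simp add: unitary_def bitrans_def)
    qed
    have "T (bitrans g h f) Z - T f (g ** Z ** h) = 0"
    proof (rule polynomial_eq_0_if_eq_0_on_unitary[where p="\<lambda>h. T (bitrans g h f) Z - T f (g ** Z ** h)"])
      show "(\<lambda>h. T (bitrans g h f) Z - T f (g ** Z ** h)) \<in> polynomials"
        unfolding TE by (intro polynomials_diff polynomials_sum polynomials_mult polynomials_const
          polynomials_bitrans_right[OF fp] polynomials_bitrans_right[OF T(2)[OF f]])
      show "T (bitrans g A f) Z - T f (g ** Z ** A) = 0" if "adj A ** A = mat 1" for A
        using 1[of A g] that by (simp add: unitary_def)
    qed
    then show ?thesis by (simp add: bitrans_def)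
  qed
  then show ?thesis by (rule ext)
qed

lemma clinear_on_vimage_subspace:
  assumes "clinear_on V cscale T" "cfun.subspace V" "cfun.subspace W"
  shows "cfun.subspace {f \<in> V. T f \<in> W}"
  by (rule cfun.subspaceI)
    (simp_all add: clinear_on_0[OF assms(1,2)] clinear_on_add[OF assms(1)] clinear_on_scale[OF assms(1)]
      cfun.subspace_0 cfun.subspace_add cfun.subspace_scale assms(2,3))

text \<open>The image of the highest weight function has the same invariance properties, hence is a multiple of
  it by uniqueness. This replaces Schur's lemma when two submodules are compared.\<close>

lemma equivariant_image_wspace:
  assumes \<mu>: "\<mu> \<in> dominant_weights"
    and T: "clinear_on (wspace \<mu>) cscale T" "\<And>f. f \<in> wspace \<mu> \<Longrightarrow> T f \<in> polynomials" "inj_on T (wspace \<mu>)"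
    and eq: "\<And>g h f. unitary g \<Longrightarrow> unitary h \<Longrightarrow> f \<in> wspace \<mu> \<Longrightarrow> T (bitrans g h f) = bitrans g h (T f)"
  shows "T ` wspace \<mu> = wspace \<mu>"
proof -
  note fd = wspace_finite_dim[OF \<mu>] and wp = wspace_polynomials[OF \<mu>] and st = wspace_bi_stable[of \<mu>]
    and sW = wspace_subspace[of \<mu>]
  have EQ: "T (bitrans g h f) = bitrans g h (T f)" if "f \<in> wspace \<mu>" for g h f
    by (rule equivariant_extension[OF fd wp st T(1,2) eq that])
  define F where "F = hwf \<mu>"
  have F: "F \<in> wspace \<mu>" by (simp add: F_def hwf_in_wspace)
  note hF = hw_functionD[OF hwf(1)[OF \<mu>], folded F_def]
  have "hw_function \<mu> (T F)"
    unfolding hw_function_def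
  proof (intro conjI allI impI)
    show "T F \<in> polynomials" by (rule T(2)[OF F])
    fix Z :: "'a cmat"
    show "T F (L ** Z) = T F Z" if L: "lower_unitriangular L" for L
    proof -
      have "bitrans L (mat 1) F = F" using hF(2)[OF L] by (simp add: bitrans_def)
      then have "T F = bitrans L (mat 1) (T F)" using EQ[OF F, of L "mat 1"] by simp
      then have "T F Z = bitrans L (mat 1) (T F) Z" by (rule fun_cong)
      then show ?thesis by (simp add: bitrans_def)
    qed
    show "T F (Z ** U) = T F Z" if U: "upper_unitriangular U" for U
    proof -
      have "bitrans (mat 1) U F = F" using hF(3)[OF U] by (simp add: bitrans_def)
      then have "T F = bitrans (mat 1) U (T F)" using EQ[OF F, of "mat 1" U] by simp
      then have "T F Z = bitrans (mat 1) U (T F) Z" by (rule fun_cong)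
      then show ?thesis by (simp add: bitrans_def)
    qed
    show "T F (diag_mat a ** Z) = torus_char \<mu> a * T F Z" if a: "\<forall>i. a i \<noteq> 0" for a
    proof -
      have "bitrans (diag_mat a) (mat 1) F = cscale (torus_char \<mu> a) F"
        using hF(4)[of a] a by (simp add: bitrans_def cscale_def)
      then have "T (cscale (torus_char \<mu> a) F) = bitrans (diag_mat a) (mat 1) (T F)"
        using EQ[OF F, of "diag_mat a" "mat 1"] by simp
      then have "cscale (torus_char \<mu> a) (T F) Z = bitrans (diag_mat a) (mat 1) (T F) Z"
        by (simp only: clinear_on_scale[OF T(1) F])
      then show ?thesis by (simp add: bitrans_def cscale_apply)
    qed
  qed
  then have TF: "T F = cscale (T F (mat 1)) F"
    unfolding F_def by (rule hw_function_unique[OF hwf[OF \<mu>]])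
  define c where "c = T F (mat 1)"
  have TF: "T F = cscale c F" using TF by (simp only: c_def)
  have c0: "c \<noteq> 0"
  proof
    assume "c = 0"
    then have "T F = T 0" unfolding TF clinear_on_0[OF T(1) sW] by (simp add: cscale_def zero_fun_def)
    then have "F = 0" using T(3) F cfun.subspace_0[OF sW] by (auto dest: inj_onD)
    then show False using hwf_nonzero[OF \<mu>] by (simp only: F_def)
  qed
  have stT: "bi_stable (T ` wspace \<mu>)"
    using st EQ unfolding bi_stable_def by (metis (no_types, lifting) image_iff)
  show ?thesis
  proof
    have sub: "cfun.subspace {f \<in> wspace \<mu>. T f \<in> wspace \<mu>}"
      by (rule clinear_on_vimage_subspace[OF T(1) sW sW])
    have "bi_span F \<subseteq> {f \<in> wspace \<mu>. T f \<in> wspace \<mu>}"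
    proof (rule bi_span_least[OF sub])
      fix g h
      have "bitrans g h F \<in> wspace \<mu>" using st F by (simp add: bi_stable_def)
      moreover have "T (bitrans g h F) = cscale c (bitrans g h F)" by (simp only: EQ[OF F] TF bitrans_cscale)
      ultimately show "bitrans g h F \<in> {f \<in> wspace \<mu>. T f \<in> wspace \<mu>}"
        using cfun.subspace_scale[OF sW] by simp
    qed
    then show "T ` wspace \<mu> \<subseteq> wspace \<mu>" by (auto simp: wspace_def F_def)
    have "cscale (1/c) (T F) \<in> T ` wspace \<mu>"
      using F by (intro cfun.subspace_scale[OF clinear_on_image_subspace[OF T(1) sW]]) auto
    moreover have "cscale (1/c) (T F) = F" using c0 unfolding TF by (simp add: cscale_def)
    ultimately have "F \<in> T ` wspace \<mu>" by simp
    then show "wspace \<mu> \<subseteq> T ` wspace \<mu>"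
      unfolding wspace_def F_def[symmetric]
      using bi_span_least_stable[OF clinear_on_image_subspace[OF T(1) sW] stT] by (simp add: wspace_def F_def)
  qed
qed

context unitary_invariant_product
begin

lemma wspace_orthogonal:
  assumes "\<mu> \<in> dominant_weights" "\<nu> \<in> dominant_weights" "\<mu> \<noteq> \<nu>" "f \<in> wspace \<mu>" "k \<in> wspace \<nu>"
  shows "ip f k = 0"
  using bi_span_orthogonal[OF hwf(1)[OF assms(1)] hwf(1)[OF assms(2)] assms(3)] assms(4,5) by (simp add: wspace_def)

text \<open>The normalised highest weight functions are unique, so the one found in \<open>V\<close> is \<open>hwf \<nu>\<close>.\<close>

lemma hw_in_stable:
  fixes V :: "('n cmat \<Rightarrow> complex) set"
  assumes V: "finite_dim V" "V \<subseteq> polynomials" "V \<noteq> {0}"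
    and st: "\<And>g h f. unitary g \<Longrightarrow> unitary h \<Longrightarrow> f \<in> V \<Longrightarrow> bitrans g h f \<in> V"
  shows "\<exists>\<nu>\<in>dominant_weights. hwf \<nu> \<in> V \<and> wspace \<nu> \<subseteq> V"
proof -
  have bs: "bi_stable V" by (rule bi_stable_if_unitary_stable[OF V(1,2) st])
  obtain \<nu> F where \<nu>: "\<nu> \<in> dominant_weights" "F \<in> V" "hw_function \<nu> F" "F (mat 1) = 1"
    using ex_hw_function_in_stable[OF V bs] by blast
  have "hwf \<nu> = cscale (hwf \<nu> (mat 1)) F" by (rule hw_function_unique[OF \<nu>(3,4) hwf(1)[OF \<nu>(1)]])
  then have "hwf \<nu> = F" by (simp add: hwf(2)[OF \<nu>(1)])
  then have "hwf \<nu> \<in> V" using \<nu>(2) by simp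
  then show ?thesis
    using \<nu>(1) bi_span_least_stable[OF finite_dim_imp_subspace[OF V(1)] bs] by (auto simp: wspace_def)
qed

lemma wspace_simple:
  fixes V :: "('n cmat \<Rightarrow> complex) set"
  assumes \<mu>: "\<mu> \<in> dominant_weights" and V: "cfun.subspace V" "V \<subseteq> wspace \<mu>" "V \<noteq> {0}"
    and st: "\<And>g h f. unitary g \<Longrightarrow> unitary h \<Longrightarrow> f \<in> V \<Longrightarrow> bitrans g h f \<in> V"
  shows "V = wspace \<mu>"
proof -
  have fd: "finite_dim V" by (rule finite_dim_subspace[OF wspace_finite_dim[OF \<mu>] V(1,2)])
  have Vp: "V \<subseteq> polynomials" using V(2) wspace_polynomials[OF \<mu>] by blast
  obtain \<nu> where \<nu>: "\<nu> \<in> dominant_weights" "hwf \<nu> \<in> V" "wspace \<nu> \<subseteq> V" using hw_in_stable[OF fd Vp V(3) st] by blast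
  have "\<nu> = \<mu>"
  proof (rule ccontr)
    assume "\<nu> \<noteq> \<mu>"
    then have "ip (hwf \<nu>) (hwf \<nu>) = 0" using wspace_orthogonal[OF \<nu>(1) \<mu>] hwf_in_wspace \<nu>(2) V(2) by blast
    then show False using ip_definite hwf_polynomial[OF \<nu>(1)] hwf_nonzero[OF \<nu>(1)] by blast
  qed
  then show ?thesis using \<nu>(3) V(2) by blast
qed

text \<open>Within the finite-dimensional space generated by \<open>p\<close>, the orthogonal complement of the part that is
  already decomposed is stable. If it were nonzero, it would contain some \<open>hwf \<nu>\<close>, which lies in the
  decomposed part.\<close>

lemma polynomials_decomposition:
  "(polynomials :: ('n cmat \<Rightarrow> complex) set) \<subseteq> cfun.span (\<Union>\<mu>\<in>dominant_weights. wspace \<mu>)" (is "_ \<subseteq> ?Y")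
proof
  fix p :: "'n cmat \<Rightarrow> complex" assume p: "p \<in> polynomials"
  have sY: "cfun.subspace ?Y" by simp
  have Yst: "bitrans g h y \<in> ?Y" if "y \<in> ?Y" for g h y
  proof -
    have "?Y \<subseteq> {f. bitrans g h f \<in> ?Y}"
    proof (rule cfun.span_minimal[OF _ subspace_bitrans_vimage[OF sY]], clarify)
      fix \<mu> :: "'n \<Rightarrow> int" and f assume "\<mu> \<in> dominant_weights" "f \<in> wspace \<mu>"
      then show "bitrans g h f \<in> ?Y" using wspace_bi_stable[of \<mu>] unfolding bi_stable_def by (intro cfun.span_base) blast
    qed
    then show ?thesis using that by blast
  qed
  define P where "P = bi_span p"
  note fdP = bi_span_finite_dim[OF p, folded P_def] and sP = bi_span_subspace[of p, folded P_def]
    and Pst = bi_span_bi_stable[of p, folded P_def] and Pp = bi_span_polynomials[OF p, folded P_def]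
  have sYP: "cfun.subspace (?Y \<inter> P)" by (rule cfun.subspace_inter[OF sY sP])
  have fYP: "finite_dim (?Y \<inter> P)" by (rule finite_dim_subspace[OF fdP sYP]) auto
  have YPp: "?Y \<inter> P \<subseteq> polynomials" using Pp by blast
  define V where "V = {f \<in> P. \<forall>y\<in>?Y \<inter> P. ip f y = 0}"
  have sV: "cfun.subspace V"
    unfolding V_def
  proof (rule cfun.subspaceI)
    show "0 \<in> {f \<in> P. \<forall>y\<in>?Y \<inter> P. ip f y = 0}" using cfun.subspace_0[OF sP] ip_zero_left Pp by blast
    show "x + y \<in> {f \<in> P. \<forall>y\<in>?Y \<inter> P. ip f y = 0}"
      if "x \<in> {f \<in> P. \<forall>y\<in>?Y \<inter> P. ip f y = 0}" "y \<in> {f \<in> P. \<forall>y\<in>?Y \<inter> P. ip f y = 0}" for x y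
    proof -
      have "ip (x + y) z = 0" if "z \<in> ?Y \<inter> P" for z
      proof -
        have "ip (x + y) z = ip x z + ip y z"
          by (rule ip_add_left) (use that \<open>x \<in> _\<close> \<open>y \<in> {f \<in> P. _ f}\<close> Pp in blast)+
        then show ?thesis using that \<open>x \<in> _\<close> \<open>y \<in> {f \<in> P. _ f}\<close> by simp
      qed
      then show ?thesis using that cfun.subspace_add[OF sP] by blast
    qed
    show "cscale c x \<in> {f \<in> P. \<forall>y\<in>?Y \<inter> P. ip f y = 0}" if "x \<in> {f \<in> P. \<forall>y\<in>?Y \<inter> P. ip f y = 0}" for c x
    proof -
      have "ip (cscale c x) z = 0" if "z \<in> ?Y \<inter> P" for z
      proof -
        have "ip (cscale c x) z = c * ip x z"
          by (rule ip_scale_left) (use that \<open>x \<in> _\<close> Pp in blast)+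
        then show ?thesis using that \<open>x \<in> _\<close> by simp
      qed
      then show ?thesis using that cfun.subspace_scale[OF sP] by blast
    qed
  qed
  have VP: "V \<subseteq> P" by (auto simp: V_def)
  have "V = {0}"
  proof (rule ccontr)
    assume "V \<noteq> {0}"
    have "bitrans g h f \<in> V" if g: "unitary g" and h: "unitary h" and f: "f \<in> V" for g h f
    proof -
      have fP: "f \<in> P" using f VP by blast
      have "ip (bitrans g h f) y = 0" if y: "y \<in> ?Y \<inter> P" for y
      proof -
        have "bitrans (adj g) (adj h) y \<in> ?Y \<inter> P" using y Yst Pst by (simp add: bi_stable_def)
        moreover have "ip (bitrans g h f) y = ip f (bitrans (adj g) (adj h) y)"
          by (rule ip_adjoint) (use fP y Pp in blast)+
        ultimately show ?thesis using f by (simp add: V_def)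
      qed
      moreover have "bitrans g h f \<in> P" using Pst fP by (simp add: bi_stable_def)
      ultimately show ?thesis by (simp add: V_def)
    qed
    then obtain \<nu> where \<nu>: "\<nu> \<in> dominant_weights" "hwf \<nu> \<in> V"
      using hw_in_stable[OF finite_dim_subspace[OF fdP sV VP] _ \<open>V \<noteq> {0}\<close>] VP Pp by blast
    have "hwf \<nu> \<in> ?Y" using \<nu>(1) hwf_in_wspace by (intro cfun.span_base) blast
    then have "ip (hwf \<nu>) (hwf \<nu>) = 0" using \<nu>(2) VP by (simp add: V_def)
    then show False using ip_definite hwf_polynomial[OF \<nu>(1)] hwf_nonzero[OF \<nu>(1)] by blast
  qed
  have pP: "p \<in> P" by (simp add: P_def bi_span_self)
  obtain q where q: "q \<in> ?Y \<inter> P" "\<And>v. v \<in> ?Y \<inter> P \<Longrightarrow> ip (p - q) v = 0"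
    using ex_projection[OF fYP YPp p] by blast
  have "p - q \<in> V" using q pP cfun.subspace_diff[OF sP] by (simp add: V_def)
  then have "p - q = 0" using \<open>V = {0}\<close> by blast
  then show "p \<in> ?Y" using q(1) by simp
qed

end

section \<open>Modules and transport of structure\<close>

lemma clinear_onI:
  assumes "\<And>u v. u \<in> V \<Longrightarrow> v \<in> V \<Longrightarrow> T (u + v) = T u + T v" "\<And>c v. v \<in> V \<Longrightarrow> T (cscale c v) = sc c (T v)"
  shows "clinear_on V sc T"
  using assms unfolding clinear_on_def by blast

lemma is_gmoduleD:
  assumes "is_gmodule G M"
  shows "cfun.subspace (vecs M)" "\<And>g v. g \<in> carrier G \<Longrightarrow> v \<in> vecs M \<Longrightarrow> act M g v \<in> vecs M"
    "\<And>g. g \<in> carrier G \<Longrightarrow> clinear_on (vecs M) cscale (act M g)"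
    "\<And>v. v \<in> vecs M \<Longrightarrow> act M \<one>\<^bsub>G\<^esub> v = v"
    "\<And>g h v. g \<in> carrier G \<Longrightarrow> h \<in> carrier G \<Longrightarrow> v \<in> vecs M \<Longrightarrow> act M (g \<otimes>\<^bsub>G\<^esub> h) v = act M g (act M h v)"
  using assms unfolding is_gmodule_def by blast+

lemma is_submoduleD:
  assumes "is_submodule G M V"
  shows "cfun.subspace V" "V \<subseteq> vecs M" "\<And>g v. g \<in> carrier G \<Longrightarrow> v \<in> V \<Longrightarrow> act M g v \<in> V"
  using assms unfolding is_submodule_def by blast+

lemma clinear_on_subset: "clinear_on V sc T \<Longrightarrow> U \<subseteq> V \<Longrightarrow> clinear_on U sc T"
  unfolding clinear_on_def by blast

lemma submodule_gmodule:
  assumes "is_gmodule G M" "is_submodule G M V" shows "is_gmodule G (M\<lparr>vecs := V\<rparr>)"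
  using is_gmoduleD[OF assms(1)] is_submoduleD[OF assms(2)]
  unfolding is_gmodule_def by (auto intro: clinear_on_subset)

lemma module_isoE:
  assumes "module_iso G M N"
  obtains T where "bij_betw T (vecs M) (vecs N)" "clinear_on (vecs M) cscale T"
    "\<And>g v. g \<in> carrier G \<Longrightarrow> v \<in> vecs M \<Longrightarrow> T (act M g v) = act N g (T v)"
  using assms unfolding module_iso_def by blast

lemma module_isoI:
  assumes "bij_betw T (vecs M) (vecs N)" "clinear_on (vecs M) cscale T"
    "\<And>g v. g \<in> carrier G \<Longrightarrow> v \<in> vecs M \<Longrightarrow> T (act M g v) = act N g (T v)"
  shows "module_iso G M N"
  using assms unfolding module_iso_def by blast

lemma module_iso_trans:
  assumes "module_iso G M N" "module_iso G N P" shows "module_iso G M P"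
proof -
  obtain S where S: "bij_betw S (vecs M) (vecs N)" "clinear_on (vecs M) cscale S"
    "\<And>g v. g \<in> carrier G \<Longrightarrow> v \<in> vecs M \<Longrightarrow> S (act M g v) = act N g (S v)" using module_isoE[OF assms(1)] by blast
  obtain T where T: "bij_betw T (vecs N) (vecs P)" "clinear_on (vecs N) cscale T"
    "\<And>g v. g \<in> carrier G \<Longrightarrow> v \<in> vecs N \<Longrightarrow> T (act N g v) = act P g (T v)" using module_isoE[OF assms(2)] by blast
  have SN: "S v \<in> vecs N" if "v \<in> vecs M" for v using S(1) that by (auto simp: bij_betw_def)
  show ?thesis
  proof (rule module_isoI[where T="\<lambda>v. T (S v)"])
    show "bij_betw (\<lambda>v. T (S v)) (vecs M) (vecs P)" using bij_betw_trans[OF S(1) T(1)] by (simp add: comp_def)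
    show "clinear_on (vecs M) cscale (\<lambda>v. T (S v))"
      by (rule clinear_onI)
        (simp_all add: clinear_on_add[OF S(2)] clinear_on_add[OF T(2)] clinear_on_scale[OF S(2)] clinear_on_scale[OF T(2)] SN)
  qed (simp_all add: S(3) T(3) SN)
qed

lemma module_iso_sym_if_closed:
  assumes MD: "cfun.subspace (vecs M)" "\<And>g v. g \<in> carrier G \<Longrightarrow> v \<in> vecs M \<Longrightarrow> act M g v \<in> vecs M"
    and iso: "module_iso G M N"
  shows "module_iso G N M"
proof -
  obtain T where T: "bij_betw T (vecs M) (vecs N)" "clinear_on (vecs M) cscale T"
    "\<And>g v. g \<in> carrier G \<Longrightarrow> v \<in> vecs M \<Longrightarrow> T (act M g v) = act N g (T v)" using module_isoE[OF iso] by blast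
  define S where "S = inv_into (vecs M) T"
  have ST: "S (T v) = v" if "v \<in> vecs M" for v using T(1) that by (simp add: S_def bij_betw_def inv_into_f_f)
  have sur: "\<exists>v\<in>vecs M. w = T v" if "w \<in> vecs N" for w using T(1) that by (auto simp: bij_betw_def)
  show ?thesis
  proof (rule module_isoI[where T=S])
    show "bij_betw S (vecs N) (vecs M)" unfolding S_def by (rule bij_betw_inv_into[OF T(1)])
    show "clinear_on (vecs N) cscale S"
    proof (rule clinear_onI)
      fix u v assume "u \<in> vecs N" "v \<in> vecs N"
      then obtain u' v' where e: "u' \<in> vecs M" "u = T u'" "v' \<in> vecs M" "v = T v'" using sur by metis
      have "S (T (u' + v')) = u' + v'" by (rule ST[OF cfun.subspace_add[OF MD(1) e(1,3)]])
      then show "S (u + v) = S u + S v" by (simp only: e ST clinear_on_add[OF T(2)])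
    next
      fix c v assume "v \<in> vecs N"
      then obtain v' where e: "v' \<in> vecs M" "v = T v'" using sur by metis
      have "S (T (cscale c v')) = cscale c v'" by (rule ST[OF cfun.subspace_scale[OF MD(1) e(1)]])
      then show "S (cscale c v) = cscale c (S v)" by (simp only: e ST clinear_on_scale[OF T(2)])
    qed
    fix g v assume g: "g \<in> carrier G" and "v \<in> vecs N"
    then obtain v' where e: "v' \<in> vecs M" "v = T v'" using sur by metis
    have "S (T (act M g v')) = act M g v'" by (rule ST[OF MD(2)[OF g e(1)]])
    then show "S (act N g v) = act M g (S v)" by (simp only: e ST T(3)[OF g e(1)])
  qed
qed

lemma module_iso_sym: "is_gmodule G M \<Longrightarrow> module_iso G M N \<Longrightarrow> module_iso G N M"
  by (rule module_iso_sym_if_closed) (auto dest: is_gmoduleD)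

text \<open>The values at the interpolation points are coordinates; number the points.\<close>

lemma ex_nat_model:
  fixes M :: "('g, 'x) gmodule"
  assumes M: "is_gmodule G M" and fd: "finite_dim (vecs M)"
  shows "\<exists>K :: ('g, nat) gmodule. is_gmodule G K \<and> module_iso G M K"
proof -
  obtain X e where I: "interpolates X e (vecs M)" using ex_interpolation fd by blast
  note J = interpolatesD[OF I] and MD = is_gmoduleD[OF M]
  obtain \<beta> :: "'x \<Rightarrow> nat" where \<beta>: "inj_on \<beta> X" using finite_imp_inj_to_nat_seg[OF J(1)] by blast
  define T :: "('x \<Rightarrow> complex) \<Rightarrow> nat \<Rightarrow> complex"
    where "T = (\<lambda>f k. if k \<in> \<beta> ` X then f (inv_into X \<beta> k) else 0)"
  have lin: "clinear_on (vecs M) cscale T"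
    by (rule clinear_onI) (auto simp: T_def fun_eq_iff cscale_def)
  have inj: "inj_on T (vecs M)"
  proof (rule inj_onI)
    fix f g assume fg: "f \<in> vecs M" "g \<in> vecs M" "T f = T g"
    have "f x = g x" if "x \<in> X" for x
      using fun_cong[OF fg(3), of "\<beta> x"] that \<beta> by (simp add: T_def inv_into_f_f)
    then have "f z = g z" for z using J(4)[OF fg(1), of z] J(4)[OF fg(2), of z] by simp
    then show "f = g" by (rule ext)
  qed
  define S where "S = inv_into (vecs M) T"
  have ST: "S (T v) = v" if "v \<in> vecs M" for v using inj that by (simp add: S_def inv_into_f_f)
  define K :: "('g, nat) gmodule" where "K = \<lparr>vecs = T ` vecs M, act = (\<lambda>g v. T (act M g (S v)))\<rparr>"
  have "is_gmodule G K"
    unfolding is_gmodule_def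
  proof (intro conjI ballI)
    show "cfun.subspace (vecs K)" unfolding K_def by (simp add: clinear_on_image_subspace[OF lin MD(1)])
    fix g assume g: "g \<in> carrier G"
    show "act K g ` vecs K \<subseteq> vecs K" using MD(2)[OF g] by (auto simp: K_def ST)
    show "clinear_on (vecs K) cscale (act K g)"
    proof (rule clinear_onI)
      fix u v assume "u \<in> vecs K" "v \<in> vecs K"
      then obtain u' v' where e: "u' \<in> vecs M" "u = T u'" "v' \<in> vecs M" "v = T v'" by (auto simp: K_def)
      have "S (u + v) = u' + v'" unfolding e clinear_on_add[OF lin e(1,3), symmetric] by (rule ST[OF cfun.subspace_add[OF MD(1) e(1,3)]])
      then show "act K g (u + v) = act K g u + act K g v"
        by (simp add: K_def e ST clinear_on_add[OF MD(3)[OF g]] clinear_on_add[OF lin] MD(2)[OF g])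
    next
      fix c v assume "v \<in> vecs K"
      then obtain v' where e: "v' \<in> vecs M" "v = T v'" by (auto simp: K_def)
      have "S (cscale c v) = cscale c v'" unfolding e clinear_on_scale[OF lin e(1), symmetric] by (rule ST[OF cfun.subspace_scale[OF MD(1) e(1)]])
      then show "act K g (cscale c v) = cscale c (act K g v)"
        by (simp add: K_def e ST clinear_on_scale[OF MD(3)[OF g]] clinear_on_scale[OF lin] MD(2)[OF g])
    qed
  qed (auto simp: K_def ST MD)
  moreover have "module_iso G M K"
    by (rule module_isoI[where T=T]) (use inj lin in \<open>auto simp: K_def ST bij_betw_def\<close>)
  ultimately show ?thesis by blast
qed

lemma simple_module_transfer:
  assumes N: "is_gmodule G N" and iso: "module_iso G M N" and simple: "simple_module G M"
  shows "simple_module G N"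
proof -
  obtain T where T: "bij_betw T (vecs M) (vecs N)" "clinear_on (vecs M) cscale T"
    "\<And>g v. g \<in> carrier G \<Longrightarrow> v \<in> vecs M \<Longrightarrow> T (act M g v) = act N g (T v)" using module_isoE[OF iso] by blast
  have M: "is_gmodule G M" and nz: "vecs M \<noteq> {0}" and sm: "\<And>V. is_submodule G M V \<Longrightarrow> V = {0} \<or> V = vecs M"
    using simple by (auto simp: simple_module_def)
  note MD = is_gmoduleD[OF M] and ND = is_gmoduleD[OF N]
  have T0: "T 0 = 0" by (rule clinear_on_0[OF T(2) MD(1)])
  have im: "T ` vecs M = vecs N" and inj: "inj_on T (vecs M)" using T(1) by (auto simp: bij_betw_def)
  show ?thesis unfolding simple_module_def
  proof (intro conjI allI impI)
    show "vecs N \<noteq> {0}"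
    proof
      assume "vecs N = {0}"
      then have "T v = T 0" if "v \<in> vecs M" for v using im that unfolding T0 by blast
      then have "v = 0" if "v \<in> vecs M" for v using inj_onD[OF inj _ that cfun.subspace_0[OF MD(1)]] that by blast
      then have "vecs M = {0}" using cfun.subspace_0[OF MD(1)] by blast
      then show False using nz by blast
    qed
    fix V assume V: "is_submodule G N V"
    note VD = is_submoduleD[OF V]
    define U where "U = {f \<in> vecs M. T f \<in> V}"
    have "is_submodule G M U" unfolding is_submodule_def
    proof (intro conjI ballI)
      show "cfun.subspace U" unfolding U_def
        by (rule cfun.subspaceI)
          (simp_all add: T0 clinear_on_add[OF T(2)] clinear_on_scale[OF T(2)]
            cfun.subspace_0 cfun.subspace_add cfun.subspace_scale MD(1) VD(1))
    qed (auto simp: U_def MD(2) T(3) VD(3))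
    then have "U = {0} \<or> U = vecs M" by (rule sm)
    moreover have "V = T ` U" using VD(2) im by (auto simp: U_def)
    ultimately show "V = {0} \<or> V = vecs N" using T0 im by auto
  qed (rule N)
qed

lemma dual_pullback:
  assumes T: "clinear_on V cscale T" "\<And>v. v \<in> V \<Longrightarrow> T v \<in> W" and \<phi>: "\<phi> \<in> dual_vecs W" and V: "cfun.subspace V"
  shows "(\<lambda>v. if v \<in> V then \<phi> (T v) else 0) \<in> dual_vecs V"
proof -
  have \<phi>1: "clinear_on W (*) \<phi>" using \<phi> by (simp add: dual_vecs_def)
  have "clinear_on V (*) (\<lambda>v. if v \<in> V then \<phi> (T v) else 0)"
    by (rule clinear_onI)
      (simp_all add: cfun.subspace_add[OF V] cfun.subspace_scale[OF V] clinear_on_add[OF T(1)] clinear_on_scale[OF T(1)]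
        clinear_on_add[OF \<phi>1] clinear_on_scale[OF \<phi>1] T(2))
  then show ?thesis by (simp add: dual_vecs_def)
qed

lemma irreducible_compact_transfer:
  assumes N: "is_gmodule G N" and iso: "module_iso G M N" and irr: "irreducible_compact G M"
  shows "irreducible_compact G N"
proof -
  obtain T where T: "bij_betw T (vecs M) (vecs N)" "clinear_on (vecs M) cscale T"
    "\<And>g v. g \<in> carrier G \<Longrightarrow> v \<in> vecs M \<Longrightarrow> T (act M g v) = act N g (T v)" using module_isoE[OF iso] by blast
  have s: "simple_module G M" "finite_dim (vecs M)"
    "\<And>v \<phi>. v \<in> vecs M \<Longrightarrow> \<phi> \<in> dual_vecs (vecs M) \<Longrightarrow> continuous_on (carrier G) (\<lambda>g. \<phi> (act M g v))"
    using irr by (auto simp: irreducible_compact_def)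
  have M: "is_gmodule G M" using s(1) by (simp add: simple_module_def)
  note MD = is_gmoduleD[OF M]
  have im: "T ` vecs M = vecs N" using T(1) by (auto simp: bij_betw_def)
  show ?thesis unfolding irreducible_compact_def
  proof (intro conjI ballI)
    show "simple_module G N" by (rule simple_module_transfer[OF N iso s(1)])
    show "finite_dim (vecs N)" using finite_dim_image[OF T(2) s(2)] im by simp
    fix w \<phi> assume "w \<in> vecs N" and \<phi>: "\<phi> \<in> dual_vecs (vecs N)"
    then obtain v where v: "v \<in> vecs M" "w = T v" using im by blast
    have "continuous_on (carrier G) (\<lambda>g. if act M g v \<in> vecs M then \<phi> (T (act M g v)) else 0)"
      by (rule s(3)[OF v(1) dual_pullback[OF T(2) _ \<phi> MD(1)]]) (use im in blast)
    then show "continuous_on (carrier G) (\<lambda>g. \<phi> (act N g w))"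
      by (rule continuous_on_eq) (simp add: v MD(2) T(3))
  qed
qed

section \<open>The isotypic decomposition defined by a dense orthogonal family\<close>

locale unitary_module = inner_product_on "vecs M" ip
  for G :: "'g::topological_space monoid" and M :: "('g, 'x) gmodule" and ip +
  assumes G: "Group.group G" and M: "is_gmodule G M"
    and ip_act: "\<And>g f h. g \<in> carrier G \<Longrightarrow> f \<in> vecs M \<Longrightarrow> h \<in> vecs M \<Longrightarrow> ip (act M g f) (act M g h) = ip f h"
begin

lemmas MD = is_gmoduleD[OF M]

text \<open>The orthogonal projection is characterised by orthogonality alone, a condition that is linear and
  preserved by the unitary action.\<close>

lemma projection_hom:
  assumes V: "is_submodule G M V" and W: "is_submodule G M W" "finite_dim W"
  shows "\<exists>p. clinear_on V cscale p \<and> p ` V \<subseteq> W \<and> (\<forall>g\<in>carrier G. \<forall>v\<in>V. p (act M g v) = act M g (p v)) \<and>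
    (\<forall>v\<in>V. \<forall>w\<in>W. ip (v - p v) w = 0)"
proof -
  note VD = is_submoduleD[OF V] and WD = is_submoduleD[OF W(1)]
  have "\<forall>v\<in>V. \<exists>q\<in>W. \<forall>w\<in>W. ip (v - q) w = 0" using ex_projection[OF W(2) WD(2)] VD(2) by blast
  then obtain p where p: "\<And>v. v \<in> V \<Longrightarrow> p v \<in> W" "\<And>v w. v \<in> V \<Longrightarrow> w \<in> W \<Longrightarrow> ip (v - p v) w = 0" by metis
  have uniq: "p v = q" if "v \<in> V" "q \<in> W" "\<And>w. w \<in> W \<Longrightarrow> ip (v - q) w = 0" for v q
  proof -
    have d: "p v - q \<in> W" by (rule cfun.subspace_diff[OF WD(1) p(1)[OF that(1)] that(2)])
    have mem: "v - q \<in> vecs M" "v - p v \<in> vecs M" "p v - q \<in> vecs M"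
      using that p(1)[OF that(1)] VD(2) WD(2) d by (auto intro!: H_simps)
    have "ip ((v - q) - (v - p v)) (p v - q) = 0"
      unfolding ip_diff_left[OF mem] that(3)[OF d] p(2)[OF that(1) d] by simp
    moreover have "(v - q) - (v - p v) = p v - q" by simp
    ultimately have "p v - q = 0" using ip_definite[OF mem(3)] by (simp only:)
    then show ?thesis by simp
  qed
  have VM: "v \<in> vecs M" if "v \<in> V" for v using that VD(2) by blast
  have WM: "v \<in> vecs M" if "v \<in> W" for v using that WD(2) by blast
  have "clinear_on V cscale p"
  proof (rule clinear_onI)
    fix u v assume u: "u \<in> V" and v: "v \<in> V"
    show "p (u + v) = p u + p v"
    proof (rule uniq[OF cfun.subspace_add[OF VD(1) u v] cfun.subspace_add[OF WD(1) p(1)[OF u] p(1)[OF v]]])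
      fix w assume w: "w \<in> W"
      have e: "u + v - (p u + p v) = (u - p u) + (v - p v)" by simp
      show "ip (u + v - (p u + p v)) w = 0"
        unfolding e using ip_add_left[of "u - p u" "v - p v" w] p(2)[OF u w] p(2)[OF v w] VM u v WM p(1) w
        by (simp add: H_simps)
    qed
  next
    fix c v assume v: "v \<in> V"
    show "p (cscale c v) = cscale c (p v)"
    proof (rule uniq[OF cfun.subspace_scale[OF VD(1) v] cfun.subspace_scale[OF WD(1) p(1)[OF v]]])
      fix w assume w: "w \<in> W"
      have e: "cscale c v - cscale c (p v) = cscale c (v - p v)" by (simp add: fun_eq_iff cscale_apply algebra_simps)
      show "ip (cscale c v - cscale c (p v)) w = 0"
        unfolding e using ip_scale_left[of "v - p v" w c] p(2)[OF v w] VM v WM p(1) w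
        by (simp add: H_simps)
    qed
  qed
  moreover have "p (act M g v) = act M g (p v)" if g: "g \<in> carrier G" and v: "v \<in> V" for g v
  proof (rule uniq[OF VD(3)[OF g v] WD(3)[OF g p(1)[OF v]]])
    fix w assume w: "w \<in> W"
    have gi: "inv\<^bsub>G\<^esub> g \<in> carrier G" using G g by (simp add: group.inv_closed)
    define w' where "w' = act M (inv\<^bsub>G\<^esub> g) w"
    have w': "w' \<in> W" using WD(3)[OF gi w] by (simp add: w'_def)
    have gw: "w = act M g w'"
      using MD(5)[OF g gi WM[OF w]] MD(4)[OF WM[OF w]] group.r_inv[OF G g] by (simp add: w'_def)
    have d: "v - p v \<in> vecs M" using VM v WM p(1) by (simp add: H_simps)
    have "act M g (v - p v + p v) = act M g (v - p v) + act M g (p v)"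
      by (rule clinear_on_add[OF MD(3)[OF g] d WM[OF p(1)[OF v]]])
    then have "act M g v - act M g (p v) = act M g (v - p v)" by simp
    then show "ip (act M g v - act M g (p v)) w = 0"
      using ip_act[OF g d WM[OF w']] p(2)[OF v w'] gw by simp
  qed
  ultimately show ?thesis using p by blast
qed

end

text \<open>The kernel and the image of \<open>p\<close> are submodules.\<close>

lemma schur_iso:
  assumes A: "simple_module G A" and B: "simple_module G B" and p: "clinear_on (vecs A) cscale p" "p ` vecs A \<subseteq> vecs B"
    and eq: "\<And>g v. g \<in> carrier G \<Longrightarrow> v \<in> vecs A \<Longrightarrow> p (act A g v) = act B g (p v)"
    and v: "v \<in> vecs A" "p v \<noteq> 0"
  shows "module_iso G A B"
proof (rule module_isoI[OF _ p(1) eq])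
  have Ag: "is_gmodule G A" and Bg: "is_gmodule G B" using A B by (simp_all add: simple_module_def)
  note AD = is_gmoduleD[OF Ag]
  have "is_submodule G B (p ` vecs A)"
    unfolding is_submodule_def
  proof (intro conjI ballI)
    show "cfun.subspace (p ` vecs A)" by (rule clinear_on_image_subspace[OF p(1) AD(1)])
    fix g assume g: "g \<in> carrier G"
    show "act B g ` p ` vecs A \<subseteq> p ` vecs A" using eq[OF g, symmetric] AD(2)[OF g] by auto
  qed (rule p(2))
  then have "p ` vecs A = {0} \<or> p ` vecs A = vecs B" using B unfolding simple_module_def by blast
  moreover have "p ` vecs A \<noteq> {0}" using imageI[OF v(1), of p] v(2) by auto
  ultimately have "p ` vecs A = vecs B" by blast
  moreover have "inj_on p (vecs A)"
  proof (rule inj_onI)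
    have "is_submodule G A {u \<in> vecs A. p u = 0}"
      unfolding is_submodule_def
    proof (intro conjI ballI)
      show "cfun.subspace {u \<in> vecs A. p u = 0}"
        using clinear_on_vimage_subspace[OF p(1) AD(1), of "{0}"] by simp
      fix g assume g: "g \<in> carrier G"
      have "act B g 0 = 0" by (rule clinear_on_0[OF is_gmoduleD(3)[OF Bg g] is_gmoduleD(1)[OF Bg]])
      then show "act A g ` {u \<in> vecs A. p u = 0} \<subseteq> {u \<in> vecs A. p u = 0}" using eq[OF g] AD(2)[OF g] by auto
    qed auto
    then have k: "{u \<in> vecs A. p u = 0} = {0}" using A v unfolding simple_module_def by blast
    fix a b assume ab: "a \<in> vecs A" "b \<in> vecs A" "p a = p b"
    have d: "a - b \<in> vecs A" by (rule cfun.subspace_diff[OF AD(1) ab(1,2)])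
    have "p (a - b + b) = p (a - b) + p b" by (rule clinear_on_add[OF p(1) d ab(2)])
    then have "p (a - b) = 0" using ab(3) by simp
    then have "a - b = 0" using k d by blast
    then show "a = b" by simp
  qed
  ultimately show "bij_betw p (vecs A) (vecs B)" by (simp add: bij_betw_def)
qed

locale unitary_module_family = unitary_module G M ip
  for G :: "'g::topological_space monoid" and M :: "('g, 'x) gmodule" and ip +
  fixes I :: "'i set" and V :: "'i \<Rightarrow> ('x \<Rightarrow> complex) set"
  assumes sub: "\<And>i. i \<in> I \<Longrightarrow> is_submodule G M (V i)"
    and irr: "\<And>i. i \<in> I \<Longrightarrow> irreducible_compact G (M\<lparr>vecs := V i\<rparr>)"
    and orth: "\<And>i j f h. i \<in> I \<Longrightarrow> j \<in> I \<Longrightarrow> i \<noteq> j \<Longrightarrow> f \<in> V i \<Longrightarrow> h \<in> V j \<Longrightarrow> ip f h = 0"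
    and noniso: "\<And>i j. i \<in> I \<Longrightarrow> j \<in> I \<Longrightarrow> module_iso G (M\<lparr>vecs := V i\<rparr>) (M\<lparr>vecs := V j\<rparr>) \<Longrightarrow> i = j"
    and dense: "hilbert_closure (vecs M) ip (cfun.span (\<Union>i\<in>I. V i)) = vecs M"
begin

lemma V_sub: "i \<in> I \<Longrightarrow> cfun.subspace (V i)" "i \<in> I \<Longrightarrow> V i \<subseteq> vecs M"
  using is_submoduleD[OF sub] by blast+

lemma V_simple: "i \<in> I \<Longrightarrow> simple_module G (M\<lparr>vecs := V i\<rparr>)"
  using irr by (simp add: irreducible_compact_def)

lemma V_finite_dim: "i \<in> I \<Longrightarrow> finite_dim (V i)"
  using irr[of i] by (simp add: irreducible_compact_def)

lemma V_nonzero: "i \<in> I \<Longrightarrow> V i \<noteq> {0}"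
  using V_simple[of i] by (simp add: simple_module_def)

lemma V_closed: "i \<in> I \<Longrightarrow> hilbert_closure (vecs M) ip (V i) = V i"
  by (rule hilbert_closure_finite_dim[OF V_finite_dim V_sub(2)])

lemma hilbert_sum: "hilbert_direct_sum (vecs M) ip I V"
  unfolding hilbert_direct_sum_def using V_sub V_closed orth dense by blast

lemma orthogonal_to_family:
  assumes v: "v \<in> vecs M" and o: "\<And>i w. i \<in> I \<Longrightarrow> w \<in> V i \<Longrightarrow> ip v w = 0"
  shows "v = 0"
proof (rule orthogonal_closure_imp_0)
  show "v \<in> hilbert_closure (vecs M) ip (cfun.span (\<Union>i\<in>I. V i))" using v dense by simp
  show "cfun.span (\<Union>i\<in>I. V i) \<subseteq> vecs M" using V_sub(2) by (intro cfun.span_minimal[OF _ H]) blast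
  show "ip v g = 0" if "g \<in> cfun.span (\<Union>i\<in>I. V i)" for g
    by (rule orthogonal_span[OF v _ _ that]) (use V_sub(2) o in auto)
qed

text \<open>The projections of \<open>W\<close> to the members of the family are homomorphisms. At least one is nonzero by density,
  and at most one, because a nonzero one is an isomorphism and the members are pairwise non-isomorphic. A vector
  minus its projection to that member is then orthogonal to the whole family, hence zero.\<close>

lemma simple_submodule_in_family:
  assumes W: "is_submodule G M W" "simple_module G (M\<lparr>vecs := W\<rparr>)"
  shows "\<exists>i\<in>I. W = V i"
proof -
  note WD = is_submoduleD[OF W(1)]
  have Wg: "is_gmodule G (M\<lparr>vecs := W\<rparr>)" by (rule submodule_gmodule[OF M W(1)])
  have Wnz: "W \<noteq> {0}" using W(2) by (simp add: simple_module_def)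
  have "\<forall>i\<in>I. \<exists>p. clinear_on W cscale p \<and> p ` W \<subseteq> V i \<and> (\<forall>g\<in>carrier G. \<forall>v\<in>W. p (act M g v) = act M g (p v)) \<and>
    (\<forall>v\<in>W. \<forall>w\<in>V i. ip (v - p v) w = 0)"
    using projection_hom[OF W(1) sub V_finite_dim] by blast
  from bchoice[OF this] obtain p where p': "\<forall>i\<in>I. clinear_on W cscale (p i) \<and> p i ` W \<subseteq> V i \<and>
    (\<forall>g\<in>carrier G. \<forall>v\<in>W. p i (act M g v) = act M g (p i v)) \<and> (\<forall>v\<in>W. \<forall>w\<in>V i. ip (v - p i v) w = 0)" ..
  have p: "\<And>i. i \<in> I \<Longrightarrow> clinear_on W cscale (p i)" "\<And>i v. i \<in> I \<Longrightarrow> v \<in> W \<Longrightarrow> p i v \<in> V i"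
    "\<And>i g v. i \<in> I \<Longrightarrow> g \<in> carrier G \<Longrightarrow> v \<in> W \<Longrightarrow> p i (act M g v) = act M g (p i v)"
    "\<And>i v w. i \<in> I \<Longrightarrow> v \<in> W \<Longrightarrow> w \<in> V i \<Longrightarrow> ip (v - p i v) w = 0"
    using p' by blast+
  have iso: "module_iso G (M\<lparr>vecs := W\<rparr>) (M\<lparr>vecs := V i\<rparr>)" if i: "i \<in> I" and v: "v \<in> W" "p i v \<noteq> 0" for i v
    by (rule schur_iso[OF W(2) V_simple[OF i], of "p i" v]) (use p(1-3)[OF i] v in auto)
  obtain u where u: "u \<in> W" "u \<noteq> 0" using Wnz cfun.subspace_0[OF WD(1)] by blast
  have "\<exists>i\<in>I. p i u \<noteq> 0"
  proof (rule ccontr)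
    assume "\<not> (\<exists>i\<in>I. p i u \<noteq> 0)"
    then have "ip u w = 0" if "i \<in> I" "w \<in> V i" for i w using p(4)[OF that(1) u(1) that(2)] that(1) by simp
    then have "u = 0" using orthogonal_to_family[of u] u(1) WD(2) by blast
    then show False using u(2) by blast
  qed
  then obtain i where i: "i \<in> I" "p i u \<noteq> 0" by blast
  have other: "p j v = 0" if "j \<in> I" "j \<noteq> i" "v \<in> W" for j v
  proof (rule ccontr)
    assume "p j v \<noteq> 0"
    then have "module_iso G (M\<lparr>vecs := W\<rparr>) (M\<lparr>vecs := V j\<rparr>)" using iso that by blast
    then have "module_iso G (M\<lparr>vecs := V i\<rparr>) (M\<lparr>vecs := V j\<rparr>)"
      using module_iso_trans module_iso_sym[OF Wg iso[OF i(1) u(1) i(2)]] by blast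
    then show False using noniso i(1) that(1,2) by blast
  qed
  have "W \<subseteq> V i"
  proof
    fix v assume v: "v \<in> W"
    have vM: "v \<in> vecs M" and pM: "p i v \<in> vecs M" using v WD(2) p(2)[OF i(1) v] V_sub(2)[OF i(1)] by blast+
    have "v - p i v = 0"
    proof (rule orthogonal_to_family)
      show "v - p i v \<in> vecs M" using vM pM by (simp add: H_simps)
      fix j w assume j: "j \<in> I" and w: "w \<in> V j"
      show "ip (v - p i v) w = 0"
      proof (cases "j = i")
        case True then show ?thesis using p(4)[OF i(1) v] w by simp
      next
        case False
        have wM: "w \<in> vecs M" using w V_sub(2)[OF j] by blast
        have "ip v w = 0" using p(4)[OF j v w] other[OF j False v] by simp
        moreover have "ip (p i v) w = 0" by (rule orth[OF i(1) j _ p(2)[OF i(1) v] w]) (use False in blast)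
        ultimately show ?thesis by (simp add: ip_diff_left vM pM wM)
      qed
    qed
    then show "v \<in> V i" using p(2)[OF i(1) v] by simp
  qed
  then have "is_submodule G (M\<lparr>vecs := V i\<rparr>) W" using W(1) by (simp add: is_submodule_def)
  then have "W = V i" using V_simple[OF i(1)] Wnz unfolding simple_module_def by auto
  then show ?thesis using i(1) by blast
qed

text \<open>The only submodule in the class of \<open>V i\<close> is \<open>V i\<close> itself, and it is closed.\<close>

lemma isotypic_component_eq:
  fixes K :: "('g, 'y) gmodule"
  assumes i: "i \<in> I" and K: "module_iso G (M\<lparr>vecs := V i\<rparr>) K"
  shows "isotypic_component G M ip K = V i"
proof -
  have "W = V i" if W: "is_submodule G M W" "module_iso G (M\<lparr>vecs := W\<rparr>) K" for W
  proof -
    have Wg: "is_gmodule G (M\<lparr>vecs := W\<rparr>)" by (rule submodule_gmodule[OF M W(1)])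
    have VW: "module_iso G (M\<lparr>vecs := V i\<rparr>) (M\<lparr>vecs := W\<rparr>)"
      by (rule module_iso_trans[OF K module_iso_sym[OF Wg W(2)]])
    obtain j where j: "j \<in> I" "W = V j"
      using simple_submodule_in_family[OF W(1) simple_module_transfer[OF Wg VW V_simple[OF i]]] by blast
    then show ?thesis using noniso[OF i j(1)] VW by simp
  qed
  then have "{W. is_submodule G M W \<and> module_iso G (M\<lparr>vecs := W\<rparr>) K} = {V i}" using sub[OF i] K by blast
  then show ?thesis
    unfolding isotypic_component_def using V_sub(1)[OF i] V_closed[OF i] by (simp add: cfun.span_eq_iff[THEN iffD2])
qed

lemma isotypic_component_cases:
  assumes X: "X \<in> isotypic_components G M ip" shows "X = {0} \<or> X \<in> V ` I"
proof -
  obtain K :: "('g, nat) gmodule" where K: "irreducible_compact G K" "X = isotypic_component G M ip K"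
    using X by (auto simp: isotypic_components_def)
  show ?thesis
  proof (cases "\<exists>W. is_submodule G M W \<and> module_iso G (M\<lparr>vecs := W\<rparr>) K")
    case True
    then obtain W where W: "is_submodule G M W" "module_iso G (M\<lparr>vecs := W\<rparr>) K" by blast
    have Wg: "is_gmodule G (M\<lparr>vecs := W\<rparr>)" by (rule submodule_gmodule[OF M W(1)])
    have "simple_module G (M\<lparr>vecs := W\<rparr>)"
      by (rule simple_module_transfer[OF Wg module_iso_sym[OF Wg W(2)]]) (use K(1) in \<open>simp add: irreducible_compact_def\<close>)
    then obtain i where i: "i \<in> I" "W = V i" using simple_submodule_in_family[OF W(1)] by blast
    then have "X = V i" using isotypic_component_eq[OF i(1)] W(2) K(2) by simp
    then show ?thesis using i(1) by blast
  next
    case False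
    then have "{W. is_submodule G M W \<and> module_iso G (M\<lparr>vecs := W\<rparr>) K} = {}" by blast
    then have "X = hilbert_closure (vecs M) ip {0}" unfolding K(2) isotypic_component_def by (simp only: Union_empty cfun.span_empty)
    also have "\<dots> = {0}"
      by (rule hilbert_closure_finite_dim)
        (auto simp: finite_dim_def H_simps intro: exI[of _ "{}"])
    finally show ?thesis by blast
  qed
qed

lemma isotypic_decomposition: "is_isotypic_decomposition G M ip I V"
proof -
  have "inj_on V I"
  proof (rule inj_onI, rule ccontr)
    fix i j assume ij: "i \<in> I" "j \<in> I" "V i = V j" "i \<noteq> j"
    have "f = 0" if "f \<in> V i" for f
      using orth[OF ij(1,2,4) that] that ij(3) V_sub(2)[OF ij(1)] ip_definite by blast
    then have "V i = {0}" using cfun.subspace_0[OF V_sub(1)[OF ij(1)]] by blast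
    then show False using V_nonzero ij(1) by blast
  qed
  moreover have "V i \<in> isotypic_components G M ip" if i: "i \<in> I" for i
  proof -
    have Vg: "is_gmodule G (M\<lparr>vecs := V i\<rparr>)" by (rule submodule_gmodule[OF M sub[OF i]])
    obtain K :: "('g, nat) gmodule" where K: "is_gmodule G K" "module_iso G (M\<lparr>vecs := V i\<rparr>) K"
      using ex_nat_model[OF Vg] V_finite_dim[OF i] by auto
    show ?thesis
      unfolding isotypic_components_def
      by (rule CollectI, rule exI[of _ K])
        (rule conjI[OF isotypic_component_eq[OF i K(2), symmetric] irreducible_compact_transfer[OF K irr[OF i]]])
  qed
  then have "V ` I = isotypic_components G M ip - {{0}}"
  proof (intro equalityI subsetI)
    fix X assume mem: "\<And>i. i \<in> I \<Longrightarrow> V i \<in> isotypic_components G M ip" and "X \<in> V ` I"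
    then obtain i where i: "i \<in> I" "X = V i" by blast
    then show "X \<in> isotypic_components G M ip - {{0}}" using mem[OF i(1)] V_nonzero[OF i(1)] by simp
  qed (use isotypic_component_cases in auto)
  ultimately show ?thesis
    unfolding is_isotypic_decomposition_def using hilbert_sum by (simp add: bij_betw_def)
qed

lemma multiplicity_free: "multiplicity_free G M ip"
  unfolding multiplicity_free_def using isotypic_component_cases irr by blast

end

section \<open>Rational modules with a given highest weight\<close>

lemma GL_simps: "carrier GL = {A. invertible A}" "mult GL = (**)" "one GL = mat 1"
  by (simp_all add: GL_def)

lemma GL_group: "Group.group (GL :: 'n::finite cmat monoid)"
proof (rule groupI)
  fix x :: "'n cmat" assume "x \<in> carrier GL"
  then show "\<exists>y\<in>carrier GL. y \<otimes>\<^bsub>GL\<^esub> x = \<one>\<^bsub>GL\<^esub>"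
    using invertible_matrix_inv[of x] matrix_inv_props[of x] by (intro bexI[of _ "matrix_inv x"]) (auto simp: GL_simps)
qed (auto simp: GL_simps invertible_mult matrix_mul_assoc invertible_det_nz det_mul)

lemma inv_GL: "invertible A \<Longrightarrow> inv\<^bsub>GL\<^esub> A = matrix_inv A"
  by (rule group.inv_equality[OF GL_group]) (auto simp: GL_simps matrix_inv_props invertible_matrix_inv)

text \<open>Regular functions on the group, with arbitrary values at singular matrices.\<close>

definition regular_functions :: "('n::finite cmat \<Rightarrow> complex) set" where
  "regular_functions = {f. \<exists>p\<in>polynomials. \<exists>k. \<forall>A. invertible A \<longrightarrow> f A = p A / det A ^ k}"

lemma regular_functionsI:
  "p \<in> polynomials \<Longrightarrow> (\<And>A. invertible A \<Longrightarrow> f A = p A / det A ^ k) \<Longrightarrow> f \<in> regular_functions"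
  unfolding regular_functions_def by blast

lemma det_polynomial: "det \<in> (polynomials :: ('n::finite cmat \<Rightarrow> complex) set)"
  by (rule polynomials_det[where T="\<lambda>x. x"]) (rule polynomials_entry)

lemma regular_polynomial: "p \<in> polynomials \<Longrightarrow> p \<in> regular_functions"
  unfolding regular_functions_def by (auto intro!: bexI[of _ p] exI[of _ 0])

lemma regular_add:
  assumes "f \<in> regular_functions" "g \<in> regular_functions"
  shows "(\<lambda>A. f A + g A) \<in> (regular_functions :: ('n::finite cmat \<Rightarrow> complex) set)"
proof -
  obtain p k q l where p: "p \<in> polynomials" "\<And>A. invertible A \<Longrightarrow> f A = p A / det A ^ k"
    and q: "q \<in> polynomials" "\<And>A. invertible A \<Longrightarrow> g A = q A / det A ^ l"
    using assms unfolding regular_functions_def by blast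
  have 1: "f A + g A = (p A * det A ^ l + q A * det A ^ k) / det A ^ (k + l)" if "invertible A" for A
    using that p(2)[OF that] q(2)[OF that] by (simp add: invertible_det_nz power_add field_simps)
  have 2: "(\<lambda>A. p A * det A ^ l + q A * det A ^ k) \<in> polynomials"
    by (intro polynomials_add polynomials_mult polynomials_power det_polynomial p q)
  show ?thesis by (rule regular_functionsI[OF 2 1])
qed

lemma regular_scale:
  assumes "f \<in> regular_functions"
  shows "(\<lambda>A. c * f A) \<in> (regular_functions :: ('n::finite cmat \<Rightarrow> complex) set)"
proof -
  obtain p k where p: "p \<in> polynomials" "\<And>A. invertible A \<Longrightarrow> f A = p A / det A ^ k"
    using assms unfolding regular_functions_def by blast
  then have "\<And>A. invertible A \<Longrightarrow> c * f A = (c * p A) / det A ^ k" by simp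
  then show ?thesis by (rule regular_functionsI[OF polynomials_scale[OF p(1), of c]])
qed

lemma regular_sum:
  "(\<And>i. i \<in> I \<Longrightarrow> f i \<in> regular_functions) \<Longrightarrow> (\<lambda>A. \<Sum>i\<in>I. f i A) \<in> (regular_functions :: ('n::finite cmat \<Rightarrow> complex) set)"
  by (induction I rule: infinite_finite_induct)
    (auto intro!: regular_add intro: regular_polynomial[OF polynomials_const])

lemma regular_diff:
  assumes "f \<in> regular_functions" "g \<in> regular_functions"
  shows "(\<lambda>A. f A - g A) \<in> (regular_functions :: ('n::finite cmat \<Rightarrow> complex) set)"
  using regular_add[OF assms(1) regular_scale[OF assms(2), of "-1"]] by simp

lemma regular_eq_0:
  assumes f: "f \<in> regular_functions" and z: "\<And>A. big_cell A \<Longrightarrow> f A = 0" and A: "invertible A"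
  shows "f A = 0"
proof -
  obtain p k where p: "p \<in> polynomials" "\<And>A. invertible A \<Longrightarrow> f A = p A / det A ^ k"
    using f unfolding regular_functions_def by blast
  have "p B = 0" if "big_cell B" for B
    using p(2)[of B] z[OF that] big_cell_invertible[OF that] by (simp add: invertible_det_nz)
  then have "p A = 0" by (rule polynomial_eq_0_if_eq_0_on_big_cell[OF p(1)])
  then show ?thesis using p(2)[OF A] by simp
qed

text \<open>Nothing is assumed about how \<open>W\<close> is constructed, so that the results apply to a module that is only known to
  exist by a choice.\<close>

locale hw_module =
  fixes \<mu> :: "'n::{finite,wellorder} \<Rightarrow> int" and W :: "('n cmat, 'x) gmodule"
  assumes \<mu>: "\<mu> \<in> dominant_weights" and rat: "rational_module W" and simple: "simple_module GL W"
    and hw: "has_highest_weight \<mu> W"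
begin

abbreviation "S \<equiv> vecs W"
abbreviation "\<rho> \<equiv> act W"
abbreviation "F \<equiv> hwf \<mu>"

lemma W: "is_gmodule GL W" using rat by (simp add: rational_module_def)
lemma fdS: "finite_dim S" using rat by (simp add: rational_module_def)
lemma sS: "cfun.subspace S" using is_gmoduleD(1)[OF W] .
lemma \<rho>_mem: "invertible A \<Longrightarrow> v \<in> S \<Longrightarrow> \<rho> A v \<in> S" using is_gmoduleD(2)[OF W] by (simp add: GL_simps)
lemma \<rho>_lin: "invertible A \<Longrightarrow> clinear_on S cscale (\<rho> A)" using is_gmoduleD(3)[OF W] by (simp add: GL_simps)
lemma \<rho>_1: "v \<in> S \<Longrightarrow> \<rho> (mat 1) v = v" using is_gmoduleD(4)[OF W] by (simp add: GL_simps)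
lemma \<rho>_mult: "invertible A \<Longrightarrow> invertible B \<Longrightarrow> v \<in> S \<Longrightarrow> \<rho> A (\<rho> B v) = \<rho> (A ** B) v"
  using is_gmoduleD(5)[OF W] by (simp add: GL_simps)

lemma submodule_cases:
  assumes "cfun.subspace V" "V \<subseteq> S" "\<And>A v. invertible A \<Longrightarrow> v \<in> V \<Longrightarrow> \<rho> A v \<in> V"
  shows "V = {0} \<or> V = S"
proof -
  have "is_submodule GL W V" unfolding is_submodule_def using assms by (auto simp: GL_simps)
  then show ?thesis using simple unfolding simple_module_def by blast
qed

definition v0 :: "'x \<Rightarrow> complex" where
  "v0 = (SOME v. v \<in> S \<and> v \<noteq> 0 \<and> (\<forall>t. (\<forall>i. t i \<noteq> 0) \<longrightarrow> \<rho> (diag_mat t) v = cscale (\<Prod>i\<in>UNIV. t i powi \<mu> i) v) \<and>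
        (\<forall>U. upper_unitriangular U \<longrightarrow> \<rho> U v = v))"

lemma v0: "v0 \<in> S" "v0 \<noteq> 0" "\<And>t. (\<And>i. t i \<noteq> 0) \<Longrightarrow> \<rho> (diag_mat t) v0 = cscale (torus_char \<mu> t) v0"
  "\<And>U. upper_unitriangular U \<Longrightarrow> \<rho> U v0 = v0"
proof -
  have "\<exists>v. v \<in> S \<and> v \<noteq> 0 \<and> (\<forall>t. (\<forall>i. t i \<noteq> 0) \<longrightarrow> \<rho> (diag_mat t) v = cscale (\<Prod>i\<in>UNIV. t i powi \<mu> i) v) \<and>
        (\<forall>U. upper_unitriangular U \<longrightarrow> \<rho> U v = v)"
    using hw unfolding has_highest_weight_def by blast
  from someI_ex[OF this, folded v0_def]
  show "v0 \<in> S" "v0 \<noteq> 0" "\<And>t. (\<And>i. t i \<noteq> 0) \<Longrightarrow> \<rho> (diag_mat t) v0 = cscale (torus_char \<mu> t) v0"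
    "\<And>U. upper_unitriangular U \<Longrightarrow> \<rho> U v0 = v0" unfolding torus_char_def by blast+
qed

text \<open>Functionals are extended by zero outside the module, as the definition of the dual requires.\<close>

lemma evaluation_dual: "(\<lambda>u. if u \<in> S then u x else 0) \<in> dual_vecs S"
proof -
  have "clinear_on S (*) (\<lambda>u. if u \<in> S then u x else 0)"
    by (rule clinear_onI) (simp_all add: cfun.subspace_add[OF sS] cfun.subspace_scale[OF sS] cscale_apply)
  then show ?thesis by (simp add: dual_vecs_def)
qed

lemma coefficient_regular: 
  assumes v: "v \<in> S" shows "(\<lambda>A. \<rho> A v x) \<in> regular_functions"
proof -
  obtain p k where p: "p \<in> polynomials" 
    "\<And>A. A \<in> carrier GL \<Longrightarrow> (if \<rho> A v \<in> S then \<rho> A v x else 0) = p A / det A ^ k"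
  proof -
    have "\<forall>v\<in>S. \<forall>\<phi>\<in>dual_vecs S. \<exists>p\<in>polynomials. \<exists>k::nat. \<forall>A\<in>carrier GL. \<phi> (\<rho> A v) = p A / det A ^ k"
      using rat unfolding rational_module_def by blast
    from bspec[OF bspec[OF this v] evaluation_dual[of x]] show ?thesis using that by blast
  qed
  have "\<rho> A v x = p A / det A ^ k" if "invertible A" for A
    using p(2)[of A] \<rho>_mem[OF that v] that by (simp add: GL_simps)
  then show ?thesis by (rule regular_functionsI[OF p(1)])
qed

text \<open>The big cell is dense: membership of \<open>\<rho> A v0\<close> in a subspace is a regular identity in \<open>A\<close>. The span is
  therefore invariant under the group and equal to \<open>S\<close> by simplicity.\<close>

lemma orbit_spans: "cfun.span {\<rho> A v0 | A. big_cell A} = S"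
proof -
  define V where "V = cfun.span {\<rho> A v0 | A. big_cell A}"
  have sV: "cfun.subspace V" by (simp add: V_def)
  have VS: "V \<subseteq> S" unfolding V_def
    by (rule cfun.span_minimal[OF _ sS]) (use \<rho>_mem v0(1) big_cell_invertible in blast)
  obtain X e where I: "interpolates X e V" using ex_interpolation finite_dim_subspace[OF fdS sV VS] by blast
  have all: "\<rho> A v0 \<in> V" if A: "invertible A" for A
  proof (rule interpolation_mem[OF I sV])
    fix z
    have "\<rho> A v0 z - (\<Sum>x\<in>X. e x z * \<rho> A v0 x) = 0"
    proof (rule regular_eq_0[OF _ _ A, where f="\<lambda>A. \<rho> A v0 z - (\<Sum>x\<in>X. e x z * \<rho> A v0 x)"])
      show "(\<lambda>A. \<rho> A v0 z - (\<Sum>x\<in>X. e x z * \<rho> A v0 x)) \<in> regular_functions"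
        by (intro regular_diff regular_sum regular_scale coefficient_regular v0(1))
      fix B :: "'n cmat" assume "big_cell B"
      then have "\<rho> B v0 \<in> V" unfolding V_def by (intro cfun.span_base) blast
      then show "\<rho> B v0 z - (\<Sum>x\<in>X. e x z * \<rho> B v0 x) = 0"
        using interpolatesD(4)[OF I, of "\<rho> B v0" z] by (simp add: mult.commute)
    qed
    then show "\<rho> A v0 z = (\<Sum>x\<in>X. \<rho> A v0 x * e x z)" by (simp add: mult.commute)
  qed
  have st: "\<rho> A v \<in> V" if A: "invertible A" and v: "v \<in> V" for A v
  proof -
    have "V \<subseteq> {f \<in> S. \<rho> A f \<in> V}"
      unfolding V_def
    proof (rule cfun.span_minimal)
      show "cfun.subspace {f \<in> S. \<rho> A f \<in> cfun.span {\<rho> A v0 |A. big_cell A}}"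
        by (rule clinear_on_vimage_subspace[OF \<rho>_lin[OF A] sS]) simp
      show "{\<rho> A v0 |A. big_cell A} \<subseteq> {f \<in> S. \<rho> A f \<in> cfun.span {\<rho> A v0 |A. big_cell A}}"
      proof clarify
        fix B :: "'n cmat" assume "big_cell B"
        then have B: "invertible B" by (rule big_cell_invertible)
        have "\<rho> (A ** B) v0 \<in> V" by (rule all[OF invertible_mult[OF A B]])
        then show "\<rho> B v0 \<in> S \<and> \<rho> A (\<rho> B v0) \<in> cfun.span {\<rho> A v0 |A. big_cell A}"
          using \<rho>_mem[OF B v0(1)] \<rho>_mult[OF A B v0(1)] by (simp add: V_def)
      qed
    qed
    then show ?thesis using v by blast
  qed
  have "v0 \<in> V" using all[of "mat 1"] \<rho>_1[OF v0(1)] by (simp add: invertible_det_nz)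
  then have "V \<noteq> {0}" using v0(2) by blast
  then have "V = S" using submodule_cases[OF sV VS st] by blast
  then show ?thesis by (simp add: V_def)
qed

text \<open>Exponents that decrease strictly along the index order.\<close>

definition d :: "'n \<Rightarrow> nat" where "d i = card {j. i < j}"

lemma d_less: "i < j \<Longrightarrow> d j < d i"
  unfolding d_def by (intro psubset_card_mono) auto

definition \<tau> :: "complex \<Rightarrow> 'n cmat" where "\<tau> r = diag_mat (\<lambda>i. (1 / r) ^ d i)"
definition \<kappa> :: "complex \<Rightarrow> complex" where "\<kappa> r = torus_char \<mu> (\<lambda>i. (1 / r) ^ d i)"
text \<open>The action of the one-parameter subgroup \<open>\<tau>\<close> of the torus, normalised by its weight \<open>\<kappa>\<close> on \<open>v0\<close>. All
  weights of \<open>W\<close> other than \<open>\<mu>\<close> are lower, so \<open>E r\<close> tends to the projection to the line of \<open>v0\<close> as \<open>r\<close> tends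
  to \<open>0\<close>.\<close>

definition E :: "complex \<Rightarrow> ('x \<Rightarrow> complex) \<Rightarrow> 'x \<Rightarrow> complex" where "E r v = cscale (1 / \<kappa> r) (\<rho> (\<tau> r) v)"

lemma \<tau>_inv: "r \<noteq> 0 \<Longrightarrow> invertible (\<tau> r)" unfolding \<tau>_def by (rule invertible_diag_mat) simp
lemma \<kappa>_nz: "r \<noteq> 0 \<Longrightarrow> \<kappa> r \<noteq> 0" unfolding \<kappa>_def by (rule torus_char_nonzero) simp

lemma E_mem: "r \<noteq> 0 \<Longrightarrow> v \<in> S \<Longrightarrow> E r v \<in> S"
  unfolding E_def by (intro cfun.subspace_scale[OF sS] \<rho>_mem \<tau>_inv)

lemma E_add: "r \<noteq> 0 \<Longrightarrow> u \<in> S \<Longrightarrow> v \<in> S \<Longrightarrow> E r (u + v) = E r u + E r v"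
  unfolding E_def clinear_on_add[OF \<rho>_lin[OF \<tau>_inv]] by (simp add: cfun.scale_right_distrib)

lemma E_scale: "r \<noteq> 0 \<Longrightarrow> v \<in> S \<Longrightarrow> E r (cscale c v) = cscale c (E r v)"
  unfolding E_def clinear_on_scale[OF \<rho>_lin[OF \<tau>_inv]] by (simp add: mult.commute)

lemma F_props: "hw_function \<mu> F" "F (mat 1) = 1" by (rule hwf[OF \<mu>])+

text \<open>On the big cell \<open>A v0\<close> is \<open>F A\<close> times \<open>L v0\<close>, and conjugation by \<open>\<tau> r\<close> contracts \<open>L\<close> to the identity. The
  limit exists since matrix coefficients are polynomial on unipotent matrices.\<close>

lemma E_orbit_tendsto:
  assumes A: "big_cell A" shows "((\<lambda>r. E r (\<rho> A v0) x) \<longlongrightarrow> F A * v0 x) (at 0)"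
proof -
  obtain U L a where c: "upper_unitriangular U" "lower_unitriangular L" "\<And>i. a i \<noteq> 0" "A ** U = L ** diag_mat a"
    using A unfolding big_cell_def by blast
  note iA = big_cell_invertible[OF A] and iU = invertible_upper_unitriangular[OF c(1)]
    and iL = invertible_lower_unitriangular[OF c(2)] and ia = invertible_diag_mat[of a, OF c(3)]
  define Ls :: "complex \<Rightarrow> 'n cmat"
    where "Ls = (\<lambda>r. \<chi> i j. if i = j then 1 else if j < i then r ^ (d j - d i) * L $ i $ j else 0)"
  have Lsu: "lower_unitriangular (Ls r)" for r by (auto simp: Ls_def lower_unitriangular_def)
  note iLs = invertible_lower_unitriangular[OF Lsu]
  have dn: "\<not> d j \<le> d i" if "j < i" for i j using d_less[OF that] by simp
  have Ls0: "Ls 0 = mat 1" by (auto simp: Ls_def vec_eq_iff mat_def power_0_left dn)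
  have FA: "F A = torus_char \<mu> a" using hw_function_big_cell[OF F_props(1) c] F_props(2) by simp
  have "E r (\<rho> A v0) = cscale (F A) (\<rho> (Ls r) v0)" if r: "r \<noteq> 0" for r
  proof -
    note i\<tau> = \<tau>_inv[OF r]
    have com: "\<tau> r ** L = Ls r ** \<tau> r"
    proof -
      have "(1 / r) ^ d i * L $ i $ j = Ls r $ i $ j * (1 / r) ^ d j" for i j
      proof (cases "j < i")
        case True
        have "r ^ (d j - d i) * (1 / r) ^ d j = (1 / r) ^ d i"
          using r d_less[OF True] by (simp add: power_one_over power_diff field_simps)
        then have "r ^ (d j - d i) * L $ i $ j * (1 / r) ^ d j = (1 / r) ^ d i * L $ i $ j"
          by (metis mult.commute mult.left_commute)
        then show ?thesis using True by (auto simp: Ls_def)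
      next
        case False
        then show ?thesis using c(2) by (cases "i = j") (auto simp: Ls_def lower_unitriangular_def)
      qed
      then show ?thesis by (simp add: vec_eq_iff \<tau>_def)
    qed
    have "\<rho> A v0 = \<rho> (A ** U) v0" using \<rho>_mult[OF iA iU v0(1)] v0(4)[OF c(1)] by simp
    also have "\<dots> = \<rho> L (\<rho> (diag_mat a) v0)" unfolding c(4) using \<rho>_mult[OF iL ia v0(1)] by simp
    also have "\<dots> = cscale (F A) (\<rho> L v0)"
      unfolding v0(3)[OF c(3)] clinear_on_scale[OF \<rho>_lin[OF iL] v0(1)] FA ..
    finally have 1: "\<rho> A v0 = cscale (F A) (\<rho> L v0)" .
    have "\<rho> (\<tau> r) (\<rho> L v0) = \<rho> (Ls r) (\<rho> (\<tau> r) v0)"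
      by (simp add: \<rho>_mult[OF i\<tau> iL v0(1)] \<rho>_mult[OF iLs i\<tau> v0(1)] com)
    also have "\<rho> (\<tau> r) v0 = cscale (\<kappa> r) v0" unfolding \<tau>_def \<kappa>_def by (rule v0(3)) (use r in simp)
    also have "\<rho> (Ls r) (cscale (\<kappa> r) v0) = cscale (\<kappa> r) (\<rho> (Ls r) v0)"
      by (rule clinear_on_scale[OF \<rho>_lin[OF iLs] v0(1)])
    finally have 2: "\<rho> (\<tau> r) (\<rho> L v0) = cscale (\<kappa> r) (\<rho> (Ls r) v0)" .
    have "E r (\<rho> A v0) = cscale (F A) (E r (\<rho> L v0))"
      unfolding 1 by (rule E_scale[OF r \<rho>_mem[OF iL v0(1)]])
    also have "E r (\<rho> L v0) = \<rho> (Ls r) v0"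
      unfolding E_def 2 using \<kappa>_nz[OF r] by simp
    finally show ?thesis .
  qed
  then have ev: "\<forall>\<^sub>F r in at 0. F A * \<rho> (Ls r) v0 x = E r (\<rho> A v0) x"
    by (auto simp: eventually_at_filter cscale_apply)
  obtain p k where p: "p \<in> polynomials" "\<And>A. invertible A \<Longrightarrow> \<rho> A v0 x = p A / det A ^ k"
    using coefficient_regular[OF v0(1), of x] unfolding regular_functions_def by blast
  have pe: "\<rho> (Ls r) v0 x = p (Ls r)" for r
    using p(2)[OF iLs, of r] det_lower_unitriangular[OF Lsu, of r] by simp
  have "is_poly1 (\<lambda>r. p (Ls r))"
  proof (rule polynomials_curve[OF p(1)])
    show "is_poly1 (\<lambda>r. Ls r $ i $ j)" for i j
      unfolding Ls_def vec_lambda_beta by (intro is_poly1_intros)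
  qed
  then obtain q where q: "\<And>r. p (Ls r) = poly q r" by (auto simp: is_poly1_def)
  have "((\<lambda>r. F A * poly q r) \<longlongrightarrow> F A * poly q 0) (at 0)" by (intro tendsto_intros)
  moreover have "poly q 0 = v0 x" using q[of 0] pe[of 0] \<rho>_1[OF v0(1)] by (simp add: Ls0)
  ultimately have "((\<lambda>r. F A * \<rho> (Ls r) v0 x) \<longlongrightarrow> F A * v0 x) (at 0)" by (simp add: pe q)
  then show ?thesis using ev by (rule Lim_transform_eventually)
qed

definition E_limit :: "('x \<Rightarrow> complex) \<Rightarrow> complex \<Rightarrow> bool" where
  "E_limit v c \<longleftrightarrow> v \<in> S \<and> (\<forall>x. ((\<lambda>r. E r v x) \<longlongrightarrow> c * v0 x) (at 0))"

lemma E_limit_0: "E_limit 0 0"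
proof -
  have "E r 0 x = 0" if "r \<noteq> 0" for r x
    using E_scale[OF that cfun.subspace_0[OF sS], of 0] by (simp add: cscale_def zero_fun_def)
  then have "\<forall>\<^sub>F r in at 0. 0 = E r 0 x" for x by (simp add: eventually_at_filter)
  then have "((\<lambda>r. E r 0 x) \<longlongrightarrow> 0) (at 0)" for x by (rule Lim_transform_eventually[OF tendsto_const])
  then show ?thesis by (simp add: E_limit_def cfun.subspace_0[OF sS])
qed

lemma E_limit_combine:
  assumes "E_limit u a" "E_limit v b" shows "E_limit (cscale c u + v) (c * a + b)"
proof -
  have uv: "u \<in> S" "v \<in> S" "cscale c u \<in> S" using assms by (auto simp: E_limit_def cfun.subspace_scale[OF sS])
  have "((\<lambda>r. E r (cscale c u + v) x) \<longlongrightarrow> (c * a + b) * v0 x) (at 0)" for x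
  proof -
    have t1: "((\<lambda>r. c * E r u x + E r v x) \<longlongrightarrow> c * (a * v0 x) + b * v0 x) (at 0)"
      using assms unfolding E_limit_def by (intro tendsto_intros) auto
    have t2: "\<forall>\<^sub>F r in at 0. c * E r u x + E r v x = E r (cscale c u + v) x"
      using E_add[OF _ uv(3,2)] E_scale[OF _ uv(1)] by (auto simp: eventually_at_filter cscale_apply)
    show ?thesis using Lim_transform_eventually[OF t1 t2] by (simp add: distrib_right mult.assoc)
  qed
  then show ?thesis using cfun.subspace_add[OF sS uv(3,2)] unfolding E_limit_def by blast
qed

lemma E_limit_unique: "E_limit v a \<Longrightarrow> E_limit v b \<Longrightarrow> a = b"
proof -
  assume "E_limit v a" "E_limit v b"
  moreover obtain x where "v0 x \<noteq> 0" using v0(2) by (auto simp: fun_eq_iff)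
  ultimately show "a = b" using tendsto_unique[of "at 0" "\<lambda>r. E r v x" "a * v0 x" "b * v0 x"] by (simp add: E_limit_def)
qed

lemma E_limit_orbit: "big_cell A \<Longrightarrow> E_limit (\<rho> A v0) (F A)"
  unfolding E_limit_def using \<rho>_mem[OF big_cell_invertible v0(1)] E_orbit_tendsto by blast

lemma ex_E_limit:
  assumes "v \<in> S" shows "\<exists>c. E_limit v c"
proof -
  have "v \<in> cfun.span {\<rho> A v0 | A. big_cell A}" using assms orbit_spans by simp
  then show ?thesis
  proof (induction rule: cfun.span_induct_alt)
    case base
    then show ?case using E_limit_0 by blast
  next
    case (step c x y)
    then show ?case using E_limit_orbit E_limit_combine by blast
  qed
qed

text \<open>The coordinate along \<open>v0\<close>, that is, the invariant functional of the opposite unipotent group.\<close>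

definition \<phi>0 :: "('x \<Rightarrow> complex) \<Rightarrow> complex" where
  "\<phi>0 v = (THE c. E_limit v c)"

lemma \<phi>0_eqI: "E_limit v c \<Longrightarrow> \<phi>0 v = c"
  unfolding \<phi>0_def by (rule the_equality) (use E_limit_unique in blast)+

lemma E_limit_\<phi>0: "v \<in> S \<Longrightarrow> E_limit v (\<phi>0 v)"
  using ex_E_limit \<phi>0_eqI by blast

lemma \<phi>0: "v \<in> S \<Longrightarrow> ((\<lambda>r. E r v x) \<longlongrightarrow> \<phi>0 v * v0 x) (at 0)"
  using E_limit_\<phi>0 by (simp add: E_limit_def)

lemma \<phi>0_linear: "clinear_on S (*) \<phi>0"
proof (rule clinear_onI)
  show "\<phi>0 (u + v) = \<phi>0 u + \<phi>0 v" if "u \<in> S" "v \<in> S" for u v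
    using \<phi>0_eqI[OF E_limit_combine[OF E_limit_\<phi>0[OF that(1)] E_limit_\<phi>0[OF that(2)], of 1]] by simp
  show "\<phi>0 (cscale b v) = b * \<phi>0 v" if "v \<in> S" for b v
    using \<phi>0_eqI[OF E_limit_combine[OF E_limit_\<phi>0[OF that] E_limit_0, of b]] by simp
qed

lemma \<phi>0_orbit:
  assumes A: "invertible A" shows "\<phi>0 (\<rho> A v0) = F A"
proof -
  obtain X e where I: "interpolates X e S" using ex_interpolation fdS by blast
  have ex: "\<phi>0 (\<rho> A v0) = (\<Sum>x\<in>X. \<phi>0 (e x) * \<rho> A v0 x)" if "invertible A" for A
    using interpolation_functional[OF I \<phi>0_linear sS \<rho>_mem[OF that v0(1)]] by (simp add: mult.commute)
  have "(\<Sum>x\<in>X. \<phi>0 (e x) * \<rho> A v0 x) - F A = 0"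
  proof (rule regular_eq_0[OF _ _ A, where f="\<lambda>A. (\<Sum>x\<in>X. \<phi>0 (e x) * \<rho> A v0 x) - F A"])
    show "(\<lambda>A. (\<Sum>x\<in>X. \<phi>0 (e x) * \<rho> A v0 x) - F A) \<in> regular_functions"
      by (intro regular_diff regular_sum regular_scale coefficient_regular v0(1) regular_polynomial hw_functionD(1)[OF F_props(1)])
    fix B :: "'n cmat" assume B: "big_cell B"
    have "\<phi>0 (\<rho> B v0) = F B" by (rule \<phi>0_eqI[OF E_limit_orbit[OF B]])
    then show "(\<Sum>x\<in>X. \<phi>0 (e x) * \<rho> B v0 x) - F B = 0" using ex[OF big_cell_invertible[OF B]] by simp
  qed
  then show ?thesis using ex[OF A] by simp
qed

text \<open>The vectors on which all translates of \<open>\<phi>0\<close> vanish form a submodule that does not contain \<open>v0\<close>.\<close>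

lemma \<phi>0_radical:
  assumes v: "v \<in> S" and z: "\<And>A. invertible A \<Longrightarrow> \<phi>0 (\<rho> A v) = 0" shows "v = 0"
proof -
  define V where "V = {v \<in> S. \<forall>A. invertible A \<longrightarrow> \<phi>0 (\<rho> A v) = 0}"
  have "\<rho> A 0 = 0" if "invertible A" for A by (rule clinear_on_0[OF \<rho>_lin[OF that] sS])
  then have sV: "cfun.subspace V"
    unfolding V_def
    by (intro cfun.subspaceI)
      (simp_all add: clinear_on_functional_0[OF \<phi>0_linear sS] cfun.subspace_0[OF sS] cfun.subspace_add[OF sS] cfun.subspace_scale[OF sS]
        clinear_on_add[OF \<rho>_lin] clinear_on_scale[OF \<rho>_lin] clinear_on_add[OF \<phi>0_linear] clinear_on_scale[OF \<phi>0_linear] \<rho>_mem)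
  have "V = {0} \<or> V = S"
    by (rule submodule_cases[OF sV]) (auto simp: V_def \<rho>_mem \<rho>_mult invertible_mult)
  moreover have "V \<noteq> S"
  proof
    assume "V = S"
    then have "v0 \<in> V" using v0(1) by simp
    then have "\<phi>0 (\<rho> (mat 1) v0) = 0" by (simp add: V_def invertible_det_nz)
    then show False using \<phi>0_orbit[of "mat 1"] F_props(2) by (simp add: invertible_det_nz)
  qed
  moreover have "v \<in> V" using v z by (simp add: V_def)
  ultimately show ?thesis by blast
qed

definition \<psi> :: "'n cmat \<Rightarrow> ('x \<Rightarrow> complex) \<Rightarrow> complex" where
  "\<psi> A = (\<lambda>v. if v \<in> S then \<phi>0 (\<rho> A v) else 0)"

lemma \<psi>_dual: "invertible A \<Longrightarrow> \<psi> A \<in> dual_vecs S"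
  unfolding \<psi>_def dual_vecs_def
  by (auto intro!: clinear_onI simp: cfun.subspace_add[OF sS] cfun.subspace_scale[OF sS]
        clinear_on_add[OF \<rho>_lin] clinear_on_scale[OF \<rho>_lin] clinear_on_add[OF \<phi>0_linear] clinear_on_scale[OF \<phi>0_linear] \<rho>_mem)

lemma dual_subspace: "cfun.subspace (dual_vecs S)"
  by (rule cfun.subspaceI) (auto simp: dual_vecs_def clinear_on_def cscale_def algebra_simps)

lemma dual_finite_dim: "finite_dim (dual_vecs S)"
proof -
  obtain X e where I: "interpolates X e S" using ex_interpolation fdS by blast
  define ev :: "'x \<Rightarrow> ('x \<Rightarrow> complex) \<Rightarrow> complex" where "ev = (\<lambda>x v. if v \<in> S then v x else 0)"
  have "dual_vecs S \<subseteq> cfun.span (ev ` X)"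
  proof
    fix \<phi> assume \<phi>: "\<phi> \<in> dual_vecs S"
    have "\<phi> v = (\<Sum>x\<in>X. cscale (\<phi> (e x)) (ev x)) v" for v
    proof (cases "v \<in> S")
      case True
      then show ?thesis using interpolation_functional[OF I _ sS True, of \<phi>] \<phi>
        by (simp add: dual_vecs_def fun_sum_apply cscale_apply ev_def mult.commute)
    next
      case False
      then show ?thesis using \<phi> by (simp add: dual_vecs_def fun_sum_apply cscale_apply ev_def)
    qed
    then have "\<phi> = (\<Sum>x\<in>X. cscale (\<phi> (e x)) (ev x))" by (rule ext)
    also have "\<dots> \<in> cfun.span (ev ` X)" by (intro cfun.span_sum cfun.span_scale cfun.span_base) auto
    finally show "\<phi> \<in> cfun.span (ev ` X)" .
  qed
  moreover have "finite_dim (cfun.span (ev ` X))" using interpolatesD(1)[OF I] unfolding finite_dim_def by blast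
  ultimately show ?thesis using finite_dim_subspace[OF _ dual_subspace] by blast
qed

text \<open>If the translates of \<open>\<phi>0\<close> spanned a smaller space, interpolation at vectors of \<open>S\<close> would give a nonzero
  vector in their common kernel, which is trivial.\<close>

lemma dual_span: "cfun.span {\<psi> A | A. invertible A} = dual_vecs S"
proof -
  define Q where "Q = cfun.span {\<psi> A | A. invertible A}"
  have sQ: "cfun.subspace Q" by (simp add: Q_def)
  have QD: "Q \<subseteq> dual_vecs S"
    unfolding Q_def by (rule cfun.span_minimal[OF _ dual_subspace]) (use \<psi>_dual in blast)
  have "\<exists>X e. X \<subseteq> S \<and> interpolates X e Q"
  proof (rule ex_interpolation_on[OF finite_dim_subspace[OF dual_finite_dim sQ QD]])
    fix f assume "f \<in> Q" and z: "\<And>x. x \<in> S \<Longrightarrow> f x = 0"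
    then have "f x = 0" for x using QD by (cases "x \<in> S") (auto simp: dual_vecs_def)
    then show "f = 0" by (simp add: fun_eq_iff)
  qed
  then obtain X e where X: "X \<subseteq> S" and I: "interpolates X e Q" by blast
  have "\<phi> \<in> Q" if \<phi>: "\<phi> \<in> dual_vecs S" for \<phi>
  proof (rule interpolation_mem[OF I sQ])
    fix u
    have \<phi>l: "clinear_on S (*) \<phi>" using \<phi> by (simp add: dual_vecs_def)
    show "\<phi> u = (\<Sum>w\<in>X. \<phi> w * e w u)"
    proof (cases "u \<in> S")
      case True
      define u' where "u' = (\<Sum>w\<in>X. cscale (e w u) w)"
      have u'S: "u' \<in> S" unfolding u'_def using X by (intro cfun.subspace_sum[OF sS] cfun.subspace_scale[OF sS]) auto
      have lin: "\<theta> u' = (\<Sum>w\<in>X. e w u * \<theta> w)" if "clinear_on S (*) \<theta>" for \<theta>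
        unfolding u'_def by (rule clinear_on_functional_sum[OF that sS]) (use X in auto)
      have "u - u' = 0"
      proof (rule \<phi>0_radical[OF cfun.subspace_diff[OF sS True u'S]])
        fix A :: "'n cmat" assume A: "invertible A"
        have l: "clinear_on S (*) (\<psi> A)" using \<psi>_dual[OF A] by (simp add: dual_vecs_def)
        have "\<psi> A \<in> Q" unfolding Q_def using A by (intro cfun.span_base) blast
        then have "\<psi> A u = \<psi> A u'" using interpolatesD(4)[OF I, of "\<psi> A" u] lin[OF l] by (simp add: mult.commute)
        moreover have "\<psi> A (u - u' + u') = \<psi> A (u - u') + \<psi> A u'"
          by (rule clinear_on_add[OF l cfun.subspace_diff[OF sS True u'S] u'S])
        ultimately show "\<phi>0 (\<rho> A (u - u')) = 0" using cfun.subspace_diff[OF sS True u'S] by (simp add: \<psi>_def)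
      qed
      then have "u = u'" by simp
      then have "\<phi> u = \<phi> u'" by simp
      also have "\<dots> = (\<Sum>w\<in>X. e w u * \<phi> w)" by (rule lin[OF \<phi>l])
      finally show ?thesis by (simp only: mult.commute)
    next
      case False
      have "e w u = 0" if "w \<in> X" for w using interpolatesD(2)[OF I that] QD False by (auto simp: dual_vecs_def)
      then show ?thesis using \<phi> False by (simp add: dual_vecs_def)
    qed
  qed
  then show ?thesis using QD by (auto simp: Q_def)
qed

end

section \<open>Matrix coefficients and the tensor product\<close>

lemma clinear_on_eq_on_span:
  assumes v: "v \<in> cfun.span B" and T: "clinear_on (cfun.span B) cscale T" and U: "clinear_on (cfun.span B) cscale U"
    and eq: "\<And>b. b \<in> B \<Longrightarrow> T b = U b"
  shows "T v = U v"
proof -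
  have "v \<in> cfun.span B \<and> T v = U v" using v
  proof (induction rule: cfun.span_induct_alt)
    case base
    show ?case
      by (rule conjI[OF cfun.span_zero trans[OF clinear_on_0[OF T cfun.subspace_span] clinear_on_0[OF U cfun.subspace_span, symmetric]]])
  next
    case (step c x y)
    have m: "x \<in> cfun.span B" "cscale c x \<in> cfun.span B" "y \<in> cfun.span B"
      using step(2) by (simp_all only: cfun.span_base[OF step(1)] cfun.span_scale)
    have "T (cscale c x + y) = U (cscale c x + y)"
      unfolding clinear_on_add[OF T m(2,3)] clinear_on_add[OF U m(2,3)] clinear_on_scale[OF T m(1)] clinear_on_scale[OF U m(1)]
      using step eq[OF step(1)] by (simp only:)
    then show ?case by (rule conjI[OF cfun.span_add[OF m(2,3)]])
  qed
  then show ?thesis ..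
qed

lemma polynomials_eq_if_eq_on_invertible:
  assumes "p \<in> polynomials" "q \<in> polynomials" "\<And>A. invertible A \<Longrightarrow> p A = q A"
  shows "p = (q :: 'n::finite cmat \<Rightarrow> complex)"
proof
  fix A
  have "p A - q A = 0"
    by (rule polynomial_eq_0_if_eq_0_on_invertible[OF polynomials_diff[OF assms(1,2)]]) (simp add: assms(3))
  then show "p A = q A" by simp
qed

context hw_module
begin

abbreviation "Tens \<equiv> outer_tensor (dual_module GL W) W"
abbreviation "TS \<equiv> vecs Tens"

definition pure :: "(('x \<Rightarrow> complex) \<Rightarrow> complex) \<Rightarrow> ('x \<Rightarrow> complex) \<Rightarrow> (('x \<Rightarrow> complex) \<times> 'x) \<Rightarrow> complex" where
  "pure f g = (\<lambda>(u, y). f u * g y)"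

lemma TS_def: "TS = cfun.span {pure f g | f g. f \<in> dual_vecs S \<and> g \<in> S}"
  by (simp add: outer_tensor_def dual_module_def pure_def)

lemma TS_subspace: "cfun.subspace TS" unfolding TS_def by simp

lemma pure_mem: "f \<in> dual_vecs S \<Longrightarrow> g \<in> S \<Longrightarrow> pure f g \<in> TS"
  unfolding TS_def by (rule cfun.span_base) blast

lemma TS_least:
  assumes "cfun.subspace V" "\<And>f g. f \<in> dual_vecs S \<Longrightarrow> g \<in> S \<Longrightarrow> pure f g \<in> V"
  shows "TS \<subseteq> V"
  unfolding TS_def by (rule cfun.span_minimal[OF _ assms(1)]) (use assms(2) in blast)

text \<open>A tensor \<open>t\<close> is a linear map from \<open>S\<close> to \<open>S\<close>: fixing its first variable leaves an element of the
  second factor.\<close>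

definition slice :: "(('x \<Rightarrow> complex) \<times> 'x \<Rightarrow> complex) \<Rightarrow> ('x \<Rightarrow> complex) \<Rightarrow> 'x \<Rightarrow> complex" where
  "slice t u = (\<lambda>y. t (u, y))"

lemma slice_add: "slice (t + t') u = slice t u + slice t' u" by (simp add: slice_def fun_eq_iff)
lemma slice_scale: "slice (cscale c t) u = cscale c (slice t u)" by (simp add: slice_def cscale_def)
lemma slice_pure: "slice (pure f g) u = cscale (f u) g" by (simp add: slice_def pure_def cscale_def)
lemma slice_0: "slice 0 u = 0" by (simp add: slice_def fun_eq_iff)

lemma slice_mem: "t \<in> TS \<Longrightarrow> slice t u \<in> S"
proof -
  have "TS \<subseteq> {t. slice t u \<in> S}"
    by (rule TS_least, rule cfun.subspaceI)
      (simp_all add: slice_add slice_scale slice_pure slice_0 cfun.subspace_0[OF sS] cfun.subspace_add[OF sS] cfun.subspace_scale[OF sS])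
  then show "t \<in> TS \<Longrightarrow> slice t u \<in> S" by blast
qed

lemma slice_outside: "t \<in> TS \<Longrightarrow> u \<notin> S \<Longrightarrow> slice t u = 0"
proof -
  assume u: "u \<notin> S"
  have "TS \<subseteq> {t. slice t u = 0}"
  proof (rule TS_least)
    show "cfun.subspace {t. slice t u = 0}"
      by (rule cfun.subspaceI) (simp_all add: slice_add slice_scale slice_0)
    show "pure f g \<in> {t. slice t u = 0}" if "f \<in> dual_vecs S" "g \<in> S" for f g
      using that u by (simp add: slice_pure dual_vecs_def)
  qed
  then show "t \<in> TS \<Longrightarrow> slice t u = 0" by blast
qed

lemma slice_linear: "t \<in> TS \<Longrightarrow> clinear_on S cscale (slice t)"
proof -
  have "TS \<subseteq> {t. clinear_on S cscale (slice t)}"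
  proof (rule TS_least)
    show "cfun.subspace {t. clinear_on S cscale (slice t)}"
      by (rule cfun.subspaceI)
        (simp_all add: clinear_on_def slice_add slice_scale slice_0 cfun.scale_right_distrib add_ac mult.commute)
    fix f g assume f: "f \<in> dual_vecs S" and "g \<in> S"
    have l: "clinear_on S (*) f" using f by (simp add: dual_vecs_def)
    show "pure f g \<in> {t. clinear_on S cscale (slice t)}"
      by (rule CollectI, rule clinear_onI)
        (simp_all only: slice_pure clinear_on_add[OF l] clinear_on_scale[OF l] cfun.scale_left_distrib cfun.scale_scale)
  qed
  then show "t \<in> TS \<Longrightarrow> clinear_on S cscale (slice t)" by blast
qed

lemma act_Tens:
  assumes "invertible a"
  shows "act Tens (a, b) t = (\<lambda>(u, y). if u \<in> S then \<rho> b (slice t (\<rho> (matrix_inv a) u)) y else 0)"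
  using assms by (simp add: outer_tensor_def dual_module_def inv_GL slice_def fun_eq_iff)

definition dual_act :: "'n cmat \<Rightarrow> (('x \<Rightarrow> complex) \<Rightarrow> complex) \<Rightarrow> ('x \<Rightarrow> complex) \<Rightarrow> complex" where
  "dual_act a f = (\<lambda>u. if u \<in> S then f (\<rho> (matrix_inv a) u) else 0)"

lemma dual_act_mem: "invertible a \<Longrightarrow> f \<in> dual_vecs S \<Longrightarrow> dual_act a f \<in> dual_vecs S"
  unfolding dual_act_def
  by (rule dual_pullback[OF \<rho>_lin[OF invertible_matrix_inv] \<rho>_mem[OF invertible_matrix_inv] _ sS])

lemma act_pure:
  assumes a: "invertible a" and b: "invertible b" and g: "g \<in> S"
  shows "act Tens (a, b) (pure f g) = pure (dual_act a f) (\<rho> b g)"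
proof -
  have "act Tens (a, b) (pure f g) (u, y) = pure (dual_act a f) (\<rho> b g) (u, y)" for u y
    unfolding act_Tens[OF a] slice_pure clinear_on_scale[OF \<rho>_lin[OF b] g]
    by (simp add: pure_def dual_act_def cscale_apply)
  then show ?thesis by (simp add: fun_eq_iff)
qed

lemma act_Tens_add:
  assumes "invertible a" "invertible b" "t \<in> TS" "t' \<in> TS"
  shows "act Tens (a, b) (t + t') = act Tens (a, b) t + act Tens (a, b) t'"
proof -
  have "act Tens (a, b) (t + t') (u, y) = (act Tens (a, b) t + act Tens (a, b) t') (u, y)" for u y
    using slice_mem[OF assms(3)] slice_mem[OF assms(4)]
    by (simp add: act_Tens[OF assms(1)] slice_add clinear_on_add[OF \<rho>_lin[OF assms(2)]])
  then show ?thesis by (simp add: fun_eq_iff)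
qed

lemma act_Tens_scale:
  assumes "invertible a" "invertible b" "t \<in> TS"
  shows "act Tens (a, b) (cscale c t) = cscale c (act Tens (a, b) t)"
proof -
  have "act Tens (a, b) (cscale c t) (u, y) = (cscale c (act Tens (a, b) t)) (u, y)" for u y
    using slice_mem[OF assms(3)]
    by (simp add: act_Tens[OF assms(1)] slice_scale clinear_on_scale[OF \<rho>_lin[OF assms(2)]] cscale_apply)
  then show ?thesis by (simp add: fun_eq_iff)
qed

lemma act_Tens_mem:
  assumes ab: "invertible a" "invertible b" and t: "t \<in> TS"
  shows "act Tens (a, b) t \<in> TS"
proof -
  have l: "clinear_on TS cscale (act Tens (a, b))"
    by (rule clinear_onI) (simp_all add: act_Tens_add[OF ab] act_Tens_scale[OF ab])
  have "TS \<subseteq> {t \<in> TS. act Tens (a, b) t \<in> TS}"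
    by (rule TS_least[OF clinear_on_vimage_subspace[OF l TS_subspace TS_subspace]])
      (simp add: pure_mem act_pure[OF ab] dual_act_mem[OF ab(1)] \<rho>_mem[OF ab(2)])
  then show ?thesis using t by blast
qed

definition nodes :: "('x set) \<times> ('x \<Rightarrow> 'x \<Rightarrow> complex)" where
  "nodes = (SOME p. interpolates (fst p) (snd p) S)"
abbreviation "X \<equiv> fst nodes"
abbreviation "e \<equiv> snd nodes"

lemma I: "interpolates X e S"
proof -
  have "\<exists>p. interpolates (fst p) (snd p) S" using ex_interpolation[OF fdS] by auto
  from someI_ex[OF this] show ?thesis unfolding nodes_def .
qed

lemmas J = interpolatesD[OF I]

text \<open>Matrix coefficients are only defined on invertible matrices; extension by zero turns equality there into
  equality of functions.\<close>

definition on_GL :: "('n cmat \<Rightarrow> complex) \<Rightarrow> 'n cmat \<Rightarrow> complex" where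
  "on_GL p = (\<lambda>A. if invertible A then p A else 0)"

definition coef :: "(('x \<Rightarrow> complex) \<Rightarrow> complex) \<Rightarrow> ('x \<Rightarrow> complex) \<Rightarrow> 'n cmat \<Rightarrow> complex" where
  "coef f g = on_GL (\<lambda>A. f (\<rho> A g))"

text \<open>The trace of \<open>A\<close> composed with the linear map \<open>slice t\<close>, computed in the basis \<open>e\<close>; on a pure tensor it
  is the matrix coefficient.\<close>

definition tr :: "(('x \<Rightarrow> complex) \<times> 'x \<Rightarrow> complex) \<Rightarrow> 'n cmat \<Rightarrow> complex" where
  "tr t = on_GL (\<lambda>A. \<Sum>x\<in>X. \<rho> A (slice t (e x)) x)"

lemma tr_pure:
  assumes "f \<in> dual_vecs S" "g \<in> S" shows "tr (pure f g) = coef f g"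
proof
  fix A
  show "tr (pure f g) A = coef f g A"
  proof (cases "invertible A")
    case True
    have "f (\<rho> A g) = (\<Sum>x\<in>X. \<rho> A g x * f (e x))"
      using interpolation_functional[OF I _ sS \<rho>_mem[OF True assms(2)], of f] assms(1) by (simp add: dual_vecs_def)
    then show ?thesis
      using True by (simp add: tr_def coef_def on_GL_def slice_pure clinear_on_scale[OF \<rho>_lin[OF True] assms(2)] cscale_apply mult.commute)
  qed (simp add: tr_def coef_def on_GL_def)
qed

lemma on_GL_linear: "clinear_on V cscale on_GL"
  by (rule clinear_onI) (simp_all add: fun_eq_iff on_GL_def cscale_apply)

lemma tr_linear: "clinear_on TS cscale tr"
  by (rule clinear_onI)
    (simp_all add: fun_eq_iff tr_def on_GL_def slice_add slice_scale clinear_on_add[OF \<rho>_lin slice_mem slice_mem]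
      clinear_on_scale[OF \<rho>_lin slice_mem] cscale_apply sum.distrib sum_distrib_left)

lemma coef_left_linear: "clinear_on (dual_vecs S) cscale (\<lambda>f. coef f g)"
  by (rule clinear_onI) (simp_all add: fun_eq_iff coef_def on_GL_def cscale_apply)

lemma coef_right_linear:
  assumes "f \<in> dual_vecs S" shows "clinear_on S cscale (coef f)"
proof -
  have l: "clinear_on S (*) f" using assms by (simp add: dual_vecs_def)
  show ?thesis
    by (rule clinear_onI)
      (simp_all add: fun_eq_iff coef_def on_GL_def cscale_apply clinear_on_add[OF \<rho>_lin] clinear_on_scale[OF \<rho>_lin]
        clinear_on_add[OF l] clinear_on_scale[OF l] \<rho>_mem)
qed

abbreviation "R \<equiv> on_GL ` wspace \<mu>"

lemma R_subspace: "cfun.subspace R"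
  by (rule clinear_on_image_subspace[OF on_GL_linear wspace_subspace])

text \<open>For translates of \<open>\<phi>0\<close> and of \<open>v0\<close> the matrix coefficient is a two-sided translate of \<open>F\<close>. These
  translates span the dual and the module.\<close>

lemma coef_in_R:
  assumes f: "f \<in> dual_vecs S" and g: "g \<in> S" shows "coef f g \<in> R"
proof -
  have 1: "coef f (\<rho> C v0) \<in> R" if C: "invertible C" for C
  proof -
    have "cfun.span {\<psi> A | A. invertible A} \<subseteq> {f \<in> dual_vecs S. coef f (\<rho> C v0) \<in> R}"
    proof (rule cfun.span_minimal[OF _ clinear_on_vimage_subspace[OF coef_left_linear dual_subspace R_subspace]], clarify)
      fix B :: "'n cmat" assume B: "invertible B"
      have "on_GL (bitrans B C F) = coef (\<psi> B) (\<rho> C v0)"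
      proof
        fix A
        show "on_GL (bitrans B C F) A = coef (\<psi> B) (\<rho> C v0) A"
          using B C \<rho>_mem[OF _ \<rho>_mem[OF C v0(1)], of A]
          by (simp add: coef_def on_GL_def \<psi>_def \<rho>_mult v0(1) invertible_mult \<phi>0_orbit bitrans_def matrix_mul_assoc)
      qed
      moreover have "bitrans B C F \<in> wspace \<mu>" by (simp add: wspace_def bi_span_base)
      ultimately have "coef (\<psi> B) (\<rho> C v0) \<in> R" by (metis imageI)
      then show "\<psi> B \<in> dual_vecs S \<and> coef (\<psi> B) (\<rho> C v0) \<in> R" using \<psi>_dual[OF B] by blast
    qed
    then show ?thesis using f dual_span by blast
  qed
  have "cfun.span {\<rho> A v0 | A. big_cell A} \<subseteq> {g \<in> S. coef f g \<in> R}"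
    by (rule cfun.span_minimal[OF _ clinear_on_vimage_subspace[OF coef_right_linear[OF f] sS R_subspace]])
      (use 1 \<rho>_mem[OF _ v0(1)] big_cell_invertible in blast)
  then show ?thesis using g orbit_spans by blast
qed

lemma tr_in_R: "t \<in> TS \<Longrightarrow> tr t \<in> R"
proof -
  have "TS \<subseteq> {t \<in> TS. tr t \<in> R}"
    by (rule TS_least[OF clinear_on_vimage_subspace[OF tr_linear TS_subspace R_subspace]])
      (simp only: mem_Collect_eq tr_pure pure_mem coef_in_R simp_thms)
  then show "t \<in> TS \<Longrightarrow> tr t \<in> R" by blast
qed

definition toPoly :: "(('x \<Rightarrow> complex) \<times> 'x \<Rightarrow> complex) \<Rightarrow> 'n cmat \<Rightarrow> complex" where
  "toPoly t = inv_into (wspace \<mu>) on_GL (tr t)"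

lemma toPoly: "t \<in> TS \<Longrightarrow> toPoly t \<in> wspace \<mu>" "t \<in> TS \<Longrightarrow> invertible A \<Longrightarrow> toPoly t A = tr t A"
proof -
  assume t: "t \<in> TS"
  show "toPoly t \<in> wspace \<mu>" unfolding toPoly_def by (rule inv_into_into[OF tr_in_R[OF t]])
  have "on_GL (toPoly t) = tr t" unfolding toPoly_def by (rule f_inv_into_f[OF tr_in_R[OF t]])
  from fun_cong[OF this, of A] show "invertible A \<Longrightarrow> toPoly t A = tr t A" by (simp add: on_GL_def)
qed

lemma wspace_eqI:
  assumes "p \<in> wspace \<mu>" "q \<in> wspace \<mu>" "\<And>A. invertible A \<Longrightarrow> p A = q A" shows "p = q"
  using polynomials_eq_if_eq_on_invertible assms wspace_polynomials[OF \<mu>] by blast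

lemma toPoly_linear: "clinear_on TS cscale toPoly"
proof (rule clinear_onI)
  fix u v assume u: "u \<in> TS" and v: "v \<in> TS"
  show "toPoly (u + v) = toPoly u + toPoly v"
    by (rule wspace_eqI[OF toPoly(1) cfun.subspace_add[OF wspace_subspace toPoly(1)[OF u] toPoly(1)[OF v]]])
      (simp_all add: toPoly(2) u v cfun.subspace_add[OF TS_subspace] clinear_on_add[OF tr_linear])
next
  fix c v assume v: "v \<in> TS"
  show "toPoly (cscale c v) = cscale c (toPoly v)"
    by (rule wspace_eqI[OF toPoly(1) cfun.subspace_scale[OF wspace_subspace toPoly(1)[OF v]]])
      (simp_all add: toPoly(2) v cfun.subspace_scale[OF TS_subspace] clinear_on_scale[OF tr_linear] cscale_apply)
qed

lemma toPoly_act: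
  assumes ab: "invertible a" "invertible b" and t: "t \<in> TS"
  shows "toPoly (act Tens (a, b) t) = bitrans (matrix_inv a) b (toPoly t)"
  using t unfolding TS_def
proof (rule clinear_on_eq_on_span)
  note tl = toPoly_linear
  show "clinear_on (cfun.span {pure f g | f g. f \<in> dual_vecs S \<and> g \<in> S}) cscale (\<lambda>t. toPoly (act Tens (a, b) t))"
    unfolding TS_def[symmetric]
    by (rule clinear_onI)
      (simp_all only: act_Tens_add[OF ab] act_Tens_scale[OF ab] clinear_on_add[OF tl] clinear_on_scale[OF tl] act_Tens_mem[OF ab])
  show "clinear_on (cfun.span {pure f g | f g. f \<in> dual_vecs S \<and> g \<in> S}) cscale (\<lambda>t. bitrans (matrix_inv a) b (toPoly t))"
    unfolding TS_def[symmetric]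
    by (rule clinear_onI) (simp_all only: clinear_on_add[OF tl] clinear_on_scale[OF tl] bitrans_add bitrans_cscale)
  fix t assume "t \<in> {pure f g | f g. f \<in> dual_vecs S \<and> g \<in> S}"
  then obtain f g where fg: "f \<in> dual_vecs S" "g \<in> S" and t: "t = pure f g" by blast
  note ia = invertible_matrix_inv[OF ab(1)] and fa = dual_act_mem[OF ab(1) fg(1)] and gb = \<rho>_mem[OF ab(2) fg(2)]
  have tT: "pure f g \<in> TS" "pure (dual_act a f) (\<rho> b g) \<in> TS" by (intro pure_mem fg fa gb)+
  show "toPoly (act Tens (a, b) t) = bitrans (matrix_inv a) b (toPoly t)"
    unfolding t act_pure[OF ab fg(2)]
  proof (rule wspace_eqI[OF toPoly(1)[OF tT(2)]])
    show "bitrans (matrix_inv a) b (toPoly (pure f g)) \<in> wspace \<mu>"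
      using wspace_bi_stable[of \<mu>] toPoly(1)[OF tT(1)] unfolding bi_stable_def by blast
    fix A :: "'n cmat" assume A: "invertible A"
    note im = invertible_mult[OF invertible_mult[OF ia A] ab(2)]
    show "toPoly (pure (dual_act a f) (\<rho> b g)) A = bitrans (matrix_inv a) b (toPoly (pure f g)) A"
      unfolding bitrans_def toPoly(2)[OF tT(2) A] toPoly(2)[OF tT(1) im] tr_pure[OF fg] tr_pure[OF fa gb]
      using \<rho>_mem[OF A gb] A im
      by (simp add: coef_def on_GL_def dual_act_def \<rho>_mult ia ab(2) fg(2) gb invertible_mult matrix_mul_assoc)
  qed
qed

text \<open>The trace of \<open>t\<close> vanishes on all products \<open>B ** \<tau> r ** A\<close>. In the limit, \<open>\<tau> r\<close> becomes the rank-one map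
  \<open>v \<mapsto> \<phi>0 v \<cdot> v0\<close>, which leaves \<open>\<phi>0 (A (slice t (B v0))) = 0\<close>. The vectors \<open>B v0\<close> span \<open>S\<close> and the
  functionals \<open>\<phi>0 A\<close> separate points.\<close>

lemma toPoly_eq_0:
  assumes t: "t \<in> TS" and z: "toPoly t = 0" shows "t = 0"
proof -
  have tr0: "tr t A = 0" if "invertible A" for A using toPoly(2)[OF t that] z by simp
  have sl: "slice t u \<in> S" for u by (rule slice_mem[OF t])
  have 1: "(\<Sum>x\<in>X. \<rho> B v0 x * \<phi>0 (\<rho> A (slice t (e x)))) = 0" if A: "invertible A" and B: "invertible B" for A B
  proof -
    have ex: "\<rho> B u x = (\<Sum>y\<in>X. u y * \<rho> B (e y) x)" if "u \<in> S" for u x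
      by (rule interpolation_linear[OF I \<rho>_lin[OF B] sS that])
    have zz: "(\<Sum>x\<in>X. \<rho> B (E r (\<rho> A (slice t (e x)))) x) = 0" if r: "r \<noteq> 0" for r
    proof -
      have "\<rho> B (E r (\<rho> A (slice t (e x)))) x = 1 / \<kappa> r * \<rho> (B ** \<tau> r ** A) (slice t (e x)) x" for x
        unfolding E_def
        by (simp add: clinear_on_scale[OF \<rho>_lin[OF B]] \<rho>_mem \<tau>_inv[OF r] A B sl \<rho>_mult invertible_mult cscale_apply matrix_mul_assoc)
      then have "(\<Sum>x\<in>X. \<rho> B (E r (\<rho> A (slice t (e x)))) x) = 1 / \<kappa> r * tr t (B ** \<tau> r ** A)"
        by (simp add: tr_def on_GL_def sum_distrib_left invertible_mult A B \<tau>_inv[OF r])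
      then show ?thesis using tr0[of "B ** \<tau> r ** A"] by (simp add: invertible_mult A B \<tau>_inv[OF r])
    qed
    have 0: "(\<Sum>x\<in>X. \<Sum>y\<in>X. E r (\<rho> A (slice t (e x))) y * \<rho> B (e y) x) = 0" if r: "r \<noteq> 0" for r
      using zz[OF r] by (simp only: ex[OF E_mem[OF r \<rho>_mem[OF A sl]]])
    have "((\<lambda>r. \<Sum>x\<in>X. \<Sum>y\<in>X. E r (\<rho> A (slice t (e x))) y * \<rho> B (e y) x) \<longlongrightarrow>
        (\<Sum>x\<in>X. \<Sum>y\<in>X. (\<phi>0 (\<rho> A (slice t (e x))) * v0 y) * \<rho> B (e y) x)) (at 0)"
      by (intro tendsto_sum tendsto_mult \<phi>0 \<rho>_mem[OF A sl] tendsto_const)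
    moreover have "((\<lambda>r. \<Sum>x\<in>X. \<Sum>y\<in>X. E r (\<rho> A (slice t (e x))) y * \<rho> B (e y) x) \<longlongrightarrow> 0) (at 0)"
      by (rule Lim_transform_eventually[of "\<lambda>r. 0"]) (auto simp: eventually_at_filter 0)
    ultimately have "(\<Sum>x\<in>X. \<Sum>y\<in>X. (\<phi>0 (\<rho> A (slice t (e x))) * v0 y) * \<rho> B (e y) x) = 0"
      by (rule tendsto_unique[rotated]) simp
    then show ?thesis by (simp add: ex[OF v0(1)] sum_distrib_left sum_distrib_right mult_ac)
  qed
  have 2: "\<phi>0 (\<rho> A (slice t u)) = 0" if A: "invertible A" and u: "u \<in> S" for A u
  proof -
    define \<theta> where "\<theta> = (\<lambda>u. \<phi>0 (\<rho> A (slice t u)))"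
    note sl_lin = slice_linear[OF t]
    have lin: "clinear_on S (*) \<theta>"
      unfolding \<theta>_def
      by (rule clinear_onI)
        (simp_all add: clinear_on_add[OF sl_lin] clinear_on_scale[OF sl_lin] clinear_on_add[OF \<rho>_lin[OF A]] clinear_on_scale[OF \<rho>_lin[OF A]]
          clinear_on_add[OF \<phi>0_linear] clinear_on_scale[OF \<phi>0_linear] sl \<rho>_mem[OF A])
    have z: "\<theta> (\<rho> B v0) = 0" if "invertible B" for B
      using interpolation_functional[OF I lin sS \<rho>_mem[OF that v0(1)]] 1[OF A that] by (simp add: \<theta>_def)
    have "cfun.span {\<rho> A v0 | A. big_cell A} \<subseteq> {u \<in> S. \<theta> u = 0}"
    proof (rule cfun.span_minimal)
      show "cfun.subspace {u \<in> S. \<theta> u = 0}"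
        by (rule cfun.subspaceI)
          (simp_all add: clinear_on_functional_0[OF lin sS] clinear_on_add[OF lin] clinear_on_scale[OF lin]
            cfun.subspace_0[OF sS] cfun.subspace_add[OF sS] cfun.subspace_scale[OF sS])
      show "{\<rho> A v0 |A. big_cell A} \<subseteq> {u \<in> S. \<theta> u = 0}"
        using z \<rho>_mem[OF _ v0(1)] big_cell_invertible by blast
    qed
    then have "\<theta> u = 0" using u orbit_spans by blast
    then show ?thesis by (simp add: \<theta>_def)
  qed
  have "slice t u = 0" for u
  proof (cases "u \<in> S")
    case True
    show ?thesis by (rule \<phi>0_radical[OF sl]) (rule 2[OF _ True])
  next
    case False
    then show ?thesis by (rule slice_outside[OF t])
  qed
  then have "slice t u y = 0" for u y by simp
  then show "t = 0" by (simp add: fun_eq_iff slice_def)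
qed

text \<open>The image is stable and contains \<open>F\<close>, the image of \<open>\<phi>0 \<otimes> v0\<close>.\<close>

lemma toPoly_image: "toPoly ` TS = wspace \<mu>"
proof
  show "toPoly ` TS \<subseteq> wspace \<mu>" using toPoly(1) by blast
  have sub: "cfun.subspace (toPoly ` TS)" by (rule clinear_on_image_subspace[OF toPoly_linear TS_subspace])
  have fd: "finite_dim (toPoly ` TS)"
    by (rule finite_dim_subspace[OF wspace_finite_dim[OF \<mu>] sub]) (use toPoly(1) in blast)
  have st: "bi_stable (toPoly ` TS)"
  proof (rule bi_stable_if_invertible_stable[OF fd])
    show "toPoly ` TS \<subseteq> polynomials" using toPoly(1) wspace_polynomials[OF \<mu>] by blast
    fix g h :: "'n cmat" and f assume g: "invertible g" and h: "invertible h" and "f \<in> toPoly ` TS"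
    then obtain t where t: "t \<in> TS" "f = toPoly t" by blast
    have "bitrans g h f = toPoly (act Tens (matrix_inv g, h) t)"
      using toPoly_act[OF invertible_matrix_inv[OF g] h t(1)] matrix_inv_matrix_inv[OF g] t(2) by simp
    then show "bitrans g h f \<in> toPoly ` TS" using act_Tens_mem[OF invertible_matrix_inv[OF g] h t(1)] by blast
  qed
  have i1: "invertible (mat 1 :: 'n cmat)" by (simp add: invertible_det_nz)
  have pm: "pure (\<psi> (mat 1)) v0 \<in> TS" by (rule pure_mem[OF \<psi>_dual[OF i1] v0(1)])
  have "toPoly (pure (\<psi> (mat 1)) v0) = F"
  proof (rule wspace_eqI[OF toPoly(1)[OF pm] hwf_in_wspace])
    fix A :: "'n cmat" assume A: "invertible A"
    show "toPoly (pure (\<psi> (mat 1)) v0) A = F A"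
      unfolding toPoly(2)[OF pm A] tr_pure[OF \<psi>_dual[OF i1] v0(1)]
      using A \<rho>_mem[OF A v0(1)] by (simp add: coef_def on_GL_def \<psi>_def \<rho>_1 \<phi>0_orbit[OF A])
  qed
  then have "F \<in> toPoly ` TS" using pm by (metis imageI)
  then show "wspace \<mu> \<subseteq> toPoly ` TS" unfolding wspace_def by (rule bi_span_least_stable[OF sub st])
qed

lemma toPoly_bij: "bij_betw toPoly TS (wspace \<mu>)"
  unfolding bij_betw_def
proof (intro conjI toPoly_image inj_onI)
  fix s t assume s: "s \<in> TS" and t: "t \<in> TS" and st: "toPoly s = toPoly t"
  have d: "s - t \<in> TS" by (rule cfun.subspace_diff[OF TS_subspace s t])
  have "toPoly (s - t + t) = toPoly (s - t) + toPoly t" by (rule clinear_on_add[OF toPoly_linear d t])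
  then have "toPoly (s - t) = 0" using st by simp
  then have "s - t = 0" by (rule toPoly_eq_0[OF d])
  then show "s = t" by simp
qed

lemma Tens_iso_wspace: "module_iso (GL \<times>\<times> GL) Tens (poly_module\<lparr>vecs := wspace \<mu>\<rparr>)"
  by (rule module_isoI[where T=toPoly])
    (use toPoly_bij toPoly_linear in \<open>auto simp: DirProd_def GL_simps toPoly_act poly_module_def two_sided_act_def bitrans_def\<close>)

lemma wspace_iso_Tens: "module_iso (GL \<times>\<times> GL) (poly_module\<lparr>vecs := wspace \<mu>\<rparr>) Tens"
  by (rule module_iso_sym_if_closed[OF TS_subspace _ Tens_iso_wspace])
    (auto simp: DirProd_def GL_simps act_Tens_mem)

end

section \<open>The polynomial components\<close>

lemma rational_module_transfer:
  assumes N: "is_gmodule GL N" and iso: "module_iso GL M N" and rat: "rational_module M"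
  shows "rational_module N"
proof -
  obtain T where T: "bij_betw T (vecs M) (vecs N)" "clinear_on (vecs M) cscale T"
    "\<And>g v. g \<in> carrier GL \<Longrightarrow> v \<in> vecs M \<Longrightarrow> T (act M g v) = act N g (T v)" using module_isoE[OF iso] by blast
  have M: "is_gmodule GL M" and fd: "finite_dim (vecs M)"
    and co: "\<And>v \<phi>. v \<in> vecs M \<Longrightarrow> \<phi> \<in> dual_vecs (vecs M) \<Longrightarrow>
      \<exists>p\<in>polynomials. \<exists>k::nat. \<forall>A\<in>carrier GL. \<phi> (act M A v) = p A / det A ^ k"
    using rat unfolding rational_module_def by blast+
  note MD = is_gmoduleD[OF M]
  have im: "T ` vecs M = vecs N" using T(1) by (auto simp: bij_betw_def)
  show ?thesis unfolding rational_module_def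
  proof (intro conjI ballI N)
    show "finite_dim (vecs N)" using finite_dim_image[OF T(2) fd] im by simp
    fix w \<phi> assume "w \<in> vecs N" and \<phi>: "\<phi> \<in> dual_vecs (vecs N)"
    then obtain v where v: "v \<in> vecs M" "w = T v" using im by blast
    have d: "(\<lambda>v. if v \<in> vecs M then \<phi> (T v) else 0) \<in> dual_vecs (vecs M)"
      by (rule dual_pullback[OF T(2) _ \<phi> MD(1)]) (use im in blast)
    obtain p k where p: "p \<in> polynomials"
      "\<And>A. A \<in> carrier GL \<Longrightarrow> (if act M A v \<in> vecs M then \<phi> (T (act M A v)) else 0) = p A / det A ^ k"
      using co[OF v(1) d] by blast
    have "\<phi> (act N A w) = p A / det A ^ k" if "A \<in> carrier GL" for A
      using p(2)[OF that] MD(2)[OF that v(1)] T(3)[OF that v(1)] v(2) by simp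
    then show "\<exists>p\<in>polynomials. \<exists>k::nat. \<forall>A\<in>carrier GL. \<phi> (act N A w) = p A / det A ^ k" using p(1) by blast
  qed
qed

lemma has_highest_weight_transfer:
  fixes M :: "('n::{finite,wellorder} cmat, 'x) gmodule"
  assumes M: "is_gmodule GL M" and iso: "module_iso GL M N" and hw: "has_highest_weight \<mu> M"
  shows "has_highest_weight \<mu> N"
proof -
  obtain T where T: "bij_betw T (vecs M) (vecs N)" "clinear_on (vecs M) cscale T"
    "\<And>g v. g \<in> carrier GL \<Longrightarrow> v \<in> vecs M \<Longrightarrow> T (act M g v) = act N g (T v)" using module_isoE[OF iso] by blast
  note MD = is_gmoduleD[OF M]
  obtain v where v: "v \<in> vecs M" "v \<noteq> 0"
    "\<And>t. (\<forall>i. t i \<noteq> 0) \<Longrightarrow> act M (diag_mat t) v = cscale (\<Prod>i\<in>UNIV. t i powi \<mu> i) v"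
    "\<And>U. upper_unitriangular U \<Longrightarrow> act M U v = v" using hw unfolding has_highest_weight_def by blast
  show ?thesis unfolding has_highest_weight_def
  proof (intro bexI conjI allI impI)
    show "T v \<in> vecs N" using T(1) v(1) by (auto simp: bij_betw_def)
    show "T v \<noteq> 0"
    proof
      assume "T v = 0"
      then have "T v = T 0" using clinear_on_0[OF T(2) MD(1)] by simp
      then have "v = 0" using T(1) v(1) cfun.subspace_0[OF MD(1)] unfolding bij_betw_def by (meson inj_onD)
      then show False using v(2) by blast
    qed
    show "act N (diag_mat t) (T v) = cscale (\<Prod>i\<in>UNIV. t i powi \<mu> i) (T v)" if t: "\<forall>i. t i \<noteq> 0" for t
    proof -
      have "diag_mat t \<in> carrier GL" using t by (simp add: GL_simps invertible_diag_mat)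
      from T(3)[OF this v(1)] show ?thesis unfolding v(3)[OF t] clinear_on_scale[OF T(2) v(1)] by (rule sym)
    qed
    show "act N U (T v) = T v" if U: "upper_unitriangular U" for U
    proof -
      have "U \<in> carrier GL" using U by (simp add: GL_simps invertible_upper_unitriangular)
      from T(3)[OF this v(1)] show ?thesis unfolding v(4)[OF U] by (rule sym)
    qed
  qed
qed

text \<open>A concrete irreducible module of highest weight \<open>\<mu>\<close>, which shows that the choice in \<open>gl_irrep\<close> is not
  vacuous.\<close>

definition right_module :: "('n::{finite,wellorder} \<Rightarrow> int) \<Rightarrow> ('n cmat, 'n cmat) gmodule" where
  "right_module \<mu> = \<lparr>vecs = cfun.span {bitrans (mat 1) h (hwf \<mu>) | h. True}, act = (\<lambda>B. bitrans (mat 1) B)\<rparr>"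

lemma upper_unitriangular_diag_conj:
  assumes a: "\<And>i. a i \<noteq> 0" and U: "upper_unitriangular U"
  obtains U' where "upper_unitriangular U'" "U ** diag_mat a = diag_mat a ** U'"
proof
  show "upper_unitriangular (\<chi> i j. U $ i $ j * a j / a i)" using U a by (auto simp: upper_unitriangular_def)
  show "U ** diag_mat a = diag_mat a ** (\<chi> i j. U $ i $ j * a j / a i)" using a by (simp add: vec_eq_iff)
qed

text \<open>A right translate by a diagonal matrix is again a highest weight function of weight \<open>\<mu>\<close>, hence a multiple.\<close>

lemma hw_function_right_torus:
  assumes \<mu>: "\<mu> \<in> dominant_weights" and a: "\<And>i. a i \<noteq> 0"
  shows "bitrans (mat 1) (diag_mat a) (hwf \<mu>) = cscale (torus_char \<mu> a) (hwf \<mu>)"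
proof -
  note h = hw_functionD[OF hwf(1)[OF \<mu>]]
  define G where "G = bitrans (mat 1) (diag_mat a) (hwf \<mu>)"
  have Ge: "G Z = hwf \<mu> (Z ** diag_mat a)" for Z by (simp add: G_def bitrans_def)
  have "hw_function \<mu> G"
    unfolding hw_function_def
  proof (intro conjI allI impI)
    show "G \<in> polynomials" unfolding G_def by (rule polynomials_bitrans[OF h(1)])
    fix Z :: "'a cmat"
    show "G (L ** Z) = G Z" if "lower_unitriangular L" for L
      using h(2)[OF that] by (simp add: Ge matrix_mul_assoc[symmetric])
    show "G (Z ** U) = G Z" if U: "upper_unitriangular U" for U
    proof -
      obtain U' where U': "upper_unitriangular U'" "U ** diag_mat a = diag_mat a ** U'"
        by (rule upper_unitriangular_diag_conj[of a U, OF a U])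
      have "Z ** U ** diag_mat a = Z ** diag_mat a ** U'"
        unfolding matrix_mul_assoc[symmetric] U'(2) ..
      then show ?thesis unfolding Ge by (simp only: h(3)[OF U'(1)])
    qed
    show "G (diag_mat b ** Z) = torus_char \<mu> b * G Z" if "\<forall>i. b i \<noteq> 0" for b
      using h(4)[of b] that by (simp add: Ge matrix_mul_assoc[symmetric])
  qed
  then have "G = cscale (G (mat 1)) (hwf \<mu>)" by (rule hw_function_unique[OF hwf[OF \<mu>]])
  moreover have "G (mat 1) = torus_char \<mu> a"
    using h(4)[of a "mat 1"] a hwf(2)[OF \<mu>] by (simp add: Ge)
  ultimately show ?thesis by (simp add: G_def)
qed

text \<open>Every element is invariant under lower unitriangular matrices and has weight \<open>\<mu>\<close> on the left. A vector of
  a submodule that is also invariant under upper unitriangular matrices on the right is therefore a multiple of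
  \<open>hwf \<mu>\<close>, the generator.\<close>

lemma right_module_props:
  assumes \<mu>: "\<mu> \<in> dominant_weights"
  shows "rational_module (right_module \<mu>)" "simple_module GL (right_module \<mu>)" "has_highest_weight \<mu> (right_module \<mu>)"
proof -
  note h = hw_functionD[OF hwf(1)[OF \<mu>]]
  define R where "R = cfun.span {bitrans (mat 1) h (hwf \<mu>) | h. True}"
  have vR: "vecs (right_module \<mu>) = R" and aR: "act (right_module \<mu>) = (\<lambda>B. bitrans (mat 1) B)"
    by (simp_all add: right_module_def R_def)
  have sR: "cfun.subspace R" by (simp add: R_def)
  have RW: "R \<subseteq> wspace \<mu>"
    unfolding R_def by (rule cfun.span_minimal[OF _ wspace_subspace]) (auto simp: wspace_def bi_span_base)
  have fR: "finite_dim R" by (rule finite_dim_subspace[OF wspace_finite_dim[OF \<mu>] sR RW])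
  have Rp: "R \<subseteq> polynomials" using RW wspace_polynomials[OF \<mu>] by blast
  have FR: "hwf \<mu> \<in> R"
    unfolding R_def by (rule cfun.span_base) (metis (mono_tags, lifting) bitrans_1 mem_Collect_eq)
  have R_least: "R \<subseteq> V" if "cfun.subspace V" "\<And>h. bitrans (mat 1) h (hwf \<mu>) \<in> V" for V
    unfolding R_def by (rule cfun.span_minimal[OF _ that(1)]) (use that(2) in auto)
  have lin: "clinear_on V cscale (bitrans (mat 1) B)" for B and V :: "('a cmat \<Rightarrow> complex) set"
    by (rule clinear_onI) (simp_all add: bitrans_add bitrans_cscale)
  have st: "bitrans (mat 1) B f \<in> R" if f: "f \<in> R" for B f
  proof -
    have "R \<subseteq> {f. bitrans (mat 1) B f \<in> R}"
    proof (rule R_least[OF subspace_bitrans_vimage[OF sR]])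
      fix h
      have "bitrans (mat 1) (B ** h) (hwf \<mu>) \<in> R" unfolding R_def by (rule cfun.span_base) auto
      then show "bitrans (mat 1) h (hwf \<mu>) \<in> {f. bitrans (mat 1) B f \<in> R}" by (simp add: bitrans_bitrans)
    qed
    then show ?thesis using f by blast
  qed
  have gm: "is_gmodule GL (right_module \<mu>)"
    unfolding is_gmodule_def vR aR using sR st lin by (auto simp: GL_simps bitrans_bitrans)
  show rat: "rational_module (right_module \<mu>)"
    unfolding rational_module_def vR aR
  proof (intro conjI ballI gm fR)
    fix v \<phi> assume v: "v \<in> R" and \<phi>: "\<phi> \<in> dual_vecs R"
    obtain X e where I: "interpolates X e R" using ex_interpolation fR by blast
    have "\<phi> (bitrans (mat 1) A v) = (\<Sum>x\<in>X. \<phi> (e x) * v (mat 1 ** x ** A))" for A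
      using interpolation_functional[OF I _ sR st[OF v], of \<phi> A] \<phi>
      by (simp add: dual_vecs_def bitrans_def mult.commute)
    moreover have "(\<lambda>A. \<Sum>x\<in>X. \<phi> (e x) * v (mat 1 ** x ** A)) \<in> polynomials"
      by (intro polynomials_sum polynomials_scale polynomials_bitrans_right) (use v Rp in blast)
    ultimately show "\<exists>p\<in>polynomials. \<exists>k::nat. \<forall>A\<in>carrier GL. \<phi> (bitrans (mat 1) A v) = p A / det A ^ k"
      by (intro bexI[of _ "\<lambda>A. \<Sum>x\<in>X. \<phi> (e x) * v (mat 1 ** x ** A)"] exI[of _ 0]) auto
  qed
  show "has_highest_weight \<mu> (right_module \<mu>)"
    unfolding has_highest_weight_def vR aR torus_char_def[symmetric]
  proof (intro bexI[OF _ FR] conjI allI impI)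
    show "hwf \<mu> \<noteq> 0" by (rule hwf_nonzero[OF \<mu>])
    show "bitrans (mat 1) (diag_mat t) (hwf \<mu>) = cscale (torus_char \<mu> t) (hwf \<mu>)" if "\<forall>i. t i \<noteq> 0" for t
      by (rule hw_function_right_torus[OF \<mu>]) (use that in blast)
    show "bitrans (mat 1) U (hwf \<mu>) = hwf \<mu>" if "upper_unitriangular U" for U
      using h(3)[OF that] by (simp add: bitrans_def)
  qed
  have inv: "f (L ** Z) = f Z" "(\<And>i. a i \<noteq> 0) \<Longrightarrow> f (diag_mat a ** Z) = torus_char \<mu> a * f Z"
    if f: "f \<in> R" and L: "lower_unitriangular L" for f L Z a
  proof -
    have "R \<subseteq> {f. f (L ** Z) = f Z}"
    proof (rule R_least)
      show "cfun.subspace {f. f (L ** Z) = f Z}" by (rule cfun.subspaceI) (simp_all add: cscale_apply)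
      show "bitrans (mat 1) k (hwf \<mu>) \<in> {f. f (L ** Z) = f Z}" for k
        using h(2)[OF L] by (simp add: bitrans_def matrix_mul_assoc[symmetric])
    qed
    then show "f (L ** Z) = f Z" using f by blast
    assume a: "\<And>i. a i \<noteq> 0"
    have "R \<subseteq> {f. f (diag_mat a ** Z) = torus_char \<mu> a * f Z}"
    proof (rule R_least)
      show "cfun.subspace {f. f (diag_mat a ** Z) = torus_char \<mu> a * f Z}"
        by (rule cfun.subspaceI) (simp_all add: cscale_apply distrib_left)
      show "bitrans (mat 1) k (hwf \<mu>) \<in> {f. f (diag_mat a ** Z) = torus_char \<mu> a * f Z}" for k
        using h(4)[OF a] by (simp add: bitrans_def matrix_mul_assoc[symmetric])
    qed
    then show "f (diag_mat a ** Z) = torus_char \<mu> a * f Z" using f by blast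
  qed
  have lid: "lower_unitriangular (mat 1 :: 'a cmat)" by (auto simp: lower_unitriangular_def mat_def)
  show "simple_module GL (right_module \<mu>)"
    unfolding simple_module_def vR
  proof (intro conjI allI impI gm)
    show "R \<noteq> {0}" using FR hwf_nonzero[OF \<mu>] by blast
    fix V assume V: "is_submodule GL (right_module \<mu>) V"
    have sV: "cfun.subspace V" and VR: "V \<subseteq> R" and VG: "\<And>A v. invertible A \<Longrightarrow> v \<in> V \<Longrightarrow> bitrans (mat 1) A v \<in> V"
      using is_submoduleD[OF V] by (auto simp: vR aR GL_simps)
    show "V = {0} \<or> V = R"
    proof (cases "V = {0}")
      case False
      have fV: "finite_dim V" by (rule finite_dim_subspace[OF fR sV VR])
      obtain X e where I: "interpolates X e V" using ex_interpolation fV by blast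
      have right: "(\<lambda>Z. f (Z ** g)) \<in> V" if f: "f \<in> V" for f g
      proof (rule interpolation_mem[OF I sV])
        fix Z
        have fp: "f \<in> polynomials" using f VR Rp by blast
        have "f (mat 1 ** Z ** g) - (\<Sum>x\<in>X. f (mat 1 ** x ** g) * e x Z) = 0"
        proof (rule polynomial_eq_0_if_eq_0_on_invertible[where p="\<lambda>g. f (mat 1 ** Z ** g) - (\<Sum>x\<in>X. f (mat 1 ** x ** g) * e x Z)"])
          show "(\<lambda>g. f (mat 1 ** Z ** g) - (\<Sum>x\<in>X. f (mat 1 ** x ** g) * e x Z)) \<in> polynomials"
            by (intro polynomials_diff polynomials_sum polynomials_mult polynomials_const polynomials_bitrans_right[OF fp])
          show "f (mat 1 ** Z ** A) - (\<Sum>x\<in>X. f (mat 1 ** x ** A) * e x Z) = 0" if "invertible A" for A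
            using interpolatesD(4)[OF I VG[OF that f], of Z] by (simp add: bitrans_def)
        qed
        then show "f (Z ** g) = (\<Sum>x\<in>X. f (x ** g) * e x Z)" by simp
      qed
      have Vp: "V \<subseteq> polynomials" using VR Rp by blast
      obtain k where k: "k \<in> V" "k \<noteq> 0" "\<And>U Z. upper_unitriangular U \<Longrightarrow> k (Z ** U) = k Z"
        using ex_right_unipotent_invariant[OF fV Vp False right] by blast
      have kR: "k \<in> R" using k(1) VR by blast
      have "hw_function \<mu> k"
        unfolding hw_function_def using k Vp inv[OF kR] lid by blast
      then have kF: "k = cscale (k (mat 1)) (hwf \<mu>)" by (rule hw_function_unique[OF hwf[OF \<mu>]])
      have k1: "k (mat 1) \<noteq> 0" by (rule hw_function_nonzero_at_1[OF \<open>hw_function \<mu> k\<close> k(2)])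
      have "cscale (1 / k (mat 1)) k = cscale (1 / k (mat 1)) (cscale (k (mat 1)) (hwf \<mu>))" by (subst kF) (rule refl)
      also have "\<dots> = hwf \<mu>" using k1 by simp
      finally have "hwf \<mu> \<in> V" using cfun.subspace_scale[OF sV k(1), of "1 / k (mat 1)"] by simp
      then have "R \<subseteq> V" using right[of "hwf \<mu>"] by (intro R_least[OF sV]) (simp add: bitrans_def)
      then show ?thesis using VR by blast
    qed simp
  qed
qed

lemma gl_irrep_props:
  assumes \<mu>: "\<mu> \<in> dominant_weights" shows "hw_module \<mu> (gl_irrep \<mu>)"
proof -
  note R = right_module_props[OF \<mu>]
  have gm: "is_gmodule GL (right_module \<mu>)" and fd: "finite_dim (vecs (right_module \<mu>))"
    using R(1) by (simp_all add: rational_module_def)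
  obtain K :: "('a cmat, nat) gmodule" where K: "is_gmodule GL K" "module_iso GL (right_module \<mu>) K"
    using ex_nat_model[OF gm fd] by blast
  have "rational_module K \<and> simple_module GL K \<and> has_highest_weight \<mu> K"
    using rational_module_transfer[OF K R(1)] simple_module_transfer[OF K R(2)] has_highest_weight_transfer[OF gm K(2) R(3)] by blast
  then have "rational_module (gl_irrep \<mu>) \<and> simple_module GL (gl_irrep \<mu>) \<and> has_highest_weight \<mu> (gl_irrep \<mu>)"
    unfolding gl_irrep_def by (rule someI)
  then show ?thesis using \<mu> by (simp add: hw_module_def)
qed

lemma wspace_iso_tensor:
  assumes \<mu>: "\<mu> \<in> dominant_weights"
  shows "module_iso (GL \<times>\<times> GL) (poly_module\<lparr>vecs := wspace \<mu>\<rparr>) (irrep_dual_tensor_irrep \<mu>)"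
    "module_iso (GL \<times>\<times> GL) (irrep_dual_tensor_irrep \<mu>) (poly_module\<lparr>vecs := wspace \<mu>\<rparr>)"
  unfolding irrep_dual_tensor_irrep_def
  by (rule hw_module.wspace_iso_Tens[OF gl_irrep_props[OF \<mu>]] hw_module.Tens_iso_wspace[OF gl_irrep_props[OF \<mu>]])+

lemma two_sided_act_bitrans: "two_sided_act (A, B) f = bitrans (matrix_inv A) B f"
  by (simp add: two_sided_act_def bitrans_def)

text \<open>Uniqueness: any submodule isomorphic to \<open>wspace \<mu>\<close> is the image of an equivariant injection, hence equal to it.\<close>

lemma poly_component_eq_wspace:
  fixes \<mu> :: "'n::{finite,wellorder} \<Rightarrow> int"
  assumes \<mu>: "\<mu> \<in> dominant_weights" shows "poly_component \<mu> = wspace \<mu>"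
  unfolding poly_component_def
proof (rule the_equality)
  show "is_submodule (GL \<times>\<times> GL) poly_module (wspace \<mu>) \<and>
    module_iso (GL \<times>\<times> GL) (poly_module\<lparr>vecs := wspace \<mu>\<rparr>) (irrep_dual_tensor_irrep \<mu>)"
    using wspace_iso_tensor[OF \<mu>] wspace_subspace[of \<mu>] wspace_polynomials[OF \<mu>] wspace_bi_stable[of \<mu>]
    by (auto simp: is_submodule_def poly_module_def DirProd_def GL_simps two_sided_act_bitrans bi_stable_def)
  fix V :: "('n cmat \<Rightarrow> complex) set"
  assume V: "is_submodule (GL \<times>\<times> GL) poly_module V \<and>
    module_iso (GL \<times>\<times> GL) (poly_module\<lparr>vecs := V\<rparr>) (irrep_dual_tensor_irrep \<mu>)"
  note VD = is_submoduleD[OF conjunct1[OF V]]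
  have Vp: "V \<subseteq> polynomials" using VD(2) by (simp add: poly_module_def)
  have "module_iso (GL \<times>\<times> GL) (poly_module\<lparr>vecs := V\<rparr>) (poly_module\<lparr>vecs := wspace \<mu>\<rparr>)"
    by (rule module_iso_trans[OF conjunct2[OF V] wspace_iso_tensor(2)[OF \<mu>]])
  then have "module_iso (GL \<times>\<times> GL) (poly_module\<lparr>vecs := wspace \<mu>\<rparr>) (poly_module\<lparr>vecs := V\<rparr>)"
    by (rule module_iso_sym_if_closed[rotated 2]) (use VD in \<open>auto simp: poly_module_def\<close>)
  then obtain T where T: "bij_betw T (wspace \<mu>) V" "clinear_on (wspace \<mu>) cscale T"
    "\<And>g v. g \<in> carrier (GL \<times>\<times> GL) \<Longrightarrow> v \<in> wspace \<mu> \<Longrightarrow> T (two_sided_act g v) = two_sided_act g (T v)"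
    by (rule module_isoE) (simp add: poly_module_def)
  have "T ` wspace \<mu> = wspace \<mu>"
  proof (rule equivariant_image_wspace[OF \<mu> T(2)])
    show "T f \<in> polynomials" if "f \<in> wspace \<mu>" for f using T(1) that Vp by (auto simp: bij_betw_def)
    show "inj_on T (wspace \<mu>)" using T(1) by (simp add: bij_betw_def)
    fix g h :: "'n cmat" and f assume "unitary g" "unitary h" and f: "f \<in> wspace \<mu>"
    then have i: "invertible g" "invertible h" by (auto intro: unitary_invertible)
    have "(matrix_inv g, h) \<in> carrier (GL \<times>\<times> GL)" using i by (simp add: DirProd_def GL_simps invertible_matrix_inv)
    from T(3)[OF this f] show "T (bitrans g h f) = bitrans g h (T f)"
      by (simp add: two_sided_act_bitrans matrix_inv_matrix_inv[OF i(1)])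
  qed
  then show "V = wspace \<mu>" using T(1) by (simp add: bij_betw_def)
qed

section \<open>Geometry of the Cartan domain\<close>

text \<open>The Hermitian inner product of column vectors; the norm on them is the Euclidean one.\<close>

definition herm :: "complex^'n \<Rightarrow> complex^'n \<Rightarrow> complex" where
  "herm u v = (\<Sum>i\<in>UNIV. cnj (u $ i) * v $ i)"

lemma herm_self: "herm v v = of_real ((norm v)\<^sup>2)" for v :: "complex^'n::finite"
proof -
  have "(norm v)\<^sup>2 = (\<Sum>i\<in>UNIV. (cmod (v $ i))\<^sup>2)"
    by (simp add: norm_vec_def L2_set_def sum_nonneg)
  then show ?thesis by (simp add: herm_def complex_norm_square[symmetric] mult.commute)
qed

lemma norm_eq_if_herm_eq: "herm u u = herm v v \<Longrightarrow> norm u = norm (v :: complex^'n::finite)"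
  unfolding herm_self of_real_eq_iff by (simp add: power2_eq_iff_nonneg)

lemma herm_adj: "herm u (A *v v) = herm (adj A *v u) (v :: complex^'n::finite)"
proof -
  have "herm u (A *v v) = (\<Sum>i\<in>UNIV. \<Sum>j\<in>UNIV. cnj (u $ i) * (A $ i $ j * v $ j))"
    by (simp add: herm_def matrix_vector_mult_def sum_distrib_left)
  also have "\<dots> = (\<Sum>j\<in>UNIV. \<Sum>i\<in>UNIV. cnj (u $ i) * (A $ i $ j * v $ j))" by (rule sum.swap)
  also have "\<dots> = herm (adj A *v u) v"
    by (simp add: herm_def matrix_vector_mult_def cnj_sum sum_distrib_right sum_distrib_left mult_ac)
  finally show ?thesis .
qed

lemma herm_diff_right: "herm u (v - w) = herm u v - herm u (w :: complex^'n::finite)"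
  by (simp add: herm_def right_diff_distrib sum_subtractf)

text \<open>The domain is the open unit ball of the operator norm.\<close>

lemma cartan_domain_iff:
  "Z \<in> cartan_domain \<longleftrightarrow> (\<forall>v. v \<noteq> 0 \<longrightarrow> norm (Z *v v) < norm (v :: complex^'n::finite))"
proof -
  have 1: "adj (mat 1 - adj Z ** Z) = mat 1 - adj Z ** Z" by (simp add: adj_diff adj_mult)
  have 2: "Re (\<Sum>i\<in>UNIV. cnj (v $ i) * ((mat 1 - adj Z ** Z) *v v) $ i) = (norm v)\<^sup>2 - (norm (Z *v v))\<^sup>2" for v
  proof -
    have "(mat 1 - adj Z ** Z) *v v = v - adj Z *v (Z *v v)"
      by (simp add: matrix_vector_mult_diff_rdistrib matrix_vector_mul_assoc)
    then have "(\<Sum>i\<in>UNIV. cnj (v $ i) * ((mat 1 - adj Z ** Z) *v v) $ i) = herm v (v - adj Z *v (Z *v v))"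
      by (simp only: herm_def)
    also have "\<dots> = herm v v - herm v (adj Z *v (Z *v v))" by (rule herm_diff_right)
    also have "\<dots> = herm v v - herm (Z *v v) (Z *v v)" by (simp add: herm_adj)
    finally show ?thesis by (simp add: herm_self)
  qed
  have "norm (Z *v v) < norm v \<longleftrightarrow> 0 < (norm v)\<^sup>2 - (norm (Z *v v))\<^sup>2" for v :: "complex^'n"
    using power_strict_mono[of "norm (Z *v v)" "norm v" 2] power2_less_imp_less[of "norm (Z *v v)" "norm v"] by auto
  then show ?thesis unfolding cartan_domain_def pos_def_def mem_Collect_eq 1 2 by simp
qed

lemma norm_matrix_mult_le:
  "norm ((A :: 'n cmat) *v v) \<le> (real CARD('n))\<^sup>2 * (norm A * norm (v :: complex^'n::finite))"
proof -
  have comp: "norm ((A *v v) $ i) \<le> real CARD('n) * (norm A * norm v)" for i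
  proof -
    have "norm ((A *v v) $ i) \<le> (\<Sum>j\<in>UNIV. norm (A $ i $ j * v $ j))"
      unfolding matrix_vector_mult_def vec_lambda_beta by (rule norm_sum)
    also have "\<dots> \<le> (\<Sum>j\<in>(UNIV :: 'n set). norm A * norm v)"
    proof (rule sum_mono)
      fix j
      have "norm (A $ i $ j) \<le> norm (A $ i)" "norm (A $ i) \<le> norm A" by (rule Finite_Cartesian_Product.norm_nth_le)+
      then have "norm (A $ i $ j) \<le> norm A" by linarith
      then show "norm (A $ i $ j * v $ j) \<le> norm A * norm v"
        unfolding norm_mult by (intro mult_mono Finite_Cartesian_Product.norm_nth_le) auto
    qed
    finally show ?thesis by simp
  qed
  have "(\<Sum>i\<in>UNIV. norm ((A *v v) $ i)) \<le> (\<Sum>i\<in>(UNIV :: 'n set). real CARD('n) * (norm A * norm v))"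
    by (rule sum_mono[OF comp])
  moreover have "norm (A *v v) \<le> (\<Sum>i\<in>UNIV. norm ((A *v v) $ i))"
    unfolding norm_vec_def by (rule L2_set_le_sum) simp
  ultimately show ?thesis by (simp add: power2_eq_square mult.assoc)
qed

text \<open>By compactness of the sphere the operator norm of \<open>Z\<close> is attained and therefore leaves some room below \<open>1\<close>.\<close>

lemma cartan_domain_open: "open (cartan_domain :: 'n::finite cmat set)"
proof (rule openI)
  fix Z :: "'n cmat" assume Z: "Z \<in> cartan_domain"
  have ne: "sphere (0 :: complex^'n) 1 \<noteq> {}" by simp
  have "continuous_on (sphere 0 1) (\<lambda>v. norm (Z *v (v :: complex^'n)))"
    unfolding matrix_vector_mult_def by (intro continuous_intros)
  then obtain v0 where v0: "v0 \<in> sphere 0 1" "\<And>v. v \<in> sphere 0 1 \<Longrightarrow> norm (Z *v v) \<le> norm (Z *v v0)"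
    using continuous_attains_sup[OF compact_sphere ne, of "\<lambda>v. norm (Z *v v)"] by blast
  define m where "m = norm (Z *v v0)"
  have "v0 \<noteq> 0" using v0(1) by auto
  then have m: "m < 1" using Z v0(1) unfolding cartan_domain_iff m_def by auto
  define N where "N = (real CARD('n))\<^sup>2"
  have N: "N > 0" by (simp add: N_def)
  have "ball Z ((1 - m) / N) \<subseteq> cartan_domain"
  proof
    fix Y assume "Y \<in> ball Z ((1 - m) / N)"
    then have Y: "N * norm (Y - Z) < 1 - m" using N by (simp add: dist_norm norm_minus_commute field_simps)
    show "Y \<in> cartan_domain" unfolding cartan_domain_iff
    proof (intro allI impI)
      fix v :: "complex^'n" assume v: "v \<noteq> 0"
      define u where "u = (1 / norm v) *\<^sub>R v"
      have u: "u \<in> sphere 0 1" using v by (simp add: u_def)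
      have Au: "norm (A *v u) = norm (A *v v) / norm v" for A :: "'n cmat"
      proof -
        have "A *v u = (1 / norm v) *\<^sub>R (A *v v)"
          by (simp add: u_def vec_eq_iff matrix_vector_mult_def scaleR_sum_right)
        then show ?thesis by simp
      qed
      have "Y *v u = Z *v u + (Y - Z) *v u" by (simp add: matrix_vector_mult_diff_rdistrib)
      then have "norm (Y *v u) \<le> norm (Z *v u) + norm ((Y - Z) *v u)" by (metis norm_triangle_ineq)
      also have "\<dots> \<le> m + N * norm (Y - Z)"
        using v0(2)[OF u] norm_matrix_mult_le[of "Y - Z" u] u by (simp add: m_def N_def)
      also have "\<dots> < 1" using Y by simp
      finally show "norm (Y *v v) < norm v" using v unfolding Au by (simp add: field_simps)
    qed
  qed
  then show "\<exists>e>0. ball Z e \<subseteq> cartan_domain" using m N by (intro exI[of _ "(1 - m) / N"]) simp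
qed

lemma norm_axis_one: "norm (axis j (1 :: complex)) = 1"
  unfolding norm_vec_def L2_set_def axis_def
  by (simp add: if_distrib[of norm] if_distrib[of "\<lambda>x. x ^ 2"] cong: if_cong)

lemma cartan_domain_entry:
  assumes "Z \<in> cartan_domain" shows "norm (Z $ i $ j) < 1"
proof -
  have "norm (Z *v axis j 1) < norm (axis j (1 :: complex))"
    using assms unfolding cartan_domain_iff by (metis axis_eq_0_iff zero_neq_one)
  moreover have "(Z *v axis j 1) $ i = Z $ i $ j"
    by (simp add: matrix_vector_mult_def axis_def if_distrib[of "\<lambda>x. _ * x"] cong: if_cong)
  moreover have "norm ((Z *v axis j 1) $ i) \<le> norm (Z *v axis j 1)" by (rule Finite_Cartesian_Product.norm_nth_le)
  ultimately show ?thesis by (simp add: norm_axis_one)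
qed

lemma norm_cmat_le: 
  assumes "\<And>i j. norm (Z $ i $ j) \<le> b" shows "norm (Z :: 'n::finite cmat) \<le> (real CARD('n))\<^sup>2 * b"
proof -
  have "norm Z \<le> (\<Sum>i\<in>UNIV. norm (Z $ i))" unfolding norm_vec_def[of Z] by (rule L2_set_le_sum) simp
  also have "\<dots> \<le> (\<Sum>i\<in>UNIV. \<Sum>j\<in>UNIV. norm (Z $ i $ j))"
    by (rule sum_mono) (simp add: norm_vec_def L2_set_le_sum)
  also have "\<dots> \<le> (\<Sum>i\<in>(UNIV :: 'n set). \<Sum>j\<in>(UNIV :: 'n set). b)" by (intro sum_mono assms)
  finally show ?thesis by (simp add: power2_eq_square)
qed

lemma cartan_domain_bounded: "bounded (cartan_domain :: 'n::finite cmat set)"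
proof -
  have "norm Z \<le> (real CARD('n))\<^sup>2 * 1" if "Z \<in> cartan_domain" for Z :: "'n cmat"
    by (rule norm_cmat_le) (use cartan_domain_entry[OF that] less_imp_le in blast)
  then show ?thesis unfolding bounded_iff by blast
qed

lemma cartan_domain_0: "0 \<in> cartan_domain"
  by (simp add: cartan_domain_iff)

lemma cartan_domain_contraction_left:
  assumes Z: "Z \<in> cartan_domain" and C: "\<And>v. norm (C *v v) \<le> norm v" shows "C ** Z \<in> cartan_domain"
  unfolding cartan_domain_iff
proof (intro allI impI)
  fix v :: "complex^'a" assume "v \<noteq> 0"
  then have "norm (Z *v v) < norm v" using Z by (simp add: cartan_domain_iff)
  then show "norm (C ** Z *v v) < norm v" using C[of "Z *v v"] by (simp add: matrix_vector_mul_assoc[symmetric])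
qed

lemma norm_diag_mult_le:
  assumes "\<And>i. cmod (t i) \<le> 1" shows "norm (diag_mat t *v v) \<le> norm (v :: complex^'n::finite)"
  unfolding norm_vec_def
proof (rule L2_set_mono)
  fix i
  have "(diag_mat t *v v) $ i = t i * v $ i"
    by (simp add: matrix_vector_mult_def diag_mat_def if_distrib[of "\<lambda>x. x * _"] cong: if_cong)
  then show "norm ((diag_mat t *v v) $ i) \<le> norm (v $ i)"
    using mult_right_mono[OF assms[of i], of "cmod (v $ i)"] by (simp add: norm_mult)
qed simp

lemma cartan_domain_diag: "Z \<in> cartan_domain \<Longrightarrow> (\<And>i. cmod (t i) \<le> 1) \<Longrightarrow> diag_mat t ** Z \<in> cartan_domain"
  by (rule cartan_domain_contraction_left[OF _ norm_diag_mult_le])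

lemma cartan_domain_scale: "Z \<in> cartan_domain \<Longrightarrow> cmod c \<le> 1 \<Longrightarrow> mat c ** Z \<in> cartan_domain"
  using cartan_domain_diag[of Z "\<lambda>i. c"] by (simp add: diag_mat_const)

lemma unitary_norm: "unitary u \<Longrightarrow> norm (u *v v) = norm (v :: complex^'n::finite)"
  by (rule norm_eq_if_herm_eq) (simp add: herm_adj matrix_vector_mul_assoc unitary_def)

lemma cartan_domain_unitary:
  assumes "unitary g" "unitary h" "Z \<in> cartan_domain" shows "g ** Z ** h \<in> cartan_domain"
  unfolding cartan_domain_iff
proof (intro allI impI)
  fix v :: "complex^'a" assume "v \<noteq> 0"
  then have "h *v v \<noteq> 0" using unitary_norm[OF assms(2), of v] by (metis norm_eq_zero)
  then have "norm (Z *v (h *v v)) < norm (h *v v)" using assms(3) by (simp add: cartan_domain_iff)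
  then show "norm (g ** Z ** h *v v) < norm v"
    using unitary_norm[OF assms(1)] unitary_norm[OF assms(2)] by (simp add: matrix_vector_mul_assoc[symmetric])
qed

lemma cartan_domain_unitary_iff:
  assumes "unitary g" "unitary h" shows "g ** Z ** h \<in> cartan_domain \<longleftrightarrow> Z \<in> cartan_domain"
proof
  assume "g ** Z ** h \<in> cartan_domain"
  then have "adj g ** (g ** Z ** h) ** adj h \<in> cartan_domain"
    by (rule cartan_domain_unitary[OF unitary_adj[OF assms(1)] unitary_adj[OF assms(2)]])
  moreover have "adj g ** (g ** Z ** h) ** adj h = (adj g ** g) ** Z ** (h ** adj h)" by (simp add: matrix_mul_assoc)
  moreover have "adj g ** g = mat 1" "h ** adj h = mat 1" using assms unitary_adj[OF assms(2)] by (simp_all add: unitary_def)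
  ultimately show "Z \<in> cartan_domain" by simp
qed (rule cartan_domain_unitary[OF assms])

definition rho :: "'n::finite cmat \<Rightarrow> real" where "rho Z = Re (det (mat 1 - Z ** adj Z))"

text \<open>If \<open>Z Z\<^sup>* v = v\<close>, then \<open>w = Z\<^sup>* v\<close> is mapped to \<open>v\<close> and has the same norm, against strict contraction.\<close>

lemma cartan_domain_det_nonzero:
  assumes Z: "Z \<in> cartan_domain" shows "det (mat 1 - Z ** adj Z) \<noteq> 0"
proof
  assume "det (mat 1 - Z ** adj Z) = 0"
  then have "\<not> invertible (mat 1 - Z ** adj Z)" by (simp add: invertible_det_nz)
  then have "\<not> (\<forall>x. (mat 1 - Z ** adj Z) *v x = 0 \<longrightarrow> x = 0)"
    using matrix_left_invertible_ker invertible_left_inverse by blast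
  then obtain v where v: "(mat 1 - Z ** adj Z) *v v = 0" "v \<noteq> 0" by blast
  define w where "w = adj Z *v v"
  have vw: "v = Z *v w"
    using v(1) by (simp add: w_def matrix_vector_mult_diff_rdistrib matrix_vector_mul_assoc)
  have "w \<noteq> 0"
  proof
    assume "w = 0"
    then have "v = 0" unfolding vw by simp
    then show False using v(2) by simp
  qed
  then have "norm v < norm w" using Z vw unfolding cartan_domain_iff by metis
  moreover have "herm w w = herm v v"
  proof -
    have "herm w w = herm (adj Z *v v) w" by (simp only: w_def[symmetric])
    also have "\<dots> = herm v (Z *v w)" by (simp only: herm_adj)
    finally show ?thesis by (simp only: vw[symmetric])
  qed
  ultimately show False using norm_eq_if_herm_eq by fastforce
qed

lemma det_real: "det (mat 1 - Z ** adj Z) = of_real (rho Z)"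
proof -
  have "adj (mat 1 - Z ** adj Z) = mat 1 - Z ** adj Z" by (simp add: adj_diff adj_mult)
  then have "cnj (det (mat 1 - Z ** adj Z)) = det (mat 1 - Z ** adj Z)" by (metis det_adj)
  then show ?thesis unfolding rho_def by (metis Reals_cnj_iff of_real_Re)
qed

lemma continuous_rho: "continuous_on S rho"
proof -
  have 1: "continuous_on S (\<lambda>Z. (mat 1 - Z ** adj Z) $ i $ j)" for i j
    unfolding matrix_matrix_mult_def adj_def by (simp, intro continuous_intros)
  show ?thesis unfolding rho_def det_def
    by (intro continuous_on_Re continuous_on_sum continuous_on_mult continuous_on_const continuous_on_prod 1)
qed

text \<open>Along the segment from \<open>0\<close> to \<open>Z\<close> the determinant is real, nonzero and equal to \<open>1\<close> at the start.\<close>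

lemma rho_pos:
  assumes Z: "Z \<in> cartan_domain" shows "0 < rho Z"
proof (rule ccontr)
  assume "\<not> 0 < rho Z"
  define p where "p = (\<lambda>s :: real. rho (mat (of_real s) ** Z))"
  have "continuous_on {0..1} p"
  proof -
    have "continuous_on {0..1} (\<lambda>s :: real. mat (of_real s) ** Z)"
      unfolding continuous_on_def by (intro ballI vec_tendstoI) (auto intro!: tendsto_eq_intros)
    then show ?thesis unfolding p_def by (rule continuous_on_compose2[OF continuous_rho[of UNIV]]) auto
  qed
  moreover have "mat 0 ** Z = 0" "mat 1 ** Z = Z" by (simp_all add: vec_eq_iff)
  then have "p 0 = 1" "p 1 \<le> 0" using \<open>\<not> 0 < rho Z\<close> by (simp_all add: p_def rho_def)
  ultimately obtain s where s: "0 \<le> s" "s \<le> 1" "p s = 0"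
    using IVT2'[of p 1 0 0] by auto
  have "mat (of_real s) ** Z \<in> cartan_domain" using Z s by (intro cartan_domain_scale) auto
  then show False using cartan_domain_det_nonzero det_real s(3) unfolding p_def by (metis of_real_0)
qed

lemma rho_unitary:
  assumes "unitary g" "unitary h" shows "rho (g ** Z ** h) = rho Z"
proof -
  have gg: "g ** adj g = mat 1" "h ** adj h = mat 1" "adj g ** g = mat 1"
    using unitary_adj[OF assms(1)] unitary_adj[OF assms(2)] assms by (simp_all add: unitary_def)
  have "mat 1 - (g ** Z ** h) ** adj (g ** Z ** h) = g ** (mat 1 - Z ** adj Z) ** adj g"
  proof -
    have "(g ** Z ** h) ** adj (g ** Z ** h) = g ** Z ** (h ** adj h) ** adj Z ** adj g"
      by (simp add: adj_mult matrix_mul_assoc)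
    then show ?thesis by (simp add: gg matrix_mult_distribs matrix_mul_assoc)
  qed
  then have "det (mat 1 - (g ** Z ** h) ** adj (g ** Z ** h)) = det (mat 1 - Z ** adj Z) * (det g * det (adj g))"
    by (simp add: det_mul)
  moreover have "det g * det (adj g) = 1" by (metis det_I det_mul gg(1))
  ultimately show ?thesis by (simp add: rho_def)
qed

section \<open>Linear changes of variables\<close>

lemma nn_integral_lborel_add:
  fixes f :: "'a::euclidean_space \<Rightarrow> ennreal"
  assumes [measurable]: "f \<in> borel_measurable borel"
  shows "(\<integral>\<^sup>+x. f (a + x) \<partial>lborel) = (\<integral>\<^sup>+x. f x \<partial>lborel)"
proof -
  have "(\<integral>\<^sup>+x. f x \<partial>lborel) = (\<integral>\<^sup>+x. f x \<partial>(distr lborel borel ((+) a)))" by (simp add: lborel_distr_plus)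
  also have "\<dots> = (\<integral>\<^sup>+x. f (a + x) \<partial>lborel)" by (rule nn_integral_distr) auto
  finally show ?thesis by simp
qed

lemma nn_integral_lborel_diff:
  fixes f :: "'a::euclidean_space \<Rightarrow> ennreal"
  assumes [measurable]: "f \<in> borel_measurable borel"
  shows "(\<integral>\<^sup>+x. f (a - x) \<partial>lborel) = (\<integral>\<^sup>+x. f x \<partial>lborel)"
proof -
  have "lborel = density (distr lborel borel (\<lambda>x. a + (- 1) *\<^sub>R x)) (\<lambda>_. ennreal (\<bar>- 1 :: real\<bar> ^ DIM('a)))"
    by (rule lborel_affine) simp
  then have l: "lborel = distr lborel borel (\<lambda>x :: 'a. a - x)" by (simp add: density_1)
  have "(\<integral>\<^sup>+x. f x \<partial>lborel) = (\<integral>\<^sup>+x. f x \<partial>(distr lborel borel (\<lambda>x. a - x)))" by (subst l) simp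
  also have "\<dots> = (\<integral>\<^sup>+x. f (a - x) \<partial>lborel)" by (rule nn_integral_distr) auto
  finally show ?thesis by simp
qed

text \<open>A linear bijection scales Lebesgue measure by a constant. In this form, proved by the Fubini theorem from
  translation invariance alone, the constant need not be known.\<close>

lemma nn_integral_linear_proportional:
  fixes T :: "'a::euclidean_space \<Rightarrow> 'a" and f g :: "'a \<Rightarrow> ennreal"
  assumes T: "linear T" "surj T" and [measurable]: "f \<in> borel_measurable borel" "g \<in> borel_measurable borel"
  shows "(\<integral>\<^sup>+x. f (T x) \<partial>lborel) * (\<integral>\<^sup>+x. g x \<partial>lborel) = (\<integral>\<^sup>+x. f x \<partial>lborel) * (\<integral>\<^sup>+x. g (T x) \<partial>lborel)"
proof -
  have [measurable]: "T \<in> borel_measurable borel"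
    by (intro borel_measurable_continuous_onI linear_continuous_on) (simp add: T(1) linear_conv_bounded_linear[symmetric])
  have 1: "(\<integral>\<^sup>+x. f (T x) \<partial>lborel) = (\<integral>\<^sup>+x. f (T x - y) \<partial>lborel)" for y
  proof -
    obtain z where z: "T z = - y" using T(2) by (metis surjD)
    have "(\<integral>\<^sup>+x. f (T (z + x)) \<partial>lborel) = (\<integral>\<^sup>+x. f (T x) \<partial>lborel)"
      by (rule nn_integral_lborel_add) measurable
    then show ?thesis using z T(1) by (simp add: linear_add)
  qed
  have "(\<integral>\<^sup>+x. f (T x) \<partial>lborel) * (\<integral>\<^sup>+x. g x \<partial>lborel) = (\<integral>\<^sup>+y. (\<integral>\<^sup>+x. f (T x - y) \<partial>lborel) * g y \<partial>lborel)"
    by (subst nn_integral_cmult[symmetric]) (simp_all add: 1[symmetric])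
  also have "\<dots> = (\<integral>\<^sup>+y. (\<integral>\<^sup>+x. f (T x - y) * g y \<partial>lborel) \<partial>lborel)"
    by (rule nn_integral_cong) (simp add: nn_integral_multc)
  also have "\<dots> = (\<integral>\<^sup>+x. (\<integral>\<^sup>+y. f (T x - y) * g y \<partial>lborel) \<partial>lborel)"
    by (rule lborel_pair.Fubini') measurable
  also have "\<dots> = (\<integral>\<^sup>+x. (\<integral>\<^sup>+y. f y * g (T x - y) \<partial>lborel) \<partial>lborel)"
  proof (rule nn_integral_cong)
    fix x
    have "(\<integral>\<^sup>+y. (\<lambda>y. f y * g (T x - y)) (T x - y) \<partial>lborel) = (\<integral>\<^sup>+y. f y * g (T x - y) \<partial>lborel)"
      by (rule nn_integral_lborel_diff) measurable
    then show "(\<integral>\<^sup>+y. f (T x - y) * g y \<partial>lborel) = (\<integral>\<^sup>+y. f y * g (T x - y) \<partial>lborel)" by simp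
  qed
  also have "\<dots> = (\<integral>\<^sup>+y. (\<integral>\<^sup>+x. f y * g (T x - y) \<partial>lborel) \<partial>lborel)"
    by (rule lborel_pair.Fubini') measurable
  also have "\<dots> = (\<integral>\<^sup>+y. f y * (\<integral>\<^sup>+x. g (T x) \<partial>lborel) \<partial>lborel)"
  proof (rule nn_integral_cong)
    fix y
    obtain z where z: "T z = - y" using T(2) by (metis surjD)
    have "(\<integral>\<^sup>+x. g (T (z + x)) \<partial>lborel) = (\<integral>\<^sup>+x. g (T x) \<partial>lborel)"
      by (rule nn_integral_lborel_add) measurable
    then have "(\<integral>\<^sup>+x. g (T x - y) \<partial>lborel) = (\<integral>\<^sup>+x. g (T x) \<partial>lborel)" using z T(1) by (simp add: linear_add)
    then show "(\<integral>\<^sup>+x. f y * g (T x - y) \<partial>lborel) = f y * (\<integral>\<^sup>+x. g (T x) \<partial>lborel)"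
      by (simp add: nn_integral_cmult)
  qed
  also have "\<dots> = (\<integral>\<^sup>+x. f x \<partial>lborel) * (\<integral>\<^sup>+x. g (T x) \<partial>lborel)" by (rule nn_integral_multc) measurable
  finally show ?thesis .
qed

lemma emeasure_lborel_open_pos:
  assumes "open U" "U \<noteq> {}" shows "0 < emeasure lborel (U :: 'a::euclidean_space set)"
proof -
  have "\<not> negligible U" by (rule open_not_negligible[OF assms])
  then have "U \<notin> null_sets lebesgue" by (simp add: negligible_iff_null_sets)
  then have "emeasure lborel U \<noteq> 0" using assms(1) null_sets_completionI[of U lborel] by (auto simp: null_sets_def)
  then show ?thesis by (simp add: zero_less_iff_neq_zero)
qed

lemma cartan_domain_borel [measurable]: "cartan_domain \<in> sets borel"
  by (rule borel_open[OF cartan_domain_open])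

lemma cartan_domain_emeasure:
  "0 < emeasure lborel (cartan_domain :: 'n::finite cmat set)" "emeasure lborel (cartan_domain :: 'n::finite cmat set) < \<infinity>"
proof -
  show "0 < emeasure lborel (cartan_domain :: 'n::finite cmat set)"
    by (rule emeasure_lborel_open_pos[OF cartan_domain_open]) (use cartan_domain_0 in blast)
  show "emeasure lborel (cartan_domain :: 'n::finite cmat set) < \<infinity>" by (rule emeasure_bounded_finite[OF cartan_domain_bounded])
qed

lemma bitrans_map_linear: "linear (\<lambda>Z :: 'n cmat. (g :: 'n::finite cmat) ** Z ** (h :: 'n cmat))"
proof (rule linearI)
  show "g ** (Y + Z) ** h = g ** Y ** h + g ** Z ** h" for Y Z :: "'n cmat" by (simp add: matrix_mult_distribs)
  have "g ** (c *\<^sub>R Z) = c *\<^sub>R (g ** Z)" "(c *\<^sub>R Z) ** h = c *\<^sub>R (Z ** h)" for c and Z :: "'n cmat"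
    by (simp_all add: vec_eq_iff matrix_matrix_mult_def scaleR_sum_right)
  then show "g ** (c *\<^sub>R Z) ** h = c *\<^sub>R (g ** Z ** h)" for c and Z :: "'n cmat" by simp
qed

lemma bitrans_map_surj: "invertible g \<Longrightarrow> invertible h \<Longrightarrow> surj (\<lambda>Z :: 'n cmat. (g :: 'n::finite cmat) ** Z ** (h :: 'n cmat))"
proof (rule surjI)
  fix Y :: "'n cmat" assume gh: "invertible g" "invertible h"
  have "g ** (matrix_inv g ** Y ** matrix_inv h) ** h = (g ** matrix_inv g) ** Y ** (matrix_inv h ** h)"
    by (simp only: matrix_mul_assoc)
  then show "g ** (matrix_inv g ** Y ** matrix_inv h) ** h = Y"
    by (simp add: matrix_inv_props gh)
qed

text \<open>The constant is \<open>1\<close>, because the domain is mapped to itself and has positive finite measure.\<close>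

lemma nn_integral_unitary:
  fixes f :: "'n::finite cmat \<Rightarrow> ennreal"
  assumes g: "unitary g" and h: "unitary h" and [measurable]: "f \<in> borel_measurable borel"
  shows "(\<integral>\<^sup>+Z. f (g ** Z ** h) \<partial>lborel) = (\<integral>\<^sup>+Z. f Z \<partial>lborel)"
proof -
  let ?D = "cartan_domain :: 'n cmat set"
  have "(\<integral>\<^sup>+Z. f (g ** Z ** h) \<partial>lborel) * (\<integral>\<^sup>+Z. indicator ?D Z \<partial>lborel)
    = (\<integral>\<^sup>+Z. f Z \<partial>lborel) * (\<integral>\<^sup>+Z. indicator ?D (g ** Z ** h) \<partial>lborel)"
    by (rule nn_integral_linear_proportional[OF bitrans_map_linear bitrans_map_surj])
      (auto intro: unitary_invertible g h)
  moreover have "indicator ?D (g ** Z ** h) = (indicator ?D Z :: ennreal)" for Z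
    using cartan_domain_unitary_iff[OF g h, of Z] by (simp add: indicator_def)
  ultimately have "(\<integral>\<^sup>+Z. f (g ** Z ** h) \<partial>lborel) * emeasure lborel ?D = (\<integral>\<^sup>+Z. f Z \<partial>lborel) * emeasure lborel ?D" by simp
  then show ?thesis
    using cartan_domain_emeasure[where 'n='n] by (metis mult_divide_eq_ennreal infinity_ennreal_def less_irrefl)
qed

section \<open>Finiteness of the weighted volume\<close>

text \<open>Only row \<open>k\<close> is multiplied by \<open>s\<close>. The integral over the domain is bounded by scaling one row at a time.\<close>

definition row_scale :: "'n \<Rightarrow> complex \<Rightarrow> 'n::finite cmat" where
  "row_scale k s = diag_mat (\<lambda>i. if i = k then s else 1)"

definition row_delete :: "'n set \<Rightarrow> 'n::finite cmat" where
  "row_delete K = diag_mat (\<lambda>i. if i \<in> K then 0 else 1)"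

lemma row_scale_mult: "row_scale k s ** row_scale k t = row_scale k (s * t)"
  by (simp add: row_scale_def diag_mult_diag if_distrib cong: if_cong)

lemma row_scale_1: "row_scale k 1 = mat 1"
  by (simp add: row_scale_def diag_mat_const)

lemma row_delete_scale: "row_delete K ** row_scale k s = row_scale k s ** row_delete K"
  by (simp add: row_scale_def row_delete_def diag_mult_diag mult.commute)

lemma row_scale_0_delete: "row_scale k 0 ** row_delete K = row_delete (insert k K)"
  by (simp add: row_scale_def row_delete_def diag_mult_diag if_distrib cong: if_cong)
    (rule arg_cong[of _ _ diag_mat], auto)

lemma adj_row_scale: "adj (row_scale k (of_real s)) = row_scale k (of_real s)"
  by (auto simp: row_scale_def vec_eq_iff diag_mat_def)

lemma row_scale_cartan: "Z \<in> cartan_domain \<Longrightarrow> cmod s \<le> 1 \<Longrightarrow> row_scale k s ** Z \<in> cartan_domain"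
  unfolding row_scale_def by (rule cartan_domain_diag) auto

lemma row_delete_cartan: "Z \<in> cartan_domain \<Longrightarrow> row_delete K ** Z \<in> cartan_domain"
  unfolding row_delete_def by (rule cartan_domain_diag) auto

lemma det_row_scale: "det (row_scale k s :: 'n::finite cmat) = s"
  unfolding row_scale_def by (subst det_diagonal) (auto simp: diag_mat_def)

text \<open>The determinant is affine in \<open>s\<^sup>2\<close>: for \<open>s \<noteq> 0\<close> pull \<open>s\<close> out of row and column \<open>k\<close>, which leaves
  \<open>1 / s\<^sup>2\<close> in the diagonal entry only.\<close>

lemma det_minus_row_scaled:
  fixes G :: "'n::finite cmat"
  shows "\<exists>a b. \<forall>s. det (mat 1 - row_scale k s ** G ** row_scale k s) = b + a * s\<^sup>2"
proof -
  define M where "M = mat 1 - G"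
  define N where "N = (\<lambda>t :: complex. \<chi> i. if i = k then M $ i + (t - 1) *s axis k 1 else M $ i)"
  define b where "b = det (\<chi> i. if i = k then axis k 1 else M $ i)"
  have N: "det (N t) = det M + (t - 1) * b" for t
  proof -
    have "det (N t) = det (\<chi> i. if i = k then M $ i else M $ i) + det (\<chi> i. if i = k then (t - 1) *s axis k 1 else M $ i)"
      unfolding N_def by (rule det_row_add)
    also have "det (\<chi> i. if i = k then (t - 1) *s axis k 1 else M $ i) = (t - 1) * b"
      unfolding b_def by (rule det_row_mul)
    finally show ?thesis by simp
  qed
  have 1: "det (mat 1 - row_scale k s ** G ** row_scale k s) = b + (det M - b) * s\<^sup>2" if s: "s \<noteq> 0" for s
  proof -
    have "mat 1 - row_scale k s ** G ** row_scale k s = row_scale k s ** N (1 / s\<^sup>2) ** row_scale k s"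
      using s by (auto simp: vec_eq_iff row_scale_def diag_mult_nth mult_diag_nth N_def M_def mat_def axis_def field_simps power2_eq_square)
    then have "det (mat 1 - row_scale k s ** G ** row_scale k s) = s * (det M + (1 / s\<^sup>2 - 1) * b) * s"
      by (simp add: det_mul det_row_scale N)
    moreover have "s * (det M + (t - 1) * b) * s = (det M - b) * s\<^sup>2 + b * (s\<^sup>2 * t)" for t
      by (simp add: algebra_simps power2_eq_square)
    ultimately show ?thesis using s by simp
  qed
  have "det (mat 1 - row_scale k s ** G ** row_scale k s) = b + (det M - b) * s\<^sup>2" for s
  proof (rule is_poly1_eq_if_eq_off_0[where \<phi>="\<lambda>s. det (mat 1 - row_scale k s ** G ** row_scale k s)"])
    show "is_poly1 (\<lambda>s. det (mat 1 - row_scale k s ** G ** row_scale k s))"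
    proof (rule det_is_poly1)
      fix i j
      have "is_poly1 (\<lambda>s. row_scale k s $ i $ j)" for i j
        unfolding row_scale_def diag_mat_def vec_lambda_beta by (intro is_poly1_if is_poly1_const is_poly1_ident)
      then show "is_poly1 (\<lambda>s. (mat 1 - row_scale k s ** G ** row_scale k s) $ i $ j)"
        unfolding vector_minus_component by (intro is_poly1_diff is_poly1_mult_entry is_poly1_const)
    qed
    show "is_poly1 (\<lambda>s. b + (det M - b) * s\<^sup>2)"
      by (intro is_poly1_add is_poly1_mult is_poly1_power is_poly1_const is_poly1_ident)
  qed (rule 1)
  then show ?thesis by blast
qed

lemma rho_row_scale:
  fixes Y :: "'n::finite cmat"
  shows "\<exists>a. \<forall>s :: real. rho (row_scale k (of_real s) ** Y) = rho (row_scale k 0 ** Y) + a * s\<^sup>2"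
proof -
  obtain a b where ab: "\<And>s. det (mat 1 - row_scale k s ** (Y ** adj Y) ** row_scale k s) = b + a * s\<^sup>2"
    using det_minus_row_scaled[of k "Y ** adj Y"] by blast
  have r: "rho (row_scale k (of_real s) ** Y) = Re b + Re a * s\<^sup>2" for s :: real
  proof -
    have "(row_scale k (of_real s) ** Y) ** adj (row_scale k (of_real s) ** Y)
        = row_scale k (of_real s) ** (Y ** adj Y) ** row_scale k (of_real s)"
      by (simp add: adj_mult adj_row_scale matrix_mul_assoc)
    then have "rho (row_scale k (of_real s) ** Y) = Re (b + a * (of_real s)\<^sup>2)" unfolding rho_def by (simp only: ab)
    then show ?thesis by (simp add: power2_eq_square)
  qed
  from r[of 0] have "rho (row_scale k 0 ** Y) = Re b" by simp
  then show ?thesis using r by auto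
qed

lemma nn_integral_powr_0_1:
  assumes "\<alpha> > -1"
  shows "(\<integral>\<^sup>+u. ennreal (u powr \<alpha>) * indicator {0..1} u \<partial>lborel) = ennreal (1 / (\<alpha> + 1))"
proof -
  have "((\<lambda>x. x powr \<alpha>) has_integral (1 powr (\<alpha> + 1) / (\<alpha> + 1))) {0..1}"
    by (rule has_integral_powr_from_0) (use assms in auto)
  then show ?thesis using nn_integral_has_integral_lebesgue'[of "{0..1}" "\<lambda>x. x powr \<alpha>"] by simp
qed

text \<open>Let \<open>a = - m q\<close>. If \<open>q > 0\<close>, then \<open>1 - q s\<^sup>2 \<ge> 1 - sqrt q * s\<close> where the left side is positive; the singularity is at worst that of
  \<open>u powr \<alpha>\<close> at \<open>0\<close>, which is integrable for \<open>\<alpha> > -1\<close>. The bound is uniform in \<open>a\<close>.\<close>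

lemma radial_integral_bound:
  fixes \<alpha> m a :: real
  assumes \<alpha>: "-1 < \<alpha>" "\<alpha> < 0" and m: "m > 0"
  shows "(\<integral>\<^sup>+s. indicator {1..2} s * (if m + a * s\<^sup>2 > 0 then ennreal ((m + a * s\<^sup>2) powr \<alpha>) else 0) \<partial>lborel)
    \<le> ennreal (2 powr (- \<alpha>) + 4 / (\<alpha> + 1)) * ennreal (m powr \<alpha>)"
proof -
  define C where "C = 2 powr (- \<alpha>) + 4 / (\<alpha> + 1)"
  have C: "1 \<le> 2 powr (- \<alpha>)" "0 < 4 / (\<alpha> + 1)" using \<alpha> by (auto simp: ge_one_powr_ge_zero)
  have box: "(\<integral>\<^sup>+s. indicator {1..2 :: real} s * ennreal K \<partial>lborel) = ennreal K" for K
    by (subst nn_integral_multc) auto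
  define q where "q = - a / m"
  have ms: "m + a * s\<^sup>2 = m * (1 - q * s\<^sup>2)" for s using m by (simp add: q_def field_simps)
  have anti: "y powr \<alpha> \<le> x powr \<alpha>" if "0 < x" "x \<le> y" for x y by (rule powr_mono2') (use that \<alpha> in auto)
  show ?thesis
  proof (cases "q \<le> 0")
    case True
    have "(m + a * s\<^sup>2) powr \<alpha> \<le> m powr \<alpha>" for s
      by (rule anti[OF m]) (use True m in \<open>simp add: ms mult_nonpos_nonneg\<close>)
    then have "(\<integral>\<^sup>+s. indicator {1..2} s * (if m + a * s\<^sup>2 > 0 then ennreal ((m + a * s\<^sup>2) powr \<alpha>) else 0) \<partial>lborel)
      \<le> (\<integral>\<^sup>+s. indicator {1..2 :: real} s * ennreal (m powr \<alpha>) \<partial>lborel)"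
      by (intro nn_integral_mono mult_left_mono) (auto intro: ennreal_leI)
    also have "\<dots> \<le> ennreal (C * m powr \<alpha>)"
      unfolding box
    proof (rule ennreal_leI)
      have "1 \<le> C" using C unfolding C_def by linarith
      from mult_right_mono[OF this, of "m powr \<alpha>"] show "m powr \<alpha> \<le> C * m powr \<alpha>" by simp
    qed
    finally show ?thesis using C by (simp add: C_def ennreal_mult)
  next
    case False
    define c where "c = sqrt q"
    have c: "c > 0" "q = c\<^sup>2" using False by (simp_all add: c_def)
    have cs: "c * s < 1 \<and> 1 - c * s \<le> 1 - q * s\<^sup>2" if "1 \<le> s" "m + a * s\<^sup>2 > 0" for s
    proof -
      have "0 < 1 - q * s\<^sup>2" using that(2) m unfolding ms by (simp add: zero_less_mult_iff)
      then have sq: "(c * s)\<^sup>2 < 1" by (simp add: c(2) power_mult_distrib)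
      have nn: "0 \<le> c * s" using c that by simp
      have lt: "c * s < 1" using sq nn by (simp add: power2_less_1_iff)
      have "(c * s)\<^sup>2 \<le> c * s" using mult_left_mono[of "c * s" 1 "c * s"] lt nn by (simp add: power2_eq_square)
      then show ?thesis using lt by (simp add: c(2) power_mult_distrib)
    qed
    have bd: "(m + a * s\<^sup>2) powr \<alpha> \<le> m powr \<alpha> * (1 - c * s) powr \<alpha>" if "1 \<le> s" "m + a * s\<^sup>2 > 0" for s
    proof -
      note k = cs[OF that]
      have "(m + a * s\<^sup>2) powr \<alpha> = m powr \<alpha> * (1 - q * s\<^sup>2) powr \<alpha>"
        unfolding ms using m k by (simp add: powr_mult)
      also have "\<dots> \<le> m powr \<alpha> * (1 - c * s) powr \<alpha>"
        by (rule mult_left_mono[OF anti]) (use k in auto)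
      finally show ?thesis .
    qed
    show ?thesis
    proof (cases "c \<le> 1 / 4")
      case True
      have "(m + a * s\<^sup>2) powr \<alpha> \<le> 2 powr (- \<alpha>) * m powr \<alpha>" if "1 \<le> s" "s \<le> 2" "m + a * s\<^sup>2 > 0" for s
      proof -
        have "c * s \<le> 1 / 4 * 2" by (rule mult_mono) (use True that in auto)
        then have "1 / 2 \<le> 1 - c * s" by simp
        then have "(1 - c * s) powr \<alpha> \<le> (1 / 2) powr \<alpha>" by (intro anti) auto
        also have "(1 / 2) powr \<alpha> = 2 powr (- \<alpha>)" by (simp add: powr_divide powr_minus_divide)
        finally have "m powr \<alpha> * (1 - c * s) powr \<alpha> \<le> m powr \<alpha> * 2 powr (- \<alpha>)" by (rule mult_left_mono) simp
        then show ?thesis using bd[OF that(1,3)] by (simp add: mult.commute)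
      qed
      then have "(\<integral>\<^sup>+s. indicator {1..2} s * (if m + a * s\<^sup>2 > 0 then ennreal ((m + a * s\<^sup>2) powr \<alpha>) else 0) \<partial>lborel)
        \<le> (\<integral>\<^sup>+s. indicator {1..2 :: real} s * ennreal (2 powr (- \<alpha>) * m powr \<alpha>) \<partial>lborel)"
        by (intro nn_integral_mono) (auto simp: indicator_def intro: ennreal_leI)
      also have "\<dots> \<le> ennreal (C * m powr \<alpha>)"
        unfolding box by (rule ennreal_leI, rule mult_right_mono) (use C in \<open>simp_all add: C_def\<close>)
      finally show ?thesis using C by (simp add: C_def ennreal_mult)
    next
      case c4: False
      define f where "f = (\<lambda>u. ennreal (u powr \<alpha>) * indicator {0..1} u)"
      have fm: "f \<in> borel_measurable borel" unfolding f_def by measurable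
      have "(\<integral>\<^sup>+s. indicator {1..2} s * (if m + a * s\<^sup>2 > 0 then ennreal ((m + a * s\<^sup>2) powr \<alpha>) else 0) \<partial>lborel)
        \<le> (\<integral>\<^sup>+s. ennreal (m powr \<alpha>) * f (1 + (- c) * s) \<partial>lborel)"
      proof (rule nn_integral_mono)
        fix s
        show "indicator {1..2} s * (if m + a * s\<^sup>2 > 0 then ennreal ((m + a * s\<^sup>2) powr \<alpha>) else 0)
          \<le> ennreal (m powr \<alpha>) * f (1 + (- c) * s)"
        proof (cases "s \<in> {1..2} \<and> m + a * s\<^sup>2 > 0")
          case True
          then have "1 - c * s \<in> {0..1}" using cs[of s] c by auto
          then show ?thesis using bd[of s] True by (simp add: f_def ennreal_mult[symmetric] ennreal_leI)
        qed auto
      qed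
      also have "\<dots> = ennreal (m powr \<alpha>) * (\<integral>\<^sup>+s. f (1 + (- c) * s) \<partial>lborel)"
        by (rule nn_integral_cmult) (use fm in measurable)
      also have "\<dots> \<le> ennreal (m powr \<alpha>) * ennreal (4 / (\<alpha> + 1))"
      proof (rule mult_left_mono)
        have "ennreal (1 / (\<alpha> + 1)) = ennreal c * (\<integral>\<^sup>+s. f (1 + (- c) * s) \<partial>lborel)"
          using nn_integral_real_affine[OF fm, of "- c" 1] nn_integral_powr_0_1[OF \<alpha>(1)] c unfolding f_def by simp
        then have "ennreal (1 / 4) * (\<integral>\<^sup>+s. f (1 + (- c) * s) \<partial>lborel) \<le> ennreal (1 / (\<alpha> + 1))"
          using c4 by (simp add: mult_right_mono ennreal_leI del: ennreal_1)
        then have "ennreal 4 * (ennreal (1 / 4) * (\<integral>\<^sup>+s. f (1 + (- c) * s) \<partial>lborel)) \<le> ennreal 4 * ennreal (1 / (\<alpha> + 1))"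
          by (rule mult_left_mono) simp
        moreover have "ennreal 4 * (ennreal (1 / 4) * x) = x" for x
          unfolding mult.assoc[symmetric] by (subst ennreal_mult[symmetric]) auto
        moreover have "ennreal 4 * ennreal (1 / (\<alpha> + 1)) = ennreal (4 / (\<alpha> + 1))"
          using \<alpha> by (subst ennreal_mult[symmetric]) auto
        ultimately show "(\<integral>\<^sup>+s. f (1 + (- c) * s) \<partial>lborel) \<le> ennreal (4 / (\<alpha> + 1))" by simp
      qed simp
      also have "\<dots> = ennreal (m powr \<alpha> * (4 / (\<alpha> + 1)))" using C(2) by (intro ennreal_mult[symmetric]) simp_all
      also have "\<dots> \<le> ennreal (C * m powr \<alpha>)"
        by (rule ennreal_leI) (simp add: C_def algebra_simps)
      finally show ?thesis using C by (simp add: C_def ennreal_mult)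
    qed
  qed
qed

text \<open>The density with the rows in \<open>K\<close> deleted from the determinant. For \<open>K = UNIV\<close> it is the indicator
  of the domain, for \<open>K = {}\<close> the full density.\<close>

definition partial_density :: "real \<Rightarrow> 'n set \<Rightarrow> 'n::finite cmat \<Rightarrow> ennreal" where
  "partial_density \<alpha> K Z = indicator cartan_domain Z * ennreal (rho (row_delete K ** Z) powr \<alpha>)"

lemma continuous_left_mult: "continuous_on S (\<lambda>Z. (A :: 'n::finite cmat) ** (Z :: 'n cmat))"
  using bitrans_map_linear[of A "mat 1"] linear_conv_bounded_linear linear_continuous_on by fastforce

lemma partial_density_measurable [measurable]: "partial_density \<alpha> K \<in> borel_measurable borel"
proof -
  have "continuous_on UNIV (\<lambda>Z. rho (row_delete K ** Z))"
    by (rule continuous_on_compose2[OF continuous_rho[of UNIV] continuous_left_mult]) auto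
  then have [measurable]: "(\<lambda>Z. rho (row_delete K ** Z)) \<in> borel_measurable borel" by (rule borel_measurable_continuous_onI)
  show ?thesis unfolding partial_density_def[abs_def] by measurable
qed

text \<open>Substitute \<open>Z\<close> with row \<open>k\<close> multiplied by \<open>s\<close> and average over \<open>s\<close> in \<open>[1, 2]\<close>. As a function of \<open>s\<close> the
  determinant is \<open>m + a s\<^sup>2\<close>, where \<open>m\<close> is the determinant with row \<open>k\<close> deleted, so the inner integral is
  bounded by a multiple of \<open>m powr \<alpha>\<close>. The open set \<open>U\<close> controls the unknown Jacobian of the substitution
  uniformly in \<open>s\<close>.\<close>

lemma partial_density_step:
  fixes k :: "'n::finite"
  assumes \<alpha>: "-1 < \<alpha>" "\<alpha> < 0" and fin: "(\<integral>\<^sup>+Z. partial_density \<alpha> (insert k K) Z \<partial>lborel) < \<infinity>"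
  shows "(\<integral>\<^sup>+Z. partial_density \<alpha> K Z \<partial>lborel) < \<infinity>"
proof -
  let ?D = "cartan_domain :: 'n cmat set"
  let ?h = "partial_density \<alpha> K" and ?I = "\<integral>\<^sup>+Z. partial_density \<alpha> K Z \<partial>lborel"
  define T where "T = (\<lambda>(s :: real) Z. row_scale k (of_real s) ** (Z :: 'n cmat))"
  have Tm: "T s (T r Z) = T (s * r) Z" for s r Z by (simp add: T_def matrix_mul_assoc row_scale_mult)
  have T1: "T 1 Z = Z" for Z by (simp add: T_def row_scale_1)
  have TD: "T s Z \<in> ?D" if "0 \<le> s" "s \<le> 1" "Z \<in> ?D" for s Z
    unfolding T_def by (rule row_scale_cartan) (use that in auto)
  have lin: "linear (T s)" for s
    using bitrans_map_linear[of "row_scale k (of_real s)" "mat 1"] by (simp add: T_def)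
  have surj: "surj (T s)" if "s > 0" for s
    by (rule surjI[of _ "T (1 / s)"]) (use that in \<open>simp add: Tm T1\<close>)
  have Tcont: "continuous_on UNIV (\<lambda>p. T (fst p) (snd p))"
    unfolding T_def continuous_on_def row_scale_def
    by (intro ballI vec_tendstoI) (auto simp: diag_mult_nth intro!: tendsto_eq_intros)
  then have [measurable]: "(\<lambda>p. T (fst p) (snd p)) \<in> borel_measurable (borel \<Otimes>\<^sub>M borel)"
    unfolding borel_prod by (rule borel_measurable_continuous_onI)
  define U where "U = {Z. T 2 Z \<in> ?D}"
  have "continuous_on UNIV (T 2)" unfolding T_def by (rule continuous_left_mult)
  then have Uo: "open U" unfolding U_def using open_vimage[OF cartan_domain_open] by (simp add: vimage_def)
  have "0 \<in> U" using cartan_domain_0 by (simp add: U_def T_def)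
  then have \<kappa>: "0 < emeasure lborel U" using emeasure_lborel_open_pos[OF Uo] by blast
  have step: "?I * emeasure lborel U \<le> emeasure lborel ?D * (\<integral>\<^sup>+Z. ?h (T s Z) \<partial>lborel)" if s: "s \<in> {1..2}" for s
  proof -
    have "(\<integral>\<^sup>+Z. ?h (T s Z) \<partial>lborel) * (\<integral>\<^sup>+Z. indicator ?D Z \<partial>lborel) = ?I * (\<integral>\<^sup>+Z. indicator ?D (T s Z) \<partial>lborel)"
      by (rule nn_integral_linear_proportional[OF lin surj]) (use s in auto)
    moreover have "emeasure lborel U \<le> (\<integral>\<^sup>+Z. indicator ?D (T s Z) \<partial>lborel)"
    proof -
      have "T s Z \<in> ?D" if "Z \<in> U" for Z
        using TD[of "s / 2" "T 2 Z"] that s by (auto simp: U_def Tm)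
      then have "(\<integral>\<^sup>+Z. indicator U Z \<partial>lborel) \<le> (\<integral>\<^sup>+Z. indicator ?D (T s Z) \<partial>lborel)"
        by (intro nn_integral_mono) (auto simp: indicator_def)
      moreover have "(\<integral>\<^sup>+Z. indicator U Z \<partial>lborel) = emeasure lborel U"
        using Uo by (intro nn_integral_indicator) simp
      ultimately show ?thesis by simp
    qed
    ultimately show ?thesis by (simp add: mult.commute) (metis mult.commute mult_left_mono zero_le)
  qed
  have inner: "(\<integral>\<^sup>+s. indicator {1..2} s * ?h (T s Z) \<partial>lborel) \<le> ennreal (2 powr (- \<alpha>) + 4 / (\<alpha> + 1)) * partial_density \<alpha> (insert k K) Z" for Z
  proof (cases "Z \<in> ?D")
    case True
    define Y where "Y = row_delete K ** Z"
    obtain a where a: "\<And>s :: real. rho (row_scale k (of_real s) ** Y) = rho (row_scale k 0 ** Y) + a * s\<^sup>2"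
      using rho_row_scale[of k Y] by blast
    define m where "m = rho (row_scale k 0 ** Y)"
    have mi: "row_scale k 0 ** Y = row_delete (insert k K) ** Z" by (simp add: Y_def matrix_mul_assoc row_scale_0_delete)
    have m: "m > 0" unfolding m_def mi by (rule rho_pos[OF row_delete_cartan[OF True]])
    have e: "row_delete K ** T s Z = row_scale k (of_real s) ** Y" for s
      by (simp add: T_def Y_def matrix_mul_assoc row_delete_scale)
    have "(\<integral>\<^sup>+s. indicator {1..2} s * ?h (T s Z) \<partial>lborel) \<le>
      (\<integral>\<^sup>+s. indicator {1..2} s * (if m + a * s\<^sup>2 > 0 then ennreal ((m + a * s\<^sup>2) powr \<alpha>) else 0) \<partial>lborel)"
    proof (intro nn_integral_mono mult_left_mono)
      fix s
      show "?h (T s Z) \<le> (if m + a * s\<^sup>2 > 0 then ennreal ((m + a * s\<^sup>2) powr \<alpha>) else 0)"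
      proof (cases "T s Z \<in> ?D")
        case True
        have "rho (row_delete K ** T s Z) > 0" by (rule rho_pos[OF row_delete_cartan[OF True]])
        then show ?thesis using True unfolding partial_density_def e a m_def by simp
      qed (simp add: partial_density_def)
    qed simp
    also have "\<dots> \<le> ennreal (2 powr (- \<alpha>) + 4 / (\<alpha> + 1)) * ennreal (m powr \<alpha>)"
      by (rule radial_integral_bound[OF \<alpha> m])
    finally show ?thesis using True by (simp add: partial_density_def m_def mi)
  next
    case False
    have "T s Z \<notin> ?D" if "s \<in> {1..2}" for s
      using TD[of "1 / s" "T s Z"] that False by (auto simp: Tm T1)
    then have "indicator {1..2} s * ?h (T s Z) = 0" for s by (auto simp: partial_density_def indicator_def)
    then have "(\<integral>\<^sup>+s. indicator {1..2} s * ?h (T s Z) \<partial>lborel) = (\<integral>\<^sup>+(s :: real). 0 \<partial>lborel)" by (simp only:)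
    then show ?thesis by simp
  qed
  have m1 [measurable]: "(\<lambda>p. indicator {1..2} (fst p) * ?h (T (fst p) (snd p))) \<in> borel_measurable (lborel \<Otimes>\<^sub>M lborel)"
    by measurable
  have "?I * emeasure lborel U = (\<integral>\<^sup>+s. indicator {1..2 :: real} s * (?I * emeasure lborel U) \<partial>lborel)"
    by (subst nn_integral_multc) auto
  also have "\<dots> \<le> (\<integral>\<^sup>+s. emeasure lborel ?D * (\<integral>\<^sup>+Z. indicator {1..2 :: real} s * ?h (T s Z) \<partial>lborel) \<partial>lborel)"
  proof (rule nn_integral_mono)
    fix s :: real
    show "indicator {1..2} s * (?I * emeasure lborel U) \<le> emeasure lborel ?D * (\<integral>\<^sup>+Z. indicator {1..2} s * ?h (T s Z) \<partial>lborel)"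
      using step[of s] by (cases "s \<in> {1..2}") auto
  qed
  also have "\<dots> = emeasure lborel ?D * (\<integral>\<^sup>+s. \<integral>\<^sup>+Z. indicator {1..2 :: real} s * ?h (T s Z) \<partial>lborel \<partial>lborel)"
    by (rule nn_integral_cmult) (use m1 in measurable)
  also have "(\<integral>\<^sup>+s. \<integral>\<^sup>+Z. indicator {1..2 :: real} s * ?h (T s Z) \<partial>lborel \<partial>lborel)
      = (\<integral>\<^sup>+Z. \<integral>\<^sup>+s. indicator {1..2 :: real} s * ?h (T s Z) \<partial>lborel \<partial>lborel)"
    by (rule lborel_pair.Fubini'[symmetric]) (use m1 in \<open>simp add: case_prod_beta'\<close>)
  also have "\<dots> \<le> (\<integral>\<^sup>+Z. ennreal (2 powr (- \<alpha>) + 4 / (\<alpha> + 1)) * partial_density \<alpha> (insert k K) Z \<partial>lborel)"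
    by (rule nn_integral_mono) (rule inner)
  also have "\<dots> = ennreal (2 powr (- \<alpha>) + 4 / (\<alpha> + 1)) * (\<integral>\<^sup>+Z. partial_density \<alpha> (insert k K) Z \<partial>lborel)"
    by (rule nn_integral_cmult) measurable
  finally have "?I * emeasure lborel U \<le> emeasure lborel ?D * (ennreal (2 powr (- \<alpha>) + 4 / (\<alpha> + 1)) * (\<integral>\<^sup>+Z. partial_density \<alpha> (insert k K) Z \<partial>lborel))"
    by (simp add: mult_left_mono)
  also have "\<dots> < \<infinity>" using fin cartan_domain_emeasure(2)[where 'n='n] by (simp add: ennreal_mult_less_top)
  finally show ?thesis using \<kappa> by (auto simp: ennreal_mult_less_top)
qed

text \<open>For \<open>\<alpha> < 0\<close> delete the rows one by one; otherwise the density is bounded.\<close>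

lemma unnormalized_finite:
  fixes \<alpha> :: real
  assumes \<alpha>: "-1 < \<alpha>"
  shows "(\<integral>\<^sup>+Z. indicator (cartan_domain :: 'n::finite cmat set) Z * ennreal (rho Z powr \<alpha>) \<partial>lborel) < \<infinity>"
proof (cases "\<alpha> < 0")
  case True
  have "(\<integral>\<^sup>+Z. partial_density \<alpha> (UNIV - S) Z \<partial>lborel) < \<infinity>" if "finite S" for S :: "'n set"
    using that
  proof (induction S rule: finite_induct)
    case empty
    have r0: "row_delete UNIV ** Z = 0" for Z :: "'n cmat"
      by (simp add: vec_eq_iff row_delete_def diag_mult_nth)
    have "partial_density \<alpha> UNIV = (indicator cartan_domain :: 'n cmat \<Rightarrow> ennreal)"
      by (simp add: fun_eq_iff partial_density_def r0 rho_def)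
    then show ?case using cartan_domain_emeasure(2)[where 'n='n] by simp
  next
    case (insert k S)
    have "insert k (UNIV - insert k S) = UNIV - S" using insert.hyps by auto
    then show ?case using partial_density_step[OF \<alpha> True, of k "UNIV - insert k S"] insert.IH by simp
  qed
  from this[of UNIV] have "(\<integral>\<^sup>+Z. partial_density \<alpha> ({} :: 'n set) Z \<partial>lborel) < \<infinity>" by simp
  moreover have "row_delete {} = (mat 1 :: 'n cmat)" by (simp add: row_delete_def diag_mat_const)
  ultimately show ?thesis by (simp add: partial_density_def)
next
  case False
  have "compact (closure (cartan_domain :: 'n cmat set))" by (simp add: cartan_domain_bounded compact_closure)
  then have "bounded (rho ` closure (cartan_domain :: 'n cmat set))"
    by (intro compact_imp_bounded compact_continuous_image continuous_rho)
  then obtain B where B: "\<And>Z :: 'n cmat. Z \<in> closure cartan_domain \<Longrightarrow> norm (rho Z) \<le> B" unfolding bounded_iff by blast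
  have "indicator cartan_domain Z * ennreal (rho Z powr \<alpha>) \<le> ennreal (B powr \<alpha>) * indicator (cartan_domain :: 'n cmat set) Z" for Z
  proof (cases "Z \<in> cartan_domain")
    case True
    have "rho Z \<le> B" using B[of Z] closure_subset True by fastforce
    then have "rho Z powr \<alpha> \<le> B powr \<alpha>" by (intro powr_mono2) (use False rho_pos[OF True] in auto)
    then show ?thesis using True by (simp add: ennreal_leI)
  qed simp
  then have "(\<integral>\<^sup>+Z. indicator (cartan_domain :: 'n cmat set) Z * ennreal (rho Z powr \<alpha>) \<partial>lborel)
    \<le> (\<integral>\<^sup>+Z. ennreal (B powr \<alpha>) * indicator (cartan_domain :: 'n cmat set) Z \<partial>lborel)" by (rule nn_integral_mono)
  also have "\<dots> = ennreal (B powr \<alpha>) * emeasure lborel (cartan_domain :: 'n cmat set)"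
    by (rule nn_integral_cmult_indicator) simp
  also have "\<dots> < \<infinity>" using cartan_domain_emeasure(2)[where 'n='n] by (simp add: ennreal_mult_less_top)
  finally show ?thesis .
qed

section \<open>The weighted Bergman space\<close>

lemma holomorphic_mat_onE:
  assumes "holomorphic_mat_on f S" "Z \<in> S"
  obtains f' where "(f has_derivative f') (at Z)" "\<And>c X. f' (mat c ** X) = c * f' X"
proof -
  obtain f' where f': "(f has_derivative f') (at Z)" "\<forall>c X. f' (\<chi> i j. c * X $ i $ j) = c * f' X"
    using assms unfolding holomorphic_mat_on_def by blast
  have "(\<chi> i j. c * X $ i $ j) = mat c ** X" for c and X :: "'a cmat" by (simp add: vec_eq_iff)
  then show ?thesis using that[OF f'(1)] f'(2) by simp
qed

lemma holomorphic_mat_onI: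
  assumes "\<And>Z. Z \<in> S \<Longrightarrow> \<exists>f'. (f has_derivative f') (at Z) \<and> (\<forall>c X. f' (mat c ** X) = c * f' X)"
  shows "holomorphic_mat_on f S"
  unfolding holomorphic_mat_on_def
proof
  fix Z :: "'a cmat" assume "Z \<in> S"
  moreover have "(\<chi> i j. c * X $ i $ j) = mat c ** X" for c and X :: "'a cmat" by (simp add: vec_eq_iff)
  ultimately show "\<exists>f'. (f has_derivative f') (at Z) \<and> (\<forall>c X. f' (\<chi> i j. c * X $ i $ j) = c * f' X)"
    using assms by simp
qed

lemma holomorphic_mat_continuous: "holomorphic_mat_on f S \<Longrightarrow> continuous_on S f"
  by (rule continuous_at_imp_continuous_on) (meson has_derivative_continuous holomorphic_mat_onE)

lemma holomorphic_mat_add: "holomorphic_mat_on f S \<Longrightarrow> holomorphic_mat_on g S \<Longrightarrow> holomorphic_mat_on (\<lambda>Z. f Z + g Z) S"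
proof (rule holomorphic_mat_onI)
  fix Z assume h: "holomorphic_mat_on f S" "holomorphic_mat_on g S" "Z \<in> S"
  obtain f' where f': "(f has_derivative f') (at Z)" "\<And>c X. f' (mat c ** X) = c * f' X" using holomorphic_mat_onE[OF h(1,3)] by blast
  obtain g' where g': "(g has_derivative g') (at Z)" "\<And>c X. g' (mat c ** X) = c * g' X" using holomorphic_mat_onE[OF h(2,3)] by blast
  show "\<exists>f'. ((\<lambda>Z. f Z + g Z) has_derivative f') (at Z) \<and> (\<forall>c X. f' (mat c ** X) = c * f' X)"
    by (rule exI[of _ "\<lambda>X. f' X + g' X"]) (use f' g' in \<open>auto intro!: derivative_eq_intros simp: distrib_left\<close>)
qed

lemma holomorphic_mat_mult: "holomorphic_mat_on f S \<Longrightarrow> holomorphic_mat_on g S \<Longrightarrow> holomorphic_mat_on (\<lambda>Z. f Z * g Z) S"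
proof (rule holomorphic_mat_onI)
  fix Z assume h: "holomorphic_mat_on f S" "holomorphic_mat_on g S" "Z \<in> S"
  obtain f' where f': "(f has_derivative f') (at Z)" "\<And>c X. f' (mat c ** X) = c * f' X" using holomorphic_mat_onE[OF h(1,3)] by blast
  obtain g' where g': "(g has_derivative g') (at Z)" "\<And>c X. g' (mat c ** X) = c * g' X" using holomorphic_mat_onE[OF h(2,3)] by blast
  show "\<exists>f'. ((\<lambda>Z. f Z * g Z) has_derivative f') (at Z) \<and> (\<forall>c X. f' (mat c ** X) = c * f' X)"
    by (rule exI[of _ "\<lambda>X. f Z * g' X + f' X * g Z"]) (use f' g' has_derivative_mult[OF f'(1) g'(1)] in \<open>auto simp: algebra_simps\<close>)
qed

lemma holomorphic_mat_const: "holomorphic_mat_on (\<lambda>Z. c) S"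
  by (rule holomorphic_mat_onI) (auto intro!: exI[of _ "\<lambda>_. 0"] derivative_eq_intros)

lemma bounded_linear_entry: "bounded_linear (\<lambda>Z :: 'n::finite cmat. Z $ i $ j)"
  by (rule bounded_linear_compose[OF bounded_linear_vec_nth bounded_linear_vec_nth])

lemma polynomial_holomorphic:
  "p \<in> polynomials \<Longrightarrow> holomorphic_mat_on p S"
proof (induction rule: polynomials_induct)
  case (entry i j)
  show ?case
  proof (rule holomorphic_mat_onI, intro exI conjI allI)
    show "((\<lambda>Z. Z $ i $ j) has_derivative (\<lambda>Z. Z $ i $ j)) (at Z)" for Z :: "'a cmat"
      by (rule bounded_linear.has_derivative[OF bounded_linear_entry has_derivative_ident])
  qed simp
qed (auto intro: holomorphic_mat_const holomorphic_mat_add holomorphic_mat_mult)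

lemma holomorphic_mat_cong_open:
  assumes "open S" "\<And>Z. Z \<in> S \<Longrightarrow> f Z = g Z" "holomorphic_mat_on f S" shows "holomorphic_mat_on g S"
proof (rule holomorphic_mat_onI)
  fix Z assume Z: "Z \<in> S"
  obtain f' where f': "(f has_derivative f') (at Z)" "\<And>c X. f' (mat c ** X) = c * f' X" using holomorphic_mat_onE[OF assms(3) Z] by blast
  have "(g has_derivative f') (at Z)"
    by (rule has_derivative_transform_within_open[OF f'(1) assms(1) Z]) (use assms(2) in auto)
  then show "\<exists>f'. (g has_derivative f') (at Z) \<and> (\<forall>c X. f' (mat c ** X) = c * f' X)" using f'(2) by blast
qed

lemma holomorphic_mat_bitrans:
  fixes g h :: "'n::finite cmat"
  assumes f: "holomorphic_mat_on f cartan_domain" and g: "unitary g" and h: "unitary h"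
  shows "holomorphic_mat_on (\<lambda>Z. f (g ** Z ** h)) cartan_domain"
proof (rule holomorphic_mat_onI)
  fix Z :: "'n cmat" assume "Z \<in> cartan_domain"
  then have TZ: "g ** Z ** h \<in> cartan_domain" by (rule cartan_domain_unitary[OF g h])
  obtain f' where f': "(f has_derivative f') (at (g ** Z ** h))" "\<And>c X. f' (mat c ** X) = c * f' X"
    using holomorphic_mat_onE[OF f TZ] by blast
  have "((\<lambda>Z. g ** Z ** h) has_derivative (\<lambda>X. g ** X ** h)) (at Z)"
    by (rule bounded_linear.has_derivative[OF _ has_derivative_ident])
      (simp add: linear_conv_bounded_linear[symmetric] bitrans_map_linear)
  from has_derivative_compose[OF this f'(1)]
  have "((\<lambda>Z. f (g ** Z ** h)) has_derivative (\<lambda>X. f' (g ** X ** h))) (at Z)" .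
  moreover have "g ** (mat c ** X) ** h = mat c ** (g ** X ** h)" for c X
  proof -
    have "g ** mat c = mat c ** g" by (simp add: vec_eq_iff)
    then show ?thesis by (simp add: matrix_mul_assoc)
  qed
  ultimately show "\<exists>f'. ((\<lambda>Z. f (g ** Z ** h)) has_derivative f') (at Z) \<and> (\<forall>c X. f' (mat c ** X) = c * f' X)"
    using f'(2) by (intro exI[of _ "\<lambda>X. f' (g ** X ** h)"]) simp
qed

lemma cnj_borel [measurable]: "cnj \<in> borel_measurable borel"
  by (intro borel_measurable_continuous_onI continuous_intros)

text \<open>The locale parameter \<open>ty\<close> only fixes the index type.\<close>

locale bergman =
  fixes lam :: real and ty :: "'n::{finite,wellorder} itself"
  assumes lam: "lam > 2 * real CARD('n) - 1"
begin

abbreviation "D \<equiv> cartan_domain :: 'n cmat set"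
abbreviation "dv \<equiv> bergman_measure lam :: 'n cmat measure"
abbreviation "H \<equiv> bergman_space lam :: ('n cmat \<Rightarrow> complex) set"
abbreviation "ip \<equiv> bergman_inner lam :: ('n cmat \<Rightarrow> complex) \<Rightarrow> ('n cmat \<Rightarrow> complex) \<Rightarrow> complex"
definition c0 :: real where "c0 = normalizing_const TYPE('n) lam"
definition u :: "'n cmat \<Rightarrow> real" where "u = unnormalized_density lam"

lemma u_eq: "u Z = indicator D Z * rho Z powr (lam - 2 * real CARD('n))"
  by (simp add: u_def unnormalized_density_def rho_def)

lemma u_pos: "Z \<in> D \<Longrightarrow> 0 < u Z" using rho_pos[of Z] by (simp add: u_eq)

lemma u_outside: "Z \<notin> D \<Longrightarrow> u Z = 0" by (simp add: u_eq)

lemma rho_measurable [measurable]: "(rho :: 'n cmat \<Rightarrow> real) \<in> borel_measurable borel"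
  by (rule borel_measurable_continuous_onI[OF continuous_rho])

lemma u_measurable [measurable]: "u \<in> borel_measurable borel"
  unfolding u_eq[abs_def] by measurable

lemma u_unitary: "unitary g \<Longrightarrow> unitary h \<Longrightarrow> u (g ** Z ** h) = u Z"
  using cartan_domain_unitary_iff[of g h Z] by (simp add: u_eq rho_unitary indicator_def)

lemma u_integral: "(\<integral>\<^sup>+Z. ennreal (u Z) \<partial>lborel) < \<infinity>" "(\<integral>\<^sup>+Z. ennreal (u Z) \<partial>lborel) \<noteq> 0"
proof -
  have "ennreal (u Z) = indicator D Z * ennreal (rho Z powr (lam - 2 * real CARD('n)))" for Z
    by (simp add: u_eq indicator_def)
  then show "(\<integral>\<^sup>+Z. ennreal (u Z) \<partial>lborel) < \<infinity>"
    using unnormalized_finite[where 'n='n, of "lam - 2 * real CARD('n)"] lam by simp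
  show "(\<integral>\<^sup>+Z. ennreal (u Z) \<partial>lborel) \<noteq> 0"
  proof
    assume "(\<integral>\<^sup>+Z. ennreal (u Z) \<partial>lborel) = 0"
    then have "AE Z in lborel. ennreal (u Z) = 0" by (subst (asm) nn_integral_0_iff_AE) auto
    then have "AE Z in lborel. Z \<notin> D" by eventually_elim (use u_pos in force)
    then have "emeasure lborel D = 0" by (subst (asm) AE_iff_measurable[OF _ refl]) auto
    then show False using cartan_domain_emeasure(1)[where 'n='n] by simp
  qed
qed

lemma emeasure_density_u:
  assumes "0 \<le> c"
  shows "emeasure (density lborel (\<lambda>Z. ennreal (c * u Z))) D = ennreal c * (\<integral>\<^sup>+Z. ennreal (u Z) \<partial>lborel)"
proof -
  have "emeasure (density lborel (\<lambda>Z. ennreal (c * u Z))) D = (\<integral>\<^sup>+Z. ennreal (c * u Z) * indicator D Z \<partial>lborel)"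
    by (rule emeasure_density) auto
  also have "\<dots> = (\<integral>\<^sup>+Z. ennreal c * ennreal (u Z) \<partial>lborel)"
    by (rule nn_integral_cong) (use assms in \<open>auto simp: ennreal_mult' indicator_def u_outside\<close>)
  also have "\<dots> = ennreal c * (\<integral>\<^sup>+Z. ennreal (u Z) \<partial>lborel)" by (rule nn_integral_cmult) measurable
  finally show ?thesis .
qed

text \<open>The description of the normalising constant is meaningful because the volume is positive and finite.\<close>

lemma c0: "0 < c0" "emeasure (density lborel (\<lambda>Z. ennreal (c0 * u Z))) D = 1"
proof -
  obtain I where I: "(\<integral>\<^sup>+Z. ennreal (u Z) \<partial>lborel) = ennreal I" "0 \<le> I"
    using u_integral(1) by (metis ennreal_cases infinity_ennreal_def less_irrefl)
  have I0: "I > 0" using u_integral(2) I by (cases "I = 0") auto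
  have iff: "0 < c \<and> emeasure (density lborel (\<lambda>Z. ennreal (c * u Z))) D = 1 \<longleftrightarrow> c = 1 / I" for c
  proof
    assume c: "0 < c \<and> emeasure (density lborel (\<lambda>Z. ennreal (c * u Z))) D = 1"
    then have "ennreal (c * I) = ennreal 1" using emeasure_density_u[of c] I by (simp add: ennreal_mult)
    then have "c * I = 1" using c I(2) by (subst (asm) ennreal_inj) auto
    then show "c = 1 / I" using I0 by (simp add: field_simps)
  next
    assume "c = 1 / I"
    then show "0 < c \<and> emeasure (density lborel (\<lambda>Z. ennreal (c * u Z))) D = 1"
      using I0 I emeasure_density_u[of c] by (simp add: ennreal_mult[symmetric])
  qed
  have "0 < c0 \<and> emeasure (density lborel (\<lambda>Z. ennreal (c0 * u Z))) D = 1"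
    unfolding c0_def normalizing_const_def u_def[symmetric] by (rule theI[of _ "1 / I"]) (simp_all only: iff)
  then show "0 < c0" "emeasure (density lborel (\<lambda>Z. ennreal (c0 * u Z))) D = 1" by auto
qed

lemma dv_eq: "dv = density lborel (\<lambda>Z. ennreal (c0 * u Z))"
  by (simp add: bergman_measure_def c0_def u_def)

lemma sets_dv [measurable_cong, simp]: "sets dv = sets borel" by (simp add: dv_eq)
lemma space_dv [simp]: "space dv = UNIV" by (simp add: dv_eq)

lemma measurable_dv [simp]: "f \<in> borel_measurable dv \<longleftrightarrow> f \<in> borel_measurable borel"
  by (simp add: dv_eq)

lemma nn_integral_dv:
  "f \<in> borel_measurable borel \<Longrightarrow> (\<integral>\<^sup>+Z. f Z \<partial>dv) = (\<integral>\<^sup>+Z. ennreal (c0 * u Z) * f Z \<partial>lborel)"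
  unfolding dv_eq by (rule nn_integral_density) auto

lemma dv_AE: "AE Z in dv. Z \<in> D"
proof -
  have "0 < ennreal (c0 * u Z) \<longrightarrow> Z \<in> D" for Z
    using u_outside[of Z] by (cases "Z \<in> D") simp_all
  then have "AE Z in lborel. 0 < ennreal (c0 * u Z) \<longrightarrow> Z \<in> D" by simp
  then show ?thesis unfolding dv_eq by (subst AE_density) simp_all
qed

lemma dv_total: "emeasure dv UNIV = 1"
proof -
  have "emeasure dv UNIV = (\<integral>\<^sup>+Z. 1 \<partial>dv)" by simp
  also have "\<dots> = (\<integral>\<^sup>+Z. indicator D Z \<partial>dv)"
    by (rule nn_integral_cong_AE) (use dv_AE in eventually_elim, simp)
  also have "\<dots> = emeasure dv D" by simp
  finally show ?thesis using c0(2) by (simp add: dv_eq)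
qed

sublocale dv: finite_measure dv by (rule finite_measureI) (simp add: dv_total)

lemma bitrans_measurable [measurable]:
  fixes g h :: "'n cmat"
  shows "(\<lambda>Z. g ** Z ** h) \<in> borel_measurable borel"
  using bitrans_map_linear[of g h]
  by (intro borel_measurable_continuous_onI linear_continuous_on) (simp add: linear_conv_bounded_linear[symmetric])

lemma dv_unitary:
  assumes "unitary g" "unitary h" shows "distr dv borel (\<lambda>Z. g ** Z ** h) = dv"
proof (rule measure_eqI)
  fix A assume "A \<in> sets (distr dv borel (\<lambda>Z. g ** Z ** h))"
  then have A [measurable]: "A \<in> sets borel" by simp
  have "emeasure (distr dv borel (\<lambda>Z. g ** Z ** h)) A = (\<integral>\<^sup>+Z. indicator A Z \<partial>(distr dv borel (\<lambda>Z. g ** Z ** h)))" by simp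
  also have "\<dots> = (\<integral>\<^sup>+Z. indicator A (g ** Z ** h) \<partial>dv)" by (rule nn_integral_distr) auto
  also have "\<dots> = (\<integral>\<^sup>+Z. ennreal (c0 * u (g ** Z ** h)) * indicator A (g ** Z ** h) \<partial>lborel)"
    by (subst nn_integral_dv) (auto simp: u_unitary[OF assms])
  also have "\<dots> = (\<integral>\<^sup>+Z. ennreal (c0 * u Z) * indicator A Z \<partial>lborel)"
    by (rule nn_integral_unitary[OF assms]) measurable
  also have "\<dots> = emeasure dv A" by (subst nn_integral_dv[symmetric]) auto
  finally show "emeasure (distr dv borel (\<lambda>Z. g ** Z ** h)) A = emeasure dv A" .
qed simp

lemma HD:
  assumes "f \<in> H"
  shows "holomorphic_mat_on f D" "\<And>Z. Z \<notin> D \<Longrightarrow> f Z = 0" "integrable dv (\<lambda>Z. (cmod (f Z))\<^sup>2)" "continuous_on D f"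
  using assms holomorphic_mat_continuous unfolding bergman_space_def by blast+

lemma measurable_if_continuous_on_D:
  fixes f :: "'n cmat \<Rightarrow> complex"
  assumes "continuous_on D f" "\<And>Z. Z \<notin> D \<Longrightarrow> f Z = 0" shows "f \<in> borel_measurable borel"
proof -
  have "(\<lambda>Z. indicator D Z *\<^sub>R f Z) \<in> borel_measurable borel"
    by (rule borel_measurable_continuous_on_indicator[OF _ assms(1)]) simp
  moreover have "indicator D Z *\<^sub>R f Z = f Z" for Z using assms(2)[of Z] by (simp add: indicator_def)
  ultimately show ?thesis by simp
qed

lemma H_measurable: "f \<in> H \<Longrightarrow> f \<in> borel_measurable borel"
  using measurable_if_continuous_on_D HD(2,4) by blast

lemma ip_integrable:
  assumes f: "f \<in> H" and g: "g \<in> H" shows "integrable dv (\<lambda>Z. f Z * cnj (g Z))"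
proof (rule Bochner_Integration.integrable_bound)
  show "integrable dv (\<lambda>Z. (cmod (f Z))\<^sup>2 + (cmod (g Z))\<^sup>2)" using HD(3)[OF f] HD(3)[OF g] by simp
  have [measurable]: "f \<in> borel_measurable borel" "g \<in> borel_measurable borel" using H_measurable f g by auto
  show "(\<lambda>Z. f Z * cnj (g Z)) \<in> borel_measurable dv" by simp
  have "norm (f Z * cnj (g Z)) \<le> norm ((cmod (f Z))\<^sup>2 + (cmod (g Z))\<^sup>2)" for Z
  proof -
    have "0 \<le> cmod (f Z) * cmod (g Z)" by simp
    then have "cmod (f Z) * cmod (g Z) \<le> (cmod (f Z))\<^sup>2 + (cmod (g Z))\<^sup>2"
      using sum_squares_bound[of "cmod (f Z)" "cmod (g Z)"] by linarith
    then show ?thesis by (simp add: norm_mult)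
  qed
  then show "AE Z in dv. norm (f Z * cnj (g Z)) \<le> norm ((cmod (f Z))\<^sup>2 + (cmod (g Z))\<^sup>2)" by simp
qed

lemma H_subspace: "cfun.subspace H"
proof (rule cfun.subspaceI)
  show "0 \<in> H" unfolding bergman_space_def using holomorphic_mat_const[of 0] by (simp add: zero_fun_def)
next
  fix f g assume f: "f \<in> H" and g: "g \<in> H"
  have [measurable]: "f \<in> borel_measurable borel" "g \<in> borel_measurable borel" using H_measurable f g by auto
  have "integrable dv (\<lambda>Z. (cmod ((f + g) Z))\<^sup>2)"
  proof (rule Bochner_Integration.integrable_bound)
    show "integrable dv (\<lambda>Z. 2 * (cmod (f Z))\<^sup>2 + 2 * (cmod (g Z))\<^sup>2)" using HD(3)[OF f] HD(3)[OF g] by simp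
    show "(\<lambda>Z. (cmod ((f + g) Z))\<^sup>2) \<in> borel_measurable dv" by simp
    have "(cmod (f Z + g Z))\<^sup>2 \<le> 2 * (cmod (f Z))\<^sup>2 + 2 * (cmod (g Z))\<^sup>2" for Z
    proof -
      have "(cmod (f Z + g Z))\<^sup>2 \<le> (cmod (f Z) + cmod (g Z))\<^sup>2" by (rule power_mono[OF norm_triangle_ineq]) simp
      also have "\<dots> \<le> 2 * (cmod (f Z))\<^sup>2 + 2 * (cmod (g Z))\<^sup>2"
        using sum_squares_bound[of "cmod (f Z)" "cmod (g Z)"] by (simp add: power2_sum)
      finally show ?thesis .
    qed
    then show "AE Z in dv. norm ((cmod ((f + g) Z))\<^sup>2) \<le> norm (2 * (cmod (f Z))\<^sup>2 + 2 * (cmod (g Z))\<^sup>2)" by simp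
  qed
  moreover have "holomorphic_mat_on (f + g) D" using holomorphic_mat_add[OF HD(1)[OF f] HD(1)[OF g]] by (simp add: plus_fun_def)
  ultimately show "f + g \<in> H" unfolding bergman_space_def using HD(2)[OF f] HD(2)[OF g] by simp
next
  fix c f assume f: "f \<in> H"
  have "holomorphic_mat_on (cscale c f) D" using holomorphic_mat_mult[OF holomorphic_mat_const HD(1)[OF f]] by (simp add: cscale_def)
  then show "cscale c f \<in> H" unfolding bergman_space_def using HD(2,3)[OF f] by (simp add: cscale_def norm_mult power_mult_distrib)
qed

lemma ip_self: "f \<in> H \<Longrightarrow> ip f f = of_real (\<integral>Z. (cmod (f Z))\<^sup>2 \<partial>dv)"
proof -
  assume f: "f \<in> H"
  have "ip f f = (\<integral>Z. complex_of_real ((cmod (f Z))\<^sup>2) \<partial>dv)"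
    unfolding bergman_inner_def by (simp only: complex_norm_square)
  then show ?thesis by (simp only: integral_complex_of_real)
qed

text \<open>A continuous function that vanishes almost everywhere on an open set vanishes on it.\<close>

lemma zero_if_integral_0:
  assumes f: "f \<in> H" and z: "(\<integral>Z. (cmod (f Z))\<^sup>2 \<partial>dv) = 0" shows "f = 0"
proof -
  have [measurable]: "f \<in> borel_measurable borel" using H_measurable f by auto
  have "AE Z in dv. (cmod (f Z))\<^sup>2 = 0"
    using z by (subst (asm) integral_nonneg_eq_0_iff_AE[OF HD(3)[OF f]]) auto
  then have "AE Z in lborel. 0 < ennreal (c0 * u Z) \<longrightarrow> f Z = 0"
    unfolding dv_eq by (subst (asm) AE_density) auto
  then have ae: "AE Z in lborel. Z \<in> D \<longrightarrow> f Z = 0"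
    by eventually_elim (use u_pos c0(1) in auto)
  define U where "U = D \<inter> f -` (- {0})"
  have Uo: "open U" unfolding U_def by (rule continuous_open_preimage[OF HD(4)[OF f] cartan_domain_open]) (simp add: open_Compl)
  have "AE Z in lborel. Z \<notin> U" using ae by eventually_elim (auto simp: U_def)
  then have "emeasure lborel U = 0" using Uo by (subst (asm) AE_iff_measurable[OF _ refl]) auto
  then have "U = {}" using emeasure_lborel_open_pos[OF Uo] by fastforce
  then have "f Z = 0" for Z using HD(2)[OF f, of Z] unfolding U_def by (cases "Z \<in> D") auto
  then show ?thesis by (simp add: fun_eq_iff)
qed

sublocale inner_product_on H ip
proof
  show "cfun.subspace H" by (rule H_subspace)
  show "ip (f + g) h = ip f h + ip g h" if "f \<in> H" "g \<in> H" "h \<in> H" for f g h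
    using ip_integrable that by (simp add: bergman_inner_def distrib_right)
  show "ip (cscale c f) h = c * ip f h" if "f \<in> H" "h \<in> H" for f h c
    using ip_integrable that by (simp add: bergman_inner_def cscale_apply mult.assoc)
  show "cnj (ip f g) = ip g f" if "f \<in> H" "g \<in> H" for f g
  proof -
    have "cnj (ip f g) = (\<integral>Z. cnj (f Z * cnj (g Z)) \<partial>dv)" unfolding bergman_inner_def using Bochner_Integration.integral_cnj[of dv "\<lambda>Z. f Z * cnj (g Z)"] by (rule sym)
    then show ?thesis by (simp add: bergman_inner_def mult.commute)
  qed
  show "0 \<le> Re (ip f f)" if "f \<in> H" for f using ip_self[OF that] by simp
  show "f = 0" if "f \<in> H" "ip f f = 0" for f using ip_self[OF that(1)] that zero_if_integral_0 by simp
qed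

lemma bitrans_H:
  assumes g: "unitary g" and h: "unitary h" and f: "f \<in> H" shows "bitrans g h f \<in> H"
proof -
  have [measurable]: "f \<in> borel_measurable borel" using H_measurable f by auto
  have "integrable (distr dv borel (\<lambda>Z. g ** Z ** h)) (\<lambda>Z. (cmod (f Z))\<^sup>2)" unfolding dv_unitary[OF g h] by (rule HD(3)[OF f])
  then have "integrable dv (\<lambda>Z. (cmod (f (g ** Z ** h)))\<^sup>2)" by (subst (asm) integrable_distr_eq) auto
  then show ?thesis unfolding bergman_space_def bitrans_def
    using holomorphic_mat_bitrans[OF HD(1)[OF f] g h] HD(2)[OF f] cartan_domain_unitary_iff[OF g h] by simp
qed

lemma ip_bitrans:
  assumes g: "unitary g" and h: "unitary h" and f: "f \<in> H" and k: "k \<in> H"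
  shows "ip (bitrans g h f) (bitrans g h k) = ip f k"
proof -
  have [measurable]: "f \<in> borel_measurable borel" "k \<in> borel_measurable borel" using H_measurable f k by auto
  have "ip f k = (\<integral>Z. f Z * cnj (k Z) \<partial>(distr dv borel (\<lambda>Z. g ** Z ** h)))" unfolding dv_unitary[OF g h] bergman_inner_def ..
  also have "\<dots> = (\<integral>Z. f (g ** Z ** h) * cnj (k (g ** Z ** h)) \<partial>dv)" by (rule integral_distr) auto
  finally show ?thesis by (simp add: bergman_inner_def bitrans_def)
qed

lemma restrict_polynomial:
  assumes p: "p \<in> polynomials" shows "restrict_domain p \<in> H"
proof -
  have hol: "holomorphic_mat_on (restrict_domain p) D"
    by (rule holomorphic_mat_cong_open[OF cartan_domain_open _ polynomial_holomorphic[OF p]]) (simp add: restrict_domain_def)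
  have out: "restrict_domain p Z = 0" if "Z \<notin> D" for Z using that by (simp add: restrict_domain_def)
  have [measurable]: "restrict_domain p \<in> borel_measurable borel"
    using measurable_if_continuous_on_D[OF holomorphic_mat_continuous[OF hol] out] .
  have "compact (closure D)" by (simp add: cartan_domain_bounded compact_closure)
  then have "bounded (p ` closure D)" by (intro compact_imp_bounded compact_continuous_image polynomials_continuous p)
  then obtain B where B: "\<And>Z. Z \<in> closure D \<Longrightarrow> norm (p Z) \<le> B" unfolding bounded_iff by blast
  have "0 \<le> B" using B[of 0] cartan_domain_0 closure_subset norm_ge_zero order_trans by blast
  then have bd: "norm (restrict_domain p Z) \<le> B" for Z
    using B[of Z] closure_subset[of D] by (auto simp: restrict_domain_def)
  have "integrable dv (\<lambda>Z. (cmod (restrict_domain p Z))\<^sup>2)"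
  proof (rule dv.integrable_const_bound[of _ "B\<^sup>2"])
    show "AE Z in dv. norm ((cmod (restrict_domain p Z))\<^sup>2) \<le> B\<^sup>2" 
    proof (rule AE_I2)
      show "norm ((cmod (restrict_domain p Z))\<^sup>2) \<le> B\<^sup>2" for Z using power_mono[OF bd norm_ge_zero, where n=2] by simp
    qed
  qed simp
  then show ?thesis unfolding bergman_space_def using hol out by simp
qed

end

section \<open>Homogeneous Taylor parts are polynomials\<close>

lemma norm_mat_mult: "norm (mat c ** Z) = cmod c * norm (Z :: 'n::finite cmat)"
proof -
  have row: "norm ((mat c ** Z) $ i) = cmod c * norm (Z $ i)" for i
    by (simp add: norm_vec_def norm_mult L2_set_right_distrib)
  have "norm (mat c ** Z) = L2_set (\<lambda>i. cmod c * norm (Z $ i)) UNIV"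
    unfolding norm_vec_def[of "mat c ** Z"] by (simp only: row)
  also have "\<dots> = cmod c * norm Z" unfolding norm_vec_def[of Z] by (rule L2_set_right_distrib[symmetric]) simp
  finally show ?thesis .
qed

lemma mat_mult_mat: "mat a ** (mat b ** Z) = mat (a * b) ** (Z :: 'n::finite cmat)"
  by (simp add: vec_eq_iff mult.assoc)

lemma line_linear: "bounded_linear (\<lambda>\<eta>. mat \<eta> ** (X :: 'n::finite cmat))"
  unfolding linear_conv_bounded_linear[symmetric]
  by (rule linearI) (simp_all add: vec_eq_iff algebra_simps)

lemma holomorphic_on_line:
  fixes Z X :: "'n::finite cmat"
  assumes f: "holomorphic_mat_on f S" and T: "\<And>\<eta>. \<eta> \<in> T \<Longrightarrow> Z + mat \<eta> ** X \<in> S"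
  shows "(\<lambda>\<eta>. f (Z + mat \<eta> ** X)) holomorphic_on T"
  unfolding holomorphic_on_def
proof
  fix \<eta> assume "\<eta> \<in> T"
  then have S: "Z + mat \<eta> ** X \<in> S" by (rule T)
  obtain f' where f': "(f has_derivative f') (at (Z + mat \<eta> ** X))" "\<And>c Y. f' (mat c ** Y) = c * f' Y"
    using holomorphic_mat_onE[OF f S] by blast
  have "((\<lambda>\<eta>. Z + mat \<eta> ** X) has_derivative (\<lambda>h. 0 + mat h ** X)) (at \<eta>)"
    by (rule has_derivative_add[OF has_derivative_const bounded_linear.has_derivative[OF line_linear has_derivative_ident]])
  from has_derivative_compose[OF this f'(1)]
  have "((\<lambda>\<eta>. f (Z + mat \<eta> ** X)) has_derivative (\<lambda>h. h * f' X)) (at \<eta>)"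
    by (simp only: add_0_left f'(2))
  then have "((\<lambda>\<eta>. f (Z + mat \<eta> ** X)) has_field_derivative f' X) (at \<eta>)"
    unfolding has_field_derivative_def by (simp add: mult.commute[of _ "f' X"])
  then show "(\<lambda>\<eta>. f (Z + mat \<eta> ** X)) field_differentiable at \<eta> within T"
    by (meson field_differentiable_at_within field_differentiable_def)
qed

definition monomial_span :: "nat \<Rightarrow> (complex \<Rightarrow> complex) set" where
  "monomial_span k = cfun.span ((\<lambda>l \<eta>. \<eta> ^ l) ` {..k})"

lemma monomial_span_sum: "(\<lambda>\<eta>. \<Sum>l\<le>k. c l * \<eta> ^ l) \<in> monomial_span k"
proof -
  have "(\<Sum>l\<le>k. cscale (c l) (\<lambda>\<eta>. \<eta> ^ l)) \<in> monomial_span k"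
    unfolding monomial_span_def by (intro cfun.span_sum cfun.span_scale cfun.span_base) auto
  also have "(\<Sum>l\<le>k. cscale (c l) (\<lambda>\<eta>. \<eta> ^ l)) = (\<lambda>\<eta>. \<Sum>l\<le>k. c l * \<eta> ^ l)"
    by (rule ext) (simp only: fun_sum_apply cscale_apply)
  finally show ?thesis .
qed

lemma monomial_span_entry:
  assumes "\<phi> \<in> monomial_span k" shows "(\<lambda>Z. \<phi> (Z $ i $ j)) \<in> (polynomials :: ('n::finite cmat \<Rightarrow> complex) set)"
  using assms unfolding monomial_span_def
proof (induction rule: cfun.span_induct_alt)
  case base
  show ?case using polynomials_const[of 0] by simp
next
  case (step c x y)
  then obtain l where x: "x = (\<lambda>\<eta>. \<eta> ^ l)" by auto
  have "(\<lambda>Z. c * (Z $ i $ j) ^ l + y (Z $ i $ j)) \<in> (polynomials :: ('n cmat \<Rightarrow> complex) set)"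
    by (rule polynomials_add[OF polynomials_scale[OF polynomials_power[OF polynomials_entry]] step(2)])
  then show ?case by (simp only: x plus_fun_apply cscale_apply)
qed

definition matrix_unit :: "'n \<Rightarrow> 'n \<Rightarrow> 'n::finite cmat" where
  "matrix_unit i j = (\<chi> a b. if a = i \<and> b = j then 1 else 0)"

text \<open>The degrees are bounded by \<open>k\<close>, so each variable can be replaced by finitely many constants through
  interpolation. The entries are treated one at a time: \<open>mix S Z W\<close> takes the entries in \<open>S\<close> from
  \<open>Z\<close> and the others from \<open>W\<close>.\<close>

lemma polynomial_if_separately_polynomial:
  fixes F :: "'n::finite cmat \<Rightarrow> complex"
  assumes sep: "\<And>Z i j. (\<lambda>\<eta>. F (Z + mat \<eta> ** matrix_unit i j)) \<in> monomial_span k"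
  shows "F \<in> polynomials"
proof -
  define mix where "mix S Z W = (\<chi> i j. if (i, j) \<in> S then Z $ i $ j else W $ i $ j)"
    for S and Z W :: "'n cmat"
  have "finite_dim (monomial_span k)" unfolding finite_dim_def monomial_span_def by blast
  then obtain X e where I: "interpolates X e (monomial_span k)" using ex_interpolation by blast
  have "\<forall>W. (\<lambda>Z. F (mix S Z W)) \<in> polynomials" if "finite S" for S
    using that
  proof (induction S rule: finite_induct)
    case empty
    have "F (mix {} Z W) = F W" for Z W
    proof -
      have "mix {} Z W = W" by (simp add: mix_def vec_eq_iff)
      then show ?thesis by simp
    qed
    then show ?case by (simp add: polynomials_const)
  next
    case (insert p S)
    obtain i j where p: "p = (i, j)" by (cases p)
    show ?case
    proof
      fix W :: "'n cmat"
      define W0 where "W0 = (\<chi> a b. if a = i \<and> b = j then 0 else W $ a $ b)"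
      have step: "mix (insert p S) Z W = mix S Z W0 + mat (Z $ i $ j) ** matrix_unit i j" for Z
        using insert(2) by (simp add: vec_eq_iff mix_def W0_def matrix_unit_def p)
      have move: "mix S Z W0 + mat x ** matrix_unit i j = mix S Z (W0 + mat x ** matrix_unit i j)" for Z x
        using insert(2) by (simp add: vec_eq_iff mix_def W0_def matrix_unit_def p)
      have "F (mix (insert p S) Z W) = (\<Sum>x\<in>X. F (mix S Z (W0 + mat x ** matrix_unit i j)) * e x (Z $ i $ j))" for Z
        unfolding step move[symmetric] by (rule interpolatesD(4)[OF I sep])
      moreover have "(\<lambda>Z. \<Sum>x\<in>X. F (mix S Z (W0 + mat x ** matrix_unit i j)) * e x (Z $ i $ j)) \<in> polynomials"
      proof (rule polynomials_sum)
        fix x assume "x \<in> X"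
        then show "(\<lambda>Z. F (mix S Z (W0 + mat x ** matrix_unit i j)) * e x (Z $ i $ j)) \<in> polynomials"
          using insert(3) monomial_span_entry[OF interpolatesD(2)[OF I]] by (intro polynomials_mult) simp_all
      qed
      ultimately show "(\<lambda>Z. F (mix (insert p S) Z W)) \<in> polynomials" by (simp only:)
    qed
  qed
  from this[of UNIV] have "(\<lambda>Z. F (mix UNIV Z 0)) \<in> polynomials" by simp
  moreover have "mix UNIV Z 0 = Z" for Z by (simp add: mix_def vec_eq_iff)
  ultimately show ?thesis by simp
qed

text \<open>The homogeneous part of degree \<open>k\<close>. It is defined for all \<open>Z\<close>, also outside the domain, because the
  line \<open>\<zeta> \<mapsto> mat \<zeta> ** Z\<close> lies in the domain near \<open>0\<close>.\<close>

definition taylor_part :: "('n::finite cmat \<Rightarrow> complex) \<Rightarrow> nat \<Rightarrow> 'n cmat \<Rightarrow> complex" where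
  "taylor_part f k Z = (deriv ^^ k) (\<lambda>\<zeta>. f (mat \<zeta> ** Z)) 0 / fact k"

locale holomorphic_on_cartan =
  fixes f :: "'n::finite cmat \<Rightarrow> complex"
  assumes hol: "holomorphic_mat_on f cartan_domain"
begin

lemma slice_holomorphic:
  assumes "\<And>\<zeta>. \<zeta> \<in> T \<Longrightarrow> mat \<zeta> ** Z \<in> cartan_domain" shows "(\<lambda>\<zeta>. f (mat \<zeta> ** Z)) holomorphic_on T"
  using holomorphic_on_line[OF hol, of T 0 Z] assms by simp

lemma small_cball: obtains \<delta> where "\<delta> > 0" "\<And>Z :: 'n cmat. norm Z \<le> \<delta> \<Longrightarrow> Z \<in> cartan_domain"
proof -
  obtain \<delta> where "\<delta> > 0" "cball (0 :: 'n cmat) \<delta> \<subseteq> cartan_domain"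
    using cartan_domain_open cartan_domain_0 open_contains_cball by blast
  then show ?thesis using that[of \<delta>] by (auto simp: subset_iff)
qed

lemma small_disc:
  fixes Z :: "'n cmat"
  obtains r where "r > 0" "\<And>\<zeta>. \<zeta> \<in> ball 0 r \<Longrightarrow> mat \<zeta> ** Z \<in> cartan_domain"
proof -
  obtain \<delta> where \<delta>: "\<delta> > 0" "\<And>Z :: 'n cmat. norm Z \<le> \<delta> \<Longrightarrow> Z \<in> cartan_domain" using small_cball by blast
  have pos: "0 < 1 + norm Z" using norm_ge_zero[of Z] by linarith
  show ?thesis
  proof (rule that[of "\<delta> / (1 + norm Z)"])
    show "0 < \<delta> / (1 + norm Z)" using \<delta>(1) pos by simp
    fix \<zeta> :: complex assume "\<zeta> \<in> ball 0 (\<delta> / (1 + norm Z))"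
    then have "cmod \<zeta> * (1 + norm Z) < \<delta>" using pos by (simp add: pos_less_divide_eq)
    then have "cmod \<zeta> + cmod \<zeta> * norm Z < \<delta>" by (simp add: distrib_left)
    then have "cmod \<zeta> * norm Z \<le> \<delta>" using norm_ge_zero[of \<zeta>] by linarith
    then show "mat \<zeta> ** Z \<in> cartan_domain" by (intro \<delta>(2)) (simp add: norm_mat_mult)
  qed
qed

lemma taylor_part_homogeneous: "taylor_part f k (mat c ** Z) = c ^ k * taylor_part f k Z"
proof -
  obtain r where r: "r > 0" "\<And>\<zeta>. \<zeta> \<in> ball 0 r \<Longrightarrow> mat \<zeta> ** Z \<in> cartan_domain" using small_disc[of Z] by blast
  let ?S = "(\<lambda>w. c * w) -` ball 0 r"
  have "open ?S" by (rule open_vimage) (auto intro!: continuous_intros)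
  then have "(deriv ^^ k) (\<lambda>w. (\<lambda>\<zeta>. f (mat \<zeta> ** Z)) (c * w)) 0 = c ^ k * (deriv ^^ k) (\<lambda>\<zeta>. f (mat \<zeta> ** Z)) (c * 0)"
    using r by (intro higher_deriv_compose_linear[where T="ball 0 r" and S="?S"] slice_holomorphic) auto
  moreover have "(\<lambda>\<zeta>. f (mat \<zeta> ** (mat c ** Z))) = (\<lambda>w. (\<lambda>\<zeta>. f (mat \<zeta> ** Z)) (c * w))"
    by (simp only: mat_mult_mat mult.commute)
  ultimately show ?thesis by (simp add: taylor_part_def)
qed

lemma taylor_part_sums:
  assumes "\<And>\<zeta>. \<zeta> \<in> ball 0 r \<Longrightarrow> mat \<zeta> ** Z \<in> cartan_domain" "\<zeta> \<in> ball 0 r"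
  shows "(\<lambda>k. taylor_part f k Z * \<zeta> ^ k) sums f (mat \<zeta> ** Z)"
  using holomorphic_power_series[OF slice_holomorphic[of "ball 0 r" Z] assms(2)] assms(1)
  by (simp add: taylor_part_def)

lemma taylor_part_bounded:
  obtains \<delta> B where "\<delta> > 0" "B \<ge> 0" "\<And>Z :: 'n cmat. norm Z \<le> \<delta> \<Longrightarrow> Z \<in> cartan_domain"
    "\<And>k Z. norm Z \<le> \<delta> \<Longrightarrow> cmod (taylor_part f k Z) \<le> B"
proof -
  obtain \<delta> where \<delta>: "\<delta> > 0" "\<And>Z :: 'n cmat. norm Z \<le> \<delta> \<Longrightarrow> Z \<in> cartan_domain" using small_cball by blast
  have "continuous_on (cball 0 \<delta>) f"
    by (rule continuous_on_subset[OF holomorphic_mat_continuous[OF hol]]) (use \<delta>(2) in auto)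
  then have "bounded (f ` cball 0 \<delta>)" by (intro compact_imp_bounded compact_continuous_image) auto
  then obtain B where "\<forall>Z\<in>cball 0 \<delta>. cmod (f Z) \<le> B" unfolding bounded_iff by blast
  then have B: "\<And>Z. norm Z \<le> \<delta> \<Longrightarrow> cmod (f Z) \<le> B" by simp
  have "0 \<le> cmod (f 0)" by simp
  also have "\<dots> \<le> B" using B[of 0] \<delta>(1) by simp
  finally have B0: "0 \<le> B" .
  have "cmod (taylor_part f k Z) \<le> B" if Z: "norm Z \<le> \<delta>" for k Z
  proof -
    have le: "norm (mat \<zeta> ** Z) \<le> \<delta>" if "cmod \<zeta> \<le> 1" for \<zeta>
      using mult_left_le_one_le[of "norm Z" "cmod \<zeta>"] that Z by (simp add: norm_mat_mult)
    have h: "(\<lambda>\<zeta>. f (mat \<zeta> ** Z)) holomorphic_on cball 0 1"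
      by (rule slice_holomorphic) (use le \<delta>(2) in auto)
    have "norm ((deriv ^^ k) (\<lambda>\<zeta>. f (mat \<zeta> ** Z)) 0) \<le> fact k * B / 1 ^ k"
    proof (rule Cauchy_inequality)
      show "(\<lambda>\<zeta>. f (mat \<zeta> ** Z)) holomorphic_on ball 0 1" by (rule holomorphic_on_subset[OF h]) auto
      show "continuous_on (cball 0 1) (\<lambda>\<zeta>. f (mat \<zeta> ** Z))" by (rule holomorphic_on_imp_continuous_on[OF h])
    qed (use B le in auto)
    then show ?thesis by (simp add: taylor_part_def norm_divide field_simps)
  qed
  then show ?thesis using that \<delta> B0 by blast
qed

lemma taylor_remainder:
  assumes d: "\<And>Z :: 'n cmat. norm Z \<le> \<delta> \<Longrightarrow> Z \<in> cartan_domain"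
    and B: "\<And>k Z. norm Z \<le> \<delta> \<Longrightarrow> cmod (taylor_part f k Z) \<le> B"
    and Z: "norm Z \<le> \<delta>" and \<zeta>: "cmod \<zeta> < 1"
  shows "cmod (f (mat \<zeta> ** Z) - (\<Sum>l<k. taylor_part f l Z * \<zeta> ^ l)) \<le> B * (cmod \<zeta> ^ k / (1 - cmod \<zeta>))"
proof (rule norm_sums_le)
  have "mat w ** Z \<in> cartan_domain" if "w \<in> ball 0 1" for w
  proof (rule d)
    show "norm (mat w ** Z) \<le> \<delta>" using mult_left_le_one_le[of "norm Z" "cmod w"] that Z by (simp add: norm_mat_mult)
  qed
  from taylor_part_sums[OF this, where \<zeta>=\<zeta>] \<zeta>
  have "(\<lambda>l. taylor_part f l Z * \<zeta> ^ l) sums f (mat \<zeta> ** Z)" by simp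
  then show "(\<lambda>i. taylor_part f (i + k) Z * \<zeta> ^ (i + k)) sums (f (mat \<zeta> ** Z) - (\<Sum>l<k. taylor_part f l Z * \<zeta> ^ l))"
    by (rule sums_split_initial_segment)
  have "(\<lambda>i. cmod \<zeta> ^ i) sums (1 / (1 - cmod \<zeta>))" by (rule geometric_sums) (use \<zeta> in simp)
  from sums_mult[OF this, of "B * cmod \<zeta> ^ k"]
  show "(\<lambda>i. B * cmod \<zeta> ^ (i + k)) sums (B * (cmod \<zeta> ^ k / (1 - cmod \<zeta>)))" by (simp add: power_add mult_ac)
  show "norm (taylor_part f (i + k) Z * \<zeta> ^ (i + k)) \<le> B * cmod \<zeta> ^ (i + k)" for i
    unfolding norm_mult norm_power by (rule mult_right_mono[OF B[OF Z]]) simp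
qed

text \<open>By induction on \<open>k\<close>: near the origin the part of degree \<open>k\<close> is the uniform limit, for \<open>\<zeta> \<rightarrow> 0\<close>, of
  \<open>\<zeta>\<^sup>-\<^sup>k\<close> times the remainder after the lower parts. Homogeneity carries this to the whole line.\<close>

lemma taylor_part_entire: "(\<lambda>\<eta>. taylor_part f k (Z + mat \<eta> ** X)) holomorphic_on UNIV"
proof (induction k arbitrary: Z X rule: less_induct)
  case (less k)
  obtain \<delta> B where d: "\<delta> > 0" "B \<ge> 0" "\<And>Z :: 'n cmat. norm Z \<le> \<delta> \<Longrightarrow> Z \<in> cartan_domain"
    and B: "\<And>k Z. norm Z \<le> \<delta> \<Longrightarrow> cmod (taylor_part f k Z) \<le> B" using taylor_part_bounded by blast
  have small: "(\<lambda>\<eta>. taylor_part f k (Y + mat \<eta> ** X)) holomorphic_on ball 0 R"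
    if small: "\<And>\<eta>. \<eta> \<in> ball 0 R \<Longrightarrow> norm (Y + mat \<eta> ** X) \<le> \<delta>" for Y X R
  proof -
    define \<zeta> where "\<zeta> m = complex_of_real (1 / (real m + 2))" for m
    have norm_\<zeta>: "cmod (\<zeta> m) = 1 / (real m + 2)" for m unfolding \<zeta>_def norm_of_real by simp
    have \<zeta>0: "\<zeta> m \<noteq> 0" for m using norm_\<zeta>[of m] by auto
    have \<zeta>1: "cmod (\<zeta> m) < 1" for m unfolding norm_\<zeta> by simp
    define \<phi> where "\<phi> m \<eta> = (f (mat (\<zeta> m) ** (Y + mat \<eta> ** X)) - (\<Sum>l<k. taylor_part f l (Y + mat \<eta> ** X) * \<zeta> m ^ l)) / \<zeta> m ^ k" for m \<eta>
    have scaled: "mat (\<zeta> m) ** (Y + mat \<eta> ** X) = mat (\<zeta> m) ** Y + mat \<eta> ** (mat (\<zeta> m) ** X)" for m \<eta>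
      by (simp add: vec_eq_iff algebra_simps)
    have in_D: "mat (\<zeta> m) ** (Y + mat \<eta> ** X) \<in> cartan_domain" if "\<eta> \<in> ball 0 R" for m \<eta>
      using cartan_domain_scale[OF d(3)[OF small[OF that]]] \<zeta>1[of m] by simp
    have \<phi>_hol: "\<phi> m holomorphic_on ball 0 R" for m
    proof -
      have 1: "(\<lambda>\<eta>. f (mat (\<zeta> m) ** (Y + mat \<eta> ** X))) holomorphic_on ball 0 R"
        unfolding scaled by (rule holomorphic_on_line[OF hol]) (use in_D in \<open>simp add: scaled\<close>)
      have "(\<lambda>\<eta>. taylor_part f l (Y + mat \<eta> ** X)) holomorphic_on ball 0 R" if "l < k" for l
        by (rule holomorphic_on_subset[OF less[OF that]]) simp
      then show ?thesis unfolding \<phi>_def[abs_def] using 1 \<zeta>0 by (intro holomorphic_intros) auto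
    qed
    have err: "cmod (\<phi> m \<eta> - taylor_part f k (Y + mat \<eta> ** X)) \<le> B / (real m + 1)" if "\<eta> \<in> ball 0 R" for m \<eta>
    proof -
      let ?Z = "Y + mat \<eta> ** X"
      have "\<phi> m \<eta> - taylor_part f k ?Z = (f (mat (\<zeta> m) ** ?Z) - (\<Sum>l<Suc k. taylor_part f l ?Z * \<zeta> m ^ l)) / \<zeta> m ^ k"
        using \<zeta>0[of m] by (simp add: \<phi>_def diff_divide_distrib add_divide_distrib)
      then have "cmod (\<phi> m \<eta> - taylor_part f k ?Z) = cmod (f (mat (\<zeta> m) ** ?Z) - (\<Sum>l<Suc k. taylor_part f l ?Z * \<zeta> m ^ l)) / cmod (\<zeta> m) ^ k"
        by (simp only: norm_divide norm_power)
      also have "\<dots> \<le> B * (cmod (\<zeta> m) ^ Suc k / (1 - cmod (\<zeta> m))) / cmod (\<zeta> m) ^ k"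
        by (rule divide_right_mono[OF taylor_remainder[OF d(3) B small[OF that] \<zeta>1]]) auto
      also have "\<dots> = B * (cmod (\<zeta> m) / (1 - cmod (\<zeta> m)))" using \<zeta>0[of m] by simp
      also have "\<dots> = B / (real m + 1)" unfolding norm_\<zeta> by (simp add: field_simps)
      finally show ?thesis .
    qed
    have lim: "uniform_limit (ball 0 R) \<phi> (\<lambda>\<eta>. taylor_part f k (Y + mat \<eta> ** X)) sequentially"
    proof (rule uniform_limitI)
      fix e :: real assume e: "e > 0"
      have "(\<lambda>m. B / (real m + 1)) \<longlonglongrightarrow> 0" by real_asymp
      then have "\<forall>\<^sub>F m in sequentially. B / (real m + 1) < e" using e by (rule order_tendstoD)
      then show "\<forall>\<^sub>F m in sequentially. \<forall>\<eta>\<in>ball 0 R. dist (\<phi> m \<eta>) (taylor_part f k (Y + mat \<eta> ** X)) < e"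
        by eventually_elim (use err le_less_trans in \<open>fastforce simp: dist_norm\<close>)
    qed
    show ?thesis
    proof (rule holomorphic_uniform_sequence[OF open_ball \<phi>_hol])
      fix x assume "x \<in> ball (0 :: complex) R"
      then obtain c where "c > 0" "cball x c \<subseteq> ball 0 R" using open_ball open_contains_cball by blast
      then show "\<exists>d>0. cball x d \<subseteq> ball 0 R \<and> uniform_limit (cball x d) \<phi> (\<lambda>\<eta>. taylor_part f k (Y + mat \<eta> ** X)) sequentially"
        using uniform_limit_on_subset[OF lim] by blast
    qed
  qed
  have "(\<lambda>\<eta>. taylor_part f k (Z + mat \<eta> ** X)) field_differentiable at \<eta>" for \<eta>
  proof -
    define R where "R = cmod \<eta> + 1"
    define b where "b = 1 + norm Z + R * norm X"
    have R0: "0 < R" by (simp add: R_def add_nonneg_pos)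
    have b0: "0 < b" unfolding b_def using R0 by (simp add: add_pos_nonneg)
    define s where "s = complex_of_real (\<delta> / b)"
    have cs: "cmod s = \<delta> / b" unfolding s_def norm_of_real using d(1) b0 by simp
    have s0: "s \<noteq> 0" using cs d(1) b0 by auto
    have scaled: "mat s ** (Z + mat w ** X) = mat s ** Z + mat w ** (mat s ** X)" for w
      by (simp add: vec_eq_iff algebra_simps)
    have "norm (mat s ** Z + mat w ** (mat s ** X)) \<le> \<delta>" if "w \<in> ball 0 R" for w
    proof -
      have "norm (Z + mat w ** X) \<le> norm Z + cmod w * norm X" using norm_triangle_ineq[of Z "mat w ** X"] by (simp add: norm_mat_mult)
      also have "\<dots> \<le> norm Z + R * norm X" using that by (intro add_left_mono mult_right_mono) auto
      also have "\<dots> \<le> b" by (simp add: b_def)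
      finally have "cmod s * norm (Z + mat w ** X) \<le> cmod s * b" by (rule mult_left_mono) simp
      then show ?thesis unfolding scaled[symmetric] norm_mat_mult using cs b0 by simp
    qed
    from small[OF this] have "(\<lambda>w. taylor_part f k (mat s ** (Z + mat w ** X))) holomorphic_on ball 0 R"
      unfolding scaled .
    then have "(\<lambda>w. s ^ k * taylor_part f k (Z + mat w ** X)) holomorphic_on ball 0 R"
      by (simp only: taylor_part_homogeneous)
    then have "(\<lambda>w. (s ^ k * taylor_part f k (Z + mat w ** X)) / s ^ k) holomorphic_on ball 0 R"
      by (rule holomorphic_on_divide[OF _ holomorphic_on_const]) (use s0 in simp)
    moreover have "(s ^ k * taylor_part f k (Z + mat w ** X)) / s ^ k = taylor_part f k (Z + mat w ** X)" for w
      using s0 by simp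
    ultimately have "(\<lambda>w. taylor_part f k (Z + mat w ** X)) holomorphic_on ball 0 R" by (simp only:)
    then show ?thesis by (rule holomorphic_on_imp_differentiable_at) (auto simp: R_def)
  qed
  then show ?case unfolding holomorphic_on_def by (auto intro: field_differentiable_at_within)
qed

text \<open>Homogeneity bounds the growth by the \<open>k\<close>-th power, so Liouville's theorem makes the function a polynomial of
  degree at most \<open>k\<close> in each entry.\<close>

lemma taylor_part_polynomial: "taylor_part f k \<in> polynomials"
proof (rule polynomial_if_separately_polynomial)
  fix Z :: "'n cmat" and i j
  let ?X = "matrix_unit i j :: 'n cmat"
  obtain \<delta> B where d: "\<delta> > 0" "B \<ge> 0" "\<And>Z :: 'n cmat. norm Z \<le> \<delta> \<Longrightarrow> Z \<in> cartan_domain"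
    and B: "\<And>k Z. norm Z \<le> \<delta> \<Longrightarrow> cmod (taylor_part f k Z) \<le> B"
    using taylor_part_bounded by blast
  have growth: "cmod (taylor_part f k Y) \<le> B * (b / \<delta>) ^ k" if "norm Y \<le> b" "0 < b" for Y b
  proof -
    let ?s = "complex_of_real (\<delta> / b)"
    have cs: "cmod ?s = \<delta> / b" unfolding norm_of_real using d(1) that by simp
    have "norm (mat ?s ** Y) \<le> \<delta>" unfolding norm_mat_mult cs using that d(1)
      by (simp add: pos_divide_le_eq mult_left_mono)
    then have "cmod (?s ^ k * taylor_part f k Y) \<le> B" using B unfolding taylor_part_homogeneous[symmetric] by blast
    then have "(\<delta> / b) ^ k * cmod (taylor_part f k Y) \<le> B" by (simp only: norm_mult norm_power cs)
    then show ?thesis using d(1) that by (simp add: power_divide field_simps)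
  qed
  define c where "c = norm Z + norm ?X + 1"
  have c0: "0 < c" by (simp add: c_def add_nonneg_pos)
  have "cmod (taylor_part f k (Z + mat \<eta> ** ?X)) \<le> (B * (c / \<delta>) ^ k) * cmod \<eta> ^ k" if "1 \<le> cmod \<eta>" for \<eta>
  proof -
    have "norm (Z + mat \<eta> ** ?X) \<le> norm Z + cmod \<eta> * norm ?X" using norm_triangle_ineq[of Z "mat \<eta> ** ?X"] by (simp add: norm_mat_mult)
    also have "\<dots> \<le> c * cmod \<eta>" using mult_right_mono[OF that norm_ge_zero[of Z]] that by (simp add: c_def algebra_simps)
    finally have "cmod (taylor_part f k (Z + mat \<eta> ** ?X)) \<le> B * ((c * cmod \<eta>) / \<delta>) ^ k"
    proof (rule growth)
      have "0 < cmod \<eta>" using that by linarith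
      then show "0 < c * cmod \<eta>" by (rule mult_pos_pos[OF c0])
    qed
    then show ?thesis by (simp add: power_mult_distrib power_divide)
  qed
  from Liouville_polynomial[OF taylor_part_entire this]
  have "(\<lambda>\<xi>. taylor_part f k (Z + mat \<xi> ** ?X))
      = (\<lambda>\<xi>. \<Sum>l\<le>k. (deriv ^^ l) (\<lambda>\<eta>. taylor_part f k (Z + mat \<eta> ** ?X)) 0 / fact l * \<xi> ^ l)"
    by (rule ext)
  then show "(\<lambda>\<eta>. taylor_part f k (Z + mat \<eta> ** ?X)) \<in> monomial_span k"
    by (rule ssubst[where P="\<lambda>g. g \<in> monomial_span k"]) (rule monomial_span_sum)
qed

end

section \<open>Fourier series on the circle\<close>

text \<open>The circle is parametrised by the unit interval through \<open>rot\<close>. A density on the whole line keeps all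
  functions of \<open>t\<close> defined everywhere.\<close>

definition circle_measure :: "real measure" where
  "circle_measure = density lborel (\<lambda>t. ennreal (indicator {0..1} t))"

definition rot :: "real \<Rightarrow> complex" where "rot t = cis (2 * pi * t)"

lemma rot_norm [simp]: "cmod (rot t) = 1" by (simp add: rot_def)

lemma rot_cnj: "rot t * cnj (rot t) = 1"
  by (simp add: complex_norm_square[symmetric])

lemma rot_continuous: "continuous_on S rot"
  unfolding rot_def cis_conv_exp by (intro continuous_intros)

lemma rot_measurable [measurable]: "rot \<in> borel_measurable borel"
  by (rule borel_measurable_continuous_onI[OF rot_continuous])

lemma sets_circle [measurable_cong, simp]: "sets circle_measure = sets borel"
  by (simp add: circle_measure_def)

lemma space_circle [simp]: "space circle_measure = UNIV"
  by (simp add: circle_measure_def)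

lemma emeasure_circle: "emeasure circle_measure UNIV = 1"
proof -
  have "emeasure circle_measure UNIV = (\<integral>\<^sup>+t. ennreal (indicator {0..1} t) * indicator UNIV t \<partial>(lborel :: real measure))"
    unfolding circle_measure_def by (rule emeasure_density) auto
  also have "\<dots> = (\<integral>\<^sup>+t. indicator {0..1} t \<partial>(lborel :: real measure))"
    by (rule nn_integral_cong) (simp add: indicator_def)
  also have "\<dots> = 1" by simp
  finally show ?thesis .
qed

interpretation circle: finite_measure circle_measure
  by (rule finite_measureI) (simp add: emeasure_circle)

lemma measure_circle [simp]: "measure circle_measure UNIV = 1"
  by (simp add: measure_def emeasure_circle)

lemma integrable_circle:
  fixes h :: "real \<Rightarrow> 'b::{banach, second_countable_topology}"
  assumes "h \<in> borel_measurable borel" "\<And>t. norm (h t) \<le> B" shows "integrable circle_measure h"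
  by (rule circle.integrable_const_bound[of _ B]) (use assms in \<open>simp_all add: measurable_def\<close>)

lemma rot_power_integrable: "integrable circle_measure (\<lambda>t. rot t ^ k * cnj (rot t) ^ l)"
  by (rule integrable_circle[of _ 1]) (simp_all add: norm_mult norm_power)

lemma rot_orthonormal: "(\<integral>t. rot t ^ k * cnj (rot t) ^ l \<partial>circle_measure) = (if k = l then 1 else 0)"
proof (cases "k = l")
  case True
  have "rot t ^ k * cnj (rot t) ^ l = 1" for t using True rot_cnj[of t] by (metis power_mult_distrib power_one)
  then show ?thesis using True measure_circle by simp
next
  case False
  define c where "c = \<i> * complex_of_real (2 * pi * (real k - real l))"
  have c0: "c \<noteq> 0" using False by (simp add: c_def)
  have eq: "rot t ^ k * cnj (rot t) ^ l = exp (c * complex_of_real t)" for t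
  proof -
    have "rot t ^ k * cnj (rot t) ^ l = cis (real k * (2 * pi * t)) * cis (real l * (- (2 * pi * t)))"
      by (simp only: rot_def cis_cnj Complex.DeMoivre)
    also have "\<dots> = cis (2 * pi * (real k - real l) * t)" by (simp add: cis_mult algebra_simps)
    finally show ?thesis by (simp add: cis_conv_exp c_def mult.assoc)
  qed
  have "((\<lambda>t. exp (c * complex_of_real t)) has_integral exp (c * complex_of_real 1) / c - exp (c * complex_of_real 0) / c) {0..1}"
  proof (rule fundamental_theorem_of_calculus)
    fix t :: real
    have "((\<lambda>z. exp (c * z) / c) has_field_derivative exp (c * complex_of_real t)) (at (complex_of_real t))"
      using c0 by (auto intro!: derivative_eq_intros)
    then show "((\<lambda>t. exp (c * complex_of_real t) / c) has_vector_derivative exp (c * complex_of_real t)) (at t within {0..1})"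
      by (rule has_vector_derivative_at_within[OF has_vector_derivative_real_field])
  qed simp
  moreover have "exp c = 1"
  proof -
    have "Im c = of_int (2 * (int k - int l)) * pi" "Re c = 0" by (simp_all add: c_def)
    then show ?thesis unfolding exp_eq_1 by blast
  qed
  ultimately have int: "integral {0..1} (\<lambda>t. rot t ^ k * cnj (rot t) ^ l) = 0"
    unfolding eq by (simp add: integral_unique)
  have si: "set_integrable lborel {0..1} (\<lambda>t. rot t ^ k * cnj (rot t) ^ l)"
    unfolding set_integrable_def
    by (rule borel_integrable_compact) (auto intro!: continuous_intros rot_continuous)
  have "(\<integral>t. rot t ^ k * cnj (rot t) ^ l \<partial>circle_measure) = (LINT t : {0..1} | lborel. rot t ^ k * cnj (rot t) ^ l)"
    unfolding circle_measure_def set_lebesgue_integral_def by (rule integral_density) auto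
  also have "\<dots> = 0" using set_borel_integral_eq_integral(2)[OF si] int by simp
  finally show ?thesis using False by simp
qed

lemma cmod_diff_unimodular:
  assumes "cmod e = 1"
  shows "(cmod (x - a * e))\<^sup>2 = (cmod x)\<^sup>2 + (cmod a)\<^sup>2 - 2 * Re (cnj a * (x * cnj e))"
proof -
  have "complex_of_real ((cmod (x - a * e))\<^sup>2) = (x - a * e) * (cnj x - cnj a * cnj e)"
    by (simp only: complex_norm_square complex_cnj_diff complex_cnj_mult)
  also have "\<dots> = x * cnj x + a * cnj a * (e * cnj e) - (cnj a * (x * cnj e) + cnj (cnj a * (x * cnj e)))"
    by (simp add: algebra_simps)
  also have "e * cnj e = 1" using assms by (simp add: complex_norm_square[symmetric])
  finally have "complex_of_real ((cmod (x - a * e))\<^sup>2)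
    = complex_of_real ((cmod x)\<^sup>2 + (cmod a)\<^sup>2 - 2 * Re (cnj a * (x * cnj e)))"
    by (simp only: complex_add_cnj complex_norm_square[symmetric] of_real_add of_real_diff mult_1_right of_real_mult of_real_numeral)
  then show ?thesis by (simp only: of_real_eq_iff)
qed

locale circle_series =
  fixes h :: "real \<Rightarrow> complex" and a :: "nat \<Rightarrow> complex"
  assumes summable: "summable (\<lambda>k. cmod (a k))" and h: "\<And>t. (\<lambda>k. a k * rot t ^ k) sums h t"
begin

definition remainder :: "nat \<Rightarrow> real \<Rightarrow> complex" where
  "remainder N t = h t - (\<Sum>k<N. a k * rot t ^ k)"

definition tail :: "nat \<Rightarrow> real" where
  "tail N = (\<Sum>k. cmod (a k)) - (\<Sum>k<N. cmod (a k))"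

lemma remainder_bound: "cmod (remainder N t) \<le> tail N"
  unfolding remainder_def tail_def
proof (rule norm_sums_le)
  show "(\<lambda>i. a (i + N) * rot t ^ (i + N)) sums (h t - (\<Sum>k<N. a k * rot t ^ k))"
    by (rule sums_split_initial_segment[OF h])
  show "(\<lambda>i. cmod (a (i + N))) sums ((\<Sum>k. cmod (a k)) - (\<Sum>k<N. cmod (a k)))"
    by (rule sums_split_initial_segment[OF summable_sums[OF summable]])
qed (simp add: norm_mult norm_power)

lemma tail_tendsto_0: "tail \<longlonglongrightarrow> 0"
proof -
  have "(\<lambda>N. (\<Sum>k. cmod (a k)) - (\<Sum>k<N. cmod (a k))) \<longlonglongrightarrow> (\<Sum>k. cmod (a k)) - (\<Sum>k. cmod (a k))"
    by (rule tendsto_diff[OF tendsto_const summable_LIMSEQ[OF summable]])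
  then show ?thesis by (simp add: tail_def[abs_def])
qed

lemma h_measurable [measurable]: "h \<in> borel_measurable borel"
proof -
  have "h = (\<lambda>t. \<Sum>k. a k * rot t ^ k)" using h by (simp add: fun_eq_iff sums_iff)
  moreover have "(\<lambda>t. \<Sum>k. a k * rot t ^ k) \<in> borel_measurable borel" by measurable
  ultimately show ?thesis by simp
qed

lemma remainder_measurable [measurable]: "remainder N \<in> borel_measurable borel"
  unfolding remainder_def[abs_def] by measurable

lemma remainder_square_integrable: "integrable circle_measure (\<lambda>t. (cmod (remainder N t))\<^sup>2)"
proof (rule integrable_circle)
  show "norm ((cmod (remainder N t))\<^sup>2) \<le> (tail N)\<^sup>2" for t
    using power_mono[OF remainder_bound norm_ge_zero, where n=2] by simp
qed measurable

lemma remainder_coefficient_integrable: "integrable circle_measure (\<lambda>t. remainder N t * cnj (rot t) ^ l)"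
proof (rule integrable_circle)
  show "norm (remainder N t * cnj (rot t) ^ l) \<le> tail N" for t
    using remainder_bound by (simp add: norm_mult norm_power)
qed measurable

lemma coefficient: "(\<integral>t. h t * cnj (rot t) ^ l \<partial>circle_measure) = a l"
proof -
  let ?g = "\<lambda>k t. a k * (rot t ^ k * cnj (rot t) ^ l)"
  have n: "norm (?g k t) = cmod (a k)" for k t by (simp add: norm_mult norm_power)
  have "(\<integral>t. (\<Sum>k. ?g k t) \<partial>circle_measure) = (\<Sum>k. \<integral>t. ?g k t \<partial>circle_measure)"
  proof (rule integral_suminf)
    show "integrable circle_measure (?g k)" for k by (rule integrable_mult_right[OF rot_power_integrable])
    show "AE t in circle_measure. summable (\<lambda>k. norm (?g k t))" unfolding n using summable by simp
    show "summable (\<lambda>k. \<integral>t. norm (?g k t) \<partial>circle_measure)" unfolding n using summable measure_circle by simp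
  qed
  moreover have "(\<Sum>k. ?g k t) = h t * cnj (rot t) ^ l" for t
  proof -
    have "(\<lambda>k. (a k * rot t ^ k) * cnj (rot t) ^ l) sums (h t * cnj (rot t) ^ l)" by (rule sums_mult2[OF h])
    then show ?thesis by (simp add: sums_iff mult.assoc)
  qed
  moreover have "(\<integral>t. ?g k t \<partial>circle_measure) = (if k = l then a l else 0)" for k
    by (simp add: rot_orthonormal)
  moreover have "(\<Sum>k. if k = l then a l else 0) = a l" using suminf_finite[of "{l}" "\<lambda>k. if k = l then a l else 0"] by simp
  ultimately show ?thesis by (simp only:)
qed

lemma remainder_coefficient: "(\<integral>t. remainder N t * cnj (rot t) ^ N \<partial>circle_measure) = a N"
proof -
  have h_int: "integrable circle_measure (\<lambda>t. h t * cnj (rot t) ^ N)"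
    using remainder_coefficient_integrable[of 0 N] by (simp add: remainder_def)
  have "remainder N t * cnj (rot t) ^ N = h t * cnj (rot t) ^ N - (\<Sum>k<N. a k * (rot t ^ k * cnj (rot t) ^ N))" for t
    by (simp add: remainder_def left_diff_distrib sum_distrib_right mult.assoc)
  then have "(\<integral>t. remainder N t * cnj (rot t) ^ N \<partial>circle_measure)
    = (\<integral>t. h t * cnj (rot t) ^ N - (\<Sum>k<N. a k * (rot t ^ k * cnj (rot t) ^ N)) \<partial>circle_measure)" by simp
  also have "\<dots> = (\<integral>t. h t * cnj (rot t) ^ N \<partial>circle_measure)
      - (\<integral>t. (\<Sum>k<N. a k * (rot t ^ k * cnj (rot t) ^ N)) \<partial>circle_measure)"
    by (rule Bochner_Integration.integral_diff[OF h_int])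
      (intro Bochner_Integration.integrable_sum integrable_mult_right rot_power_integrable)
  also have "(\<integral>t. (\<Sum>k<N. a k * (rot t ^ k * cnj (rot t) ^ N)) \<partial>circle_measure)
      = (\<Sum>k<N. \<integral>t. a k * (rot t ^ k * cnj (rot t) ^ N) \<partial>circle_measure)"
    by (rule Bochner_Integration.integral_sum) (intro integrable_mult_right rot_power_integrable)
  also have "\<dots> = 0" by (rule sum.neutral) (simp add: rot_orthonormal)
  finally show ?thesis by (simp add: coefficient)
qed

text \<open>Subtracting the next term lowers the square norm by \<open>(cmod (a N))\<^sup>2\<close>.\<close>

lemma bessel: "(\<integral>t. (cmod (remainder N t))\<^sup>2 \<partial>circle_measure) \<le> (\<integral>t. (cmod (h t))\<^sup>2 \<partial>circle_measure)"
proof (induction N)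
  case 0
  then show ?case by (simp add: remainder_def)
next
  case (Suc N)
  let ?x = "\<lambda>t. cnj (a N) * (remainder N t * cnj (rot t) ^ N)"
  have x_int: "integrable circle_measure ?x" by (rule integrable_mult_right[OF remainder_coefficient_integrable])
  have "(cmod (remainder (Suc N) t))\<^sup>2 = (cmod (remainder N t))\<^sup>2 + ((cmod (a N))\<^sup>2 - 2 * Re (?x t))" for t
  proof -
    have "remainder (Suc N) t = remainder N t - a N * rot t ^ N" by (simp add: remainder_def)
    then show ?thesis using cmod_diff_unimodular[of "rot t ^ N" "remainder N t" "a N"] by (simp add: norm_power)
  qed
  then have "(\<integral>t. (cmod (remainder (Suc N) t))\<^sup>2 \<partial>circle_measure)
    = (\<integral>t. (cmod (remainder N t))\<^sup>2 + ((cmod (a N))\<^sup>2 - 2 * Re (?x t)) \<partial>circle_measure)" by (simp only:)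
  also have "\<dots> = (\<integral>t. (cmod (remainder N t))\<^sup>2 \<partial>circle_measure) + (\<integral>t. (cmod (a N))\<^sup>2 - 2 * Re (?x t) \<partial>circle_measure)"
    by (rule Bochner_Integration.integral_add[OF remainder_square_integrable])
      (intro Bochner_Integration.integrable_diff integrable_mult_right integrable_Re x_int circle.integrable_const)
  also have "(\<integral>t. (cmod (a N))\<^sup>2 - 2 * Re (?x t) \<partial>circle_measure)
    = (\<integral>t. (cmod (a N))\<^sup>2 \<partial>circle_measure) - (\<integral>t. 2 * Re (?x t) \<partial>circle_measure)"
    by (rule Bochner_Integration.integral_diff) (intro integrable_mult_right integrable_Re x_int circle.integrable_const)+
  also have "(\<integral>t. 2 * Re (?x t) \<partial>circle_measure) = 2 * Re (\<integral>t. ?x t \<partial>circle_measure)"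
    unfolding integral_Re[OF x_int, symmetric] by (rule integral_mult_right_zero)
  also have "(\<integral>t. ?x t \<partial>circle_measure) = of_real ((cmod (a N))\<^sup>2)"
    unfolding integral_mult_right_zero remainder_coefficient complex_norm_square by (rule mult.commute)
  also have "(\<integral>t. (cmod (a N))\<^sup>2 \<partial>circle_measure) = (cmod (a N))\<^sup>2" using measure_circle by simp
  finally have "(\<integral>t. (cmod (remainder (Suc N) t))\<^sup>2 \<partial>circle_measure)
    = (\<integral>t. (cmod (remainder N t))\<^sup>2 \<partial>circle_measure) - (cmod (a N))\<^sup>2" by simp
  then show ?case using Suc by (smt (verit) zero_le_power2)
qed

lemma remainder_L2_tendsto_0: "(\<lambda>N. \<integral>t. (cmod (remainder N t))\<^sup>2 \<partial>circle_measure) \<longlonglongrightarrow> 0"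
proof (rule tendsto_sandwich[where f="\<lambda>_. 0" and h="\<lambda>N. (tail N)\<^sup>2"])
  show "(\<lambda>N. (tail N)\<^sup>2) \<longlonglongrightarrow> 0" using tendsto_power[OF tail_tendsto_0, of 2] by simp
  have "(\<integral>t. (cmod (remainder N t))\<^sup>2 \<partial>circle_measure) \<le> (\<integral>t. (tail N)\<^sup>2 \<partial>circle_measure)" for N
    by (rule integral_mono[OF remainder_square_integrable circle.integrable_const]) (rule power_mono[OF remainder_bound norm_ge_zero])
  then show "\<forall>\<^sub>F N in sequentially. (\<integral>t. (cmod (remainder N t))\<^sup>2 \<partial>circle_measure) \<le> (tail N)\<^sup>2"
    using measure_circle by simp
  show "\<forall>\<^sub>F N in sequentially. 0 \<le> (\<integral>t. (cmod (remainder N t))\<^sup>2 \<partial>circle_measure)" by simp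
qed simp

end

section \<open>Density of the polynomials\<close>

text \<open>The domain is open, so the Taylor series at \<open>Z\<close> converges on a disc of radius \<open>R > 1\<close>, absolutely on the
  unit circle.\<close>

lemma taylor_series_on_circle:
  fixes f :: "'n::finite cmat \<Rightarrow> complex"
  assumes f: "holomorphic_mat_on f cartan_domain" and Z: "Z \<in> cartan_domain"
  shows "circle_series (\<lambda>t. f (mat (rot t) ** Z)) (\<lambda>k. taylor_part f k Z)"
proof -
  interpret holomorphic_on_cartan f by (rule holomorphic_on_cartan.intro[OF f])
  have "open ((\<lambda>\<eta>. mat \<eta> ** Z) -` cartan_domain)"
    by (rule open_vimage[OF cartan_domain_open]) (rule linear_continuous_on[OF line_linear])
  moreover have "1 \<in> (\<lambda>\<eta>. mat \<eta> ** Z) -` cartan_domain" using Z by simp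
  ultimately obtain e where e: "e > 0" "ball 1 e \<subseteq> (\<lambda>\<eta>. mat \<eta> ** Z) -` cartan_domain"
    using open_contains_ball by blast
  define R where "R = 1 + e / 2"
  have R1: "1 < R" using e(1) by (simp add: R_def)
  have cR: "cmod (complex_of_real R) = R" using R1 by simp
  have "complex_of_real R \<in> ball 1 e"
  proof -
    have "complex_of_real R = 1 + complex_of_real (e / 2)" by (simp add: R_def)
    moreover have "cmod (complex_of_real (e / 2)) < e" unfolding norm_of_real using e(1) by simp
    ultimately show ?thesis by (simp add: dist_norm norm_minus_commute)
  qed
  then have RZ: "mat (complex_of_real R) ** Z \<in> cartan_domain" using e(2) by blast
  have disc: "mat \<zeta> ** Z \<in> cartan_domain" if "\<zeta> \<in> ball 0 R" for \<zeta>
  proof -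
    have "mat \<zeta> ** Z = mat (\<zeta> / complex_of_real R) ** (mat (complex_of_real R) ** Z)"
      using R1 by (simp add: mat_mult_mat)
    also have "\<dots> \<in> cartan_domain"
      by (rule cartan_domain_scale[OF RZ]) (use that R1 in \<open>simp add: norm_divide\<close>)
    finally show ?thesis .
  qed
  note sums = taylor_part_sums[where r=R, OF disc]
  show ?thesis
  proof
    define r where "r = complex_of_real ((1 + R) / 2)"
    have cr: "cmod r = (1 + R) / 2" unfolding r_def norm_of_real using R1 by simp
    then have "summable (\<lambda>k. taylor_part f k Z * r ^ k)" using sums[of r] R1 by (simp add: sums_iff)
    then have "summable (\<lambda>k. norm (taylor_part f k Z * 1 ^ k))"
      by (rule powser_insidea) (use cr R1 in simp)
    then show "summable (\<lambda>k. cmod (taylor_part f k Z))" by simp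
    show "(\<lambda>k. taylor_part f k Z * rot t ^ k) sums f (mat (rot t) ** Z)" for t
    proof (rule sums)
      show "rot t \<in> ball 0 R" unfolding mem_ball_0 rot_norm by (rule R1)
    qed
  qed
qed

context bergman
begin

lemma unitary_rot: "unitary (mat (rot t) :: 'n cmat)"
proof -
  have nth: "(mat c :: 'n cmat) $ i $ j = (if i = j then c else 0)" for c i j by (simp add: mat_def)
  have "adj (mat (rot t)) = (mat (cnj (rot t)) :: 'n cmat)" by (simp add: vec_eq_iff nth)
  then show ?thesis using rot_cnj[of t] by (simp add: unitary_def vec_eq_iff nth mult.commute)
qed

lemma rot_in_D: "mat (rot t) ** Z \<in> D \<longleftrightarrow> Z \<in> D"
proof -
  have "unitary (mat 1 :: 'n cmat)" by (simp add: unitary_def)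
  from cartan_domain_unitary_iff[OF unitary_rot[of t] this, of Z] show ?thesis by simp
qed

lemma rot_pair_measurable:
  assumes g: "g \<in> borel_measurable borel"
  shows "(\<lambda>(Z :: 'n cmat, t). g (mat (rot t) ** Z)) \<in> borel_measurable (dv \<Otimes>\<^sub>M circle_measure)"
proof -
  have "continuous_on UNIV (\<lambda>x :: 'n cmat \<times> real. mat (rot (snd x)) ** fst x)"
  proof -
    have "mat (rot (snd x)) ** fst x = (\<chi> i j. rot (snd x) * fst x $ i $ j)" for x :: "'n cmat \<times> real"
      by (simp add: vec_eq_iff)
    moreover have "continuous_on UNIV (\<lambda>x :: 'n cmat \<times> real. \<chi> i j. rot (snd x) * fst x $ i $ j)"
      by (intro continuous_intros continuous_on_compose2[OF rot_continuous[of UNIV]]) auto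
    ultimately show ?thesis by simp
  qed
  then have "(\<lambda>x :: 'n cmat \<times> real. mat (rot (snd x)) ** fst x) \<in> borel_measurable borel"
    by (rule borel_measurable_continuous_onI)
  from measurable_compose[OF this g]
  have "(\<lambda>x :: 'n cmat \<times> real. g (mat (rot (snd x)) ** fst x)) \<in> borel_measurable borel" .
  moreover have "sets (dv \<Otimes>\<^sub>M circle_measure) = sets (borel :: ('n cmat \<times> real) measure)"
    using sets_pair_measure_cong[OF sets_dv sets_circle] unfolding borel_prod .
  ultimately show ?thesis by (simp add: case_prod_beta' cong: measurable_cong_sets)
qed

text \<open>Exchange the integrals and use the invariance of the measure under each rotation.\<close>

lemma nn_integral_circle_average:
  fixes g :: "'n cmat \<Rightarrow> ennreal"
  assumes g [measurable]: "g \<in> borel_measurable borel"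
  shows "(\<integral>\<^sup>+Z. (\<integral>\<^sup>+t. g (mat (rot t) ** Z) \<partial>circle_measure) \<partial>dv) = (\<integral>\<^sup>+Z. g Z \<partial>dv)"
proof -
  interpret pair_sigma_finite dv circle_measure ..
  have "(\<integral>\<^sup>+Z. (\<integral>\<^sup>+t. g (mat (rot t) ** Z) \<partial>circle_measure) \<partial>dv) = (\<integral>\<^sup>+t. (\<integral>\<^sup>+Z. g (mat (rot t) ** Z) \<partial>dv) \<partial>circle_measure)"
    using Fubini'[OF rot_pair_measurable[OF g]] by simp
  also have "\<dots> = (\<integral>\<^sup>+t. (\<integral>\<^sup>+Z. g Z \<partial>dv) \<partial>circle_measure)"
  proof (rule nn_integral_cong)
    fix t
    have "unitary (mat 1 :: 'n cmat)" by (simp add: unitary_def)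
    then have "(\<integral>\<^sup>+Z. g Z \<partial>dv) = (\<integral>\<^sup>+Z. g Z \<partial>(distr dv borel (\<lambda>Z. mat (rot t) ** Z ** mat 1)))"
      by (simp only: dv_unitary[OF unitary_rot])
    also have "\<dots> = (\<integral>\<^sup>+Z. g (mat (rot t) ** Z ** mat 1) \<partial>dv)" by (rule nn_integral_distr) measurable
    finally show "(\<integral>\<^sup>+Z. g (mat (rot t) ** Z) \<partial>dv) = (\<integral>\<^sup>+Z. g Z \<partial>dv)" by simp
  qed
  finally show ?thesis by (simp add: emeasure_circle)
qed

text \<open>Let \<open>F N\<close> be the difference between \<open>f\<close> and its Taylor polynomial of degree below \<open>N\<close>, and \<open>I N Z\<close> its mean square on the
  circle through \<open>Z\<close>. Pointwise \<open>I N Z\<close> tends to \<open>0\<close> by uniform convergence and is at most \<open>I 0 Z\<close> by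
  the Bessel inequality; the integral of \<open>I N\<close> is the square norm of \<open>F N\<close>.\<close>

theorem polynomials_dense: "hilbert_closure H ip (restrict_domain ` polynomials) = H"
proof
  show "hilbert_closure H ip (restrict_domain ` polynomials) \<subseteq> H" by (auto simp: hilbert_closure_def)
  show "H \<subseteq> hilbert_closure H ip (restrict_domain ` polynomials)"
  proof
    fix f assume f: "f \<in> H"
    interpret holomorphic_on_cartan f by (rule holomorphic_on_cartan.intro[OF HD(1)[OF f]])
    define p where "p N Z = (\<Sum>k<N. taylor_part f k Z)" for N Z
    have p: "p N \<in> polynomials" for N
      unfolding p_def[abs_def] by (rule polynomials_sum[OF taylor_part_polynomial])
    define F where "F N = f - restrict_domain (p N)" for N
    have FH: "F N \<in> H" for N
      unfolding F_def by (rule cfun.subspace_diff[OF H_subspace f restrict_polynomial[OF p]])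
    have F_out: "F N Z = 0" if "Z \<notin> D" for N Z using HD(2)[OF FH that] .
    have F_in: "F N (mat (rot t) ** Z) = circle_series.remainder (\<lambda>t. f (mat (rot t) ** Z)) (\<lambda>k. taylor_part f k Z) N t"
      if Z: "Z \<in> D" for N t Z
      using Z rot_in_D[of t Z]
      by (simp add: circle_series.remainder_def[OF taylor_series_on_circle[OF hol Z]] F_def
          restrict_domain_def p_def taylor_part_homogeneous mult.commute)
    define I where "I N Z = (\<integral>\<^sup>+t. ennreal ((cmod (F N (mat (rot t) ** Z)))\<^sup>2) \<partial>circle_measure)" for N Z
    have F_meas [measurable]: "F N \<in> borel_measurable borel" for N by (rule H_measurable[OF FH])
    have g_meas: "(\<lambda>Z. ennreal ((cmod (F N Z))\<^sup>2)) \<in> borel_measurable borel" for N by measurable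
    have I_meas: "I N \<in> borel_measurable dv" for N
      unfolding I_def[abs_def]
      by (rule circle.borel_measurable_nn_integral) (use rot_pair_measurable[OF g_meas] in simp)
    have I_in: "I N Z = ennreal (\<integral>t. (cmod (circle_series.remainder (\<lambda>t. f (mat (rot t) ** Z)) (\<lambda>k. taylor_part f k Z) N t))\<^sup>2 \<partial>circle_measure)"
      if Z: "Z \<in> D" for N Z
      unfolding I_def F_in[OF Z]
      by (rule nn_integral_eq_integral[OF circle_series.remainder_square_integrable[OF taylor_series_on_circle[OF hol Z]]]) simp
    have I_out: "I N Z = 0" if "Z \<notin> D" for N Z using that rot_in_D F_out by (simp add: I_def)
    have I0: "I N Z \<le> I 0 Z" for N Z
    proof (cases "Z \<in> D")
      case True
      interpret circle_series "\<lambda>t. f (mat (rot t) ** Z)" "\<lambda>k. taylor_part f k Z" by (rule taylor_series_on_circle[OF hol True])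
      have "remainder 0 t = f (mat (rot t) ** Z)" for t by (simp add: remainder_def)
      then show ?thesis unfolding I_in[OF True] using bessel[of N] by (simp add: ennreal_leI)
    qed (simp add: I_out)
    have lim: "(\<lambda>N. I N Z) \<longlonglongrightarrow> 0" for Z
    proof (cases "Z \<in> D")
      case True
      interpret circle_series "\<lambda>t. f (mat (rot t) ** Z)" "\<lambda>k. taylor_part f k Z" by (rule taylor_series_on_circle[OF hol True])
      show ?thesis unfolding I_in[OF True] using tendsto_ennrealI[OF remainder_L2_tendsto_0] by simp
    qed (simp add: I_out)
    have int_I: "(\<integral>\<^sup>+Z. I N Z \<partial>dv) = ennreal (\<integral>Z. (cmod (F N Z))\<^sup>2 \<partial>dv)" for N
    proof -
      have "(\<integral>\<^sup>+Z. I N Z \<partial>dv) = (\<integral>\<^sup>+Z. ennreal ((cmod (F N Z))\<^sup>2) \<partial>dv)"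
        unfolding I_def by (rule nn_integral_circle_average[OF g_meas])
      also have "\<dots> = ennreal (\<integral>Z. (cmod (F N Z))\<^sup>2 \<partial>dv)" by (rule nn_integral_eq_integral[OF HD(3)[OF FH]]) simp
      finally show ?thesis .
    qed
    have "(\<lambda>N. \<integral>\<^sup>+Z. I N Z \<partial>dv) \<longlonglongrightarrow> (\<integral>\<^sup>+Z. 0 \<partial>dv)"
      by (rule nn_integral_dominated_convergence[where w="I 0"]) (use I_meas in \<open>simp_all add: I0 lim int_I\<close>)
    then have "(\<lambda>N. ennreal (\<integral>Z. (cmod (F N Z))\<^sup>2 \<partial>dv)) \<longlonglongrightarrow> ennreal 0" by (simp add: int_I)
    then have lim0: "(\<lambda>N. \<integral>Z. (cmod (F N Z))\<^sup>2 \<partial>dv) \<longlonglongrightarrow> 0"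
      by (subst (asm) tendsto_ennreal_iff) auto
    show "f \<in> hilbert_closure H ip (restrict_domain ` polynomials)"
      unfolding hilbert_closure_def
    proof (intro CollectI conjI f allI impI)
      fix e :: real assume e: "e > 0"
      have "\<forall>\<^sub>F N in sequentially. (\<integral>Z. (cmod (F N Z))\<^sup>2 \<partial>dv) < e\<^sup>2"
        by (rule order_tendstoD(2)[OF lim0]) (use e in simp)
      then obtain N where N: "(\<integral>Z. (cmod (F N Z))\<^sup>2 \<partial>dv) < e\<^sup>2" using eventually_happens sequentially_bot by blast
      have "sqrt (Re (ip (F N) (F N))) < sqrt (e\<^sup>2)" unfolding ip_self[OF FH] Re_complex_of_real by (rule real_sqrt_less_mono[OF N])
      then have "sqrt (Re (ip (f - restrict_domain (p N)) (f - restrict_domain (p N)))) < e" using e by (simp add: F_def)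
      then show "\<exists>g\<in>restrict_domain ` polynomials. sqrt (Re (ip (f - g) (f - g))) < e" using p by blast
    qed
  qed
qed

end

section \<open>The isotypic decomposition\<close>

lemma restrict_add: "restrict_domain (p + q) = restrict_domain p + restrict_domain q"
  by (rule ext) (simp add: restrict_domain_def)

lemma restrict_cscale: "restrict_domain (cscale c p) = cscale c (restrict_domain p)"
  by (rule ext) (simp add: restrict_domain_def cscale_apply)

lemma restrict_zero: "restrict_domain 0 = 0"
  by (rule ext) (simp add: restrict_domain_def)

lemma restrict_clinear: "clinear_on V cscale restrict_domain"
  by (rule clinear_onI) (rule restrict_add restrict_cscale)+

lemma restrict_bitrans:
  assumes "unitary g" "unitary h"
  shows "restrict_domain (bitrans g h p) = bitrans g h (restrict_domain p)"
  by (rule ext) (simp add: restrict_domain_def bitrans_def cartan_domain_unitary_iff[OF assms])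

text \<open>A polynomial that vanishes near the origin of a line vanishes on the line.\<close>

lemma restrict_eq_0_imp_0:
  assumes p: "p \<in> polynomials" and 0: "restrict_domain p = 0"
  shows "p = (0 :: 'n::finite cmat \<Rightarrow> complex)"
proof
  fix Z :: "'n cmat"
  interpret holomorphic_on_cartan p by (rule holomorphic_on_cartan.intro[OF polynomial_holomorphic[OF p]])
  obtain r where r: "r > 0" "\<And>\<zeta>. \<zeta> \<in> ball 0 r \<Longrightarrow> mat \<zeta> ** Z \<in> cartan_domain" using small_disc[of Z] by blast
  have "p W = 0" if "W \<in> cartan_domain" for W
    using fun_cong[OF 0, of W] that by (simp add: restrict_domain_def)
  then have "ball 0 r \<subseteq> {s. p (mat s ** Z) = 0}" using r(2) by blast
  moreover have "infinite (ball (0 :: complex) r)"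
    using uncountable_ball[OF r(1)] countable_finite by blast
  ultimately have "infinite {s. p (mat s ** Z) = 0}" using infinite_super by blast
  moreover have "is_poly1 (\<lambda>s. p (mat s ** Z))"
    by (rule polynomials_curve[OF p]) (simp, intro is_poly1_mult is_poly1_ident is_poly1_const)
  ultimately have "p (mat 1 ** Z) = 0" by (rule is_poly1_zero_infinite[rotated])
  then show "p Z = 0 Z" by simp
qed

lemma restrict_inj: "inj_on restrict_domain polynomials"
proof (rule inj_onI)
  fix p q :: "'n::finite cmat \<Rightarrow> complex"
  assume p: "p \<in> polynomials" and q: "q \<in> polynomials" and eq: "restrict_domain p = restrict_domain q"
  have "p - q \<in> polynomials" by (rule cfun.subspace_diff[OF polynomials_subspace p q])
  moreover have "restrict_domain (p - q) = 0"
  proof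
    fix Z
    show "restrict_domain (p - q) Z = 0 Z" using fun_cong[OF eq, of Z] by (cases "Z \<in> cartan_domain") (simp_all add: restrict_domain_def)
  qed
  ultimately have "p - q = 0" by (rule restrict_eq_0_imp_0)
  then show "p = q" by (rule eq_iff_diff_eq_0[THEN iffD2])
qed

lemma bergman_component_eq:
  fixes \<mu> :: "'n::{finite,wellorder} \<Rightarrow> int"
  shows "\<mu> \<in> dominant_weights \<Longrightarrow> bergman_component \<mu> = restrict_domain ` wspace \<mu>"
  by (simp add: bergman_component_def poly_component_eq_wspace)

abbreviation UU :: "('n::finite cmat \<times> 'n cmat) monoid" where
  "UU \<equiv> unitary_grp \<times>\<times> unitary_grp"

lemma carrier_unitary_grp [simp]: "A \<in> carrier unitary_grp \<longleftrightarrow> unitary A"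
  by (simp add: unitary_grp_def unitary_def)

lemma carrier_UU: "(A, B) \<in> carrier UU \<longleftrightarrow> unitary A \<and> unitary B"
  by (simp add: DirProd_def unitary_grp_def unitary_def)

lemma unitary_mult: "unitary A \<Longrightarrow> unitary B \<Longrightarrow> unitary (A ** B)"
proof -
  assume A: "unitary A" and B: "unitary B"
  have "adj (A ** B) ** (A ** B) = adj B ** (adj A ** A) ** B" by (simp add: adj_mult matrix_mul_assoc)
  then show ?thesis using A B by (simp add: unitary_def)
qed

lemma group_unitary: "Group.group (unitary_grp :: 'n::finite cmat monoid)"
proof (rule groupI)
  fix A assume A: "A \<in> carrier (unitary_grp :: 'n cmat monoid)"
  then have "unitary (adj A)" by (intro unitary_adj) (simp add: unitary_grp_def unitary_def)
  then show "\<exists>y\<in>carrier unitary_grp. y \<otimes>\<^bsub>unitary_grp\<^esub> A = \<one>\<^bsub>unitary_grp\<^esub>"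
    using A by (intro bexI[of _ "adj A"]) (simp_all add: unitary_grp_def unitary_def)
next
  show "A \<otimes>\<^bsub>unitary_grp\<^esub> B \<in> carrier unitary_grp"
    if "A \<in> carrier unitary_grp" "B \<in> carrier unitary_grp" for A B :: "'n cmat"
    using unitary_mult[of A B] that by (simp add: unitary_grp_def unitary_def)
qed (simp_all add: unitary_grp_def matrix_mul_assoc)

lemma group_UU: "Group.group UU"
  by (rule DirProd_group[OF group_unitary group_unitary])

lemma UU_act:
  assumes "(A, B) \<in> carrier UU" shows "two_sided_act (A, B) f = bitrans (adj A) B f" "unitary (adj A)" "unitary B"
  using assms unitary_matrix_inv[of A] unitary_adj[of A] by (simp_all add: carrier_UU two_sided_act_bitrans)

lemma module_iso_restrict_group:
  assumes "module_iso G M N" "carrier K \<subseteq> carrier G" shows "module_iso K M N"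
  using assms unfolding module_iso_def by blast

lemma carrier_UU_GL: "carrier UU \<subseteq> carrier (GL \<times>\<times> GL)"
  using unitary_invertible by (auto simp: carrier_UU DirProd_def GL_def unitary_grp_def unitary_def)

context bergman
begin

abbreviation "BM \<equiv> bergman_module lam :: ('n cmat \<times> 'n cmat, 'n cmat) gmodule"

sublocale poly: unitary_invariant_product "\<lambda>p q :: 'n cmat \<Rightarrow> complex. ip (restrict_domain p) (restrict_domain q)"
proof
  show "cfun.subspace (polynomials :: ('n cmat \<Rightarrow> complex) set)" by (rule polynomials_subspace)
  fix f g h :: "'n cmat \<Rightarrow> complex" and c
  show "ip (restrict_domain (f + g)) (restrict_domain h)
      = ip (restrict_domain f) (restrict_domain h) + ip (restrict_domain g) (restrict_domain h)"
    if "f \<in> polynomials" "g \<in> polynomials" "h \<in> polynomials"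
    unfolding restrict_add by (rule ip_add_left) (rule restrict_polynomial that)+
  show "ip (restrict_domain (cscale c f)) (restrict_domain h) = c * ip (restrict_domain f) (restrict_domain h)"
    if "f \<in> polynomials" "h \<in> polynomials"
    unfolding restrict_cscale by (rule ip_scale_left) (rule restrict_polynomial that)+
  show "cnj (ip (restrict_domain f) (restrict_domain g)) = ip (restrict_domain g) (restrict_domain f)"
    if "f \<in> polynomials" "g \<in> polynomials"
    by (rule ip_cnj) (rule restrict_polynomial that)+
  show "0 \<le> Re (ip (restrict_domain f) (restrict_domain f))" if "f \<in> polynomials"
    by (rule ip_pos[OF restrict_polynomial[OF that]])
  show "f = 0" if "f \<in> polynomials" "ip (restrict_domain f) (restrict_domain f) = 0"
    by (rule restrict_eq_0_imp_0[OF that(1) ip_definite[OF restrict_polynomial[OF that(1)] that(2)]])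
next
  fix g h :: "'n cmat" and f k :: "'n cmat \<Rightarrow> complex"
  assume u: "unitary g" "unitary h" and p: "f \<in> polynomials" "k \<in> polynomials"
  show "ip (restrict_domain (bitrans g h f)) (restrict_domain (bitrans g h k)) = ip (restrict_domain f) (restrict_domain k)"
    unfolding restrict_bitrans[OF u] by (rule ip_bitrans[OF u]) (rule restrict_polynomial p)+
qed

lemma bergman_gmodule: "is_gmodule UU BM"
  unfolding is_gmodule_def
proof (intro conjI ballI)
  show "cfun.subspace (vecs BM)"
    using H_subspace by (simp add: bergman_module_def)
  fix x :: "'n cmat \<times> 'n cmat" assume x: "x \<in> carrier UU"
  obtain A B where AB: "x = (A, B)" by (cases x)
  note X = UU_act[OF x[unfolded AB]]
  have act: "act BM x = bitrans (adj A) B"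
    by (rule ext) (simp add: bergman_module_def AB X(1))
  show "act BM x ` vecs BM \<subseteq> vecs BM"
    unfolding act using bitrans_H[OF X(2,3)] by (auto simp: bergman_module_def)
  show "clinear_on (vecs BM) cscale (act BM x)"
    unfolding act by (rule clinear_onI) (rule bitrans_add bitrans_cscale)+
  fix y :: "'n cmat \<times> 'n cmat" and v assume y: "y \<in> carrier UU"
  obtain A' B' where AB': "y = (A', B')" by (cases y)
  note Y = UU_act[OF y[unfolded AB']]
  have prod: "(A ** A', B ** B') \<in> carrier UU"
    using x y by (simp add: AB AB' carrier_UU unitary_mult)
  have "x \<otimes>\<^bsub>UU\<^esub> y = (A ** A', B ** B')" by (simp add: AB AB' DirProd_def unitary_grp_def)
  then show "act BM (x \<otimes>\<^bsub>UU\<^esub> y) v = act BM x (act BM y v)"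
    by (simp add: bergman_module_def AB AB' X(1) Y(1) UU_act(1)[OF prod] bitrans_bitrans adj_mult)
next
  fix v :: "'n cmat \<Rightarrow> complex"
  have one: "(mat 1, mat 1) \<in> carrier (UU :: ('n cmat \<times> 'n cmat) monoid)" by (simp add: carrier_UU unitary_def)
  have "\<one>\<^bsub>UU\<^esub> = (mat 1, mat 1 :: 'n cmat)" by (simp add: DirProd_def unitary_grp_def)
  then show "act BM \<one>\<^bsub>UU\<^esub> v = v"
    by (simp add: bergman_module_def UU_act(1)[OF one])
qed

lemma bergman_unitary_module: "unitary_module UU BM ip"
proof (rule unitary_module.intro)
  show "inner_product_on (vecs BM) ip"
    using inner_product_on_axioms by (simp add: bergman_module_def)
  show "unitary_module_axioms UU BM ip"
  proof (rule unitary_module_axioms.intro[OF group_UU bergman_gmodule])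
    fix x :: "'n cmat \<times> 'n cmat" and f k
    assume x: "x \<in> carrier UU" and f: "f \<in> vecs BM"
      "k \<in> vecs BM"
    obtain A B where AB: "x = (A, B)" by (cases x)
    note X = UU_act[OF x[unfolded AB]]
    show "ip (act BM x f) (act BM x k) = ip f k"
      using ip_bitrans[OF X(2,3), of f k] f by (simp add: bergman_module_def AB X(1))
  qed
qed

abbreviation V :: "('n \<Rightarrow> int) \<Rightarrow> ('n cmat \<Rightarrow> complex) set" where
  "V \<mu> \<equiv> restrict_domain ` wspace \<mu>"

lemma V_subset_H: "\<mu> \<in> dominant_weights \<Longrightarrow> V \<mu> \<subseteq> H"
  using wspace_polynomials restrict_polynomial by blast

lemma V_subspace: "cfun.subspace (V \<mu>)"
  by (rule clinear_on_image_subspace[OF restrict_clinear wspace_subspace])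

lemma V_finite_dim: "\<mu> \<in> dominant_weights \<Longrightarrow> finite_dim (V \<mu>)"
  by (rule finite_dim_image[OF restrict_clinear wspace_finite_dim])

lemma V_submodule:
  assumes "\<mu> \<in> dominant_weights" shows "is_submodule UU BM (V \<mu>)"
  unfolding is_submodule_def
proof (intro conjI ballI)
  show "V \<mu> \<subseteq> vecs BM" using V_subset_H[OF assms] by (simp add: bergman_module_def)
  fix x :: "'n cmat \<times> 'n cmat" assume x: "x \<in> carrier UU"
  obtain A B where AB: "x = (A, B)" by (cases x)
  note X = UU_act[OF x[unfolded AB]]
  show "act BM x ` V \<mu> \<subseteq> V \<mu>"
    using wspace_bi_stable[of \<mu>]
    by (auto simp: bergman_module_def AB X(1) restrict_bitrans[OF X(2,3), symmetric] bi_stable_def)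
qed (rule V_subspace)

lemma V_iso_wspace:
  assumes \<mu>: "\<mu> \<in> dominant_weights"
  shows "module_iso UU (poly_module\<lparr>vecs := wspace \<mu>\<rparr>) (BM\<lparr>vecs := V \<mu>\<rparr>)"
proof (rule module_isoI[where T=restrict_domain])
  show "bij_betw restrict_domain (vecs (poly_module\<lparr>vecs := wspace \<mu>\<rparr>)) (vecs (BM\<lparr>vecs := V \<mu>\<rparr>))"
    using inj_on_subset[OF restrict_inj wspace_polynomials[OF \<mu>]] by (simp add: bij_betw_def)
  show "clinear_on (vecs (poly_module\<lparr>vecs := wspace \<mu>\<rparr>)) cscale restrict_domain" by (rule restrict_clinear)
  fix x :: "'n cmat \<times> 'n cmat" and v assume x: "x \<in> carrier UU"
  obtain A B where AB: "x = (A, B)" by (cases x)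
  note X = UU_act[OF x[unfolded AB]]
  show "restrict_domain (act (poly_module\<lparr>vecs := wspace \<mu>\<rparr>) x v)
    = act (BM\<lparr>vecs := V \<mu>\<rparr>) x (restrict_domain v)"
    by (simp add: poly_module_def bergman_module_def AB X(1) restrict_bitrans[OF X(2,3)])
qed

lemma wspace_closed_UU:
  assumes "x \<in> carrier UU" "v \<in> wspace (\<mu> :: 'n \<Rightarrow> int)" shows "two_sided_act x v \<in> wspace \<mu>"
proof -
  obtain A B where AB: "x = (A, B)" by (cases x)
  show ?thesis using wspace_bi_stable[of \<mu>] assms(2) by (simp add: AB two_sided_act_bitrans bi_stable_def)
qed

lemma V_iso_tensor:
  assumes \<mu>: "\<mu> \<in> dominant_weights"
  shows "module_iso UU (BM\<lparr>vecs := V \<mu>\<rparr>) (irrep_dual_tensor_irrep \<mu>)"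
proof (rule module_iso_trans)
  show "module_iso UU (BM\<lparr>vecs := V \<mu>\<rparr>) (poly_module\<lparr>vecs := wspace \<mu>\<rparr>)"
    by (rule module_iso_sym_if_closed[OF _ _ V_iso_wspace[OF \<mu>]])
      (simp_all add: wspace_subspace poly_module_def wspace_closed_UU)
  show "module_iso UU (poly_module\<lparr>vecs := wspace \<mu>\<rparr>) (irrep_dual_tensor_irrep \<mu>)"
    by (rule module_iso_restrict_group[OF wspace_iso_tensor(1)[OF \<mu>] carrier_UU_GL])
qed

lemma V_simple:
  assumes \<mu>: "\<mu> \<in> dominant_weights"
  shows "simple_module UU (BM\<lparr>vecs := V \<mu>\<rparr>)"
  unfolding simple_module_def
proof (intro conjI allI impI)
  show "is_gmodule UU (BM\<lparr>vecs := V \<mu>\<rparr>)"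
    by (rule submodule_gmodule[OF bergman_gmodule V_submodule[OF \<mu>]])
  have "restrict_domain (hwf \<mu>) \<noteq> 0"
    using restrict_eq_0_imp_0[OF hwf_polynomial[OF \<mu>]] hwf_nonzero[OF \<mu>] by blast
  moreover have "restrict_domain (hwf \<mu>) \<in> V \<mu>" by (rule imageI[OF hwf_in_wspace])
  ultimately show "vecs (BM\<lparr>vecs := V \<mu>\<rparr>) \<noteq> {0}" by auto
  fix W assume W: "is_submodule UU (BM\<lparr>vecs := V \<mu>\<rparr>) W"
  note WD = is_submoduleD[OF W]
  show "W = {0} \<or> W = vecs (BM\<lparr>vecs := V \<mu>\<rparr>)"
  proof (cases "W = {0}")
    case False
    define P where "P = {p \<in> wspace \<mu>. restrict_domain p \<in> W}"
    have WV: "W \<subseteq> V \<mu>" using WD(2) by simp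
    have WP: "W = restrict_domain ` P" using WV by (auto simp: P_def)
    have "P \<noteq> {0}" using False WP by (auto simp: restrict_zero)
    moreover have "cfun.subspace P"
      unfolding P_def by (rule clinear_on_vimage_subspace[OF restrict_clinear wspace_subspace WD(1)])
    moreover have "bitrans g h p \<in> P" if g: "unitary g" and h: "unitary h" and p: "p \<in> P" for g h p
    proof -
      have c: "(adj g, h) \<in> carrier UU" using unitary_adj[OF g] h by (simp add: carrier_UU)
      have "two_sided_act (adj g, h) (restrict_domain p) \<in> W"
        using WD(3)[OF c, of "restrict_domain p"] p by (simp add: P_def bergman_module_def)
      then have "restrict_domain (bitrans g h p) \<in> W" by (simp add: UU_act(1)[OF c] restrict_bitrans[OF g h])
      then show ?thesis using p wspace_bi_stable[of \<mu>] by (simp add: P_def bi_stable_def)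
    qed
    ultimately have "P = wspace \<mu>" using poly.wspace_simple[OF \<mu>, of P] by (auto simp: P_def)
    then show ?thesis using WP by simp
  qed simp
qed

lemma translate_continuous: "continuous_on S (\<lambda>x :: 'n cmat \<times> 'n cmat. adj (fst x) ** Z ** snd x)"
  unfolding matrix_matrix_mult_def adj_def by (intro continuous_intros)

text \<open>For the continuity of matrix coefficients, evaluate at interpolation points: \<open>z\<close> contributes the polynomial
  \<open>p\<close> at \<open>adj A ** z ** B\<close> if it lies in the domain, and \<open>0\<close> for all group elements otherwise.\<close>

lemma V_irreducible:
  assumes \<mu>: "\<mu> \<in> dominant_weights"
  shows "irreducible_compact UU (BM\<lparr>vecs := V \<mu>\<rparr>)"
  unfolding irreducible_compact_def
proof (intro conjI ballI)
  show "simple_module UU (BM\<lparr>vecs := V \<mu>\<rparr>)" by (rule V_simple[OF \<mu>])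
  show "finite_dim (vecs (BM\<lparr>vecs := V \<mu>\<rparr>))" using V_finite_dim[OF \<mu>] by simp
  fix v \<phi> assume v: "v \<in> vecs (BM\<lparr>vecs := V \<mu>\<rparr>)"
    and \<phi>: "\<phi> \<in> dual_vecs (vecs (BM\<lparr>vecs := V \<mu>\<rparr>))"
  obtain p where p: "p \<in> wspace \<mu>" "v = restrict_domain p" using v by auto
  obtain X e where I: "interpolates X e (V \<mu>)" using ex_interpolation[OF V_finite_dim[OF \<mu>]] by blast
  have lin: "clinear_on (V \<mu>) (*) \<phi>" using \<phi> by (simp add: dual_vecs_def)
  have pc: "continuous_on UNIV p" using polynomials_continuous wspace_polynomials[OF \<mu>] p(1) by blast
  have eq: "\<phi> (act (BM\<lparr>vecs := V \<mu>\<rparr>) x v)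
      = (\<Sum>z\<in>X. (if z \<in> D then p (adj (fst x) ** z ** snd x) else 0) * \<phi> (e z))" if x: "x \<in> carrier UU" for x
  proof -
    obtain A B where AB: "x = (A, B)" by (cases x)
    note U = UU_act[OF x[unfolded AB]]
    have m: "bitrans (adj A) B v \<in> V \<mu>"
      using wspace_bi_stable[of \<mu>] p by (auto simp: restrict_bitrans[OF U(2,3), symmetric] bi_stable_def)
    have "\<phi> (bitrans (adj A) B v) = (\<Sum>z\<in>X. bitrans (adj A) B v z * \<phi> (e z))"
      by (rule interpolation_functional[OF I lin V_subspace m])
    then show ?thesis unfolding AB fst_conv snd_conv
      by (simp add: bergman_module_def U(1) p(2) bitrans_def restrict_domain_def cartan_domain_unitary_iff[OF U(2,3)])
  qed
  have "continuous_on (carrier UU) (\<lambda>x. \<Sum>z\<in>X. (if z \<in> D then p (adj (fst x) ** z ** snd x) else 0) * \<phi> (e z))"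
  proof (intro continuous_on_sum continuous_on_mult continuous_on_const)
    fix z
    show "continuous_on (carrier UU) (\<lambda>x. if z \<in> D then p (adj (fst x) ** z ** snd x) else 0)"
      by (cases "z \<in> D") (auto intro: continuous_on_compose2[OF pc translate_continuous])
  qed
  then show "continuous_on (carrier UU) (\<lambda>x. \<phi> (act (BM\<lparr>vecs := V \<mu>\<rparr>) x v))"
    by (rule continuous_on_eq) (rule eq[symmetric])
qed

lemma V_orthogonal:
  assumes "\<mu> \<in> dominant_weights" "\<nu> \<in> dominant_weights" "\<mu> \<noteq> \<nu>" "f \<in> V \<mu>" "k \<in> V \<nu>"
  shows "ip f k = 0"
  using assms poly.wspace_orthogonal by blast

text \<open>An isomorphism would map \<open>wspace \<mu>\<close> to itself and also onto the orthogonal space \<open>wspace \<nu>\<close>.\<close>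

lemma V_not_isomorphic:
  assumes \<mu>: "\<mu> \<in> dominant_weights" and \<nu>: "\<nu> \<in> dominant_weights"
    and iso: "module_iso UU (BM\<lparr>vecs := V \<mu>\<rparr>) (BM\<lparr>vecs := V \<nu>\<rparr>)"
  shows "\<mu> = \<nu>"
proof (rule ccontr)
  assume ne: "\<mu> \<noteq> \<nu>"
  have "module_iso UU (BM\<lparr>vecs := V \<nu>\<rparr>) (poly_module\<lparr>vecs := wspace \<nu>\<rparr>)"
    by (rule module_iso_sym_if_closed[OF _ _ V_iso_wspace[OF \<nu>]])
      (simp_all add: wspace_subspace poly_module_def wspace_closed_UU)
  with V_iso_wspace[OF \<mu>] iso have "module_iso UU (poly_module\<lparr>vecs := wspace \<mu>\<rparr>) (poly_module\<lparr>vecs := wspace \<nu>\<rparr>)"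
    by (blast intro: module_iso_trans)
  then obtain T where T: "bij_betw T (wspace \<mu>) (wspace \<nu>)" "clinear_on (wspace \<mu>) cscale T"
    "\<And>x v. x \<in> carrier UU \<Longrightarrow> v \<in> wspace \<mu> \<Longrightarrow> T (two_sided_act x v) = two_sided_act x (T v)"
    by (rule module_isoE) (simp add: poly_module_def)
  have "T ` wspace \<mu> = wspace \<mu>"
  proof (rule equivariant_image_wspace[OF \<mu> T(2)])
    show "T f \<in> polynomials" if "f \<in> wspace \<mu>" for f
      using T(1) that wspace_polynomials[OF \<nu>] by (auto simp: bij_betw_def)
    show "inj_on T (wspace \<mu>)" using T(1) by (simp add: bij_betw_def)
    show "T (bitrans g h f) = bitrans g h (T f)" if g: "unitary g" and h: "unitary h" and f: "f \<in> wspace \<mu>" for g h f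
    proof -
      have c: "(adj g, h) \<in> carrier UU" using unitary_adj[OF g] h by (simp add: carrier_UU)
      show ?thesis using T(3)[OF c f] by (simp add: UU_act(1)[OF c])
    qed
  qed
  then have "wspace \<mu> = wspace \<nu>" using T(1) by (simp add: bij_betw_def)
  then have "hwf \<mu> \<in> wspace \<nu>" using hwf_in_wspace by blast
  then have "ip (restrict_domain (hwf \<mu>)) (restrict_domain (hwf \<mu>)) = 0"
    using poly.wspace_orthogonal[OF \<mu> \<nu> ne hwf_in_wspace] by blast
  then have "hwf \<mu> = 0" by (rule poly.ip_definite[OF hwf_polynomial[OF \<mu>]])
  then show False using hwf_nonzero[OF \<mu>] by blast
qed

lemma V_dense: "hilbert_closure H ip (cfun.span (\<Union>\<mu>\<in>dominant_weights. V \<mu>)) = H"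
proof
  show "hilbert_closure H ip (cfun.span (\<Union>\<mu>\<in>dominant_weights. V \<mu>)) \<subseteq> H" by (auto simp: hilbert_closure_def)
  let ?S = "cfun.span (\<Union>\<mu>\<in>dominant_weights. V \<mu>)"
  have "cfun.subspace {p \<in> polynomials. restrict_domain p \<in> ?S}"
    by (rule clinear_on_vimage_subspace[OF restrict_clinear polynomials_subspace cfun.subspace_span])
  moreover have "(\<Union>\<mu>\<in>dominant_weights. wspace \<mu>) \<subseteq> {p \<in> polynomials. restrict_domain p \<in> ?S}"
    using wspace_polynomials by (auto intro!: cfun.span_base)
  ultimately have "cfun.span (\<Union>\<mu>\<in>dominant_weights. wspace \<mu>) \<subseteq> {p \<in> polynomials. restrict_domain p \<in> ?S}"
    by (rule cfun.span_minimal[rotated])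
  then have "restrict_domain ` polynomials \<subseteq> ?S" using poly.polynomials_decomposition by blast
  then have "hilbert_closure H ip (restrict_domain ` polynomials) \<subseteq> hilbert_closure H ip ?S"
    unfolding hilbert_closure_def by blast
  then show "H \<subseteq> hilbert_closure H ip ?S" by (simp only: polynomials_dense)
qed

lemma bergman_family: "unitary_module_family UU BM ip dominant_weights bergman_component"
proof (rule unitary_module_family.intro[OF bergman_unitary_module unitary_module_family_axioms.intro])
  note eq = bergman_component_eq
  fix \<mu> \<nu> :: "'n \<Rightarrow> int" assume \<mu>: "\<mu> \<in> dominant_weights"
  show "is_submodule UU BM (bergman_component \<mu>)" using V_submodule[OF \<mu>] by (simp only: eq[OF \<mu>])
  show "irreducible_compact UU (BM\<lparr>vecs := bergman_component \<mu>\<rparr>)" using V_irreducible[OF \<mu>] by (simp only: eq[OF \<mu>])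
  assume \<nu>: "\<nu> \<in> dominant_weights"
  show "ip f h = 0" if "\<mu> \<noteq> \<nu>" "f \<in> bergman_component \<mu>" "h \<in> bergman_component \<nu>" for f h
    by (rule V_orthogonal[OF \<mu> \<nu> that(1)]) (use that(2,3) in \<open>simp_all only: eq[OF \<mu>] eq[OF \<nu>]\<close>)
  show "\<mu> = \<nu>" if "module_iso UU (BM\<lparr>vecs := bergman_component \<mu>\<rparr>) (BM\<lparr>vecs := bergman_component \<nu>\<rparr>)"
    using V_not_isomorphic[OF \<mu> \<nu>] that by (simp only: eq[OF \<mu>] eq[OF \<nu>])
next
  have "(\<Union>\<mu>\<in>dominant_weights. bergman_component \<mu>) = (\<Union>\<mu>\<in>dominant_weights. V \<mu>)"
    by (rule SUP_cong) (simp_all add: bergman_component_eq)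
  then show "hilbert_closure (vecs BM) ip (cfun.span (\<Union>\<mu>\<in>dominant_weights. bergman_component \<mu>)) = vecs BM"
    using V_dense by (simp add: bergman_module_def)
qed

end

theorem theorem4p10:
  fixes lam :: real
  assumes "lam > 2 * real CARD('n::{finite,wellorder}) - 1"
  shows "hilbert_direct_sum (bergman_space lam) (bergman_inner lam)
           (dominant_weights :: ('n \<Rightarrow> int) set) bergman_component \<and>
         is_isotypic_decomposition (unitary_grp \<times>\<times> unitary_grp)
           (bergman_module lam) (bergman_inner lam)
           (dominant_weights :: ('n \<Rightarrow> int) set) bergman_component \<and>
         (\<forall>\<mu>\<in>(dominant_weights :: ('n \<Rightarrow> int) set).
           module_iso (unitary_grp \<times>\<times> unitary_grp)
             ((bergman_module lam)\<lparr>vecs := bergman_component \<mu>\<rparr>) (irrep_dual_tensor_irrep \<mu>)) \<and>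
         multiplicity_free (unitary_grp \<times>\<times> unitary_grp)
           (bergman_module lam :: ('n cmat \<times> 'n cmat, 'n cmat) gmodule) (bergman_inner lam)"
proof -
  interpret bergman lam "TYPE('n)" by (rule bergman.intro[OF assms])
  interpret unitary_module_family UU BM ip dominant_weights bergman_component by (rule bergman_family)
  show ?thesis
  proof (intro conjI ballI)
    show "hilbert_direct_sum (bergman_space lam) (bergman_inner lam)
           (dominant_weights :: ('n \<Rightarrow> int) set) bergman_component"
      using hilbert_sum by (simp add: bergman_module_def)
    fix \<mu> :: "'n \<Rightarrow> int" assume \<mu>: "\<mu> \<in> dominant_weights"
    show "module_iso (unitary_grp \<times>\<times> unitary_grp)
        ((bergman_module lam)\<lparr>vecs := bergman_component \<mu>\<rparr>) (irrep_dual_tensor_irrep \<mu>)"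
      using V_iso_tensor[OF \<mu>] by (simp only: bergman_component_eq[OF \<mu>])
  qed (rule isotypic_decomposition multiplicity_free)+
qed

end
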